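(* Let $r\in\mathbb{N}$, $0\neq\mathtt{x}\in\Bbbk^2$, $s\in\mathbb{N}_0$ and $i\in\{0,1\}$. Then, as $\mathfrak{u}(\mathfrak{m})$-modules: (i) $\mathtt{A}_{\mathtt{x}}(r)\otimes\Omega^{-s}(V_i)\simeq\mathtt{A}_{\mathtt{x}}(r)\oplus P(0,2rs)$ if $s+i$ is even, and $\mathtt{A}_{\mathtt{x}}(r)\otimes\Omega^{-s}(V_i)\simeq\mathtt{B}_{\mathtt{x}}(r)\oplus P(rs,r(s+1))$ if $s+i$ is odd; (ii) $\mathtt{B}_{\mathtt{x}}(r)\otimes\Omega^{-s}(V_i)\simeq\mathtt{B}_{\mathtt{x}}(r)\oplus P(rs,rs)$ if $s+i$ is even, and $\mathtt{B}_{\mathtt{x}}(r)\otimes\Omega^{-s}(V_i)\simeq\mathtt{A}_{\mathtt{x}}(r)\oplus P(0,r(2s+1))$ if $s+i$ is odd.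
   Context: $\Bbbk$ is an algebraically closed field of characteristic $2$; $\mathbb{N}=\{1,2,\dots\}$, $\mathbb{N}_0=\mathbb N\cup\{0\}$. $\mathfrak{u}(\mathfrak{m})$ is the unital associative $\Bbbk$-algebra generated by $a,b,c$ with relations $ab+ba=c$, $ac+ca=a$, $bc+cb=b$, $a^4=b^4=0$, $c^2+c=0$; it is a Hopf algebra in which $a,b,c$ are primitive; tensor products of modules are over $\Bbbk$ with action through the comultiplication, and the dual $V^*$ of a module has action $(h\cdot\varphi)(v)=\varphi(\mathcal S(h)v)$, $\mathcal S$ the antipode. $V_0$ is the trivial one-dimensional module and $V_1$ is the simple module with basis $v_1,v_2,v_3$ and $av_1=v_2$, $av_2=v_3$, $av_3=0$, $bv_1=0$, $bv_2=v_1$, $bv_3=v_2$, $cv_1=v_1$, $cv_2=0$, $cv_3=v_3$. $P_i$ is the projective cover of $V_i$ and $P(m,n)=mP_0\oplus nP_1$. $\Omega^{-1}(M)$ is the cokernel of an injective envelope $M\to I(M)$, $\Omega^0(V_i)=V_i$, $\Omega^{-(s+1)}=\Omega^{-1}\Omega^{-s}$. For $r\in\mathbb{N}$ and $0\ne\mathtt{x}=(x_1,x_2)\in\Bbbk^2$, $\mathtt{A}_{\mathtt{x}}(r)$ is the module with basis $z_1,\dots,z_{4r}$ where $cz_i=z_i$ for $i$ even and $cz_i=0$ for $i$ odd; for $i\equiv2\ (4)$: $az_i=z_{i+1}$, $bz_i=0$; for $i\equiv3\ (4)$: $az_i=z_{i+1}$, $bz_i=z_{i-1}$; for $i\equiv0\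 (4)$: $az_i=0$, $bz_i=z_{i-1}$; and for $i\equiv1\ (4)$: if $x_1\ne x_2$, then $az_1=x_1z_2$, $bz_1=x_2z_4$, and $az_{i}=x_1z_{i+1}+x_2z_{i-3}$, $bz_{i}=x_1z_{i-1}+x_2z_{i+3}$ for $i>1$; if $x_1=x_2$, then (by convention) $az_1=z_2$, $bz_1=z_4$, and $az_i=z_{i+1}$, $bz_i=z_{i-1}+z_{i+3}$ for $i>1$. Moreover $\mathtt{B}_{\mathtt{x}}(r)=\mathtt{A}_{\mathtt{x}}(r)^*$. *)

theory Defs
  imports
    "Jordan_Normal_Form.Matrix_Kernel"
    "HOL-Library.Poly_Mapping"
    "HOL-Library.Product_Plus"
    "HOL-Computational_Algebra.Polynomial"
begin

datatype letter = La | Lb | Lc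

text \<open>Words form a monoid under concatenation. It is written additively, because the product
  of \<^typ>\<open>'m \<Rightarrow>\<^sub>0 'k\<close> is the convolution product over an additive monoid; thus
  \<open>word \<Rightarrow>\<^sub>0 'k\<close> is the free associative algebra on \<open>a\<close>, \<open>b\<close>, \<open>c\<close>, and
  \<open>word \<times> word \<Rightarrow>\<^sub>0 'k\<close> is its tensor square, with the usual (unsigned) product.\<close>

datatype word = Word (letters: "letter list")

instantiation word :: monoid_add
begin
definition zero_word :: word where "0 = Word []"
definition plus_word :: "word \<Rightarrow> word \<Rightarrow> word" where "u + v = Word (letters u @ letters v)"
instance by standard (auto simp: zero_word_def plus_word_def)
end

type_synonym 'k free = "word \<Rightarrow>\<^sub>0 'k"

definition fgen :: "letter \<Rightarrow> 'k::field free" where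
  "fgen x = Poly_Mapping.single (Word [x]) 1"

definition relators :: "'k::field free set" where
  "relators = (let a = fgen La; b = fgen Lb; c = fgen Lc in
     {a * b + b * a - c, a * c + c * a - a, b * c + c * b - b, a ^ 4, b ^ 4, c ^ 2 + c})"

inductive_set two_sided_ideal :: "'r::ring_1 set \<Rightarrow> 'r set" for R where
  zero: "0 \<in> two_sided_ideal R"
| gen: "r \<in> R \<Longrightarrow> p * r * q \<in> two_sided_ideal R"
| add: "p \<in> two_sided_ideal R \<Longrightarrow> q \<in> two_sided_ideal R \<Longrightarrow> p + q \<in> two_sided_ideal R"

lemma two_sided_ideal_mult_left:
  "p \<in> two_sided_ideal R \<Longrightarrow> s * p \<in> two_sided_ideal R"
  by (induction rule: two_sided_ideal.induct)
    (auto simp: distrib_left mult.assoc[symmetric] intro: two_sided_ideal.intros)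

lemma two_sided_ideal_mult_right:
  "p \<in> two_sided_ideal R \<Longrightarrow> p * s \<in> two_sided_ideal R"
proof (induction rule: two_sided_ideal.induct)
  case (gen r p q)
  then show ?case using two_sided_ideal.gen[of r R p "q * s"] by (simp add: mult.assoc)
qed (auto simp: distrib_right intro: two_sided_ideal.intros)

lemma two_sided_ideal_uminus:
  "p \<in> two_sided_ideal R \<Longrightarrow> - p \<in> two_sided_ideal R"
  using two_sided_ideal_mult_left[of p R "- 1"] by simp

lemma two_sided_ideal_diff:
  "p \<in> two_sided_ideal R \<Longrightarrow> q \<in> two_sided_ideal R \<Longrightarrow> p - q \<in> two_sided_ideal R"
  using two_sided_ideal.add[of p R "- q"] two_sided_ideal_uminus by fastforce

definition um_rel :: "'k::field free \<Rightarrow> 'k free \<Rightarrow> bool" where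
  "um_rel p q \<longleftrightarrow> p - q \<in> two_sided_ideal relators"

lemma equivp_um_rel: "equivp (um_rel :: 'k::field free \<Rightarrow> _)"
proof (rule equivpI)
  show "reflp (um_rel :: 'k free \<Rightarrow> _)" by (auto simp: reflp_def um_rel_def intro: two_sided_ideal.zero)
  show "symp (um_rel :: 'k free \<Rightarrow> _)" unfolding symp_def um_rel_def
    using two_sided_ideal_uminus by (metis minus_diff_eq)
  show "transp (um_rel :: 'k free \<Rightarrow> _)"
  proof (rule transpI)
    fix p q r :: "'k free"
    assume "um_rel p q" "um_rel q r"
    then have "(p - q) + (q - r) \<in> two_sided_ideal relators"
      unfolding um_rel_def by (rule two_sided_ideal.add)
    then show "um_rel p r" by (simp add: um_rel_def)
  qed
qed

quotient_type (overloaded) 'k um = "'k::field free" / um_rel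
  by (rule equivp_um_rel)

lemma lookup_mult_zero_word:
  fixes p q :: "'k::field free"
  shows "Poly_Mapping.lookup (p * q) 0 = Poly_Mapping.lookup p 0 * Poly_Mapping.lookup q 0"
proof -
  have iff: "0 = u + v \<longleftrightarrow> u = 0 \<and> v = 0" for u v :: word
    by (cases u; cases v) (auto simp: zero_word_def plus_word_def)
  have "(\<Sum>v. Poly_Mapping.lookup q v when 0 = u + v) = (Poly_Mapping.lookup q 0 when u = 0)"
    for u :: word
    by (cases "u = 0") (simp_all add: iff)
  then have "Poly_Mapping.lookup (p * q) 0
      = (\<Sum>u. Poly_Mapping.lookup p u * (Poly_Mapping.lookup q 0 when u = 0))"
    by (simp add: lookup_mult)
  also have "\<dots> = (\<Sum>u. (Poly_Mapping.lookup p u * Poly_Mapping.lookup q 0) when u = 0)"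
    by (simp add: mult_when)
  finally show ?thesis by simp
qed

lemma lookup_relator_zero:
  fixes r :: "'k::field free"
  assumes "r \<in> relators"
  shows "Poly_Mapping.lookup r 0 = 0"
proof -
  have "Poly_Mapping.lookup (fgen x :: 'k free) 0 = 0" for x
    by (simp add: fgen_def lookup_single zero_word_def)
  then show ?thesis
    using assms
    by (auto simp: relators_def Let_def lookup_add lookup_minus lookup_mult_zero_word numeral_eq_Suc)
qed

lemma lookup_ideal_zero:
  "p \<in> two_sided_ideal relators \<Longrightarrow> Poly_Mapping.lookup p 0 = 0"
  by (induction rule: two_sided_ideal.induct)
    (simp_all add: lookup_add lookup_mult_zero_word lookup_relator_zero)

instantiation um :: (field) ring_1
begin

lift_definition zero_um :: "'a um" is 0 .

lift_definition one_um :: "'a um" is 1 .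

lift_definition plus_um :: "'a um \<Rightarrow> 'a um \<Rightarrow> 'a um" is "(+)"
  unfolding um_rel_def add_diff_add by (rule two_sided_ideal.add)

lift_definition uminus_um :: "'a um \<Rightarrow> 'a um" is uminus
  unfolding um_rel_def minus_diff_minus by (rule two_sided_ideal_uminus)

lift_definition minus_um :: "'a um \<Rightarrow> 'a um \<Rightarrow> 'a um" is "(-)"
proof -
  fix p p' q q' :: "'a free"
  assume "um_rel p p'" "um_rel q q'"
  then have "(p - p') - (q - q') \<in> two_sided_ideal relators"
    unfolding um_rel_def by (rule two_sided_ideal_diff)
  then show "um_rel (p - q) (p' - q')"
    by (simp add: um_rel_def algebra_simps)
qed

lift_definition times_um :: "'a um \<Rightarrow> 'a um \<Rightarrow> 'a um" is "(*)"
proof -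
  fix p p' q q' :: "'a free"
  assume "um_rel p p'" "um_rel q q'"
  then have "(p - p') * q + p' * (q - q') \<in> two_sided_ideal relators"
    unfolding um_rel_def
    by (intro two_sided_ideal.add two_sided_ideal_mult_left two_sided_ideal_mult_right)
  then show "um_rel (p * q) (p' * q')"
    by (simp add: um_rel_def algebra_simps)
qed

instance
proof
  show "(0::'a um) \<noteq> 1"
    by transfer (auto simp: um_rel_def lookup_one dest!: lookup_ideal_zero)
qed (transfer; simp add: um_rel_def algebra_simps two_sided_ideal.zero)+

end

definition um_scalar :: "'k::field \<Rightarrow> 'k um" where
  "um_scalar k = abs_um (Poly_Mapping.single 0 k)"

definition um_word :: "word \<Rightarrow> 'k::field um" where
  "um_word w = abs_um (Poly_Mapping.single w 1)"

text \<open>The Hopf structure, on representatives in the free algebra: the comultiplication is the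
  algebra map and the antipode the anti-algebra map for which the letters are primitive. Both
  are compatible with the relators in characteristic 2, so that the actions of u(m) defined
  through them below do not depend on the representative \<^term>\<open>rep_um h\<close>.\<close>

definition coprod :: "'k::field free \<Rightarrow> (word \<times> word \<Rightarrow>\<^sub>0 'k)" where
  "coprod p = (\<Sum>w\<in>Poly_Mapping.keys p. Poly_Mapping.single 0 (Poly_Mapping.lookup p w) *
     prod_list (map (\<lambda>x. Poly_Mapping.single (Word [x], 0) 1 + Poly_Mapping.single (0, Word [x]) 1)
       (letters w)))"

definition antipode :: "'k::field free \<Rightarrow> 'k free" where
  "antipode p = (\<Sum>w\<in>Poly_Mapping.keys p. Poly_Mapping.single 0 (Poly_Mapping.lookup p w) *
     prod_list (map (\<lambda>x. - fgen x) (rev (letters w))))"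

text \<open>A finite-dimensional left module is given in coordinates: its underlying space is
  \<^term>\<open>carrier_vec n\<close> and \<open>h\<close> acts by the matrix \<open>uact M h\<close> on column vectors.\<close>

record (overloaded) ('k::field) umod =
  udim :: nat
  uact :: "'k um \<Rightarrow> 'k mat"

definition um_module :: "'k::field umod \<Rightarrow> bool" where
  "um_module M \<longleftrightarrow>
     (\<forall>h. uact M h \<in> carrier_mat (udim M) (udim M)) \<and>
     uact M 1 = 1\<^sub>m (udim M) \<and>
     (\<forall>h h'. uact M (h * h') = uact M h * uact M h') \<and>
     (\<forall>h h'. uact M (h + h') = uact M h + uact M h') \<and>
     (\<forall>k. uact M (um_scalar k) = k \<cdot>\<^sub>m 1\<^sub>m (udim M))"

definition umod_hom :: "'k::field umod \<Rightarrow> 'k umod \<Rightarrow> 'k mat set" where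
  "umod_hom M N = {f \<in> carrier_mat (udim N) (udim M). \<forall>h. f * uact M h = uact N h * f}"

definition umod_iso :: "'k::field umod \<Rightarrow> 'k umod \<Rightarrow> bool" (infix \<open>\<cong>\<^sub>u\<close> 50) where
  "M \<cong>\<^sub>u N \<longleftrightarrow> (\<exists>f\<in>umod_hom M N. \<exists>g\<in>umod_hom N M.
     g * f = 1\<^sub>m (udim M) \<and> f * g = 1\<^sub>m (udim N))"

definition mat_image :: "'k::field mat \<Rightarrow> 'k vec set" where
  "mat_image f = (\<lambda>v. f *\<^sub>v v) ` carrier_vec (dim_col f)"

definition umod_inj :: "'k::field umod \<Rightarrow> 'k umod \<Rightarrow> 'k mat \<Rightarrow> bool" where
  "umod_inj M N f \<longleftrightarrow> f \<in> umod_hom M N \<and> inj_on (\<lambda>v. f *\<^sub>v v) (carrier_vec (udim M))"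

definition umod_surj :: "'k::field umod \<Rightarrow> 'k umod \<Rightarrow> 'k mat \<Rightarrow> bool" where
  "umod_surj M N f \<longleftrightarrow> f \<in> umod_hom M N \<and> mat_image f = carrier_vec (udim N)"

definition submodule_of :: "'k::field vec set \<Rightarrow> 'k umod \<Rightarrow> bool" where
  "submodule_of W M \<longleftrightarrow> W \<subseteq> carrier_vec (udim M) \<and> 0\<^sub>v (udim M) \<in> W \<and>
     (\<forall>v\<in>W. \<forall>w\<in>W. v + w \<in> W) \<and> (\<forall>h. \<forall>v\<in>W. uact M h *\<^sub>v v \<in> W)"

text \<open>Lifting and extension properties are tested on finite-dimensional modules. Since u(m) is
  finite-dimensional, this agrees with testing on all modules.\<close>

definition projective_umod :: "'k::field umod \<Rightarrow> bool" where
  "projective_umod P \<longleftrightarrow> um_module P \<and>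
     (\<forall>M N g f. um_module M \<longrightarrow> um_module N \<longrightarrow> umod_surj M N g \<longrightarrow> f \<in> umod_hom P N \<longrightarrow>
        (\<exists>f'\<in>umod_hom P M. g * f' = f))"

definition injective_umod :: "'k::field umod \<Rightarrow> bool" where
  "injective_umod I \<longleftrightarrow> um_module I \<and>
     (\<forall>M N g f. um_module M \<longrightarrow> um_module N \<longrightarrow> umod_inj M N g \<longrightarrow> f \<in> umod_hom M I \<longrightarrow>
        (\<exists>f'\<in>umod_hom N I. f' * g = f))"

definition projective_cover :: "'k::field umod \<Rightarrow> 'k umod \<Rightarrow> bool" where
  "projective_cover P V \<longleftrightarrow> projective_umod P \<and>
     (\<exists>p. umod_surj P V p \<and>
       (\<forall>W. submodule_of W P \<and> {v + w |v w. v \<in> W \<and> w \<in> mat_kernel p} = carrier_vec (udim P)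
          \<longrightarrow> W = carrier_vec (udim P)))"

definition injective_envelope :: "'k::field umod \<Rightarrow> 'k umod \<Rightarrow> 'k mat \<Rightarrow> bool" where
  "injective_envelope M I \<iota> \<longleftrightarrow> injective_umod I \<and> umod_inj M I \<iota> \<and>
     (\<forall>W. submodule_of W I \<and> W \<inter> mat_image \<iota> = {0\<^sub>v (udim I)} \<longrightarrow> W = {0\<^sub>v (udim I)})"

definition is_cokernel :: "'k::field umod \<Rightarrow> 'k mat \<Rightarrow> 'k umod \<Rightarrow> bool" where
  "is_cokernel I \<iota> C \<longleftrightarrow> um_module C \<and> (\<exists>p. umod_surj I C p \<and> mat_kernel p = mat_image \<iota>)"

text \<open>\<open>is_Omega_neg s V W\<close>: the module \<open>W\<close> arises from \<open>V\<close> by \<open>s\<close> times taking the cokernel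
  of an injective envelope, that is, \<open>W\<close> is a model of \<open>\<Omega>\<^sup>-\<^sup>s(V)\<close>.\<close>

inductive is_Omega_neg :: "nat \<Rightarrow> 'k::field umod \<Rightarrow> 'k umod \<Rightarrow> bool" where
  zero: "is_Omega_neg 0 V V"
| Suc: "is_Omega_neg s V M \<Longrightarrow> injective_envelope M I \<iota> \<Longrightarrow> is_cokernel I \<iota> C \<Longrightarrow>
    is_Omega_neg (Suc s) V C"

definition lin_ext :: "nat \<Rightarrow> ('w \<Rightarrow> 'k::field mat) \<Rightarrow> ('w \<Rightarrow>\<^sub>0 'k) \<Rightarrow> 'k mat" where
  "lin_ext n F p = mat n n (\<lambda>ij. \<Sum>w\<in>Poly_Mapping.keys p. Poly_Mapping.lookup p w * F w $$ ij)"

text \<open>The module with basis \<open>z\<^sub>1, \<dots>, z\<^sub>n\<close> on which the letter \<open>x\<close> acts by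
  \<open>x z\<^sub>j = (\<Sum>i=1..n. co x j i \<cdot> z\<^sub>i)\<close>. Coefficients with \<open>i\<close> outside \<open>{1..n}\<close> are ignored.
  This is a module, with an action not depending on the representative \<^term>\<open>rep_um h\<close>,
  whenever the three matrices satisfy the defining relations of u(m).\<close>

definition basis_module :: "nat \<Rightarrow> (letter \<Rightarrow> nat \<Rightarrow> nat \<Rightarrow> 'k::field) \<Rightarrow> 'k umod" where
  "basis_module n co = \<lparr>udim = n, uact = \<lambda>h. lin_ext n
     (\<lambda>w. foldr (\<lambda>x X. mat n n (\<lambda>(i, j). co x (j + 1) (i + 1)) * X) (letters w) (1\<^sub>m n)) (rep_um h)\<rparr>"

definition kron :: "'k::field mat \<Rightarrow> 'k mat \<Rightarrow> 'k mat" where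
  "kron X Y = mat (dim_row X * dim_row Y) (dim_col X * dim_col Y)
     (\<lambda>(i, j). X $$ (i div dim_row Y, j div dim_col Y) * Y $$ (i mod dim_row Y, j mod dim_col Y))"

definition umod_tensor :: "'k::field umod \<Rightarrow> 'k umod \<Rightarrow> 'k umod" (infixl \<open>\<otimes>\<^sub>u\<close> 70) where
  "M \<otimes>\<^sub>u N = \<lparr>udim = udim M * udim N, uact = \<lambda>h. lin_ext (udim M * udim N)
     (\<lambda>(u, v). kron (uact M (um_word u)) (uact N (um_word v))) (coprod (rep_um h))\<rparr>"

text \<open>Coordinates on the dual are taken with respect to the dual basis.\<close>

definition umod_dual :: "'k::field umod \<Rightarrow> 'k umod" where
  "umod_dual M = \<lparr>udim = udim M,
     uact = \<lambda>h. transpose_mat (uact M (abs_um (antipode (rep_um h))))\<rparr>"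

definition umod_sum :: "'k::field umod \<Rightarrow> 'k umod \<Rightarrow> 'k umod" (infixr \<open>\<oplus>\<^sub>u\<close> 65) where
  "M \<oplus>\<^sub>u N = \<lparr>udim = udim M + udim N, uact = \<lambda>h. four_block_mat
     (uact M h) (0\<^sub>m (udim M) (udim N)) (0\<^sub>m (udim N) (udim M)) (uact N h)\<rparr>"

primrec umod_copies :: "nat \<Rightarrow> 'k::field umod \<Rightarrow> 'k umod" where
  "umod_copies 0 M = \<lparr>udim = 0, uact = \<lambda>h. 0\<^sub>m 0 0\<rparr>"
| "umod_copies (Suc n) M = M \<oplus>\<^sub>u umod_copies n M"

fun V_coeff :: "letter \<Rightarrow> nat \<Rightarrow> nat \<Rightarrow> 'k::field" where
  "V_coeff La j i = of_bool (i = j + 1)"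
| "V_coeff Lb j i = of_bool (i + 1 = j)"
| "V_coeff Lc j i = of_bool (i = j \<and> odd j)"

definition V_simple :: "nat \<Rightarrow> 'k::field umod" where
  "V_simple i = (if i = 0 then basis_module 1 (\<lambda>_ _ _. 0) else basis_module 3 V_coeff)"

fun A_coeff :: "'k::field \<Rightarrow> 'k \<Rightarrow> letter \<Rightarrow> nat \<Rightarrow> nat \<Rightarrow> 'k" where
  "A_coeff x1 x2 La j i =
     (if j mod 4 = 2 \<or> j mod 4 = 3 then of_bool (i = j + 1)
      else if j mod 4 = 0 then 0
      else if x1 \<noteq> x2 then
        (if j = 1 then x1 * of_bool (i = 2)
         else x1 * of_bool (i = j + 1) + x2 * of_bool (i = j - 3))
      else (if j = 1 then of_bool (i = 2) else of_bool (i = j + 1)))"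
| "A_coeff x1 x2 Lb j i =
     (if j mod 4 = 2 then 0
      else if j mod 4 = 3 \<or> j mod 4 = 0 then of_bool (i = j - 1)
      else if x1 \<noteq> x2 then
        (if j = 1 then x2 * of_bool (i = 4)
         else x1 * of_bool (i = j - 1) + x2 * of_bool (i = j + 3))
      else (if j = 1 then of_bool (i = 4) else of_bool (i = j - 1) + of_bool (i = j + 3)))"
| "A_coeff x1 x2 Lc j i = of_bool (i = j \<and> even j)"

definition A_mod :: "'k::field \<times> 'k \<Rightarrow> nat \<Rightarrow> 'k umod" where
  "A_mod x r = basis_module (4 * r) (A_coeff (fst x) (snd x))"

definition B_mod :: "'k::field \<times> 'k \<Rightarrow> nat \<Rightarrow> 'k umod" where
  "B_mod x r = umod_dual (A_mod x r)"

definition P_mod :: "'k::field umod \<Rightarrow> 'k umod \<Rightarrow> nat \<Rightarrow> nat \<Rightarrow> 'k umod" where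
  "P_mod P0 P1 m n = umod_copies m P0 \<oplus>\<^sub>u umod_copies n P1"

end

theory Submission
  imports Defs "HOL-Library.Function_Algebras"
begin

text \<open>
  All modules in the statement have Loewy length 2 up to projectives, and are described by a pair of linear
  maps between vector spaces. In suitable coordinates \<open>\<Omega>\<^sup>-\<^sup>1\<close> exchanges \<open>A\<close> and \<open>B\<close>, and \<open>A \<otimes> V\<^sub>0 \<cong> A\<close>,
  \<open>A \<otimes> V\<^sub>1 \<cong> B \<oplus> rP\<^sub>1\<close>, \<open>B \<otimes> V\<^sub>1 \<cong> A \<oplus> rP\<^sub>1\<close> by explicit isomorphisms. Tensoring an injective envelope
  \<open>\<Omega>\<^sup>-\<^sup>s(V\<^sub>i) \<rightarrow> E\<close> with \<open>A\<close> gives an exact sequence whose middle term is projective, because the extension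
  \<open>A \<otimes> E\<close> of copies of \<open>E\<close> by copies of \<open>V\<^sub>1 \<otimes> E\<close> splits. A Schanuel argument, using that the \<open>P\<^sub>i\<close> are injective
  with simple socles, then identifies the cokernel \<open>A \<otimes> \<Omega>\<^sup>-\<^sup>(\<^sup>s\<^sup>+\<^sup>1\<^sup>)(V\<^sub>i)\<close> up to projective summands, and
  the multiplicities follow by counting. The same works for \<open>B\<close>.
\<close>

section \<open>Finitely supported sequences\<close>

text \<open>Injective envelopes, cosyzygies and projective covers are given only by their defining
  properties, so each of them has to be identified with an explicit module; and multiplicities have
  to be cancelled, which is done without appeal to a Krull-Schmidt theorem. Both difficulties are
  met by socles: a homomorphism that is injective on an essential submodule is injective, and an
  embedding between sums of copies of P_0 and P_1 restricts on the socle to two linear maps, which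
  can be completed to bijections. This exhibits a complement with the right number of copies. The
  parameter x enters only through a pair S = s0 + s1 N, T = t0 + t1 N with N the nilpotent shift; S
  and T commute and one of them is invertible, so that the pair is its own cosyzygy and only the
  layers V_0 and V_1 change places. The numbers come from V_1 \<otimes> P_0 = 3 P_1 and V_1
  \<otimes> P_1 = P_0 + 2 P_1: the middle term obtained from n copies of either P_i is P(rn, 3rn),
  from which one subtracts the projective part of the previous step and the hull of A, which is P(0,
  r), or of B, which is P(r, 0).\<close>

definition fscale :: "'k::field \<Rightarrow> (nat \<Rightarrow> 'k) \<Rightarrow> nat \<Rightarrow> 'k" where
  "fscale k f = (\<lambda>i. k * f i)"

interpretation fs: vector_space fscale
  by standard (auto simp: fscale_def algebra_simps fun_eq_iff)

text \<open>Every k^n is a subspace of one type, so that a dimension may depend on parameters such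
  as \<open>r\<close> and \<open>s\<close>, and k^m lies inside k^n for m \<le> n without an
  embedding.\<close>

definition kn :: "nat \<Rightarrow> (nat \<Rightarrow> 'a::zero) set" where
  "kn n = {f. \<forall>i\<ge>n. f i = 0}"

definition unitf :: "nat \<Rightarrow> nat \<Rightarrow> 'k::field" where
  "unitf i = (\<lambda>j. of_bool (j = i))"

definition trunc :: "nat \<Rightarrow> (nat \<Rightarrow> 'a::zero) \<Rightarrow> nat \<Rightarrow> 'a" where
  "trunc n f = (\<lambda>i. if i < n then f i else 0)"

text \<open>Linearity is demanded on the subspace \<open>V\<close> only: the maps below are
  controlled on carriers, and their values elsewhere are arbitrary.\<close>

definition linon :: "'v set \<Rightarrow> ('k \<Rightarrow> 'v \<Rightarrow> 'v) \<Rightarrow> ('k \<Rightarrow> 'w \<Rightarrow> 'w) \<Rightarrow> ('v::plus \<Rightarrow> 'w::plus) \<Rightarrow> bool" where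
  "linon V s s' f \<longleftrightarrow> (\<forall>x\<in>V. \<forall>y\<in>V. f (x + y) = f x + f y) \<and> (\<forall>k. \<forall>x\<in>V. f (s k x) = s' k (f x))"

lemma kn_zero [simp]: "0 \<in> kn n" by (simp add: kn_def)
lemma kn_add [simp]: "f \<in> kn n \<Longrightarrow> g \<in> kn n \<Longrightarrow> (f::nat \<Rightarrow> 'a::monoid_add) + g \<in> kn n" by (simp add: kn_def)
lemma kn_scale [simp]: "f \<in> kn n \<Longrightarrow> fscale k f \<in> kn n" by (simp add: kn_def fscale_def)
lemma kn_trunc [simp]: "trunc n f \<in> kn n" by (simp add: kn_def trunc_def)
lemma trunc_id [simp]: "f \<in> kn n \<Longrightarrow> trunc n f = f" by (force simp: kn_def trunc_def)
lemma kn_unitf [simp]: "unitf i \<in> kn n \<longleftrightarrow> i < n"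
  by (auto simp: kn_def unitf_def of_bool_def not_less split: if_splits)
lemma kn_mono: "n \<le> m \<Longrightarrow> kn n \<subseteq> kn m" by (auto simp: kn_def)
lemma kn_0 [simp]: "kn 0 = {0}" by (auto simp: kn_def)
lemma trunc_add: "trunc n (f + g) = trunc n f + trunc n (g::nat \<Rightarrow> 'a::monoid_add)"
  by (auto simp: trunc_def)
lemma trunc_scale: "trunc n (fscale k f) = fscale k (trunc n f)"
  by (auto simp: trunc_def fscale_def)
lemma inj_unitf: "inj unitf"
  by (rule injI) (metis unitf_def of_bool_eq_0_iff zero_neq_one of_bool_eq(2))

lemma sum_apply: "(\<Sum>i\<in>A. f i) j = (\<Sum>i\<in>A. f i j)"
  by (induction A rule: infinite_finite_induct) auto

lemma kn_expand:
  assumes "f \<in> kn n"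
  shows "f = (\<Sum>i<n. fscale (f i) (unitf i))"
proof
  fix j
  have "(\<Sum>i<n. fscale (f i) (unitf i)) j = (\<Sum>i<n. if j = i then f i else 0)"
    unfolding sum_apply by (rule sum.cong) (auto simp: fscale_def unitf_def)
  then show "f j = (\<Sum>i<n. fscale (f i) (unitf i)) j"
    using assms by (simp add: sum.delta kn_def)
qed

lemma kn_subspace: "fs.subspace (kn n)" by (simp add: fs.subspace_def)

lemma independent_unitf: "fs.independent (unitf ` {..<n})"
proof (rule fs.independent_if_scalars_zero)
  fix f :: "(nat \<Rightarrow> 'a) \<Rightarrow> 'a" and x :: "nat \<Rightarrow> 'a"
  assume 0: "(\<Sum>x\<in>unitf ` {..<n}. fscale (f x) x) = 0" and "x \<in> unitf ` {..<n}"
  then obtain i where i: "i < n" "x = unitf i" by auto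
  have "(\<Sum>x\<in>unitf ` {..<n}. fscale (f x) x) = (\<Sum>i<n. fscale (f (unitf i)) (unitf i))"
    by (subst sum.reindex) (auto intro: inj_on_subset[OF inj_unitf])
  then have "(\<Sum>i<n. fscale (f (unitf i)) (unitf i)) i = 0" using 0 by simp
  then show "f x = 0" using i by (simp add: sum_apply fscale_def unitf_def)
qed auto

lemma span_unitf: "fs.span (unitf ` {..<n}) = (kn n :: (nat \<Rightarrow> 'k::field) set)"
proof
  show "fs.span (unitf ` {..<n}) \<subseteq> (kn n :: (nat \<Rightarrow> 'k::field) set)"
    by (rule fs.span_minimal) (auto simp: kn_subspace)
  show "(kn n :: (nat \<Rightarrow> 'k::field) set) \<subseteq> fs.span (unitf ` {..<n})"
  proof
    fix f :: "nat \<Rightarrow> 'k" assume f: "f \<in> kn n"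
    have "(\<Sum>i<n. fscale (f i) (unitf i)) \<in> fs.span (unitf ` {..<n})"
      by (intro fs.span_sum fs.span_scale fs.span_base) auto
    then show "f \<in> fs.span (unitf ` {..<n})"
      using kn_expand[OF f] by simp
  qed
qed

lemma dim_kn: "fs.dim (kn n) = n"
  using fs.dim_eq_card[OF _ independent_unitf, of n "kn n"] span_unitf[of n]
  by (simp add: card_image[OF inj_on_subset[OF inj_unitf]] span_unitf[symmetric] fs.span_span)

lemma linon_zero:
  assumes "vector_space s" "vector_space s'" "linon V s s' f" "0 \<in> V"
  shows "f 0 = 0"
proof -
  interpret a: vector_space s by fact
  interpret b: vector_space s' by fact
  have "f (s 0 0) = s' 0 (f 0)" using assms unfolding linon_def by blast
  then show ?thesis by simp
qed

lemma linon_sum: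
  assumes "vector_space s" "vector_space s'" "linon V s s' f" "module.subspace s V"
    and "finite A" "\<And>i. i \<in> A \<Longrightarrow> x i \<in> V"
  shows "f (\<Sum>i\<in>A. s (c i) (x i)) = (\<Sum>i\<in>A. s' (c i) (f (x i)))"
  using assms(5,6)
proof (induction A rule: finite_induct)
  interpret a: vector_space s by fact
  case empty
  then show ?case using linon_zero[OF assms(1-3)] assms(4) by (simp add: a.subspace_0)
next
  interpret a: vector_space s by fact
  case (insert i A)
  have "s (c i) (x i) \<in> V" "(\<Sum>i\<in>A. s (c i) (x i)) \<in> V"
    using insert assms(4) by (auto intro!: a.subspace_sum a.subspace_scale)
  then show ?case using insert assms(3) by (simp add: linon_def)
qed

text \<open>Truncation extends a map known to be linear only on \<open>kn n\<close> to a total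
  linear map, to which the results on \<open>Vector_Spaces.linear\<close> apply.\<close>

lemma linear_trunc:
  assumes "vector_space s" "linon (kn n) fscale s f"
  shows "Vector_Spaces.linear fscale s (f \<circ> trunc n)"
proof -
  interpret b: vector_space s by fact
  show ?thesis
    by standard (use assms(2) in \<open>auto simp: linon_def trunc_add trunc_scale\<close>)
qed

text \<open>Since \<open>kn d \<subseteq> kn d'\<close>, Steinitz exchange takes the form of an extension statement.\<close>

lemma kn_inj_extend:
  fixes g :: "(nat \<Rightarrow> 'k::field) \<Rightarrow> nat \<Rightarrow> 'k"
  assumes lin: "linon (kn d) fscale fscale g" and inj: "inj_on g (kn d)"
    and im: "g ` kn d \<subseteq> kn d'"
  obtains G where "d \<le> d'" "linon UNIV fscale fscale G" "bij_betw G (kn d') (kn d')"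
    "\<And>x. x \<in> kn d \<Longrightarrow> G x = g x"
proof -
  let ?g = "g \<circ> trunc d"
  interpret vp: vector_space_pair "fscale :: 'k \<Rightarrow> _" "fscale :: 'k \<Rightarrow> _" ..
  have l: "Vector_Spaces.linear fscale fscale ?g"
    by (rule linear_trunc[OF _ lin]) unfold_locales
  define B where "B = (\<lambda>i. g (unitf i)) ` {..<d}"
  have B_eq: "B = ?g ` unitf ` {..<d}" by (auto simp: B_def image_image)
  have inj': "inj_on ?g (kn d)" using inj by (auto simp: inj_on_def)
  have "fs.independent B"
    unfolding B_eq by (rule vp.linear_independent_injective_image[OF l independent_unitf])
      (simp add: span_unitf inj')
  then have Bi: "fs.independent B" .
  have Bk: "B \<subseteq> kn d'" using im by (auto simp: B_def)
  obtain C where C: "B \<subseteq> C" "C \<subseteq> kn d'" "fs.independent C" "kn d' \<subseteq> fs.span C"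
    by (rule fs.maximal_independent_subset_extend[OF Bk Bi]) (rule that; assumption)
  have cardC: "card C = d'" using fs.basis_card_eq_dim[OF C(2,4,3)] by (simp add: dim_kn)
  have finC: "finite C"
    using fs.independent_span_bound[OF _ C(3), of "unitf ` {..<d'}"] C(2) by (simp add: span_unitf)
  have ib: "inj_on (\<lambda>i. g (unitf i)) {..<d}"
    by (intro inj_onI) (metis inj_onD[OF inj] inj_unitf injD kn_unitf lessThan_iff)
  have cardB: "card B = d" by (simp add: B_def card_image[OF ib])
  then have le: "d \<le> d'" using card_mono[OF finC C(1)] cardC by simp
  have "card {d..<d'} = card (C - B)"
    using C(1) finC cardB cardC by (simp add: card_Diff_subset finite_subset)
  then obtain h0 where h0: "bij_betw h0 {d..<d'} (C - B)"
    using finite_same_card_bij[of "{d..<d'}" "C - B"] finC by auto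
  \<comment> \<open>Indices below \<open>d\<close> go to the images of the unit vectors, the others
    to the vectors that complete \<open>B\<close> to the basis \<open>C\<close>; \<open>G\<close> is
    the linear map with these values on the unit vectors.\<close>
  define h where "h i = (if i < d then g (unitf i) else h0 i)" for i
  have "bij_betw h {..<d} B" unfolding B_def
    by (rule bij_betw_cong[THEN iffD1, OF _ inj_on_imp_bij_betw[OF ib]]) (simp add: h_def)
  moreover have "bij_betw h {d..<d'} (C - B)"
    by (rule bij_betw_cong[THEN iffD1, OF _ h0]) (simp add: h_def)
  ultimately have "bij_betw h ({..<d} \<union> {d..<d'}) (B \<union> (C - B))" by (rule bij_betw_combine) auto
  moreover have "{..<d} \<union> {d..<d'} = {..<d'}" "B \<union> (C - B) = C" using le C(1) by auto
  ultimately have h: "bij_betw h {..<d'} C" by simp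
  define G where "G x = (\<Sum>i<d'. fscale (x i) (h i))" for x
  have Glin: "linon UNIV fscale fscale G"
    by (auto simp: linon_def G_def fun_eq_iff fscale_def sum_apply sum_distrib_left algebra_simps
        sum.distrib)
  have Gkn: "G ` kn d' \<subseteq> kn d'"
    using C(2) h unfolding G_def
    by (auto intro!: fs.subspace_sum[OF kn_subspace] fs.subspace_scale[OF kn_subspace] simp: bij_betw_def)
  have "kn d' \<subseteq> G ` kn d'"
  proof
    fix y :: "nat \<Rightarrow> 'k" assume "y \<in> kn d'"
    then obtain u where u: "y = (\<Sum>v\<in>C. fscale (u v) v)"
      using C(4) fs.span_finite[OF finC] by auto
    also have "\<dots> = (\<Sum>i<d'. fscale (u (h i)) (h i))"
      by (rule sum.reindex_bij_betw[OF h, symmetric])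
    also have "\<dots> = G (trunc d' (u \<circ> h))" unfolding G_def
      by (rule sum.cong) (auto simp: trunc_def)
    finally show "y \<in> G ` kn d'" by auto
  qed
  moreover have "inj_on G (kn d')"
  proof (rule inj_onI)
    fix x y :: "nat \<Rightarrow> 'k" assume xy: "x \<in> kn d'" "y \<in> kn d'" "G x = G y"
    define u where "u v = (x - y) (the_inv_into {..<d'} h v)" for v
    have "(\<Sum>v\<in>C. fscale (u v) v) = (\<Sum>i<d'. fscale (u (h i)) (h i))"
      by (rule sum.reindex_bij_betw[OF h, symmetric])
    also have "\<dots> = (\<Sum>i<d'. fscale ((x - y) i) (h i))"
      using h by (intro sum.cong) (auto simp: u_def the_inv_into_f_f bij_betw_def)
    also have "\<dots> = G x - G y"
      by (auto simp: G_def fun_eq_iff fscale_def sum_apply algebra_simps sum_subtractf)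
    finally have "(\<Sum>v\<in>C. fscale (u v) v) = 0" using xy by simp
    then have "u v = 0" if "v \<in> C" for v using fs.independentD[OF C(3) finC] that by blast
    then have "(x - y) i = 0" if "i < d'" for i
      using that h unfolding u_def by (metis bij_betw_def imageI lessThan_iff the_inv_into_f_f)
    then show "x = y" using xy(1,2) by (auto simp: fun_eq_iff kn_def) (metis not_less right_minus_eq)
  qed
  moreover have "G x = g x" if x: "x \<in> kn d" for x
  proof -
    have "G x = (\<Sum>i<d'. if i < d then fscale (x i) (h i) else 0)"
      unfolding G_def using x by (intro sum.cong) (auto simp: kn_def)
    also have "\<dots> = (\<Sum>i<d. fscale (x i) (g (unitf i)))"
      using le by (intro sum.mono_neutral_cong_right) (auto simp: h_def)
    also have "\<dots> = g (\<Sum>i<d. fscale (x i) (unitf i))"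
      by (rule linon_sum[OF _ _ lin kn_subspace, symmetric]) (auto intro: fs.vector_space_axioms)
    also have "\<dots> = g x" using kn_expand[OF x] by simp
    finally show ?thesis .
  qed
  ultimately show ?thesis using that[OF le Glin] Gkn by (auto simp: bij_betw_def)
qed

section \<open>Representations on subspaces\<close>

record ('k, 'v) rep =
  carr :: "'v set"
  scl :: "'k \<Rightarrow> 'v \<Rightarrow> 'v"
  gen :: "letter \<Rightarrow> 'v \<Rightarrow> 'v"

text \<open>Unlike in \<^term>\<open>um_module\<close>, the underlying space may be any subspace \<open>carr X\<close> of a type, so that
  direct sums, tensor products and the explicit modules below live on tuples of sequences without renumbering
  of bases. The relations, and characteristic 2, are imposed on the whole type and not just on \<open>carr X\<close>.\<close>

definition is_rep :: "('k::field, 'v::ab_group_add) rep \<Rightarrow> bool" where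
  "is_rep X \<longleftrightarrow> vector_space (scl X) \<and> module.subspace (scl X) (carr X) \<and> (\<forall>v::'v. v + v = 0) \<and>
     (\<forall>x v w. gen X x (v + w) = gen X x v + gen X x w) \<and>
     (\<forall>x k v. gen X x (scl X k v) = scl X k (gen X x v)) \<and>
     (\<forall>x. \<forall>v\<in>carr X. gen X x v \<in> carr X) \<and>
     (\<forall>v. gen X Lb (gen X La v) = gen X La (gen X Lb v) + gen X Lc v) \<and>
     (\<forall>v. gen X Lc (gen X La v) = gen X La (gen X Lc v) + gen X La v) \<and>
     (\<forall>v. gen X Lc (gen X Lb v) = gen X Lb (gen X Lc v) + gen X Lb v) \<and>
     (\<forall>v. gen X Lc (gen X Lc v) = gen X Lc v) \<and>
     (\<forall>v. gen X La (gen X La (gen X La (gen X La v))) = 0) \<and>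
     (\<forall>v. gen X Lb (gen X Lb (gen X Lb (gen X Lb v))) = 0)"

lemma is_repI:
  fixes X :: "('k::field, 'v::ab_group_add) rep"
  assumes "\<And>k v w. scl X k (v + w) = scl X k v + scl X k w"
    "\<And>k l v. scl X (k + l) v = scl X k v + scl X l v"
    "\<And>k l v. scl X k (scl X l v) = scl X (k * l) v" "\<And>v. scl X 1 v = v"
    "0 \<in> carr X" "\<And>v w. v \<in> carr X \<Longrightarrow> w \<in> carr X \<Longrightarrow> v + w \<in> carr X"
    "\<And>k v. v \<in> carr X \<Longrightarrow> scl X k v \<in> carr X" "\<And>v::'v. v + v = 0"
    "\<And>x v w. gen X x (v + w) = gen X x v + gen X x w"
    "\<And>x k v. gen X x (scl X k v) = scl X k (gen X x v)"
    "\<And>x v. v \<in> carr X \<Longrightarrow> gen X x v \<in> carr X"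
    "\<And>v. gen X Lb (gen X La v) = gen X La (gen X Lb v) + gen X Lc v"
    "\<And>v. gen X Lc (gen X La v) = gen X La (gen X Lc v) + gen X La v"
    "\<And>v. gen X Lc (gen X Lb v) = gen X Lb (gen X Lc v) + gen X Lb v"
    "\<And>v. gen X Lc (gen X Lc v) = gen X Lc v"
    "\<And>v. gen X La (gen X La (gen X La (gen X La v))) = 0"
    "\<And>v. gen X Lb (gen X Lb (gen X Lb (gen X Lb v))) = 0"
  shows "is_rep X"
proof -
  interpret vector_space "scl X" by standard (use assms(1-4) in auto)
  show ?thesis unfolding is_rep_def subspace_def
    using assms(5-) vector_space_axioms by auto
qed

lemma is_repI':
  fixes X :: "('k::field, 'v::ab_group_add) rep"
  assumes "\<And>k v w. scl X k (v + w) = scl X k v + scl X k w"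
    "\<And>k l v. scl X (k + l) v = scl X k v + scl X l v"
    "\<And>k l v. scl X k (scl X l v) = scl X (k * l) v" "\<And>v. scl X 1 v = v"
    "0 \<in> carr X" "\<And>v w. v \<in> carr X \<Longrightarrow> w \<in> carr X \<Longrightarrow> v + w \<in> carr X"
    "\<And>k v. v \<in> carr X \<Longrightarrow> scl X k v \<in> carr X" "\<And>v::'v. v + v = 0"
    "\<And>v w. gen X La (v + w) = gen X La v + gen X La w"
    "\<And>v w. gen X Lb (v + w) = gen X Lb v + gen X Lb w"
    "\<And>v w. gen X Lc (v + w) = gen X Lc v + gen X Lc w"
    "\<And>k v. gen X La (scl X k v) = scl X k (gen X La v)"
    "\<And>k v. gen X Lb (scl X k v) = scl X k (gen X Lb v)"
    "\<And>k v. gen X Lc (scl X k v) = scl X k (gen X Lc v)"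
    "\<And>v. v \<in> carr X \<Longrightarrow> gen X La v \<in> carr X"
    "\<And>v. v \<in> carr X \<Longrightarrow> gen X Lb v \<in> carr X"
    "\<And>v. v \<in> carr X \<Longrightarrow> gen X Lc v \<in> carr X"
    "\<And>v. gen X Lb (gen X La v) = gen X La (gen X Lb v) + gen X Lc v"
    "\<And>v. gen X Lc (gen X La v) = gen X La (gen X Lc v) + gen X La v"
    "\<And>v. gen X Lc (gen X Lb v) = gen X Lb (gen X Lc v) + gen X Lb v"
    "\<And>v. gen X Lc (gen X Lc v) = gen X Lc v"
    "\<And>v. gen X La (gen X La (gen X La (gen X La v))) = 0"
    "\<And>v. gen X Lb (gen X Lb (gen X Lb (gen X Lb v))) = 0"
  shows "is_rep X"
proof (rule is_repI)
  fix x k v w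
  show "gen X x (v + w) = gen X x v + gen X x w" using assms(9-11) by (cases x) auto
  show "gen X x (scl X k v) = scl X k (gen X x v)" using assms(12-14) by (cases x) auto
  show "v \<in> carr X \<Longrightarrow> gen X x v \<in> carr X" using assms(15-17) by (cases x) auto
qed (fact assms)+

context
  fixes X :: "('k::field, 'v::ab_group_add) rep"
  assumes X: "is_rep X"
begin

lemma rep_vs: "vector_space (scl X)" using X by (simp add: is_rep_def)

lemma rep_self [simp]: "(v::'v) + v = 0" using X by (simp add: is_rep_def)

lemma rep_self2 [simp]: "(v::'v) + (v + w) = w"
  by (simp add: add.assoc[symmetric])

lemma rep_uminus [simp]: "- (v::'v) = v"
  using rep_self[of v] by (metis minus_unique)

lemma rep_minus [simp]: "(v::'v) - w = v + w"
  using rep_uminus[of w] by (metis diff_conv_add_uminus)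

lemma rep_eq: "(v::'v) = w \<longleftrightarrow> v + w = 0"
  using rep_minus[of v w] by (metis right_minus_eq)

lemma rep_subspace: "module.subspace (scl X) (carr X)" using X by (simp add: is_rep_def)

lemma rep_scl_simps [simp]: "scl X k (v + w) = scl X k v + scl X k w"
  "scl X (k + l) v = scl X k v + scl X l v" "scl X k (scl X l v) = scl X (k * l) v"
  "scl X 1 v = v" "scl X k 0 = 0" "scl X 0 v = 0"
proof -
  interpret vector_space "scl X" by (rule rep_vs)
  show "scl X k (v + w) = scl X k v + scl X k w" "scl X (k + l) v = scl X k v + scl X l v"
    "scl X k (scl X l v) = scl X (k * l) v" "scl X 1 v = v" "scl X k 0 = 0" "scl X 0 v = 0"
    by (simp_all add: scale_right_distrib scale_left_distrib)
qed

lemma rep_closed [simp]: "0 \<in> carr X" "v \<in> carr X \<Longrightarrow> w \<in> carr X \<Longrightarrow> v + w \<in> carr X"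
  "v \<in> carr X \<Longrightarrow> scl X k v \<in> carr X" "v \<in> carr X \<Longrightarrow> gen X x v \<in> carr X"
proof -
  interpret vector_space "scl X" by (rule rep_vs)
  show "0 \<in> carr X" "v \<in> carr X \<Longrightarrow> w \<in> carr X \<Longrightarrow> v + w \<in> carr X"
    "v \<in> carr X \<Longrightarrow> scl X k v \<in> carr X"
    using rep_subspace by (simp_all add: subspace_def)
  show "v \<in> carr X \<Longrightarrow> gen X x v \<in> carr X" using X by (simp add: is_rep_def)
qed

lemma rep_gen_add [simp]: "gen X x (v + w) = gen X x v + gen X x w"
  and rep_gen_scl [simp]: "gen X x (scl X k v) = scl X k (gen X x v)"
  using X by (simp_all add: is_rep_def)

lemma rep_gen_zero [simp]: "gen X x 0 = 0"
  using rep_gen_scl[of x 0 0] by simp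

lemma rep_rels [simp]: "gen X Lb (gen X La v) = gen X La (gen X Lb v) + gen X Lc v"
  "gen X Lc (gen X La v) = gen X La (gen X Lc v) + gen X La v"
  "gen X Lc (gen X Lb v) = gen X Lb (gen X Lc v) + gen X Lb v"
  "gen X Lc (gen X Lc v) = gen X Lc v"
  "gen X La (gen X La (gen X La (gen X La v))) = 0"
  "gen X Lb (gen X Lb (gen X Lb (gen X Lb v))) = 0"
  using X by (simp_all add: is_rep_def)

end

section \<open>Homomorphisms, isomorphisms and direct sums of representations\<close>

definition rhom :: "('k, 'v::plus) rep \<Rightarrow> ('k, 'w::plus) rep \<Rightarrow> ('v \<Rightarrow> 'w) \<Rightarrow> bool" where
  "rhom X Y f \<longleftrightarrow> f ` carr X \<subseteq> carr Y \<and> linon (carr X) (scl X) (scl Y) f \<and>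
     (\<forall>x. \<forall>v\<in>carr X. f (gen X x v) = gen Y x (f v))"

lemma rhomI:
  assumes "\<And>v. v \<in> carr X \<Longrightarrow> f v \<in> carr Y"
    "\<And>v w. v \<in> carr X \<Longrightarrow> w \<in> carr X \<Longrightarrow> f (v + w) = f v + f w"
    "\<And>k v. v \<in> carr X \<Longrightarrow> f (scl X k v) = scl Y k (f v)"
    "\<And>v. v \<in> carr X \<Longrightarrow> f (gen X La v) = gen Y La (f v)"
    "\<And>v. v \<in> carr X \<Longrightarrow> f (gen X Lb v) = gen Y Lb (f v)"
    "\<And>v. v \<in> carr X \<Longrightarrow> f (gen X Lc v) = gen Y Lc (f v)"
  shows "rhom X Y f"
proof -
  have "f (gen X x v) = gen Y x (f v)" if "v \<in> carr X" for x v
    using assms(4-6)[OF that] by (cases x) auto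
  then show ?thesis using assms(1-3) by (auto simp: rhom_def linon_def)
qed

lemma rhomD:
  assumes "rhom X Y f"
  shows "v \<in> carr X \<Longrightarrow> f v \<in> carr Y"
    "v \<in> carr X \<Longrightarrow> w \<in> carr X \<Longrightarrow> f (v + w) = f v + f w"
    "v \<in> carr X \<Longrightarrow> f (scl X k v) = scl Y k (f v)"
    "v \<in> carr X \<Longrightarrow> f (gen X x v) = gen Y x (f v)"
    "linon (carr X) (scl X) (scl Y) f"
  using assms by (auto simp: rhom_def linon_def)

lemma rhom_zero:
  assumes "rhom X Y f" "is_rep X" "is_rep Y"
  shows "f 0 = 0"
  using rhomD(3)[OF assms(1), of 0 0] assms(2,3) by simp

lemma rhom_inj_iff:
  assumes "rhom X Y f" "is_rep X" "is_rep Y"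
  shows "inj_on f (carr X) \<longleftrightarrow> (\<forall>v\<in>carr X. f v = 0 \<longrightarrow> v = 0)"
proof (intro iffI ballI impI)
  fix v assume "inj_on f (carr X)" "v \<in> carr X" "f v = 0"
  then show "v = 0" using rhom_zero[OF assms] assms(2) by (metis inj_onD rep_closed(1))
next
  assume *: "\<forall>v\<in>carr X. f v = 0 \<longrightarrow> v = 0"
  show "inj_on f (carr X)"
  proof (rule inj_onI)
    fix v w assume vw: "v \<in> carr X" "w \<in> carr X" "f v = f w"
    then have "f (v + w) = 0" using rhomD(2)[OF assms(1)] assms(3) by simp
    then have "v + w = 0" using * vw assms(2) by simp
    then show "v = w" using rep_eq[OF assms(2)] by blast
  qed
qed

lemma rhom_id: "rhom X X (\<lambda>x. x)"
  by (rule rhomI) auto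

lemma rhom_comp: "rhom X Y f \<Longrightarrow> rhom Y Z g \<Longrightarrow> rhom X Z (\<lambda>x. g (f x))"
  by (rule rhomI) (auto simp: rhomD)

lemma rhom_inv:
  assumes "rhom X Y f" "bij_betw f (carr X) (carr Y)" "is_rep X"
  shows "rhom Y X (the_inv_into (carr X) f)"
proof -
  let ?g = "the_inv_into (carr X) f"
  have i: "inj_on f (carr X)" and s: "f ` carr X = carr Y" using assms(2) by (auto simp: bij_betw_def)
  have g: "?g (f x) = x" if "x \<in> carr X" for x using the_inv_into_f_f[OF i that] .
  have ex: "\<exists>x\<in>carr X. v = f x" if "v \<in> carr Y" for v using s that by blast
  show ?thesis
  proof (rule rhomI)
    show "?g v \<in> carr X" if "v \<in> carr Y" for v using ex[OF that] g by auto
    fix v w assume "v \<in> carr Y" "w \<in> carr Y"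
    then obtain x y where xy: "x \<in> carr X" "v = f x" "y \<in> carr X" "w = f y" using ex by metis
    then show "?g (v + w) = ?g v + ?g w"
      using g assms(3) by (simp add: rhomD(2)[OF assms(1), symmetric])
  next
    fix k v assume "v \<in> carr Y"
    then obtain x where xy: "x \<in> carr X" "v = f x" using ex by metis
    then show "?g (scl Y k v) = scl X k (?g v)"
      using g assms(3) by (simp add: rhomD(3)[OF assms(1), symmetric])
    show "?g (gen Y La v) = gen X La (?g v)" "?g (gen Y Lb v) = gen X Lb (?g v)"
      "?g (gen Y Lc v) = gen X Lc (?g v)"
      using g assms(3) xy by (simp_all add: rhomD(4)[OF assms(1), symmetric])
  qed
qed

definition riso :: "('k, 'v::plus) rep \<Rightarrow> ('k, 'w::plus) rep \<Rightarrow> bool" where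
  "riso X Y \<longleftrightarrow> (\<exists>f. rhom X Y f \<and> bij_betw f (carr X) (carr Y))"

lemma risoI: "rhom X Y f \<Longrightarrow> bij_betw f (carr X) (carr Y) \<Longrightarrow> riso X Y"
  by (auto simp: riso_def)

lemma riso_byWitness:
  assumes "rhom X Y f" "\<And>y. y \<in> carr Y \<Longrightarrow> g y \<in> carr X"
    "\<And>x. x \<in> carr X \<Longrightarrow> g (f x) = x" "\<And>y. y \<in> carr Y \<Longrightarrow> f (g y) = y"
  shows "riso X Y"
  by (rule risoI[OF assms(1)], rule bij_betw_byWitness[where f' = g])
    (use assms in \<open>auto simp: rhomD(1)\<close>)

lemma riso_refl: "riso X X"
  by (rule risoI[OF rhom_id]) (simp add: bij_betw_def)

lemma riso_sym: "is_rep X \<Longrightarrow> riso X Y \<Longrightarrow> riso Y X"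
  unfolding riso_def using rhom_inv bij_betw_the_inv_into by metis

lemma riso_trans [trans]: "riso X Y \<Longrightarrow> riso Y Z \<Longrightarrow> riso X Z"
  unfolding riso_def using rhom_comp bij_betw_trans[unfolded comp_def] by metis

definition rprod :: "('k, 'v) rep \<Rightarrow> ('k, 'w) rep \<Rightarrow> ('k, 'v \<times> 'w) rep" (infixr \<open>\<times>\<^sub>r\<close> 70) where
  "X \<times>\<^sub>r Y = \<lparr>carr = carr X \<times> carr Y, scl = (\<lambda>k (v, w). (scl X k v, scl Y k w)),
     gen = (\<lambda>x (v, w). (gen X x v, gen Y x w))\<rparr>"

lemma rprod_simps [simp]: "carr (X \<times>\<^sub>r Y) = carr X \<times> carr Y"
  "scl (X \<times>\<^sub>r Y) k (v, w) = (scl X k v, scl Y k w)"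
  "gen (X \<times>\<^sub>r Y) x (v, w) = (gen X x v, gen Y x w)"
  by (simp_all add: rprod_def)

lemma is_rep_rprod [simp]: "is_rep X \<Longrightarrow> is_rep Y \<Longrightarrow> is_rep (X \<times>\<^sub>r Y)"
  by (rule is_repI) (auto simp: zero_prod_def split: prod.splits)

lemma rhom_rprod:
  assumes "rhom X X' f" "rhom Y Y' g"
  shows "rhom (X \<times>\<^sub>r Y) (X' \<times>\<^sub>r Y') (map_prod f g)"
  by (rule rhomI) (use assms in \<open>auto simp: rhomD\<close>)

lemma riso_rprod:
  assumes "riso X X'" "riso Y Y'"
  shows "riso (X \<times>\<^sub>r Y) (X' \<times>\<^sub>r Y')"
proof -
  obtain f g where "rhom X X' f" "bij_betw f (carr X) (carr X')" "rhom Y Y' g"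
    "bij_betw g (carr Y) (carr Y')" using assms by (auto simp: riso_def)
  then show ?thesis by (intro risoI[OF rhom_rprod]) (auto intro: bij_betw_map_prod)
qed

lemma riso_rprod_assoc: "riso ((X \<times>\<^sub>r Y) \<times>\<^sub>r Z) (X \<times>\<^sub>r (Y \<times>\<^sub>r Z))"
  by (rule riso_byWitness[where f = "\<lambda>((x, y), z). (x, (y, z))" and g = "\<lambda>(x, (y, z)). ((x, y), z)"])
    (auto intro!: rhomI)

lemma riso_rprod_comm: "riso (X \<times>\<^sub>r Y) (Y \<times>\<^sub>r X)"
  by (rule riso_byWitness[where f = prod.swap and g = prod.swap]) (auto intro!: rhomI)

definition rfun :: "nat \<Rightarrow> ('k, 'v::zero) rep \<Rightarrow> ('k, nat \<Rightarrow> 'v) rep" where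
  "rfun r X = \<lparr>carr = {f \<in> kn r. \<forall>i. f i \<in> carr X}, scl = (\<lambda>k f i. scl X k (f i)),
     gen = (\<lambda>x f i. gen X x (f i))\<rparr>"

lemma rfun_simps [simp]: "carr (rfun r X) = {f \<in> kn r. \<forall>i. f i \<in> carr X}"
  "scl (rfun r X) k f = (\<lambda>i. scl X k (f i))" "gen (rfun r X) x f = (\<lambda>i. gen X x (f i))"
  by (simp_all add: rfun_def)

lemma is_rep_rfun [simp]: "is_rep X \<Longrightarrow> is_rep (rfun r X)"
  by (rule is_repI) (auto simp: fun_eq_iff kn_def)

section \<open>Short exact sequences and uniqueness of cokernels\<close>

definition rses :: "('k, 'v::plus) rep \<Rightarrow> ('k, 'w::plus) rep \<Rightarrow> ('k, 'u::{plus,zero}) rep \<Rightarrow>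
    ('v \<Rightarrow> 'w) \<Rightarrow> ('w \<Rightarrow> 'u) \<Rightarrow> bool" where
  "rses X Y Z f p \<longleftrightarrow> rhom X Y f \<and> inj_on f (carr X) \<and> rhom Y Z p \<and> p ` carr Y = carr Z \<and>
     (\<forall>y\<in>carr Y. p y = 0 \<longleftrightarrow> y \<in> f ` carr X)"

text \<open>The isomorphisms \<open>a\<close> and \<open>b\<close> match the kernels of
  \<open>p\<close> and \<open>p'\<close>, so \<open>p'\<close> after \<open>b\<close> factors
  through \<open>p\<close>, and the induced map is injective and onto. All later identifications of
  cokernels end here.\<close>

lemma rses_unique:
  assumes "rses X Y Z f p" "rses X' Y' Z' f' p'"
    and a: "rhom X X' a" "bij_betw a (carr X) (carr X')"
    and b: "rhom Y Y' b" "bij_betw b (carr Y) (carr Y')"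
    and ab: "\<And>x. x \<in> carr X \<Longrightarrow> b (f x) = f' (a x)"
    and rep: "is_rep Y" "is_rep Z" "is_rep Y'" "is_rep Z'"
  shows "riso Z Z'"
proof -
  have f: "rhom X Y f" and p: "rhom Y Z p" "p ` carr Y = carr Z"
    and ker: "\<And>y. y \<in> carr Y \<Longrightarrow> p y = 0 \<longleftrightarrow> y \<in> f ` carr X"
    using assms(1) by (auto simp: rses_def)
  have f': "rhom X' Y' f'" and p': "rhom Y' Z' p'" "p' ` carr Y' = carr Z'"
    and ker': "\<And>y. y \<in> carr Y' \<Longrightarrow> p' y = 0 \<longleftrightarrow> y \<in> f' ` carr X'"
    using assms(2) by (auto simp: rses_def)
  have bi: "inj_on b (carr Y)" using b by (auto simp: bij_betw_def)
  have key: "p' (b y) = 0 \<longleftrightarrow> p y = 0" if y: "y \<in> carr Y" for y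
  proof -
    have "p' (b y) = 0 \<longleftrightarrow> b y \<in> f' ` carr X'" using ker' rhomD(1)[OF b(1) y] by blast
    also have "\<dots> \<longleftrightarrow> b y \<in> f' ` a ` carr X" using a(2) by (simp add: bij_betw_def)
    also have "\<dots> \<longleftrightarrow> b y \<in> b ` f ` carr X" by (simp add: image_image ab cong: image_cong)
    also have "\<dots> \<longleftrightarrow> y \<in> f ` carr X"
      using y rhomD(1)[OF f] inj_on_image_mem_iff[OF bi] by blast
    finally show ?thesis using ker[OF y] by simp
  qed
  \<comment> \<open>An arbitrary preimage under \<open>p\<close> is chosen; two preimages differ by
    an element of the kernel, which \<open>key\<close> sends into the kernel of \<open>p'\<close>.
    Differences are sums, the characteristic being 2.\<close>
  define h where "h z = p' (b (SOME y. y \<in> carr Y \<and> p y = z))" for z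
  have h: "h (p y) = p' (b y)" if y: "y \<in> carr Y" for y
  proof -
    let ?w = "SOME w. w \<in> carr Y \<and> p w = p y"
    have w: "?w \<in> carr Y" "p ?w = p y"
      using someI[of "\<lambda>w. w \<in> carr Y \<and> p w = p y" y] y by auto
    then have "p (?w + y) = 0" using rhomD(2)[OF p(1) w(1) y] rep(2) by simp
    then have "p' (b (?w + y)) = 0" using key w y rep(1) by simp
    then have "p' (b ?w) + p' (b y) = 0"
      using w y rhomD(2)[OF b(1)] rhomD(2)[OF p'(1)] rhomD(1)[OF b(1)] by simp
    then show ?thesis unfolding h_def using rep_eq[OF rep(4)] by blast
  qed
  have ex: "\<exists>y\<in>carr Y. z = p y" if "z \<in> carr Z" for z using p(2) that by blast
  have hh: "rhom Z Z' h"
  proof (rule rhomI)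
    show "h v \<in> carr Z'" if "v \<in> carr Z" for v
      using ex[OF that] h rhomD(1)[OF b(1)] rhomD(1)[OF p'(1)] by auto
    fix v w assume "v \<in> carr Z" "w \<in> carr Z"
    then obtain x y where xy: "x \<in> carr Y" "v = p x" "y \<in> carr Y" "w = p y" using ex by metis
    then have "h (v + w) = h (p (x + y))" using rhomD(2)[OF p(1)] by simp
    also have "\<dots> = h v + h w" using xy h rep(1)
      by (simp add: rhomD(2)[OF p'(1)] rhomD(2)[OF b(1)] rhomD(1)[OF b(1)])
    finally show "h (v + w) = h v + h w" .
  next
    fix k v assume "v \<in> carr Z"
    then obtain x where xy: "x \<in> carr Y" "v = p x" using ex by metis
    have "h (scl Z k v) = h (p (scl Y k x))" using rhomD(3)[OF p(1)] xy by simp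
    also have "\<dots> = scl Z' k (h v)" using xy h rep(1)
      by (simp add: rhomD(3)[OF p'(1)] rhomD(3)[OF b(1)] rhomD(1)[OF b(1)])
    finally show "h (scl Z k v) = scl Z' k (h v)" .
    have "h (gen Z l v) = gen Z' l (h v)" for l
    proof -
      have "h (gen Z l v) = h (p (gen Y l x))" using rhomD(4)[OF p(1)] xy by simp
      also have "\<dots> = gen Z' l (h v)" using xy h rep(1)
        by (simp add: rhomD(4)[OF p'(1)] rhomD(4)[OF b(1)] rhomD(1)[OF b(1)])
      finally show ?thesis .
    qed
    then show "h (gen Z La v) = gen Z' La (h v)" "h (gen Z Lb v) = gen Z' Lb (h v)"
      "h (gen Z Lc v) = gen Z' Lc (h v)" by auto
  qed
  have "inj_on h (carr Z)"
    unfolding rhom_inj_iff[OF hh rep(2,4)] using ex h key by metis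
  moreover have "h ` carr Z = carr Z'"
  proof -
    have "h ` p ` carr Y = p' ` b ` carr Y" by (simp add: image_image h cong: image_cong)
    then show ?thesis using p(2) p'(2) b(2) by (simp add: bij_betw_def)
  qed
  ultimately show ?thesis using risoI[OF hh] by (simp add: bij_betw_def)
qed

section \<open>Dimension and linear retractions\<close>

definition fdim :: "'v::plus set \<Rightarrow> ('k::field \<Rightarrow> 'v \<Rightarrow> 'v) \<Rightarrow> nat \<Rightarrow> bool" where
  "fdim V s n \<longleftrightarrow> (\<exists>f. linon (kn n) fscale s f \<and> bij_betw f (kn n) V)"

lemma fdim_kn: "fdim (kn n) fscale n"
  unfolding fdim_def by (rule exI[of _ id]) (simp add: linon_def)

lemma fdim_prod:
  fixes s :: "'k::field \<Rightarrow> 'v::plus \<Rightarrow> 'v" and s' :: "'k \<Rightarrow> 'w::plus \<Rightarrow> 'w"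
  assumes "fdim V s n" "fdim W s' m"
  shows "fdim (V \<times> W) (\<lambda>k (v, w). (s k v, s' k w)) (n + m)"
proof -
  obtain f g where f: "linon (kn n) fscale s f" "bij_betw f (kn n) V"
    and g: "linon (kn m) fscale s' g" "bij_betw g (kn m) W"
    using assms by (auto simp: fdim_def)
  define h where "h x = (trunc n x, \<lambda>i. x (i + n))" for x :: "nat \<Rightarrow> 'k"
  have "bij_betw h (kn (n + m)) (kn n \<times> kn m)"
    by (rule bij_betw_byWitness[where f' = "\<lambda>(x, y) i. if i < n then x i else y (i - n)"])
      (auto simp: h_def kn_def trunc_def fun_eq_iff)
  moreover have "bij_betw (map_prod f g) (kn n \<times> kn m) (V \<times> W)"
    using f(2) g(2) by (rule bij_betw_map_prod)
  ultimately have "bij_betw (map_prod f g \<circ> h) (kn (n + m)) (V \<times> W)" by (rule bij_betw_trans)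
  moreover have "linon (kn (n + m)) fscale (\<lambda>k (v, w). (s k v, s' k w)) (map_prod f g \<circ> h)"
  proof -
    have sh: "(\<lambda>i. x (i + n)) \<in> kn m" if "x \<in> kn (n + m)" for x :: "nat \<Rightarrow> 'k"
      using that by (auto simp: kn_def)
    have "f (trunc n x + trunc n y) = f (trunc n x) + f (trunc n y)" for x y
      using f(1) by (simp add: linon_def)
    moreover have "f (fscale k (trunc n x)) = s k (f (trunc n x))" for k x
      using f(1) by (simp add: linon_def)
    moreover have "g ((\<lambda>i. x (i + n)) + (\<lambda>i. y (i + n))) = g (\<lambda>i. x (i + n)) + g (\<lambda>i. y (i + n))"
      if "x \<in> kn (n + m)" "y \<in> kn (n + m)" for x y
      using g(1) sh that by (simp add: linon_def)
    moreover have "g (fscale k (\<lambda>i. x (i + n))) = s' k (g (\<lambda>i. x (i + n)))"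
      if "x \<in> kn (n + m)" for k x
      using g(1) sh that by (simp add: linon_def)
    ultimately show ?thesis
      by (simp add: linon_def h_def trunc_add trunc_scale)
        (simp add: fscale_def plus_fun_def)
  qed
  ultimately show ?thesis unfolding fdim_def by blast
qed

text \<open>In coordinates \<open>f\<close> becomes an injective endomorphism of
  \<open>kn n\<close>. The extension that \<open>kn_inj_extend\<close> provides for d = d' is
  bijective and agrees with it everywhere on \<open>kn n\<close>, so the endomorphism is
  onto.\<close>

lemma fdim_inj_bij:
  assumes V: "fdim V s n" and W: "fdim W s' n"
    and f: "linon V s s' f" "inj_on f V" "f ` V \<subseteq> W"
    and sub: "\<And>v w. v \<in> W \<Longrightarrow> w \<in> W \<Longrightarrow> v + w \<in> W" "\<And>k v. v \<in> W \<Longrightarrow> s' k v \<in> W"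
  shows "bij_betw f V W"
proof -
  obtain a where a: "linon (kn n) fscale s a" "bij_betw a (kn n) V" using V by (auto simp: fdim_def)
  obtain b where b: "linon (kn n) fscale s' b" "bij_betw b (kn n) W" using W by (auto simp: fdim_def)
  have ai: "a x \<in> V" if "x \<in> kn n" for x using a that by (auto simp: bij_betw_def)
  let ?bi = "the_inv_into (kn n) b"
  have bb: "inj_on b (kn n)" "b ` kn n = W" using b by (auto simp: bij_betw_def)
  have bi: "?bi (b x) = x" if "x \<in> kn n" for x using the_inv_into_f_f[OF bb(1) that] .
  have bil: "?bi v \<in> kn n \<and> b (?bi v) = v" if "v \<in> W" for v using that bb(2) bi by auto
  have bi_add: "?bi (v + w) = ?bi v + ?bi w" if "v \<in> W" "w \<in> W" for v w
  proof -
    have "b (?bi v + ?bi w) = v + w" using bil that b(1) by (simp add: linon_def)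
    then show ?thesis using bi[of "?bi v + ?bi w"] bil that by simp
  qed
  have bi_scl: "?bi (s' k v) = fscale k (?bi v)" if "v \<in> W" for v k
  proof -
    have "b (fscale k (?bi v)) = s' k v" using bil that b(1) by (simp add: linon_def)
    then show ?thesis using bi[of "fscale k (?bi v)"] bil that by simp
  qed
  define g where "g x = ?bi (f (a x))" for x
  have fW: "f (a x) \<in> W" if "x \<in> kn n" for x using f(3) ai that by blast
  have "linon (kn n) fscale fscale g"
    using a(1) f(1) ai fW unfolding linon_def g_def by (simp add: bi_add bi_scl)
  moreover have gi: "inj_on g (kn n)"
  proof (rule inj_onI)
    fix x y assume xy: "x \<in> kn n" "y \<in> kn n" "g x = g y"
    then have "f (a x) = f (a y)" using bil fW unfolding g_def by metis
    then have "a x = a y" using inj_onD[OF f(2)] ai xy by simp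
    then show "x = y" using inj_onD[OF bij_betw_imp_inj_on[OF a(2)]] xy by simp
  qed
  moreover have "g ` kn n \<subseteq> kn n" using bil fW by (auto simp: g_def)
  ultimately obtain G where G: "bij_betw G (kn n) (kn n)" "\<And>x. x \<in> kn n \<Longrightarrow> G x = g x"
    using kn_inj_extend[of n g n] by metis
  have "W \<subseteq> f ` V"
  proof
    fix w assume w: "w \<in> W"
    then obtain x where x: "x \<in> kn n" "?bi w = G x" using bil G(1) by (metis bij_betw_def imageE)
    then have "b (?bi w) = f (a x)" using G(2) bil fW by (simp add: g_def)
    then have "w = f (a x)" using bil w by simp
    then show "w \<in> f ` V" using ai x by auto
  qed
  then show ?thesis using f(2,3) by (auto simp: bij_betw_def)
qed

text \<open>The left inverse is linear but not equivariant. It serves to extend a functional from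
  \<open>X\<close> to \<open>Y\<close>, after which injectivity of \<open>E0\<close> and
  \<open>E1\<close> is obtained by correcting that functional.\<close>

lemma fdim_retraction:
  assumes X: "fdim (carr X) (scl X) n" "is_rep X" and Y: "is_rep Y"
    and f: "rhom X Y f" "inj_on f (carr X)"
  obtains l where "linon UNIV (scl Y) (scl X) l" "\<And>y. l y \<in> carr X"
    "\<And>x. x \<in> carr X \<Longrightarrow> l (f x) = x"
proof -
  obtain a where a: "linon (kn n) fscale (scl X) a" "bij_betw a (kn n) (carr X)"
    using X by (auto simp: fdim_def)
  have ai: "a x \<in> carr X" if "x \<in> kn n" for x using a that by (auto simp: bij_betw_def)
  interpret vp: vector_space_pair "fscale" "scl Y"
    by (rule vector_space_pair.intro[OF fs.vector_space_axioms rep_vs[OF Y]])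
  let ?h = "(\<lambda>x. f (a x)) \<circ> trunc n"
  have "linon (kn n) fscale (scl Y) (\<lambda>x. f (a x))"
    using a(1) ai rhomD[OF f(1)] by (simp add: linon_def)
  then have hl: "Vector_Spaces.linear fscale (scl Y) ?h"
    by (rule linear_trunc[OF rep_vs[OF Y]])
  have hi: "inj_on ?h (kn n)"
  proof (rule inj_onI)
    fix x y assume xy: "x \<in> kn n" "y \<in> kn n" "?h x = ?h y"
    then have "f (a x) = f (a y)" by simp
    then have "a x = a y" using inj_onD[OF f(2)] ai xy by simp
    then show "x = y" using inj_onD[OF bij_betw_imp_inj_on[OF a(2)]] xy by simp
  qed
  obtain g where g: "range g \<subseteq> kn n" "Vector_Spaces.linear (scl Y) fscale g"
    "\<forall>v\<in>kn n. g (?h v) = v"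
    using vp.linear_exists_left_inverse_on[OF hl kn_subspace hi] by metis
  have gk: "g y \<in> kn n" for y using g(1) by blast
  interpret gl: Vector_Spaces.linear "scl Y" fscale g by fact
  have "linon UNIV (scl Y) (scl X) (\<lambda>y. a (g y))"
    using a(1) gk by (simp add: linon_def gl.add gl.scale)
  moreover have "a (g (f x)) = x" if "x \<in> carr X" for x
  proof -
    obtain v where v: "v \<in> kn n" "x = a v"
      using bij_betw_imp_surj_on[OF a(2)] \<open>x \<in> carr X\<close> by blast
    have "g (?h v) = v" using g(3) v by blast
    then show ?thesis using v by simp
  qed
  ultimately show ?thesis using that[of "\<lambda>y. a (g y)"] gk ai by blast
qed

section \<open>Essential submodules\<close>

definition rsub :: "('k, 'v::{plus,zero}) rep \<Rightarrow> 'v set \<Rightarrow> bool" where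
  "rsub X K \<longleftrightarrow> K \<subseteq> carr X \<and> 0 \<in> K \<and> (\<forall>v\<in>K. \<forall>w\<in>K. v + w \<in> K) \<and> (\<forall>x. \<forall>v\<in>K. gen X x v \<in> K)"

text \<open>\<open>S\<close> is an essential submodule. The point is \<open>ress_inj\<close>:
  injectivity of a homomorphism need only be checked on \<open>S\<close>, which for
  \<open>E0\<close> and \<open>E1\<close> will be the socle.\<close>

definition ress :: "('k, 'v::{plus,zero}) rep \<Rightarrow> 'v set \<Rightarrow> bool" where
  "ress X S \<longleftrightarrow> rsub X S \<and> (\<forall>K. rsub X K \<longrightarrow> K \<inter> S \<subseteq> {0} \<longrightarrow> K \<subseteq> {0})"

lemma rsub_kernel:
  assumes "rhom X Y f" "is_rep X" "is_rep Y"
  shows "rsub X {v \<in> carr X. f v = 0}"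
  unfolding rsub_def using rhomD[OF assms(1)] rhom_zero[OF assms] assms(2,3) by auto

lemma ress_inj:
  assumes "rhom X Y f" "is_rep X" "is_rep Y" "ress X S"
    and "\<And>x. x \<in> S \<Longrightarrow> f x = 0 \<Longrightarrow> x = 0"
  shows "inj_on f (carr X)"
  using rsub_kernel[OF assms(1-3)] assms(4,5)
  unfolding rhom_inj_iff[OF assms(1-3)] ress_def by blast

lemma ress_self: "is_rep X \<Longrightarrow> ress X (carr X)"
  unfolding ress_def rsub_def by auto

text \<open>The second coordinates of those elements of \<open>K\<close> whose first coordinate lies
  in \<open>S\<close> form a submodule meeting \<open>T\<close> in 0, hence vanish. So an element of
  \<open>K\<close> with first coordinate in \<open>S\<close> lies in S \<times> T and is 0; thus the
  first projection of \<open>K\<close> meets \<open>S\<close> in 0 and vanishes too, and what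
  remains of \<open>K\<close> was already seen to be 0.\<close>

lemma ress_rprod:
  assumes "is_rep X" "is_rep Y" "ress X S" "ress Y T"
  shows "ress (X \<times>\<^sub>r Y) (S \<times> T)"
  unfolding ress_def
proof (intro conjI allI impI)
  have S: "rsub X S" and T: "rsub Y T" using assms by (auto simp: ress_def)
  show "rsub (X \<times>\<^sub>r Y) (S \<times> T)"
    using S T by (auto simp: rsub_def zero_prod_def)
  fix K assume K: "rsub (X \<times>\<^sub>r Y) K" and KST: "K \<inter> S \<times> T \<subseteq> {0}"
  define K1 where "K1 = {y. \<exists>x\<in>S. (x, y) \<in> K}"
  have Kc: "(x, y) \<in> K \<Longrightarrow> x \<in> carr X \<and> y \<in> carr Y" for x y using K by (auto simp: rsub_def)
  have Ka: "(x, y) \<in> K \<Longrightarrow> (x', y') \<in> K \<Longrightarrow> (x + x', y + y') \<in> K" for x y x' y'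
    using K unfolding rsub_def by (metis add_Pair)
  have Kg: "(x, y) \<in> K \<Longrightarrow> (gen X l x, gen Y l y) \<in> K" for x y l
    using K unfolding rsub_def by (metis rprod_simps(3))
  have K0: "(0, 0) \<in> K" using K by (simp add: rsub_def zero_prod_def)
  have "rsub Y K1"
    unfolding rsub_def
  proof (intro conjI ballI allI)
    show "K1 \<subseteq> carr Y" using Kc by (auto simp: K1_def)
    show "0 \<in> K1" using S K0 by (auto simp: K1_def rsub_def)
    show "v + w \<in> K1" if vw: "v \<in> K1" "w \<in> K1" for v w
    proof -
      obtain x x' where "x \<in> S" "(x, v) \<in> K" "x' \<in> S" "(x', w) \<in> K"
        using vw by (auto simp: K1_def)
      then have "x + x' \<in> S" "(x + x', v + w) \<in> K" using S Ka by (auto simp: rsub_def)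
      then show ?thesis by (auto simp: K1_def)
    qed
    show "gen Y l v \<in> K1" if v: "v \<in> K1" for l v
    proof -
      obtain x where "x \<in> S" "(x, v) \<in> K" using v by (auto simp: K1_def)
      then have "gen X l x \<in> S" "(gen X l x, gen Y l v) \<in> K" using S Kg by (auto simp: rsub_def)
      then show ?thesis by (auto simp: K1_def)
    qed
  qed
  moreover have "K1 \<inter> T \<subseteq> {0}" using KST by (auto simp: K1_def zero_prod_def)
  ultimately have K1: "K1 \<subseteq> {0}" using assms(4) by (simp add: ress_def)
  have "rsub X (fst ` K)"
    unfolding rsub_def
  proof (intro conjI ballI allI)
    show "fst ` K \<subseteq> carr X" using Kc by auto
    show "0 \<in> fst ` K" using image_eqI[of 0 fst "(0, 0)" K] K0 by simp
    show "v + w \<in> fst ` K" if vw: "v \<in> fst ` K" "w \<in> fst ` K" for v w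
    proof -
      obtain y y' where "(v, y) \<in> K" "(w, y') \<in> K" using vw by auto
      then show ?thesis using image_eqI[of "v + w" fst "(v + w, y + y')" K] Ka by simp
    qed
    show "gen X l v \<in> fst ` K" if v: "v \<in> fst ` K" for l v
    proof -
      obtain y where "(v, y) \<in> K" using v by auto
      then show ?thesis using image_eqI[of "gen X l v" fst "(gen X l v, gen Y l y)" K] Kg by simp
    qed
  qed
  moreover have "fst ` K \<inter> S \<subseteq> {0}"
  proof clarify
    fix x y assume xy: "(x, y) \<in> K" "fst (x, y) \<in> S"
    then have "y = 0" using K1 by (auto simp: K1_def)
    then show "fst (x, y) = 0" using xy KST T by (auto simp: rsub_def zero_prod_def)
  qed
  ultimately have f: "fst ` K \<subseteq> {0}" using assms(3) by (simp add: ress_def)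
  show "K \<subseteq> {0}"
  proof
    fix z assume z: "z \<in> K"
    then have "fst z = 0" using f by blast
    moreover have "(0, snd z) \<in> K" using z calculation by (metis prod.collapse)
    then have "snd z = 0" using K1 S by (auto simp: K1_def rsub_def)
    ultimately show "z \<in> {0}" by (simp add: zero_prod_def prod_eq_iff)
  qed
qed

section \<open>Explicit modules\<close>

text \<open>\<open>E0 n\<close> and \<open>E1 n\<close> are \<open>n\<close> copies of the projective covers of \<open>V\<^sub>0\<close> and \<open>V\<^sub>1\<close>. In \<open>E0\<close> the coordinate
  \<open>z\<close> is the top and \<open>t\<close> the socle; in \<open>E1\<close> these are \<open>w1, w2, w3\<close> and \<open>u1, u2, u3\<close>.\<close>

definition E0 :: "nat \<Rightarrow> ('k::field, _) rep" where
  "E0 n = \<lparr>carr = kn n \<times> kn n \<times> kn n \<times> kn n \<times> kn n \<times> kn n \<times> kn n \<times> kn n,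
     scl = (\<lambda>k (z, p1, p2, p3, q1, q2, q3, t). (fscale k z, fscale k p1, fscale k p2, fscale k p3,
        fscale k q1, fscale k q2, fscale k q3, fscale k t)),
     gen = (\<lambda>x (z, p1, p2, p3, q1, q2, q3, t). case x of
        La \<Rightarrow> (0, z, p1, p2, 0, q1, q2, q3)
      | Lb \<Rightarrow> (0, p2, p3, 0, q2, q3, z, p1)
      | Lc \<Rightarrow> (0, p1, 0, p3, q1, 0, q3, 0))\<rparr>"

definition E1 :: "nat \<Rightarrow> ('k::field, _) rep" where
  "E1 n = \<lparr>carr = kn n \<times> kn n \<times> kn n \<times> kn n \<times> kn n \<times> kn n \<times> kn n \<times> kn n,
     scl = (\<lambda>k (w1, w2, w3, y, y', u1, u2, u3). (fscale k w1, fscale k w2, fscale k w3, fscale k y,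
        fscale k y', fscale k u1, fscale k u2, fscale k u3)),
     gen = (\<lambda>x (w1, w2, w3, y, y', u1, u2, u3). case x of
        La \<Rightarrow> (0, w1, w2, w3, 0, y', u1, u2)
      | Lb \<Rightarrow> (w2, w3, 0, 0, w1, w2 + u2, w3 + u3, y)
      | Lc \<Rightarrow> (w1, 0, w3, 0, 0, u1, 0, u3))\<rparr>"

text \<open>A pair of linear maps \<open>X, Y: k\<^sup>p \<rightarrow> k\<^sup>q\<close> glues \<open>p\<close> copies of \<open>V\<^sub>0\<close> on top of \<open>q\<close> copies of \<open>V\<^sub>1\<close>, giving \<open>F1\<close>,
  or \<open>p\<close> copies of \<open>V\<^sub>1\<close> on top of \<open>q\<close> copies of \<open>V\<^sub>0\<close>, giving \<open>F0\<close>. The modules \<open>A\<close>, \<open>B\<close> and all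
  \<open>\<Omega>\<^sup>-\<^sup>s(V\<^sub>i)\<close> are of this form.\<close>

definition F1 :: "nat \<Rightarrow> nat \<Rightarrow> ((nat \<Rightarrow> 'k) \<Rightarrow> (nat \<Rightarrow> 'k)) \<Rightarrow> ((nat \<Rightarrow> 'k) \<Rightarrow> (nat \<Rightarrow> 'k)) \<Rightarrow>
    ('k::field, _) rep" where
  "F1 p q X Y = \<lparr>carr = kn p \<times> kn q \<times> kn q \<times> kn q,
     scl = (\<lambda>k (z, v1, v2, v3). (fscale k z, fscale k v1, fscale k v2, fscale k v3)),
     gen = (\<lambda>x (z, v1, v2, v3). case x of
        La \<Rightarrow> (0, X z, v1, v2) | Lb \<Rightarrow> (0, v2, v3, Y z) | Lc \<Rightarrow> (0, v1, 0, v3))\<rparr>"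

definition F0 :: "nat \<Rightarrow> nat \<Rightarrow> ((nat \<Rightarrow> 'k) \<Rightarrow> (nat \<Rightarrow> 'k)) \<Rightarrow> ((nat \<Rightarrow> 'k) \<Rightarrow> (nat \<Rightarrow> 'k)) \<Rightarrow>
    ('k::field, _) rep" where
  "F0 p q X Y = \<lparr>carr = kn q \<times> kn p \<times> kn p \<times> kn p,
     scl = (\<lambda>k (z, v1, v2, v3). (fscale k z, fscale k v1, fscale k v2, fscale k v3)),
     gen = (\<lambda>x (z, v1, v2, v3). case x of
        La \<Rightarrow> (X v3, 0, v1, v2) | Lb \<Rightarrow> (Y v1, v2, v3, 0) | Lc \<Rightarrow> (0, v1, 0, v3))\<rparr>"

lemma E0_simps [simp]:
  "carr (E0 n) = kn n \<times> kn n \<times> kn n \<times> kn n \<times> kn n \<times> kn n \<times> kn n \<times> kn n"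
  "scl (E0 n) k (z, p1, p2, p3, q1, q2, q3, t) = (fscale k z, fscale k p1, fscale k p2, fscale k p3,
        fscale k q1, fscale k q2, fscale k q3, fscale k t)"
  "gen (E0 n) La (z, p1, p2, p3, q1, q2, q3, t) = (0, z, p1, p2, 0, q1, q2, q3)"
  "gen (E0 n) Lb (z, p1, p2, p3, q1, q2, q3, t) = (0, p2, p3, 0, q2, q3, z, p1)"
  "gen (E0 n) Lc (z, p1, p2, p3, q1, q2, q3, t) = (0, p1, 0, p3, q1, 0, q3, 0)"
  by (simp_all add: E0_def)

lemma E1_simps [simp]:
  "carr (E1 n) = kn n \<times> kn n \<times> kn n \<times> kn n \<times> kn n \<times> kn n \<times> kn n \<times> kn n"
  "scl (E1 n) k (w1, w2, w3, y, y', u1, u2, u3) = (fscale k w1, fscale k w2, fscale k w3, fscale k y,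
        fscale k y', fscale k u1, fscale k u2, fscale k u3)"
  "gen (E1 n) La (w1, w2, w3, y, y', u1, u2, u3) = (0, w1, w2, w3, 0, y', u1, u2)"
  "gen (E1 n) Lb (w1, w2, w3, y, y', u1, u2, u3) = (w2, w3, 0, 0, w1, w2 + u2, w3 + u3, y)"
  "gen (E1 n) Lc (w1, w2, w3, y, y', u1, u2, u3) = (w1, 0, w3, 0, 0, u1, 0, u3)"
  by (simp_all add: E1_def)

lemma F1_simps [simp]:
  "carr (F1 p q X Y) = kn p \<times> kn q \<times> kn q \<times> kn q"
  "scl (F1 p q X Y) k (z, v1, v2, v3) = (fscale k z, fscale k v1, fscale k v2, fscale k v3)"
  "gen (F1 p q X Y) La (z, v1, v2, v3) = (0, X z, v1, v2)"
  "gen (F1 p q X Y) Lb (z, v1, v2, v3) = (0, v2, v3, Y z)"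
  "gen (F1 p q X Y) Lc (z, v1, v2, v3) = (0, v1, 0, v3)"
  by (simp_all add: F1_def)

lemma F0_simps [simp]:
  "carr (F0 p q X Y) = kn q \<times> kn p \<times> kn p \<times> kn p"
  "scl (F0 p q X Y) k (z, v1, v2, v3) = (fscale k z, fscale k v1, fscale k v2, fscale k v3)"
  "gen (F0 p q X Y) La (z, v1, v2, v3) = (X v3, 0, v1, v2)"
  "gen (F0 p q X Y) Lb (z, v1, v2, v3) = (Y v1, v2, v3, 0)"
  "gen (F0 p q X Y) Lc (z, v1, v2, v3) = (0, v1, 0, v3)"
  by (simp_all add: F0_def)

section \<open>Pencils of linear maps and the exact sequences they give\<close>

definition pen :: "nat \<Rightarrow> nat \<Rightarrow> ((nat \<Rightarrow> 'k::field) \<Rightarrow> (nat \<Rightarrow> 'k)) \<Rightarrow> bool" where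
  "pen p q X \<longleftrightarrow> linon UNIV fscale fscale X \<and> X ` kn p \<subseteq> kn q"

lemma penD: assumes "pen p q X"
  shows "X (f + g) = X f + X g" "X (fscale k f) = fscale k (X f)" "X 0 = 0"
    "f \<in> kn p \<Longrightarrow> X f \<in> kn q"
proof -
  show "X (f + g) = X f + X g" "X (fscale k f) = fscale k (X f)" "f \<in> kn p \<Longrightarrow> X f \<in> kn q"
    using assms by (auto simp: pen_def linon_def)
  show "X 0 = 0" using linon_zero[OF fs.vector_space_axioms fs.vector_space_axioms, of UNIV X] assms
    by (simp add: pen_def)
qed

text \<open>Under this exactness condition on the pairs, the injective envelope of one of \<open>F0\<close>, \<open>F1\<close> for \<open>(X, Y)\<close>
  has the other one for \<open>(X', Y')\<close> as its cokernel.\<close>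

definition kexact :: "nat \<Rightarrow> nat \<Rightarrow> nat \<Rightarrow> ((nat \<Rightarrow> 'k::field) \<Rightarrow> (nat \<Rightarrow> 'k)) \<Rightarrow> ((nat \<Rightarrow> 'k) \<Rightarrow> (nat \<Rightarrow> 'k)) \<Rightarrow>
    ((nat \<Rightarrow> 'k) \<Rightarrow> (nat \<Rightarrow> 'k)) \<Rightarrow> ((nat \<Rightarrow> 'k) \<Rightarrow> (nat \<Rightarrow> 'k)) \<Rightarrow> bool" where
  "kexact p q q' X Y X' Y' \<longleftrightarrow> pen p q X \<and> pen p q Y \<and> pen q q' X' \<and> pen q q' Y' \<and>
     (\<forall>u\<in>kn p. X u = 0 \<and> Y u = 0 \<longrightarrow> u = 0) \<and>
     (\<forall>f\<in>kn q. \<forall>g\<in>kn q. X' f + Y' g = 0 \<longleftrightarrow> (\<exists>u\<in>kn p. f = Y u \<and> g = X u)) \<and>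
     (\<forall>h\<in>kn q'. \<exists>f\<in>kn q. \<exists>g\<in>kn q. h = X' f + Y' g)"

locale char2 =
  fixes field_type :: "'k::field itself"
  assumes char2: "CHAR('k) = 2"
begin

lemma k_self [simp]: "(x::'k) + x = 0"
proof -
  have "(2::'k) = of_nat CHAR('k)" by (simp add: char2)
  then have "(2::'k) = 0" by (simp only: of_nat_CHAR)
  then show ?thesis by (metis mult_2 mult_zero_left)
qed

lemma k_two [simp]: "(2::'k) = 0"
  using k_self[of 1] by (metis one_add_one)

lemma k_self2 [simp]: "(x::'k) + (x + y) = y"
  by (simp add: add.assoc[symmetric])

lemma k_uminus [simp]: "- (x::'k) = x"
  using k_self[of x] by (metis minus_unique)

lemma f_self [simp]: "(x::nat \<Rightarrow> 'k) + x = 0"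
  by (rule ext) simp

lemma f_self2 [simp]: "(x::nat \<Rightarrow> 'k) + (x + y) = y"
  by (simp add: add.assoc[symmetric])

lemma f_eq: "(x::nat \<Rightarrow> 'k) = y \<longleftrightarrow> x + y = 0"
  by (metis f_self f_self2 add.right_neutral)

lemma fscale_simps [simp]: "fscale 1 f = f" "fscale k (fscale l f) = fscale (k * l) f"
  "fscale (k + l) f = fscale k f + fscale l f" "fscale k (f + g) = fscale k f + fscale k g"
  "fscale k 0 = 0"
  by (simp_all add: fs.scale_left_distrib fs.scale_right_distrib)

lemma is_rep_E0 [simp]: "is_rep (E0 n :: ('k, _) rep)"
  by (rule is_repI') (simp_all add: split_paired_all zero_prod_def ac_simps)

lemma is_rep_E1 [simp]: "is_rep (E1 n :: ('k, _) rep)"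
  by (rule is_repI') (simp_all add: split_paired_all zero_prod_def ac_simps)

lemma is_rep_F1:
  assumes "pen p q X" "pen p q Y" shows "is_rep (F1 p q X Y :: ('k, _) rep)"
  by (rule is_repI') (simp_all add: split_paired_all zero_prod_def ac_simps penD[OF assms(1)] penD[OF assms(2)])

lemma is_rep_F0:
  assumes "pen p q X" "pen p q Y" shows "is_rep (F0 p q X Y :: ('k, _) rep)"
  by (rule is_repI') (simp_all add: split_paired_all zero_prod_def ac_simps penD[OF assms(1)] penD[OF assms(2)])

lemma fdim_E0: "fdim (carr (E0 n)) (scl (E0 n :: ('k, _) rep)) (8 * n)"
proof -
  have eq: "8 * n = n + (n + (n + (n + (n + (n + (n + n))))))" by simp
  show ?thesis unfolding eq
    using fdim_prod[OF fdim_kn fdim_prod[OF fdim_kn fdim_prod[OF fdim_kn fdim_prod[OF fdim_kn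
      fdim_prod[OF fdim_kn fdim_prod[OF fdim_kn fdim_prod[OF fdim_kn fdim_kn]]]]]], of n n n n n n n n]
    by (simp add: E0_def case_prod_unfold)
qed

lemma fdim_E1: "fdim (carr (E1 n)) (scl (E1 n :: ('k, _) rep)) (8 * n)"
  using fdim_E0[of n] by (simp add: E0_def E1_def)

lemma fdim_F1: "fdim (carr (F1 p q X Y)) (scl (F1 p q X Y :: ('k, _) rep)) (p + 3 * q)"
proof -
  have eq: "p + 3 * q = p + (q + (q + q))" by simp
  show ?thesis unfolding eq
    using fdim_prod[OF fdim_kn fdim_prod[OF fdim_kn fdim_prod[OF fdim_kn fdim_kn]], of p q q q]
    by (simp add: F1_def case_prod_unfold)
qed

lemma fdim_F0: "fdim (carr (F0 p q X Y)) (scl (F0 p q X Y :: ('k, _) rep)) (q + 3 * p)"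
  using fdim_F1[of q p] by (simp add: F0_def F1_def)

text \<open>Above the socle V_1^q of \<open>E1 q\<close> lie two copies of k^q of trivial modules,
  with coordinates \<open>y\<close> and \<open>y'\<close>; \<open>b\<close> sends the one,
  \<open>a\<close> the other to the socle. A top vector z of \<open>F1\<close> must therefore go to
  y = Y z, y' = X z. Modulo these pairs the layer becomes k^q' by (y, y') \<mapsto> X' y + Y' y',
  which is exactly what \<open>kexact\<close> says.\<close>

lemma rses_F1:
  assumes "kexact p q q' X Y X' Y'"
  shows "rses (F1 p q X Y) (E1 q) (F0 q q' X' Y' :: ('k, _) rep)
    (\<lambda>(z, v1, v2, v3). (0, 0, 0, Y z, X z, v1, v2, v3))
    (\<lambda>(w1, w2, w3, y, y', u1, u2, u3). (X' y + Y' y', w1, w2, w3))"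
proof -
  have pens: "pen p q X" "pen p q Y" "pen q q' X'" "pen q q' Y'" using assms by (auto simp: kexact_def)
  note [simp] = penD[OF pens(1)] penD[OF pens(2)] penD[OF pens(3)] penD[OF pens(4)]
  let ?f = "\<lambda>(z, v1, v2, v3). (0 :: nat \<Rightarrow> 'k, 0 :: nat \<Rightarrow> 'k, 0 :: nat \<Rightarrow> 'k, Y z, X z, v1, v2, v3)"
  let ?g = "\<lambda>(w1, w2, w3, y, y', u1, u2, u3). (X' y + Y' y', w1, w2, w3)"
  have f: "rhom (F1 p q X Y) (E1 q) ?f"
    by (rule rhomI; auto simp: split_paired_all)
  have g: "rhom (E1 q) (F0 q q' X' Y') ?g"
    by (rule rhomI; auto simp: split_paired_all ac_simps)
  have "inj_on ?f (carr (F1 p q X Y))"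
    unfolding rhom_inj_iff[OF f is_rep_F1[OF pens(1,2)] is_rep_E1]
    using assms by (auto simp: kexact_def zero_prod_def)
  moreover have "?g ` carr (E1 q) = carr (F0 q q' X' Y')"
  proof
    show "?g ` carr (E1 q) \<subseteq> carr (F0 q q' X' Y')" using rhomD(1)[OF g] by blast
    show "carr (F0 q q' X' Y') \<subseteq> ?g ` carr (E1 q)"
    proof clarsimp
      fix h w1 w2 w3 :: "nat \<Rightarrow> 'k"
      assume "h \<in> kn q'" and w: "w1 \<in> kn q" "w2 \<in> kn q" "w3 \<in> kn q"
      then obtain f g where "f \<in> kn q" "g \<in> kn q" "h = X' f + Y' g" using assms by (auto simp: kexact_def)
      then show "(h, w1, w2, w3) \<in> ?g ` (kn q \<times> kn q \<times> kn q \<times> kn q \<times> kn q \<times> kn q \<times> kn q \<times> kn q)"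
        using w by (intro image_eqI[of _ _ "(w1, w2, w3, f, g, 0, 0, 0)"]) auto
    qed
  qed
  moreover have "?g v = 0 \<longleftrightarrow> v \<in> ?f ` carr (F1 p q X Y)" if "v \<in> carr (E1 q)" for v
  proof -
    obtain w1 w2 w3 y y' u1 u2 u3 where v: "v = (w1, w2, w3, y, y', u1, u2, u3)" by (cases v) auto
    have "?g v = 0 \<longleftrightarrow> w1 = 0 \<and> w2 = 0 \<and> w3 = 0 \<and> (\<exists>u\<in>kn p. y = Y u \<and> y' = X u)"
      using assms that unfolding v by (auto simp: kexact_def zero_prod_def)
    also have "\<dots> \<longleftrightarrow> v \<in> ?f ` carr (F1 p q X Y)"
      using that unfolding v by (auto simp: image_iff Bex_def)
    finally show ?thesis .
  qed
  ultimately show ?thesis using f g by (auto simp: rses_def)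
qed

text \<open>Here the middle layer of \<open>E0 q\<close> consists of two copies of V_1^q, with
  coordinates \<open>p\<close> and \<open>q\<close>, over the socle V_0^q; the pair of maps is
  applied in each of the three coordinates of V_1, so \<open>kexact\<close> is used three times
  over.\<close>

lemma rses_F0:
  assumes "kexact p q q' X Y X' Y'"
  shows "rses (F0 p q X Y) (E0 q) (F1 q q' X' Y' :: ('k, _) rep)
    (\<lambda>(z, w1, w2, w3). (0, Y w1, Y w2, Y w3, X w1, X w2, X w3, z))
    (\<lambda>(z, p1, p2, p3, q1, q2, q3, t). (z, X' p1 + Y' q1, X' p2 + Y' q2, X' p3 + Y' q3))"
proof -
  have pens: "pen p q X" "pen p q Y" "pen q q' X'" "pen q q' Y'" using assms by (auto simp: kexact_def)
  note [simp] = penD[OF pens(1)] penD[OF pens(2)] penD[OF pens(3)] penD[OF pens(4)]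
  let ?f = "\<lambda>(z, w1, w2, w3). (0 :: nat \<Rightarrow> 'k, Y w1, Y w2, Y w3, X w1, X w2, X w3, z)"
  let ?g = "\<lambda>(z, p1, p2, p3, q1, q2, q3, t). (z, X' p1 + Y' q1, X' p2 + Y' q2, X' p3 + Y' q3)"
  have f: "rhom (F0 p q X Y) (E0 q) ?f"
    by (rule rhomI; auto simp: split_paired_all)
  have g: "rhom (E0 q) (F1 q q' X' Y') ?g"
    by (rule rhomI; auto simp: split_paired_all ac_simps)
  have "inj_on ?f (carr (F0 p q X Y))"
    unfolding rhom_inj_iff[OF f is_rep_F0[OF pens(1,2)] is_rep_E0]
    using assms by (auto simp: kexact_def zero_prod_def)
  moreover have "?g ` carr (E0 q) = carr (F1 q q' X' Y')"
  proof
    show "?g ` carr (E0 q) \<subseteq> carr (F1 q q' X' Y')" using rhomD(1)[OF g] by blast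
    show "carr (F1 q q' X' Y') \<subseteq> ?g ` carr (E0 q)"
    proof clarsimp
      fix z h1 h2 h3 :: "nat \<Rightarrow> 'k"
      assume z: "z \<in> kn q" and h: "h1 \<in> kn q'" "h2 \<in> kn q'" "h3 \<in> kn q'"
      have *: "\<exists>f\<in>kn q. \<exists>g\<in>kn q. h = X' f + Y' g" if "h \<in> kn q'" for h
        using assms that by (auto simp: kexact_def)
      obtain f1 g1 f2 g2 f3 g3 where "f1 \<in> kn q" "g1 \<in> kn q" "h1 = X' f1 + Y' g1"
        "f2 \<in> kn q" "g2 \<in> kn q" "h2 = X' f2 + Y' g2" "f3 \<in> kn q" "g3 \<in> kn q" "h3 = X' f3 + Y' g3"
        using *[OF h(1)] *[OF h(2)] *[OF h(3)] by auto
      then show "(z, h1, h2, h3) \<in> ?g ` (kn q \<times> kn q \<times> kn q \<times> kn q \<times> kn q \<times> kn q \<times> kn q \<times> kn q)"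
        using z by (intro image_eqI[of _ _ "(z, f1, f2, f3, g1, g2, g3, 0)"]) auto
    qed
  qed
  moreover have "?g v = 0 \<longleftrightarrow> v \<in> ?f ` carr (F0 p q X Y)" if "v \<in> carr (E0 q)" for v
  proof -
    obtain z p1 p2 p3 q1 q2 q3 t where v: "v = (z, p1, p2, p3, q1, q2, q3, t)" by (cases v) auto
    have "?g v = 0 \<longleftrightarrow> z = 0 \<and> (\<exists>u\<in>kn p. p1 = Y u \<and> q1 = X u) \<and> (\<exists>u\<in>kn p. p2 = Y u \<and> q2 = X u)
        \<and> (\<exists>u\<in>kn p. p3 = Y u \<and> q3 = X u)"
      using assms that unfolding v by (auto simp: kexact_def zero_prod_def)
    also have "\<dots> \<longleftrightarrow> v \<in> ?f ` carr (F0 p q X Y)"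
      using that unfolding v by (auto simp: image_iff Bex_def)
    finally show ?thesis .
  qed
  ultimately show ?thesis using f g by (auto simp: rses_def)
qed

section \<open>The two families of pencils: multiplication by a variable, and commuting
  operators\<close>

definition shiftr :: "(nat \<Rightarrow> 'k) \<Rightarrow> nat \<Rightarrow> 'k" where
  "shiftr f i = (case i of 0 \<Rightarrow> 0 | Suc j \<Rightarrow> f j)"

text \<open>Read \<open>kn n\<close> as the polynomials of degree below n, so that
  \<open>shiftr\<close> is multiplication by the variable t. A relation f + t g = 0 forces f = t u,
  g = u, and f + t g reaches every polynomial of degree at most s + 1. This pencil describes the
  cosyzygies of V_0 and V_1.\<close>

lemma kexact_shift: "kexact s (Suc s) (Suc (Suc s)) (\<lambda>f. f) shiftr (\<lambda>f. f) (shiftr)"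
proof -
  have 1: "pen n (Suc n) (\<lambda>f. f :: nat \<Rightarrow> 'k)" for n
    by (auto simp: pen_def linon_def kn_def)
  have 2: "pen n (Suc n) shiftr" for n
    by (auto simp: pen_def linon_def kn_def shiftr_def fscale_def fun_eq_iff split: nat.splits)
  have 3: "f + shiftr g = 0 \<longleftrightarrow> (\<exists>u\<in>kn s. f = shiftr u \<and> g = u)" if "f \<in> kn (Suc s)" for f g
  proof -
    have "g \<in> kn s" if "f = shiftr g"
      using \<open>f \<in> kn (Suc s)\<close> that by (auto simp: kn_def shiftr_def)
    then show ?thesis using f_eq[of f "shiftr g"] by auto
  qed
  have 4: "\<exists>f\<in>kn (Suc s). \<exists>g\<in>kn (Suc s). h = f + shiftr g" if h: "h \<in> kn (Suc (Suc s))" for h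
  proof -
    \<comment> \<open>Only the leading coefficient of \<open>h\<close>, at index
      \<open>Suc s\<close>, is out of reach of the unshifted summand; it is placed at index
      \<open>s\<close>, one lower.\<close>
    define g where "g = (\<lambda>i. if i = s then h (Suc s) else 0)"
    have g: "g \<in> kn (Suc s)" by (auto simp: g_def kn_def)
    have "h i = 0" if "\<not> i < Suc s" "i \<noteq> Suc s" for i
      using h that by (auto simp: kn_def)
    then have "h = trunc (Suc s) h + shiftr g"
      by (auto simp: fun_eq_iff trunc_def shiftr_def g_def split: nat.splits)
    then show ?thesis using g by (intro bexI[of _ "trunc (Suc s) h"] bexI[of _ g]) auto
  qed
  show ?thesis unfolding kexact_def using 1[of s] 1[of "Suc s"] 2[of s] 2[of "Suc s"] 3 4 by auto
qed

text \<open>The operator s0 + s1 N, where N is the backward shift, nilpotent on \<open>kn r\<close>.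
  Any two of these commute, being polynomials in N.\<close>

definition sop :: "'k \<Rightarrow> 'k \<Rightarrow> (nat \<Rightarrow> 'k) \<Rightarrow> nat \<Rightarrow> 'k" where
  "sop s0 s1 f = (\<lambda>i. s0 * f i + s1 * f (Suc i))"

lemma pen_sop: "pen r r (sop s0 s1)"
  by (auto simp: pen_def linon_def kn_def sop_def fscale_def fun_eq_iff algebra_simps)

lemma sop_commute: "sop s0 s1 (sop t0 t1 f) = sop t0 t1 (sop s0 s1 f)"
  by (auto simp: sop_def fun_eq_iff algebra_simps)

text \<open>The operator is triangular with \<open>s0\<close> on the diagonal, so the coefficients
  vanish one after another from index \<open>r\<close> downwards.\<close>

lemma sop_inj:
  assumes "s0 \<noteq> 0" "f \<in> kn r" "sop s0 s1 f = 0"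
  shows "f = 0"
proof -
  have "f (r - j) = 0" if "j \<le> r" for j using that
  proof (induction j)
    case 0 then show ?case using assms(2) by (simp add: kn_def)
  next
    case (Suc j)
    then have "s0 * f (r - Suc j) + s1 * f (r - j) = 0"
      using fun_cong[OF assms(3), of "r - Suc j"] by (simp add: sop_def Suc_diff_Suc)
    then show ?case using Suc assms(1) by simp
  qed
  then have "f i = 0" if "i < r" for i using that by (metis diff_diff_cancel diff_le_self less_imp_le)
  then show ?thesis using assms(2) by (auto simp: kn_def fun_eq_iff) (metis not_less)
qed

lemma sop_bij:
  assumes "s0 \<noteq> 0"
  shows "bij_betw (sop s0 s1) (kn r) (kn r)"
proof (rule fdim_inj_bij[OF fdim_kn fdim_kn])
  note p = pen_sop[of r s0 s1]
  show "linon (kn r) fscale fscale (sop s0 s1)" using penD[OF p] by (simp add: linon_def)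
  show "sop s0 s1 ` kn r \<subseteq> kn r" using penD[OF p] by blast
  show "inj_on (sop s0 s1) (kn r)"
  proof (rule inj_onI)
    fix f g assume fg: "f \<in> kn r" "g \<in> kn r" "sop s0 s1 f = sop s0 s1 g"
    then have "sop s0 s1 (f + g) = 0" using penD(1)[OF p] by simp
    moreover have "f + g \<in> kn r" using fg by simp
    ultimately have "f + g = 0" using sop_inj[OF assms] by blast
    then show "f = g" using f_eq by blast
  qed
qed simp_all

text \<open>One of the two commuting operators S, T is invertible, and a solution of S f = T g can
  be divided by it to give f = T u, g = S u. Since the same pair stands on both sides, taking a
  cosyzygy of A or B changes only the layers and not the parameter.\<close>

lemma kexact_sop:
  assumes "s0 \<noteq> 0 \<or> t0 \<noteq> 0"
  shows "kexact r r r (sop s0 s1) (sop t0 t1) (sop s0 s1) (sop t0 t1)"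
proof -
  let ?S = "sop s0 s1" and ?T = "sop t0 t1"
  have S: "\<exists>u\<in>kn r. f = ?S u" if "s0 \<noteq> 0" "f \<in> kn r" for f
    using sop_bij[OF that(1), of s1 r] that(2) by (auto simp: bij_betw_def)
  have T: "\<exists>u\<in>kn r. f = ?T u" if "t0 \<noteq> 0" "f \<in> kn r" for f
    using sop_bij[OF that(1), of t1 r] that(2) by (auto simp: bij_betw_def)
  have Si: "f = g" if "s0 \<noteq> 0" "f \<in> kn r" "g \<in> kn r" "?S f = ?S g" for f g
    using sop_bij[OF that(1), of s1 r] that by (auto simp: bij_betw_def dest: inj_onD)
  have Ti: "f = g" if "t0 \<noteq> 0" "f \<in> kn r" "g \<in> kn r" "?T f = ?T g" for f g
    using sop_bij[OF that(1), of t1 r] that by (auto simp: bij_betw_def dest: inj_onD)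
  have k: "?S f \<in> kn r" "?T f \<in> kn r" if "f \<in> kn r" for f using penD(4)[OF pen_sop] that by auto
  have 1: "\<exists>u\<in>kn r. f = ?T u \<and> g = ?S u" if fg: "f \<in> kn r" "g \<in> kn r" "?S f + ?T g = 0" for f g
  proof -
    have eq: "?S f = ?T g" using fg f_eq by blast
    show ?thesis
    proof (cases "s0 = 0")
      case False
      then obtain u where u: "u \<in> kn r" "g = ?S u" using S fg by blast
      then have "?S f = ?S (?T u)" using eq sop_commute by metis
      then show ?thesis using Si[OF False fg(1) k(2)[OF u(1)]] u by blast
    next
      case True
      then have t: "t0 \<noteq> 0" using assms by simp
      then obtain u where u: "u \<in> kn r" "f = ?T u" using T fg by blast
      then have "?T g = ?T (?S u)" using eq sop_commute by metis
      then show ?thesis using Ti[OF t fg(2) k(1)[OF u(1)]] u by blast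
    qed
  qed
  have 2: "\<exists>f\<in>kn r. \<exists>g\<in>kn r. h = ?S f + ?T g" if h: "h \<in> kn r" for h
  proof (cases "s0 = 0")
    case False
    then obtain u where "u \<in> kn r" "h = ?S u" using S h by blast
    then show ?thesis using penD(3)[OF pen_sop[of r t0 t1]] by (intro bexI[of _ u] bexI[of _ 0]) auto
  next
    case True
    then obtain u where "u \<in> kn r" "h = ?T u" using T h assms by blast
    then show ?thesis using penD(3)[OF pen_sop[of r s0 s1]] by (intro bexI[of _ 0] bexI[of _ u]) auto
  qed
  have 3: "?S (?T u) + ?T (?S u) = 0" for u using sop_commute[of s0 s1 t0 t1 u] by simp
  show ?thesis unfolding kexact_def using pen_sop 1 2 3 sop_inj assms by blast
qed

end

section \<open>Tensor products with \<open>A\<close> and \<open>B\<close>\<close>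

text \<open>\<open>TF1\<close>, \<open>TF0\<close> and \<open>TV1\<close> are the tensor products of \<open>X\<close> with \<open>A\<close>, with \<open>B\<close> and with \<open>V\<^sub>1\<close>, in coordinates.\<close>

definition TF1 :: "nat \<Rightarrow> 'k \<Rightarrow> 'k \<Rightarrow> 'k \<Rightarrow> 'k \<Rightarrow> ('k::field, 'v::ab_group_add) rep \<Rightarrow> ('k, _) rep" where
  "TF1 r s0 s1 t0 t1 X = \<lparr>carr = carr (rfun r X) \<times> carr (rfun r X) \<times> carr (rfun r X) \<times> carr (rfun r X),
     scl = (\<lambda>k (z, v1, v2, v3). (\<lambda>i. scl X k (z i), \<lambda>i. scl X k (v1 i), \<lambda>i. scl X k (v2 i), \<lambda>i. scl X k (v3 i))),
     gen = (\<lambda>x (z, v1, v2, v3). case x of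
        La \<Rightarrow> (\<lambda>i. gen X La (z i), \<lambda>i. gen X La (v1 i) + (scl X s0 (z i) + scl X s1 (z (Suc i))),
               \<lambda>i. gen X La (v2 i) + v1 i, \<lambda>i. gen X La (v3 i) + v2 i)
      | Lb \<Rightarrow> (\<lambda>i. gen X Lb (z i), \<lambda>i. gen X Lb (v1 i) + v2 i, \<lambda>i. gen X Lb (v2 i) + v3 i,
               \<lambda>i. gen X Lb (v3 i) + (scl X t0 (z i) + scl X t1 (z (Suc i))))
      | Lc \<Rightarrow> (\<lambda>i. gen X Lc (z i), \<lambda>i. gen X Lc (v1 i) + v1 i, \<lambda>i. gen X Lc (v2 i),
               \<lambda>i. gen X Lc (v3 i) + v3 i))\<rparr>"

definition TF0 :: "nat \<Rightarrow> 'k \<Rightarrow> 'k \<Rightarrow> 'k \<Rightarrow> 'k \<Rightarrow> ('k::field, 'v::ab_group_add) rep \<Rightarrow> ('k, _) rep" where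
  "TF0 r s0 s1 t0 t1 X = \<lparr>carr = carr (rfun r X) \<times> carr (rfun r X) \<times> carr (rfun r X) \<times> carr (rfun r X),
     scl = (\<lambda>k (z, v1, v2, v3). (\<lambda>i. scl X k (z i), \<lambda>i. scl X k (v1 i), \<lambda>i. scl X k (v2 i), \<lambda>i. scl X k (v3 i))),
     gen = (\<lambda>x (z, v1, v2, v3). case x of
        La \<Rightarrow> (\<lambda>i. gen X La (z i) + (scl X s0 (v3 i) + scl X s1 (v3 (Suc i))), \<lambda>i. gen X La (v1 i),
               \<lambda>i. gen X La (v2 i) + v1 i, \<lambda>i. gen X La (v3 i) + v2 i)
      | Lb \<Rightarrow> (\<lambda>i. gen X Lb (z i) + (scl X t0 (v1 i) + scl X t1 (v1 (Suc i))), \<lambda>i. gen X Lb (v1 i) + v2 i,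
               \<lambda>i. gen X Lb (v2 i) + v3 i, \<lambda>i. gen X Lb (v3 i))
      | Lc \<Rightarrow> (\<lambda>i. gen X Lc (z i), \<lambda>i. gen X Lc (v1 i) + v1 i, \<lambda>i. gen X Lc (v2 i),
               \<lambda>i. gen X Lc (v3 i) + v3 i))\<rparr>"

definition TV1 :: "('k::field, 'v::ab_group_add) rep \<Rightarrow> ('k, _) rep" where
  "TV1 X = \<lparr>carr = carr X \<times> carr X \<times> carr X,
     scl = (\<lambda>k (v1, v2, v3). (scl X k v1, scl X k v2, scl X k v3)),
     gen = (\<lambda>x (v1, v2, v3). case x of
        La \<Rightarrow> (gen X La v1, gen X La v2 + v1, gen X La v3 + v2)
      | Lb \<Rightarrow> (gen X Lb v1 + v2, gen X Lb v2 + v3, gen X Lb v3)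
      | Lc \<Rightarrow> (gen X Lc v1 + v1, gen X Lc v2, gen X Lc v3 + v3))\<rparr>"

definition V0r :: "('k::field, 'k) rep" where
  "V0r = \<lparr>carr = UNIV, scl = (*), gen = (\<lambda>_ _. 0)\<rparr>"

definition V1r :: "('k::field, 'k \<times> 'k \<times> 'k) rep" where
  "V1r = \<lparr>carr = UNIV, scl = (\<lambda>k (x, y, z). (k * x, k * y, k * z)),
     gen = (\<lambda>l (x, y, z). case l of La \<Rightarrow> (0, x, y) | Lb \<Rightarrow> (y, z, 0) | Lc \<Rightarrow> (x, 0, z))\<rparr>"

lemma TF1_simps [simp]:
  "carr (TF1 r s0 s1 t0 t1 X) = carr (rfun r X) \<times> carr (rfun r X) \<times> carr (rfun r X) \<times> carr (rfun r X)"
  "scl (TF1 r s0 s1 t0 t1 X) k (z, v1, v2, v3) = (\<lambda>i. scl X k (z i), \<lambda>i. scl X k (v1 i), \<lambda>i. scl X k (v2 i),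
      \<lambda>i. scl X k (v3 i))"
  "gen (TF1 r s0 s1 t0 t1 X) La (z, v1, v2, v3) = (\<lambda>i. gen X La (z i),
      \<lambda>i. gen X La (v1 i) + (scl X s0 (z i) + scl X s1 (z (Suc i))),
               \<lambda>i. gen X La (v2 i) + v1 i, \<lambda>i. gen X La (v3 i) + v2 i)"
  "gen (TF1 r s0 s1 t0 t1 X) Lb (z, v1, v2, v3) = (\<lambda>i. gen X Lb (z i),
      \<lambda>i. gen X Lb (v1 i) + v2 i, \<lambda>i. gen X Lb (v2 i) + v3 i,
               \<lambda>i. gen X Lb (v3 i) + (scl X t0 (z i) + scl X t1 (z (Suc i))))"
  "gen (TF1 r s0 s1 t0 t1 X) Lc (z, v1, v2, v3) = (\<lambda>i. gen X Lc (z i), \<lambda>i. gen X Lc (v1 i) + v1 i, \<lambda>i. gen X Lc (v2 i),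
               \<lambda>i. gen X Lc (v3 i) + v3 i)"
  by (simp_all add: TF1_def)

lemma TF0_simps [simp]:
  "carr (TF0 r s0 s1 t0 t1 X) = carr (rfun r X) \<times> carr (rfun r X) \<times> carr (rfun r X) \<times> carr (rfun r X)"
  "scl (TF0 r s0 s1 t0 t1 X) k (z, v1, v2, v3) = (\<lambda>i. scl X k (z i), \<lambda>i. scl X k (v1 i), \<lambda>i. scl X k (v2 i),
      \<lambda>i. scl X k (v3 i))"
  "gen (TF0 r s0 s1 t0 t1 X) La (z, v1, v2, v3) = (\<lambda>i. gen X La (z i) + (scl X s0 (v3 i) + scl X s1 (v3 (Suc
      i))), \<lambda>i. gen X La (v1 i),
               \<lambda>i. gen X La (v2 i) + v1 i, \<lambda>i. gen X La (v3 i) + v2 i)"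
  "gen (TF0 r s0 s1 t0 t1 X) Lb (z, v1, v2, v3) = (\<lambda>i. gen X Lb (z i) + (scl X t0 (v1 i) + scl X t1 (v1 (Suc
      i))), \<lambda>i. gen X Lb (v1 i) + v2 i,
               \<lambda>i. gen X Lb (v2 i) + v3 i, \<lambda>i. gen X Lb (v3 i))"
  "gen (TF0 r s0 s1 t0 t1 X) Lc (z, v1, v2, v3) = (\<lambda>i. gen X Lc (z i), \<lambda>i. gen X Lc (v1 i) + v1 i, \<lambda>i. gen X Lc (v2 i),
               \<lambda>i. gen X Lc (v3 i) + v3 i)"
  by (simp_all add: TF0_def)

lemma TV1_simps [simp]:
  "carr (TV1 X) = carr X \<times> carr X \<times> carr X"
  "scl (TV1 X) k (v1, v2, v3) = (scl X k v1, scl X k v2, scl X k v3)"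
  "gen (TV1 X) La (v1, v2, v3) = (gen X La v1, gen X La v2 + v1, gen X La v3 + v2)"
  "gen (TV1 X) Lb (v1, v2, v3) = (gen X Lb v1 + v2, gen X Lb v2 + v3, gen X Lb v3)"
  "gen (TV1 X) Lc (v1, v2, v3) = (gen X Lc v1 + v1, gen X Lc v2, gen X Lc v3 + v3)"
  by (simp_all add: TV1_def)

lemma V0r_simps [simp]: "carr V0r = UNIV" "scl V0r k x = k * x" "gen V0r l x = 0"
  by (simp_all add: V0r_def)

lemma V1r_simps [simp]: "carr V1r = UNIV" "scl V1r k (x, y, z) = (k * x, k * y, k * z)"
  "gen V1r La (x, y, z) = (0, x, y)" "gen V1r Lb (x, y, z) = (y, z, 0)"
  "gen V1r Lc (x, y, z) = (x, 0, z)"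
  by (simp_all add: V1r_def)

lemma is_rep_TV1 [simp]: assumes "is_rep X" shows "is_rep (TV1 X)"
proof -
  note [simp] = rep_self[OF assms] rep_self2[OF assms] assms
  show ?thesis by (rule is_repI') (simp_all add: split_paired_all zero_prod_def ac_simps)
qed

lemma is_rep_TF1 [simp]: assumes "is_rep X" shows "is_rep (TF1 r s0 s1 t0 t1 X)"
proof -
  note [simp] = rep_self[OF assms] rep_self2[OF assms] assms
  show ?thesis
    by (rule is_repI') (simp_all add: split_paired_all zero_prod_def fun_eq_iff ac_simps kn_def)
qed

lemma is_rep_TF0 [simp]: assumes "is_rep X" shows "is_rep (TF0 r s0 s1 t0 t1 X)"
proof -
  note [simp] = rep_self[OF assms] rep_self2[OF assms] assms
  show ?thesis
    by (rule is_repI') (simp_all add: split_paired_all zero_prod_def fun_eq_iff ac_simps kn_def)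
qed

abbreviation quad :: "'a set \<Rightarrow> ('a \<times> 'a \<times> 'a \<times> 'a) set" where
  "quad A \<equiv> A \<times> A \<times> A \<times> A"

definition tm :: "('v \<Rightarrow> 'w) \<Rightarrow> (nat \<Rightarrow> 'v) \<times> (nat \<Rightarrow> 'v) \<times> (nat \<Rightarrow> 'v) \<times> (nat \<Rightarrow> 'v) \<Rightarrow>
    (nat \<Rightarrow> 'w) \<times> (nat \<Rightarrow> 'w) \<times> (nat \<Rightarrow> 'w) \<times> (nat \<Rightarrow> 'w)" where
  "tm f = (\<lambda>(z, v1, v2, v3). (\<lambda>i. f (z i), \<lambda>i. f (v1 i), \<lambda>i. f (v2 i), \<lambda>i. f (v3 i)))"

lemma tm_map: "tm f = map_prod (\<lambda>z i. f (z i)) (map_prod (\<lambda>z i. f (z i)) (map_prod (\<lambda>z i. f (z i)) (\<lambda>z i. f (z i))))"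
  by (auto simp: tm_def)

lemma rhom_TF1:
  assumes "rhom X Y f" "is_rep X" "is_rep Y"
  shows "rhom (TF1 r s0 s1 t0 t1 X) (TF1 r s0 s1 t0 t1 Y) (tm f)"
  using rhom_zero[OF assms] assms(2,3)
  by (intro rhomI) (auto simp: tm_def rhomD[OF assms(1)] kn_def fun_eq_iff)

lemma rhom_TF0:
  assumes "rhom X Y f" "is_rep X" "is_rep Y"
  shows "rhom (TF0 r s0 s1 t0 t1 X) (TF0 r s0 s1 t0 t1 Y) (tm f)"
  using rhom_zero[OF assms] assms(2,3)
  by (intro rhomI) (auto simp: tm_def rhomD[OF assms(1)] kn_def fun_eq_iff)

lemma rses_rfun:
  assumes "rses X Y Z f p" "is_rep X" "is_rep Y" "is_rep Z"
  shows "rses (rfun r X) (rfun r Y) (rfun r Z) (\<lambda>h i. f (h i)) (\<lambda>h i. p (h i))"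
proof -
  have f: "rhom X Y f" "inj_on f (carr X)" and p: "rhom Y Z p" "p ` carr Y = carr Z"
    and ker: "\<And>y. y \<in> carr Y \<Longrightarrow> p y = 0 \<longleftrightarrow> y \<in> f ` carr X"
    using assms(1) by (auto simp: rses_def)
  note f0 = rhom_zero[OF f(1) assms(2,3)] and p0 = rhom_zero[OF p(1) assms(3,4)]
  have hf: "rhom (rfun r X) (rfun r Y) (\<lambda>h i. f (h i))"
    using f0 by (intro rhomI) (auto simp: rhomD[OF f(1)] kn_def)
  have hp: "rhom (rfun r Y) (rfun r Z) (\<lambda>h i. p (h i))"
    using p0 by (intro rhomI) (auto simp: rhomD[OF p(1)] kn_def)
  have "inj_on (\<lambda>h i. f (h i)) (carr (rfun r X))"
    by (rule inj_onI) (use inj_onD[OF f(2)] in \<open>auto simp: fun_eq_iff\<close>)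
  moreover have "(\<lambda>h i. p (h i)) ` carr (rfun r Y) = carr (rfun r Z)"
  proof
    show "(\<lambda>h i. p (h i)) ` carr (rfun r Y) \<subseteq> carr (rfun r Z)" using rhomD(1)[OF hp] by blast
    show "carr (rfun r Z) \<subseteq> (\<lambda>h i. p (h i)) ` carr (rfun r Y)"
    proof
      fix h assume h: "h \<in> carr (rfun r Z)"
      then have "\<forall>i. \<exists>y\<in>carr Y. h i = p y" using p(2) by (auto simp: image_iff)
      then obtain g where g: "\<And>i. g i \<in> carr Y" "\<And>i. h i = p (g i)" by metis
      \<comment> \<open>The chosen preimages may be nonzero from index \<open>r\<close> on; cutting
        them off is harmless because \<open>p\<close> sends 0 to 0.\<close>
      have "h = (\<lambda>i. p (trunc r g i))" using h g p0 by (auto simp: fun_eq_iff trunc_def kn_def)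
      moreover have "trunc r g \<in> carr (rfun r Y)" using g assms(3) by (auto simp: trunc_def kn_def)
      ultimately show "h \<in> (\<lambda>h i. p (h i)) ` carr (rfun r Y)" by blast
    qed
  qed
  moreover have "(\<lambda>i. p (h i)) = 0 \<longleftrightarrow> h \<in> (\<lambda>h i. f (h i)) ` carr (rfun r X)"
    if h: "h \<in> carr (rfun r Y)" for h
  proof
    assume "(\<lambda>i. p (h i)) = 0"
    then have "\<forall>i. \<exists>x\<in>carr X. h i = f x" using ker h by (auto simp: image_iff fun_eq_iff)
    then obtain g where g: "\<And>i. g i \<in> carr X" "\<And>i. h i = f (g i)" by metis
    have "h = (\<lambda>i. f (trunc r g i))" using h g f0 by (auto simp: fun_eq_iff trunc_def kn_def)
    moreover have "trunc r g \<in> carr (rfun r X)" using g assms(2) by (auto simp: trunc_def kn_def)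
    ultimately show "h \<in> (\<lambda>h i. f (h i)) ` carr (rfun r X)" by blast
  next
    assume "h \<in> (\<lambda>h i. f (h i)) ` carr (rfun r X)"
    then show "(\<lambda>i. p (h i)) = 0" using ker h by (auto simp: fun_eq_iff)
  qed
  ultimately show ?thesis using hf hp unfolding rses_def by blast
qed

lemma exact_prod:
  assumes "inj_on f A" "p ` B = C" "\<forall>y\<in>B. p y = 0 \<longleftrightarrow> y \<in> f ` A"
    and "inj_on f' A'" "p' ` B' = C'" "\<forall>y\<in>B'. p' y = 0 \<longleftrightarrow> y \<in> f' ` A'"
  shows "inj_on (map_prod f f') (A \<times> A')" "map_prod p p' ` (B \<times> B') = C \<times> C'"
    "\<forall>y\<in>B \<times> B'. map_prod p p' y = 0 \<longleftrightarrow> y \<in> map_prod f f' ` (A \<times> A')"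
  using assms(3,6) map_prod_inj_on[OF assms(1,4)] map_prod_surj_on[OF assms(2,5)]
    map_prod_surj_on[OF refl[of "f ` A"] refl[of "f' ` A'"]]
  by (auto simp: zero_prod_def)

lemma exact_tm:
  assumes "rses X Y Z f p" "is_rep X" "is_rep Y" "is_rep Z"
  shows "inj_on (tm f) (quad (carr (rfun r X)))"
    "tm p ` quad (carr (rfun r Y)) = quad (carr (rfun r Z))"
    "\<forall>y\<in>quad (carr (rfun r Y)). tm p y = 0 \<longleftrightarrow> y \<in> tm f ` quad (carr (rfun r X))"
proof -
  note R = rses_rfun[OF assms, of r, unfolded rses_def, THEN conjunct2]
  note e = R[THEN conjunct1] R[THEN conjunct2, THEN conjunct2, THEN conjunct1] R[THEN conjunct2,
      THEN conjunct2, THEN conjunct2]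
  note e2 = exact_prod[OF e e] note e3 = exact_prod[OF e e2] note e4 = exact_prod[OF e e3]
  show "inj_on (tm f) (quad (carr (rfun r X)))"
    "tm p ` quad (carr (rfun r Y)) = quad (carr (rfun r Z))"
    "\<forall>y\<in>quad (carr (rfun r Y)). tm p y = 0 \<longleftrightarrow> y \<in> tm f ` quad (carr (rfun r X))"
    unfolding tm_map using e4 by blast+
qed

lemma rses_TF1:
  assumes "rses X Y Z f p" "is_rep X" "is_rep Y" "is_rep Z"
  shows "rses (TF1 r s0 s1 t0 t1 X) (TF1 r s0 s1 t0 t1 Y) (TF1 r s0 s1 t0 t1 Z) (tm f) (tm p)"
proof -
  have "rhom X Y f" "rhom Y Z p" using assms(1) by (simp_all add: rses_def)
  then have h: "rhom (TF1 r s0 s1 t0 t1 X) (TF1 r s0 s1 t0 t1 Y) (tm f)"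
    "rhom (TF1 r s0 s1 t0 t1 Y) (TF1 r s0 s1 t0 t1 Z) (tm p)"
    using rhom_TF1 assms(2-4) by metis+
  show ?thesis unfolding rses_def TF1_simps by (intro conjI h exact_tm[OF assms])
qed

lemma rses_TF0:
  assumes "rses X Y Z f p" "is_rep X" "is_rep Y" "is_rep Z"
  shows "rses (TF0 r s0 s1 t0 t1 X) (TF0 r s0 s1 t0 t1 Y) (TF0 r s0 s1 t0 t1 Z) (tm f) (tm p)"
proof -
  have "rhom X Y f" "rhom Y Z p" using assms(1) by (simp_all add: rses_def)
  then have h: "rhom (TF0 r s0 s1 t0 t1 X) (TF0 r s0 s1 t0 t1 Y) (tm f)"
    "rhom (TF0 r s0 s1 t0 t1 Y) (TF0 r s0 s1 t0 t1 Z) (tm p)"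
    using rhom_TF0 assms(2-4) by metis+
  show ?thesis unfolding rses_def TF0_simps by (intro conjI h exact_tm[OF assms])
qed

lemma bij_tm:
  assumes "riso X Y" "is_rep X" "is_rep Y"
  obtains f where "rhom X Y f"
    "bij_betw (tm f) (quad (carr (rfun r X))) (quad (carr (rfun r Y)))"
proof -
  obtain f where f: "rhom X Y f" "bij_betw f (carr X) (carr Y)" using assms by (auto simp: riso_def)
  let ?g = "the_inv_into (carr X) f"
  have g: "rhom Y X ?g" by (rule rhom_inv[OF f assms(2)])
  have i: "inj_on f (carr X)" using f(2) by (auto simp: bij_betw_def)
  have 0: "f 0 = 0" "?g 0 = 0" using rhom_zero f(1) g assms by blast+
  have "bij_betw (\<lambda>h i. f (h i)) (carr (rfun r X)) (carr (rfun r Y))"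
    by (rule bij_betw_byWitness[where f' = "\<lambda>h i. ?g (h i)"])
      (use 0 the_inv_into_f_f[OF i] f_the_inv_into_f_bij_betw[OF f(2)] rhomD(1)[OF f(1)] rhomD(1)[OF g]
        in \<open>auto simp: kn_def\<close>)
  then show ?thesis using that[OF f(1)] unfolding tm_map by (blast intro: bij_betw_map_prod)
qed

lemma riso_TF1:
  assumes "riso X Y" "is_rep X" "is_rep Y"
  shows "riso (TF1 r s0 s1 t0 t1 X) (TF1 r s0 s1 t0 t1 Y)"
  by (rule bij_tm[OF assms, of r], rule risoI, erule rhom_TF1[OF _ assms(2,3)]) simp

lemma riso_TF0:
  assumes "riso X Y" "is_rep X" "is_rep Y"
  shows "riso (TF0 r s0 s1 t0 t1 X) (TF0 r s0 s1 t0 t1 Y)"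
  by (rule bij_tm[OF assms, of r], rule risoI, erule rhom_TF0[OF _ assms(2,3)]) simp

section \<open>Splitting the extensions of X by V_1 \<otimes> X and of V_1 \<otimes> X by X\<close>

definition rlin :: "('k, 'v::plus) rep \<Rightarrow> ('v \<Rightarrow> 'v) \<Rightarrow> bool" where
  "rlin X f \<longleftrightarrow> (\<forall>v w. f (v + w) = f v + f w) \<and> (\<forall>k v. f (scl X k v) = scl X k (f v)) \<and>
     (\<forall>v\<in>carr X. f v \<in> carr X)"

text \<open>Operators \<open>\<sigma>\<^sub>1, \<sigma>\<^sub>2, \<sigma>\<^sub>3\<close> as below split the extension of \<open>X\<close> by \<open>V\<^sub>1 \<otimes> X\<close> that comes
  from one of the two generators of \<open>Ext(V\<^sub>0, V\<^sub>1)\<close> (selected by \<open>\<alpha>, \<beta>\<close>), and dually.\<close>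

definition splitting :: "('k::field, 'v::ab_group_add) rep \<Rightarrow> 'k \<Rightarrow> 'k \<Rightarrow> ('v \<Rightarrow> 'v) \<Rightarrow> ('v \<Rightarrow> 'v) \<Rightarrow> ('v \<Rightarrow> 'v) \<Rightarrow> bool" where
  "splitting X \<alpha> \<beta> f1 f2 f3 \<longleftrightarrow> rlin X f1 \<and> rlin X f2 \<and> rlin X f3 \<and>
    (\<forall>x. f1 (gen X La x) = gen X La (f1 x) + scl X \<alpha> x \<and> f2 (gen X La x) = gen X La (f2 x) + f1 x \<and>
         f3 (gen X La x) = gen X La (f3 x) + f2 x \<and>
         f1 (gen X Lb x) = gen X Lb (f1 x) + f2 x \<and> f2 (gen X Lb x) = gen X Lb (f2 x) + f3 x \<and>
         f3 (gen X Lb x) = gen X Lb (f3 x) + scl X \<beta> x \<and>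
         f1 (gen X Lc x) = gen X Lc (f1 x) + f1 x \<and> f2 (gen X Lc x) = gen X Lc (f2 x) \<and>
         f3 (gen X Lc x) = gen X Lc (f3 x) + f3 x)"

lemma splittingD:
  assumes "splitting X \<alpha> \<beta> f1 f2 f3"
  shows "f1 (v + w) = f1 v + f1 w" "f2 (v + w) = f2 v + f2 w" "f3 (v + w) = f3 v + f3 w"
    "f1 (scl X k v) = scl X k (f1 v)" "f2 (scl X k v) = scl X k (f2 v)" "f3 (scl X k v) = scl X k (f3 v)"
    "v \<in> carr X \<Longrightarrow> f1 v \<in> carr X" "v \<in> carr X \<Longrightarrow> f2 v \<in> carr X" "v \<in> carr X \<Longrightarrow> f3 v \<in> carr X"
    "f1 (gen X La x) = gen X La (f1 x) + scl X \<alpha> x" "f2 (gen X La x) = gen X La (f2 x) + f1 x"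
    "f3 (gen X La x) = gen X La (f3 x) + f2 x"
    "f1 (gen X Lb x) = gen X Lb (f1 x) + f2 x" "f2 (gen X Lb x) = gen X Lb (f2 x) + f3 x"
    "f3 (gen X Lb x) = gen X Lb (f3 x) + scl X \<beta> x"
    "f1 (gen X Lc x) = gen X Lc (f1 x) + f1 x" "f2 (gen X Lc x) = gen X Lc (f2 x)"
    "f3 (gen X Lc x) = gen X Lc (f3 x) + f3 x"
  using assms by (auto simp: splitting_def rlin_def)

lemma splitting_zero:
  assumes "splitting X \<alpha> \<beta> f1 f2 f3"
  shows "f1 0 = 0" "f2 0 = 0" "f3 0 = 0"
  using splittingD(1-3)[OF assms, of 0 0] by simp_all

lemma riso_TV1:
  assumes "riso X Y" "is_rep X" "is_rep Y"
  shows "riso (TV1 X) (TV1 Y)"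
proof -
  obtain f where f: "rhom X Y f" "bij_betw f (carr X) (carr Y)" using assms by (auto simp: riso_def)
  have "rhom (TV1 X) (TV1 Y) (map_prod f (map_prod f f))"
    using assms by (intro rhomI) (auto simp: rhomD[OF f(1)])
  then show ?thesis using f(2) by (rule_tac risoI) (auto intro!: bij_betw_map_prod)
qed

context
  fixes X :: "('k::field, 'v::ab_group_add) rep" and f1 f2 f3 g1 g2 g3 and s0 s1 t0 t1 :: 'k
  assumes X: "is_rep X" and s: "splitting X 1 0 f1 f2 f3" and t: "splitting X 0 1 g1 g2 g3"
begin

text \<open>The extension given by the pencil (S, T) is S times the first generator plus T times the
  second, so its splitting is the same combination of the two given splittings.\<close>

private definition comb :: "('v \<Rightarrow> 'v) \<Rightarrow> ('v \<Rightarrow> 'v) \<Rightarrow> (nat \<Rightarrow> 'v) \<Rightarrow> nat \<Rightarrow> 'v" where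
  "comb f g v i = scl X s0 (f (v i)) + scl X s1 (f (v (Suc i))) + (scl X t0 (g (v i)) + scl X t1 (g (v (Suc i))))"

lemmas [simp] = rep_self[OF X] rep_self2[OF X] X

private lemma comb_simps [simp]:
  "comb f1 g1 (\<lambda>i. gen X La (v i)) i = gen X La (comb f1 g1 v i) + (scl X s0 (v i) + scl X s1 (v (Suc i)))"
  "comb f2 g2 (\<lambda>i. gen X La (v i)) i = gen X La (comb f2 g2 v i) + comb f1 g1 v i"
  "comb f3 g3 (\<lambda>i. gen X La (v i)) i = gen X La (comb f3 g3 v i) + comb f2 g2 v i"
  "comb f1 g1 (\<lambda>i. gen X Lb (v i)) i = gen X Lb (comb f1 g1 v i) + comb f2 g2 v i"
  "comb f2 g2 (\<lambda>i. gen X Lb (v i)) i = gen X Lb (comb f2 g2 v i) + comb f3 g3 v i"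
  "comb f3 g3 (\<lambda>i. gen X Lb (v i)) i = gen X Lb (comb f3 g3 v i) + (scl X t0 (v i) + scl X t1 (v (Suc i)))"
  "comb f1 g1 (\<lambda>i. gen X Lc (v i)) i = gen X Lc (comb f1 g1 v i) + comb f1 g1 v i"
  "comb f2 g2 (\<lambda>i. gen X Lc (v i)) i = gen X Lc (comb f2 g2 v i)"
  "comb f3 g3 (\<lambda>i. gen X Lc (v i)) i = gen X Lc (comb f3 g3 v i) + comb f3 g3 v i"
  by (simp_all add: comb_def splittingD[OF s] splittingD[OF t] ac_simps)

private lemma comb_lin:
  assumes "f = f1 \<and> g = g1 \<or> f = f2 \<and> g = g2 \<or> f = f3 \<and> g = g3"
  shows "comb f g (v + w) i = comb f g v i + comb f g w i"
    "comb f g (\<lambda>i. v i + w i) i = comb f g v i + comb f g w i"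
    "comb f g (\<lambda>i. scl X k (v i)) i = scl X k (comb f g v i)"
    "(\<And>i. v i \<in> carr X) \<Longrightarrow> comb f g v i \<in> carr X" "v \<in> kn r \<Longrightarrow> comb f g v \<in> kn r"
  using assms
  by (auto simp: comb_def splittingD[OF s] splittingD[OF t] splitting_zero[OF s] splitting_zero[OF t]
      kn_def ac_simps)

text \<open>By the \<open>splitting\<close> equations z \<mapsto> (z, \<open>comb\<close> z) is a
  homomorphic section of the projection to the top \<open>rfun r X\<close>. Adding it is a shear,
  which in characteristic 2 is its own inverse; hence the same formula in both directions.\<close>

lemma TF1_split: "riso (TF1 r s0 s1 t0 t1 X) (rfun r X \<times>\<^sub>r TV1 (rfun r X))"
proof (rule riso_sym)
  note [simp] = comb_lin[where f = f1 and g = g1] comb_lin[where f = f2 and g = g2] comb_lin[where f = f3 and g = g3]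
  show "is_rep (rfun r X \<times>\<^sub>r TV1 (rfun r X))" by simp
  let ?f = "\<lambda>(z, v1, v2, v3). (z, comb f1 g1 z + v1, comb f2 g2 z + v2, comb f3 g3 z + v3)"
  show "riso (rfun r X \<times>\<^sub>r TV1 (rfun r X)) (TF1 r s0 s1 t0 t1 X)"
  proof (rule riso_byWitness[where f = ?f and g = ?f])
    show "rhom (rfun r X \<times>\<^sub>r TV1 (rfun r X)) (TF1 r s0 s1 t0 t1 X) ?f"
      by (rule rhomI) (auto simp: fun_eq_iff ac_simps)
  qed (auto simp: fun_eq_iff)
qed

text \<open>The dual situation: the operators now map V_1 \<otimes> X to X. They occur in reverse
  order, \<open>f3\<close> with \<open>v1\<close> and \<open>f1\<close> with \<open>v3\<close>,
  since the duality of V_1 exchanges its first and third basis vectors; accordingly \<open>a\<close>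
  reaches the socle from \<open>v3\<close> and \<open>b\<close> from \<open>v1\<close>.\<close>

lemma TF0_split: "riso (TF0 r s0 s1 t0 t1 X) (rfun r X \<times>\<^sub>r TV1 (rfun r X))"
proof (rule riso_sym)
  note [simp] = comb_lin[where f = f1 and g = g1] comb_lin[where f = f2 and g = g2] comb_lin[where f = f3 and g = g3]
  show "is_rep (rfun r X \<times>\<^sub>r TV1 (rfun r X))" by simp
  let ?f = "\<lambda>(z, v1, v2, v3). (z + (comb f3 g3 v1 + (comb f2 g2 v2 + comb f1 g1 v3)), v1, v2, v3)"
  show "riso (rfun r X \<times>\<^sub>r TV1 (rfun r X)) (TF0 r s0 s1 t0 t1 X)"
  proof (rule riso_byWitness[where f = ?f and g = ?f])
    show "rhom (rfun r X \<times>\<^sub>r TV1 (rfun r X)) (TF0 r s0 s1 t0 t1 X) ?f"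
      by (rule rhomI) (auto simp: fun_eq_iff ac_simps)
  qed (auto simp: fun_eq_iff ac_simps)
qed

end

context char2
begin

text \<open>The tables below, here and for the operators \<open>splitting\<close>, solve the linear equations for an intertwining map.\<close>

lemma riso_TV1_E0: "riso (TV1 (E0 n)) (E1 n \<times>\<^sub>r E1 n \<times>\<^sub>r E1 n :: ('k, _) rep)"
proof (rule riso_byWitness[where
    f = "\<lambda>((za, p1a, p2a, p3a, q1a, q2a, q3a, ta), (zb, p1b, p2b, p3b, q1b, q2b, q3b, tb),
        (zc, p1c, p2c, p3c, q1c, q2c, q3c, tc)). ((q2a + q1b, q3a + q1c, za + q3b + q2c, zb + q3c, q1a, q2a,
        q2b + q1c, za + q2c), (p2a + p1b + zc, p3a + p1c, p3b + p2c, p3c, p1a + zb, p2a + zc, p2b + p1c, p2c),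
        (za, zb, zc, p3a + p2b + p1c, q3a + q2b + q1c, za + ta + q2c, p1a + tb + q3c, p2a + tc))" and
    g = "\<lambda>((w1x, w2x, w3x, yx, y'x, u1x, u2x, u3x), (w1y, w2y, w3y, yy, y'y, u1y, u2y, u3y),
        (w1z, w2z, w3z, yz, y'z, u1z, u2z, u3z)). ((w1z, y'y + w2z, u1y + w3z, u2y + yz, y'x, u1x, u2x + y'z,
        u3x + u1z), (w2z, w1y + u1y, w2y + yz, w3y + u3y, w1x + u1x, w2x + y'z, w3x + u3x, yx + y'y + u2z),
        (w3z, w2y + u2y + yz, u3y, yy, w2x + u2x + y'z, u3x + w1z, yx + w2z, u1y + w3z + u3z))"])
qed (auto simp: split_paired_all ac_simps intro!: rhomI)

lemma riso_TV1_E1: "riso (TV1 (E1 n)) (E0 n \<times>\<^sub>r E1 n \<times>\<^sub>r E1 n :: ('k, _) rep)"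
proof (rule riso_byWitness[where
    f = "\<lambda>((w1a, w2a, w3a, ya, y'a, u1a, u2a, u3a), (w1b, w2b, w3b, yb, y'b, u1b, u2b, u3b),
        (w1c, w2c, w3c, yc, y'c, u1c, u2c, u3c)). ((w3a + w2b + w1c, ya + w2c, yb + w3c, yc, y'a, w1a + y'b,
        w2a + y'c, w3a + u3a + u2b + u1c), (u2a + u1b + y'c, w3a + u3a + w2b + w1c + u1c, ya + u3b + w2c + u2c,
        yb + w3c + u3c, w1a + u1a + y'b, w2a + u2a + y'c, w3a + u2b + u1c, ya + u2c),
        (w2a + w1b, w3a + w1c, w3b + w2c, w3c, w1a, w2a, w2b + w1c, w2c))" and
    g = "\<lambda>((zx, p1x, p2x, p3x, q1x, q2x, q3x, tx), (w1y, w2y, w3y, yy, y'y, u1y, u2y, u3y),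
        (w1z, w2z, w3z, yz, y'z, u1z, u2z, u3z)). ((y'z, u1z, zx + u2z, p1x + u3z, q1x, q2x + y'y, q3x + u1y,
        tx + u2y), (w1z + u1z, zx + w2z, w3z + u3z, p2x + yz, q2x + y'z, w1y + u1y + u1z, tx + w2y + u2z,
        w3y + u3y + u3z), (zx + w2z + u2z, u3z, yz, p3x, q3x + u1z, zx + tx + w2y + u2y, p1x + u3y + u3z, p2x + yy))"])
qed (auto simp: split_paired_all ac_simps intro!: rhomI)

lemma splitting_E0_a: "splitting (E0 n :: ('k, _) rep) 1 0
   (\<lambda>(z, p1, p2, p3, q1, q2, q3, t). (p1, 0, p3, 0, q2, 0, t, 0))
   (\<lambda>(z, p1, p2, p3, q1, q2, q3, t). (p2, p3, 0, 0, q3, t, 0, 0))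
   (\<lambda>(z, p1, p2, p3, q1, q2, q3, t). (p3, 0, 0, 0, z + t, p1, p2, p3))"
  by (auto simp: splitting_def rlin_def ac_simps)

lemma splitting_E0_b: "splitting (E0 n :: ('k, _) rep) 0 1
   (\<lambda>(z, p1, p2, p3, q1, q2, q3, t). (q1, q2, q3, z + t, 0, 0, 0, q1))
   (\<lambda>(z, p1, p2, p3, q1, q2, q3, t). (q2, 0, t, p1, 0, 0, q1, 0))
   (\<lambda>(z, p1, p2, p3, q1, q2, q3, t). (q3, t, 0, p2, 0, q1, 0, 0))"
  by (auto simp: splitting_def rlin_def ac_simps)

lemma splitting_E1_a: "splitting (E1 n :: ('k, _) rep) 1 0
   (\<lambda>(w1, w2, w3, y, y', u1, u2, u3). (w2, 0, y, 0, u1, 0, u3, 0))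
   (\<lambda>(w1, w2, w3, y, y', u1, u2, u3). (w3, y, 0, 0, u2, u3, 0, 0))
   (\<lambda>(w1, w2, w3, y, y', u1, u2, u3). (y, 0, 0, 0, u3, 0, 0, 0))"
  by (auto simp: splitting_def rlin_def ac_simps)

lemma splitting_E1_b: "splitting (E1 n :: ('k, _) rep) 0 1
   (\<lambda>(w1, w2, w3, y, y', u1, u2, u3). (0, 0, y', u1, 0, 0, 0, 0))
   (\<lambda>(w1, w2, w3, y, y', u1, u2, u3). (0, y', w1, w2 + u2, 0, 0, y', u1))
   (\<lambda>(w1, w2, w3, y, y', u1, u2, u3). (y', 0, w2, u3, 0, 0, u1, 0))"
  by (auto simp: splitting_def rlin_def ac_simps)

lemma is_rep_V0r [simp]: "is_rep (V0r :: ('k, _) rep)"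
  by (rule is_repI') (simp_all add: algebra_simps)

lemma is_rep_V1r [simp]: "is_rep (V1r :: ('k, _) rep)"
  by (rule is_repI') (simp_all add: split_paired_all zero_prod_def algebra_simps)

lemma riso_TF1_V0: "riso (TF1 r s0 s1 t0 t1 V0r) (F1 r r (sop s0 s1) (sop t0 t1) :: ('k, _) rep)"
  by (rule riso_byWitness[where f = "\<lambda>x. x" and g = "\<lambda>x. x"])
    (auto intro!: rhomI simp: sop_def fscale_def fun_eq_iff)

lemma riso_TF0_V0: "riso (TF0 r s0 s1 t0 t1 V0r) (F0 r r (sop s0 s1) (sop t0 t1) :: ('k, _) rep)"
  by (rule riso_byWitness[where f = "\<lambda>x. x" and g = "\<lambda>x. x"])
    (auto intro!: rhomI simp: sop_def fscale_def fun_eq_iff)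

text \<open>The pairing of v_i with v_(4-i) is an invariant form on V_1; applied to the lower layer
  V_1 \<otimes> V_1 it yields the V_0 coordinate of B, while the upper layer V_0 \<otimes> V_1 is
  the V_1 layer of B. What remains, 8 of the 12 dimensions for each of the \<open>r\<close> copies,
  is P_1; the terms in S and T straighten the extension.\<close>

lemma riso_TF1_V1:
  "riso (TF1 r s0 s1 t0 t1 V1r) (F0 r r (sop s0 s1) (sop t0 t1) \<times>\<^sub>r E1 r :: ('k, _) rep)"
proof -
  let ?S = "sop s0 s1" and ?T = "sop t0 t1"
  let ?f = "\<lambda>h :: nat \<Rightarrow> 'k \<times> 'k \<times> 'k. \<lambda>i. fst (h i)" and ?g = "\<lambda>h :: nat \<Rightarrow> 'k \<times> 'k \<times> 'k. \<lambda>i. fst (snd (h i))"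
    and ?h = "\<lambda>h :: nat \<Rightarrow> 'k \<times> 'k \<times> 'k. \<lambda>i. snd (snd (h i))"
  let ?m = "\<lambda>x y z i. (x i, y i, z i)"
  show ?thesis
  proof (rule riso_byWitness[where
      f = "\<lambda>(z, v1, v2, v3). ((?h v1 + ?g v2 + ?f v3, ?f z, ?g z, ?h z),
         (?g v1 + ?f v2 + ?S (?h z), ?h v1 + ?f v3, ?h v2 + ?g v3 + ?T (?f z), ?h v3 + ?T (?g z),
          ?f v1 + ?S (?g z), ?g v1, ?g v2 + ?f v3, ?g v3))" and
      g = "\<lambda>((z, v1, v2, v3), (w1, w2, w3, y, y', u1, u2, u3)). (?m v1 v2 v3,
         ?m (y' + ?S v2) u1 (z + u2), ?m (w1 + u1 + ?S v3) (z + w2) (w3 + u3 + ?T v1),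
         ?m (z + w2 + u2) u3 (y + ?T v2))"])
  qed (auto intro!: rhomI ext simp: kn_def zero_prod_def sop_def fscale_def algebra_simps fun_eq_iff V1r_def
      prod_eq_iff case_prod_beta)
qed

text \<open>The same invariant form, now applied to the upper layer V_1 \<otimes> V_1, gives the V_0
  at the top of A, and the lower layer V_0 \<otimes> V_1, corrected by S and T, gives its
  socle.\<close>

lemma riso_TF0_V1:
  "riso (TF0 r s0 s1 t0 t1 V1r) (F1 r r (sop s0 s1) (sop t0 t1) \<times>\<^sub>r E1 r :: ('k, _) rep)"
proof -
  let ?S = "sop s0 s1" and ?T = "sop t0 t1"
  let ?f = "\<lambda>h :: nat \<Rightarrow> 'k \<times> 'k \<times> 'k. \<lambda>i. fst (h i)" and ?g = "\<lambda>h :: nat \<Rightarrow> 'k \<times> 'k \<times> 'k. \<lambda>i. fst (snd (h i))"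
    and ?h = "\<lambda>h :: nat \<Rightarrow> 'k \<times> 'k \<times> 'k. \<lambda>i. snd (snd (h i))"
  let ?m = "\<lambda>x y z i. (x i, y i, z i)"
  show ?thesis
  proof (rule riso_byWitness[where
      f = "\<lambda>(z, v1, v2, v3). ((?h v1 + ?g v2 + ?f v3, ?f z + ?S (?h v2), ?g z + ?S (?h v3) + ?T (?f v1),
          ?h z + ?T (?f v2)),
         (?g v1 + ?f v2, ?h v1 + ?f v3, ?h v2 + ?g v3, ?h v3,
          ?f v1, ?f v2, ?h v1 + ?g v2, ?h v2))" and
      g = "\<lambda>((z, v1, v2, v3), (w1, w2, w3, y, y', u1, u2, u3)).
         (?m (v1 + ?S u3) (v2 + ?S y + ?T y') (v3 + ?T u1),
          ?m y' (w1 + u1) (z + w2 + u2), ?m u1 (z + w2) u3, ?m (z + u2) (w3 + u3) y)"])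
  qed (auto intro!: rhomI ext simp: kn_def zero_prod_def sop_def fscale_def algebra_simps fun_eq_iff V1r_def
      prod_eq_iff case_prod_beta)
qed

section \<open>Renumbering: copies of copies and sums of copies\<close>

definition flat :: "nat \<Rightarrow> nat \<Rightarrow> (nat \<Rightarrow> nat \<Rightarrow> 'k) \<Rightarrow> nat \<Rightarrow> 'k" where
  "flat r n h = (\<lambda>i. if i < r * n then h (i div n) (i mod n) else 0)"

text \<open>The convention \<open>i * n + j\<close> is that of \<open>kron\<close>, so this map also
  provides the coordinates for tensor products of matrix modules.\<close>

definition unflat :: "nat \<Rightarrow> nat \<Rightarrow> (nat \<Rightarrow> 'k) \<Rightarrow> nat \<Rightarrow> nat \<Rightarrow> 'k" where
  "unflat r n x = (\<lambda>i j. if i < r \<and> j < n then x (i * n + j) else 0)"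

lemma flat_simps: "flat r n (h + h') = flat r n h + flat r n h'"
  "flat r n (\<lambda>i. fscale k (h i)) = fscale k (flat r n h)" "flat r n 0 = 0" "flat r n (\<lambda>i. 0) = 0" "flat r n h \<in>
      kn (r * n)"
  by (auto simp: flat_def fun_eq_iff kn_def fscale_def)

lemma flat_unflat: "x \<in> kn (r * n) \<Longrightarrow> flat r n (unflat r n x) = x"
  by (auto simp: flat_def unflat_def fun_eq_iff kn_def less_mult_imp_div_less mod_less_divisor)
    (metis mod_less_divisor mult_0_right not_gr_zero not_less_zero)+

lemma unflat_flat: "h \<in> kn r \<Longrightarrow> (\<And>i. h i \<in> kn n) \<Longrightarrow> unflat r n (flat r n h) = h"
proof (intro ext)
  fix i j assume h: "h \<in> kn r" "\<And>i. h i \<in> kn n"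
  show "unflat r n (flat r n h) i j = h i j"
  proof (cases "i < r \<and> j < n")
    case True
    then have "i * n + j < Suc i * n" by simp
    also have "\<dots> \<le> r * n" using True by (intro mult_le_mono1) simp
    finally show ?thesis using True by (simp add: unflat_def flat_def)
  next
    case False
    then show ?thesis using h by (auto simp: unflat_def kn_def)
  qed
qed

lemma unflat_kn: "unflat r n x \<in> kn r" "unflat r n x i \<in> kn n"
  by (auto simp: unflat_def kn_def fun_eq_iff)

type_synonym 'f oct = "'f \<times> 'f \<times> 'f \<times> 'f \<times> 'f \<times> 'f \<times> 'f \<times> 'f"

definition zip8 :: "_ \<Rightarrow> _ \<Rightarrow> _ \<Rightarrow> _ \<Rightarrow> _ \<Rightarrow> _ \<Rightarrow> _ \<Rightarrow> _ \<Rightarrow> nat \<Rightarrow> (nat \<Rightarrow> 'k) oct" where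
  "zip8 z p1 p2 p3 q1 q2 q3 t = (\<lambda>i. (z i, p1 i, p2 i, p3 i, q1 i, q2 i, q3 i, t i))"

lemma zip8_exhaust:
  obtains z p1 p2 p3 q1 q2 q3 t where "h = zip8 z p1 p2 p3 q1 q2 q3 t"
proof -
  have "h = zip8 (\<lambda>i. fst (h i)) (\<lambda>i. fst (snd (h i))) (\<lambda>i. fst (snd (snd (h i))))
    (\<lambda>i. fst (snd (snd (snd (h i))))) (\<lambda>i. fst (snd (snd (snd (snd (h i)))))) (\<lambda>i. fst (snd (snd (snd (snd (snd
        (h i)))))))
    (\<lambda>i. fst (snd (snd (snd (snd (snd (snd (h i)))))))) (\<lambda>i. snd (snd (snd (snd (snd (snd (snd (h i))))))))"
    by (simp add: zip8_def)
  then show ?thesis using that by blast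
qed

definition flat8 :: "nat \<Rightarrow> nat \<Rightarrow> (nat \<Rightarrow> (nat \<Rightarrow> 'k) oct) \<Rightarrow> (nat \<Rightarrow> 'k) oct" where
  "flat8 r n h =
    (flat r n (\<lambda>i. fst (h i)), flat r n (\<lambda>i. fst (snd (h i))), flat r n (\<lambda>i. fst (snd (snd (h i)))),
     flat r n (\<lambda>i. fst (snd (snd (snd (h i))))), flat r n (\<lambda>i. fst (snd (snd (snd (snd (h i)))))),
     flat r n (\<lambda>i. fst (snd (snd (snd (snd (snd (h i))))))),
     flat r n (\<lambda>i. fst (snd (snd (snd (snd (snd (snd (h i)))))))),
         flat r n (\<lambda>i. snd (snd (snd (snd (snd (snd (snd (h i)))))))))"

lemma flat8_zip8: "flat8 r n (zip8 z p1 p2 p3 q1 q2 q3 t) = (flat r n z, flat r n p1, flat r n p2, flat r n p3,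
    flat r n q1, flat r n q2, flat r n q3, flat r n t)"
  by (simp add: flat8_def zip8_def)

lemma zip8_add: "zip8 z p1 p2 p3 q1 q2 q3 t + zip8 z' p1' p2' p3' q1' q2' q3' t' =
    zip8 (z + z') (p1 + p1') (p2 + p2') (p3 + p3') (q1 + q1') (q2 + q2') (q3 + q3') (t + t')"
  by (simp add: zip8_def fun_eq_iff)

lemma zip8_kn: "zip8 z p1 p2 p3 q1 q2 q3 t \<in> kn r \<longleftrightarrow> z \<in> kn r \<and> p1 \<in> kn r \<and> p2 \<in> kn r \<and> p3 \<in> kn r \<and>
    q1 \<in> kn r \<and> q2 \<in> kn r \<and> q3 \<in> kn r \<and> t \<in> kn r"
  by (auto simp: zip8_def kn_def zero_prod_def)

text \<open>\<open>E0\<close> and \<open>E1\<close> have the same underlying space and differ only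
  in the action, so this bijection serves for both.\<close>

lemma flat8_bij: "bij_betw (flat8 r n) (carr (rfun r (E0 n))) (carr (E0 (r * n)))"
proof (rule bij_betw_byWitness[where f' = "\<lambda>(z, p1, p2, p3, q1, q2, q3, t).
    zip8 (unflat r n z) (unflat r n p1) (unflat r n p2) (unflat r n p3)
        (unflat r n q1) (unflat r n q2) (unflat r n q3) (unflat r n t)"])
  let ?g = "\<lambda>(z, p1, p2, p3, q1, q2, q3, t). zip8 (unflat r n z) (unflat r n p1) (unflat r n p2) (unflat r n p3)
        (unflat r n q1) (unflat r n q2) (unflat r n q3) (unflat r n t)"
  show "\<forall>h\<in>carr (rfun r (E0 n)). ?g (flat8 r n h) = h"
  proof
    fix h assume h: "h \<in> carr (rfun r (E0 n) :: ('k, _) rep)"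
    obtain z p1 p2 p3 q1 q2 q3 t where e: "h = zip8 z p1 p2 p3 q1 q2 q3 t" by (rule zip8_exhaust)
    have "zip8 z p1 p2 p3 q1 q2 q3 t i = (z i, p1 i, p2 i, p3 i, q1 i, q2 i, q3 i, t i)" for i by (simp add: zip8_def)
    then show "?g (flat8 r n h) = h" using h unfolding e by (simp add: flat8_zip8 zip8_kn unflat_flat)
  qed
  show "\<forall>h\<in>carr (E0 (r * n)). flat8 r n (?g h) = h"
    by (auto simp: flat8_zip8 flat_unflat)
  show "flat8 r n ` carr (rfun r (E0 n)) \<subseteq> carr (E0 (r * n))"
    by (auto simp: flat8_def flat_simps)
  show "?g ` carr (E0 (r * n)) \<subseteq> carr (rfun r (E0 n))"
    by (auto simp: zip8_kn unflat_kn) (simp add: zip8_def unflat_kn)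
qed

lemma riso_rfun_E0: "riso (rfun r (E0 n)) (E0 (r * n) :: ('k, _) rep)"
proof (rule risoI[OF rhomI flat8_bij])
  fix v w assume v: "v \<in> carr (rfun r (E0 n) :: ('k, _) rep)"
  then show "flat8 r n v \<in> carr (E0 (r * n))" using flat8_bij bij_betwE by blast
  obtain z p1 p2 p3 q1 q2 q3 t where e: "v = zip8 z p1 p2 p3 q1 q2 q3 t" by (rule zip8_exhaust)
  obtain z' p1' p2' p3' q1' q2' q3' t' where e': "w = zip8 z' p1' p2' p3' q1' q2' q3' t'" by (rule zip8_exhaust)
  show "flat8 r n (v + w) = flat8 r n v + flat8 r n w"
    by (simp add: e e' zip8_add flat8_zip8 flat_simps)
  have z8: "zip8 z p1 p2 p3 q1 q2 q3 t = (\<lambda>i. (z i, p1 i, p2 i, p3 i, q1 i, q2 i, q3 i, t i))"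
    by (simp add: zip8_def)
  show "flat8 r n (scl (rfun r (E0 n)) k v) = scl (E0 (r * n)) k (flat8 r n v)" for k
    by (simp add: e z8 flat8_def flat_simps)
  show "flat8 r n (gen (rfun r (E0 n)) La v) = gen (E0 (r * n)) La (flat8 r n v)"
    "flat8 r n (gen (rfun r (E0 n)) Lb v) = gen (E0 (r * n)) Lb (flat8 r n v)"
    "flat8 r n (gen (rfun r (E0 n)) Lc v) = gen (E0 (r * n)) Lc (flat8 r n v)"
    by (simp_all add: e z8 flat8_def flat_simps)
qed

lemma riso_rfun_E1: "riso (rfun r (E1 n)) (E1 (r * n) :: ('k, _) rep)"
proof (rule risoI[OF rhomI])
  have c: "carr (rfun r (E1 n)) = carr (rfun r (E0 n :: ('k,
      _) rep))" "carr (E1 (r * n)) = carr (E0 (r * n) :: ('k, _) rep)" by simp_all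
  show "bij_betw (flat8 r n) (carr (rfun r (E1 n))) (carr (E1 (r * n)))" unfolding c by (rule flat8_bij)
  fix v w assume v: "v \<in> carr (rfun r (E1 n) :: ('k, _) rep)"
  then show "flat8 r n v \<in> carr (E1 (r * n))" unfolding c using flat8_bij bij_betwE by blast
  obtain z p1 p2 p3 q1 q2 q3 t where e: "v = zip8 z p1 p2 p3 q1 q2 q3 t" by (rule zip8_exhaust)
  obtain z' p1' p2' p3' q1' q2' q3' t' where e': "w = zip8 z' p1' p2' p3' q1' q2' q3' t'" by (rule zip8_exhaust)
  show "flat8 r n (v + w) = flat8 r n v + flat8 r n w"
    by (simp add: e e' zip8_add flat8_zip8 flat_simps)
  have z8: "zip8 z p1 p2 p3 q1 q2 q3 t = (\<lambda>i. (z i, p1 i, p2 i, p3 i, q1 i, q2 i, q3 i, t i))"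
    by (simp add: zip8_def)
  have fa: "flat r n (\<lambda>i. f i + g i) = flat r n f + flat r n g" for f g
    using flat_simps(1)[of r n f g] by (simp add: plus_fun_def)
  show "flat8 r n (scl (rfun r (E1 n)) k v) = scl (E1 (r * n)) k (flat8 r n v)" for k
    by (simp add: e z8 flat8_def flat_simps)
  show "flat8 r n (gen (rfun r (E1 n)) La v) = gen (E1 (r * n)) La (flat8 r n v)"
    "flat8 r n (gen (rfun r (E1 n)) Lb v) = gen (E1 (r * n)) Lb (flat8 r n v)"
    "flat8 r n (gen (rfun r (E1 n)) Lc v) = gen (E1 (r * n)) Lc (flat8 r n v)"
    by (simp_all add: e z8 flat8_def flat_simps fa)
qed

definition join :: "nat \<Rightarrow> (nat \<Rightarrow> 'k) \<Rightarrow> (nat \<Rightarrow> 'k) \<Rightarrow> nat \<Rightarrow> 'k" where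
  "join m f g = (\<lambda>i. if i < m then f i else g (i - m))"

lemma join_simps: "join m (f + f') (g + g') = join m f g + join m f' g'"
  "join m (fscale k f) (fscale k g) = fscale k (join m f g)" "join m 0 0 = 0"
  "g \<in> kn n \<Longrightarrow> join m f g \<in> kn (m + n)"
  by (auto simp: join_def fun_eq_iff fscale_def kn_def)

lemma join_inv: "f \<in> kn m \<Longrightarrow> trunc m (join m f g) = f" "(\<lambda>i. join m f g (i + m)) = g"
  "join m (trunc m h) (\<lambda>i. h (i + m)) = h" "h \<in> kn (m + n) \<Longrightarrow> (\<lambda>i. h (i + m)) \<in> kn n"
  by (auto simp: join_def fun_eq_iff kn_def trunc_def)

lemma riso_E0_add: "riso (E0 m \<times>\<^sub>r E0 n) (E0 (m + n) :: ('k, _) rep)"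
  by (rule riso_byWitness[where
    f = "\<lambda>((z, p1, p2, p3, q1, q2, q3, t), (z', p1', p2', p3', q1', q2', q3', t')).
      (join m z z', join m p1 p1', join m p2 p2', join m p3 p3', join m q1 q1', join m q2 q2', join m q3 q3',
          join m t t')"
    and g = "\<lambda>(z, p1, p2, p3, q1, q2, q3, t). ((trunc m z, trunc m p1, trunc m p2, trunc m p3, trunc m q1,
       trunc m q2, trunc m q3, trunc m t), (\<lambda>i. z (i + m), \<lambda>i. p1 (i + m), \<lambda>i. p2 (i + m), \<lambda>i. p3 (i + m),
       \<lambda>i. q1 (i + m), \<lambda>i. q2 (i + m), \<lambda>i. q3 (i + m), \<lambda>i. t (i + m)))"])
    (auto intro!: rhomI simp: join_simps join_inv)

lemma riso_E1_add: "riso (E1 m \<times>\<^sub>r E1 n) (E1 (m + n) :: ('k, _) rep)"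
  by (rule riso_byWitness[where
    f = "\<lambda>((z, p1, p2, p3, q1, q2, q3, t), (z', p1', p2', p3', q1', q2', q3', t')).
      (join m z z', join m p1 p1', join m p2 p2', join m p3 p3', join m q1 q1', join m q2 q2', join m q3 q3',
          join m t t')"
    and g = "\<lambda>(z, p1, p2, p3, q1, q2, q3, t). ((trunc m z, trunc m p1, trunc m p2, trunc m p3, trunc m q1,
       trunc m q2, trunc m q3, trunc m t), (\<lambda>i. z (i + m), \<lambda>i. p1 (i + m), \<lambda>i. p2 (i + m), \<lambda>i. p3 (i + m),
       \<lambda>i. q1 (i + m), \<lambda>i. q2 (i + m), \<lambda>i. q3 (i + m), \<lambda>i. t (i + m)))"])
    (auto intro!: rhomI simp: join_simps join_inv)

lemma oct_cases:
  obtains x1 x2 x3 x4 x5 x6 x7 x8 where "(x :: 'f oct) = (x1, x2, x3, x4, x5, x6, x7, x8)"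
  by (cases x) auto

section \<open>Projective and injective modules\<close>

text \<open>The module P(m, n) of the statement on an explicit space; the comparison with arbitrary
  projective covers comes only at the end.\<close>

definition Pr :: "nat \<Rightarrow> nat \<Rightarrow> ('k, _) rep" where
  "Pr m n = E0 m \<times>\<^sub>r E1 n"

lemma is_rep_Pr [simp]: "is_rep (Pr m n)"
  by (simp add: Pr_def)

lemma fdim_Pr: "fdim (carr (Pr m n)) (scl (Pr m n)) (8 * m + 8 * n)"
  using fdim_prod[OF fdim_E0 fdim_E1, of m n] by (simp add: Pr_def rprod_def)

definition soc0 :: "nat \<Rightarrow> (nat \<Rightarrow> 'k) oct set" where
  "soc0 n = {0} \<times> {0} \<times> {0} \<times> {0} \<times> {0} \<times> {0} \<times> {0} \<times> kn n"

definition soc1 :: "nat \<Rightarrow> (nat \<Rightarrow> 'k) oct set" where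
  "soc1 n = {0} \<times> {0} \<times> {0} \<times> {0} \<times> {0} \<times> kn n \<times> kn n \<times> kn n"

text \<open>Suitable elements of the algebra move each coordinate outside the socle, in isolation,
  to the socle coordinate. The factor 1 + c selects the part of weight 0; on it ab + abab isolates
  \<open>z\<close>, while bbabab and aaabab isolate \<open>p2\<close> and \<open>q2\<close>. One
  application of \<open>a\<close> or \<open>b\<close> moves \<open>p1\<close>, \<open>p3\<close> to
  the place of \<open>p2\<close> and \<open>q1\<close>, \<open>q3\<close> to that of
  \<open>q2\<close>.\<close>

lemma ress_E0: "ress (E0 n) (soc0 n)"
  unfolding ress_def
proof (intro conjI allI impI)
  show "rsub (E0 n) (soc0 n)"
    unfolding rsub_def
  proof (intro conjI allI ballI)
    fix x and v :: "(nat \<Rightarrow> 'k) oct" assume "v \<in> soc0 n"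
    then show "gen (E0 n) x v \<in> soc0 n" by (cases x) (auto simp: soc0_def)
  qed (auto simp: soc0_def zero_prod_def)
  fix K assume K: "rsub (E0 n) K" and S: "K \<inter> soc0 n \<subseteq> {0}"
  have Kg: "v \<in> K \<Longrightarrow> gen (E0 n) x v \<in> K" and Ka: "v \<in> K \<Longrightarrow> w \<in> K \<Longrightarrow> v + w \<in> K" for v w x
    using K by (simp_all add: rsub_def)
  have Kc: "(z, p1, p2, p3, q1, q2, q3, t) \<in> K \<Longrightarrow> z \<in> kn n \<and> p1 \<in> kn n \<and> p2 \<in> kn n \<and> p3 \<in> kn n \<and>
      q1 \<in> kn n \<and> q2 \<in> kn n \<and> q3 \<in> kn n \<and> t \<in> kn n" for z p1 p2 p3 q1 q2 q3 t
    using K by (auto simp: rsub_def)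
  have a: "(z, p1, p2, p3, q1, q2, q3, t) \<in> K \<Longrightarrow> (0, z, p1, p2, 0, q1, q2, q3) \<in> K"
    and b: "(z, p1, p2, p3, q1, q2, q3, t) \<in> K \<Longrightarrow> (0, p2, p3, 0, q2, q3, z, p1) \<in> K"
    and c: "(z, p1, p2, p3, q1, q2, q3, t) \<in> K \<Longrightarrow> (0, p1, 0, p3, q1, 0, q3, 0) \<in> K" for z p1 p2 p3 q1 q2 q3 t
    using Kg[of "(z, p1, p2, p3, q1, q2, q3, t)" La] Kg[of "(z, p1, p2, p3, q1, q2, q3, t)" Lb]
      Kg[of "(z, p1, p2, p3, q1, q2, q3, t)" Lc] by simp_all
  have ad: "(z, p1, p2, p3, q1, q2, q3, t) \<in> K \<Longrightarrow> (z', p1', p2', p3', q1', q2', q3', t') \<in> K \<Longrightarrow>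
     (z + z', p1 + p1', p2 + p2', p3 + p3', q1 + q1', q2 + q2', q3 + q3', t + t') \<in> K"
    for z p1 p2 p3 q1 q2 q3 t z' p1' p2' p3' q1' q2' q3' t'
    using Ka[of "(z, p1, p2, p3, q1, q2, q3, t)" "(z', p1', p2', p3', q1', q2', q3', t')"] by simp
  have s: "t = 0" if "(0, 0, 0, 0, 0, 0, 0, t) \<in> K" for t
    using S that Kc by (auto simp: soc0_def zero_prod_def)
  have e: "(z, 0, p2, 0, 0, q2, 0, t) \<in> K" if "(z, p1, p2, p3, q1, q2, q3, t) \<in> K" for z p1 p2 p3 q1 q2 q3 t
    using ad[OF that c[OF that]] by simp
  have ab: "(0, 0, p2, 0, 0, q2, 0, z) \<in> K" if "(z, p1, p2, p3, q1, q2, q3, t) \<in> K" for z p1 p2 p3 q1 q2 q3 t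
    using a[OF b[OF e[OF that]]] by simp
  have z0: "z = 0" if "(z, p1, p2, p3, q1, q2, q3, t) \<in> K" for z p1 p2 p3 q1 q2 q3 t
    using s[of z] ad[OF ab[OF that] ab[OF ab[OF that]]] by simp
  have p2: "p2 = 0" if "(z, p1, p2, p3, q1, q2, q3, t) \<in> K" for z p1 p2 p3 q1 q2 q3 t
    using s[of p2] b[OF b[OF ab[OF ab[OF that]]]] by simp
  have q2: "q2 = 0" if "(z, p1, p2, p3, q1, q2, q3, t) \<in> K" for z p1 p2 p3 q1 q2 q3 t
    using s[of q2] a[OF a[OF ab[OF ab[OF that]]]] by simp
  have "p1 = 0 \<and> p3 = 0 \<and> q1 = 0 \<and> q3 = 0" if "(z, p1, p2, p3, q1, q2, q3, t) \<in> K" for z p1 p2 p3 q1 q2 q3 t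
    using p2[OF a[OF that]] p2[OF b[OF that]] q2[OF a[OF that]] q2[OF b[OF that]] by simp
  then have all: "z = 0 \<and> p1 = 0 \<and> p2 = 0 \<and> p3 = 0 \<and> q1 = 0 \<and> q2 = 0 \<and> q3 = 0"
    if "(z, p1, p2, p3, q1, q2, q3, t) \<in> K" for z p1 p2 p3 q1 q2 q3 t
    using z0[OF that] p2[OF that] q2[OF that] that by blast
  show "K \<subseteq> {0}"
  proof
    fix v assume v: "v \<in> K"
    obtain z p1 p2 p3 q1 q2 q3 t where e: "v = (z, p1, p2, p3, q1, q2, q3, t)" by (rule oct_cases)
    show "v \<in> {0}" using all[of z p1 p2 p3 q1 q2 q3 t] s[of t] v by (simp add: e zero_prod_def)
  qed
qed

text \<open>After projecting to weight 0 by 1 + c, the element ab + abab moves \<open>w2\<close>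
  alone to the place of \<open>u2\<close>, so \<open>w2\<close> vanishes; \<open>a\<close> and
  \<open>b\<close> move \<open>w1\<close> and \<open>w3\<close> to the place of \<open>w2\<close>.
  What is left of the weight 0 part lands in the socle under \<open>a\<close> and \<open>b\<close>,
  with \<open>y'\<close> and \<open>y\<close> as coordinates.\<close>

lemma ress_E1: "ress (E1 n) (soc1 n)"
  unfolding ress_def
proof (intro conjI allI impI)
  show "rsub (E1 n) (soc1 n)"
    unfolding rsub_def
  proof (intro conjI allI ballI)
    fix x and v :: "(nat \<Rightarrow> 'k) oct" assume "v \<in> soc1 n"
    then show "gen (E1 n) x v \<in> soc1 n" by (cases x) (auto simp: soc1_def)
  qed (auto simp: soc1_def zero_prod_def)
  fix K assume K: "rsub (E1 n) K" and S: "K \<inter> soc1 n \<subseteq> {0}"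
  have Kg: "v \<in> K \<Longrightarrow> gen (E1 n) x v \<in> K" and Ka: "v \<in> K \<Longrightarrow> w \<in> K \<Longrightarrow> v + w \<in> K" for v w x
    using K by (simp_all add: rsub_def)
  have Kc: "(w1, w2, w3, y, y', u1, u2, u3) \<in> K \<Longrightarrow> w1 \<in> kn n \<and> w2 \<in> kn n \<and> w3 \<in> kn n \<and> y \<in> kn n \<and>
      y' \<in> kn n \<and> u1 \<in> kn n \<and> u2 \<in> kn n \<and> u3 \<in> kn n" for w1 w2 w3 y y' u1 u2 u3
    using K by (auto simp: rsub_def)
  have a: "(w1, w2, w3, y, y', u1, u2, u3) \<in> K \<Longrightarrow> (0, w1, w2, w3, 0, y', u1, u2) \<in> K"
    and b: "(w1, w2, w3, y, y', u1, u2, u3) \<in> K \<Longrightarrow> (w2, w3, 0, 0, w1, w2 + u2, w3 + u3, y) \<in> K"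
    and c: "(w1, w2, w3, y, y', u1, u2, u3) \<in> K \<Longrightarrow> (w1, 0, w3, 0, 0, u1, 0, u3) \<in> K" for w1 w2 w3 y y' u1 u2 u3
    using Kg[of "(w1, w2, w3, y, y', u1, u2, u3)" La] Kg[of "(w1, w2, w3, y, y', u1, u2, u3)" Lb]
      Kg[of "(w1, w2, w3, y, y', u1, u2, u3)" Lc] by simp_all
  have ad: "(z, p1, p2, p3, q1, q2, q3, t) \<in> K \<Longrightarrow> (z', p1', p2', p3', q1', q2', q3', t') \<in> K \<Longrightarrow>
     (z + z', p1 + p1', p2 + p2', p3 + p3', q1 + q1', q2 + q2', q3 + q3', t + t') \<in> K"
    for z p1 p2 p3 q1 q2 q3 t z' p1' p2' p3' q1' q2' q3' t'
    using Ka[of "(z, p1, p2, p3, q1, q2, q3, t)" "(z', p1', p2', p3', q1', q2', q3', t')"] by simp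
  have s: "u1 = 0 \<and> u2 = 0 \<and> u3 = 0" if "(0, 0, 0, 0, 0, u1, u2, u3) \<in> K" for u1 u2 u3
    using S that Kc by (auto simp: soc1_def zero_prod_def)
  have e: "(0, w2, 0, y, y', 0, u2, 0) \<in> K" if "(w1, w2, w3, y, y', u1, u2, u3) \<in> K" for w1 w2 w3 y y' u1 u2 u3
    using ad[OF that c[OF that]] by simp
  have ab: "(0, w2, 0, 0, 0, 0, w2 + u2, 0) \<in> K" if "(w1, w2, w3, y, y', u1, u2, u3) \<in> K" for w1 w2 w3 y y' u1 u2 u3
    using a[OF b[OF e[OF that]]] by simp
  have w2: "w2 = 0" if "(w1, w2, w3, y, y', u1, u2, u3) \<in> K" for w1 w2 w3 y y' u1 u2 u3
    using s[of 0 w2 0] ad[OF ab[OF that] ab[OF ab[OF that]]] by (simp add: ac_simps)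
  have w: "w1 = 0 \<and> w3 = 0" if "(w1, w2, w3, y, y', u1, u2, u3) \<in> K" for w1 w2 w3 y y' u1 u2 u3
    using w2[OF a[OF that]] w2[OF b[OF that]] by simp
  have mid: "y = 0 \<and> y' = 0" if "(w1, w2, w3, y, y', u1, u2, u3) \<in> K" for w1 w2 w3 y y' u1 u2 u3
  proof -
    have "w2 = 0" "w1 = 0" "w3 = 0" using w2 w that by blast+
    then have "(0, 0, 0, y, y', 0, u2, 0) \<in> K" using e[OF that] by simp
    from a[OF this] b[OF this] show ?thesis using s[of y' 0 u2] s[of 0 u2 y] s[of u2 0 y] by auto
  qed
  show "K \<subseteq> {0}"
  proof
    fix v assume v: "v \<in> K"
    obtain w1 w2 w3 y y' u1 u2 u3 where e: "v = (w1, w2, w3, y, y', u1, u2, u3)" by (cases v) auto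
    have "w1 = 0" "w2 = 0" "w3 = 0" "y = 0" "y' = 0" using w[OF v[unfolded e]] w2[OF v[unfolded e]] mid[OF
        v[unfolded e]] by auto
    then show "v \<in> {0}" using s v by (auto simp: e zero_prod_def)
  qed
qed

lemma ress_Pr: "ress (Pr m n) (soc0 m \<times> soc1 n)"
  unfolding Pr_def by (intro ress_rprod ress_E0 ress_E1 is_rep_E0 is_rep_E1)

text \<open>Coinduction: \<open>E0\<close> is determined by its socle coordinate functional. A functional \<open>\<rho>\<close> on \<open>Y\<close>
  comes from a homomorphism to \<open>E0\<close> if it kills \<open>c Y\<close>, \<open>aba Y\<close>, \<open>abb Y\<close>, and precomposing with
  \<open>(1 + c)(1 + abab)\<close> forces these conditions.\<close>

lemma E0_injective:
  assumes X: "is_rep X" "fdim (carr X) (scl X) N" and Y: "is_rep Y"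
    and i: "rhom X Y \<iota>" "inj_on \<iota> (carr X)" and f: "rhom X (E0 n :: ('k, _) rep) f"
  obtains g where "rhom Y (E0 n) g" "\<And>x. x \<in> carr X \<Longrightarrow> g (\<iota> x) = f x"
proof -
  obtain l where l: "linon UNIV (scl Y) (scl X) l" "\<And>y. l y \<in> carr X" "\<And>x. x \<in> carr X \<Longrightarrow> l (\<iota> x) = x"
    using fdim_retraction[OF X(2,1) Y i] by blast
  define tc :: "(nat \<Rightarrow> 'k) oct \<Rightarrow> nat \<Rightarrow> 'k" where "tc = (\<lambda>(z, p1, p2, p3, q1, q2, q3, t). t)"
  \<comment> \<open>A linear extension to \<open>Y\<close> of the socle coordinate of
    \<open>f\<close>, so far without regard to the action.\<close>
  define \<psi> where "\<psi> y = tc (f (l y))" for y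
  have \<psi>k: "\<psi> y \<in> kn n" for y
    using rhomD(1)[OF f l(2)[of y]] by (auto simp: \<psi>_def tc_def split: prod.splits)
  have tc: "tc (v + w) = tc v + tc w" "tc (scl (E0 n) k v) = fscale k (tc v)" for v w k
    by (auto simp: tc_def split: prod.splits)
  have \<psi>: "\<psi> (v + w) = \<psi> v + \<psi> w" "\<psi> (scl Y k v) = fscale k (\<psi> v)" for v w k
    using l(1,2) by (simp_all add: \<psi>_def linon_def rhomD[OF f] tc)
  let ?a = "gen Y La" and ?b = "gen Y Lb" and ?c = "gen Y Lc"
  note [simp] = rep_self[OF Y] rep_self2[OF Y] Y
  define \<rho> where "\<rho> v = \<psi> (let w = v + ?a (?b (?a (?b v))) in w + ?c w)" for v
  have \<psi>0: "\<psi> 0 = 0" using \<psi>(2)[of 0 0] by simp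
  have \<rho>: "\<rho> (v + w) = \<rho> v + \<rho> w" "\<rho> (scl Y k v) = fscale k (\<rho> v)" "\<rho> v \<in> kn n" for v w k
    by (simp_all add: \<rho>_def \<psi> \<psi>k Let_def ac_simps)
  have r1: "\<rho> (?c v) = 0" for v by (simp add: \<rho>_def Let_def \<psi>0 ac_simps)
  have R2: "\<rho> (?a (?b (?a v))) = 0" for v by (simp add: \<rho>_def Let_def \<psi>0 ac_simps)
  have r8: "\<rho> (?a (?b (?b v))) = 0" for v by (simp add: \<rho>_def Let_def \<psi>0 ac_simps)
  have r2: "\<rho> (?a (?c v)) = \<rho> (?a v)" "\<rho> (?b (?c v)) = \<rho> (?b v)" for v
    using r1[of "?a v"] r1[of "?b v"] f_eq by (simp_all add: \<rho>)
  have r3: "\<rho> (?a (?a (?c v))) = 0" "\<rho> (?a (?b (?c v))) = 0" "\<rho> (?b (?b (?c v))) = 0" for v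
    using r1[of "?a (?a v)"] r1[of "?a (?b v)"] r1[of "?b (?b v)"] by (simp_all add: \<rho> ac_simps)
  have r4: "\<rho> (?a (?a (?a (?c v)))) = \<rho> (?a (?a (?a v)))" "\<rho> (?b (?b (?b (?c v)))) = \<rho> (?b (?b (?b v)))" for v
    using r1[of "?a (?a (?a v))"] r1[of "?b (?b (?b v))"] f_eq by (simp_all add: \<rho> ac_simps)
  have r5: "\<rho> (?a (?a (?b v))) = \<rho> (?a v)" for v
    using R2[of v] f_eq by (simp add: \<rho> r2)
  have r6: "\<rho> (?a (?a (?a (?b v)))) = \<rho> (?a (?a v))" for v
    using r5[of "?a v"] by (simp add: \<rho> r3)
  \<comment> \<open>In \<open>E0\<close> each coordinate is the \<open>t\<close> coordinate of the
    image under the monomial listed here, so a homomorphism with last coordinate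
    \<open>\<rho>\<close> can have no other form.\<close>
  define g where "g v = (\<rho> (?a (?b v)), \<rho> (?b v), \<rho> (?b (?b v)), \<rho> (?b (?b (?b v))), \<rho> (?a (?a (?a v))),
     \<rho> (?a (?a v)), \<rho> (?a v), \<rho> v)" for v
  have \<rho>0: "\<rho> 0 = 0" using \<rho>(2)[of 0 0] by simp
  have "rhom Y (E0 n) g"
    by (rule rhomI) (simp_all add: g_def \<rho> r1 r8 r2 r3 r4 r5 r6 \<rho>0 ac_simps)
  moreover have "g (\<iota> x) = f x" if x: "x \<in> carr X" for x
  proof -
    \<comment> \<open>Precomposition with the correcting element does not change the
      \<open>t\<close> coordinate on \<open>E0\<close>, so on the image of \<open>\<iota>\<close>
      the corrected functional still agrees with the given one.\<close>
    have \<rho>\<iota>: "\<rho> (\<iota> v) = tc (f v)" if v: "v \<in> carr X" for v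
    proof -
      have "\<rho> (\<iota> v) = \<psi> (\<iota> (let w = v + gen X La (gen X Lb (gen X La (gen X Lb v))) in w + gen X Lc w))"
        using v X(1) by (simp add: \<rho>_def Let_def rhomD[OF i(1)] del: rep_rels)
      also have "\<dots> = tc (let w = f v + gen (E0 n) La (gen (E0 n) Lb (gen (E0 n) La (gen (E0 n) Lb (f v)))) in w
          + gen (E0 n) Lc w)"
        using v X(1) by (simp add: \<psi>_def l(3) Let_def rhomD[OF f] del: rep_rels)
      also have "\<dots> = tc (f v)"
        by (cases "f v" rule: oct_cases) (simp add: tc_def)
      finally show ?thesis .
    qed
    have "g (\<iota> x) = (let E = E0 n; v = f x in (tc (gen E La (gen E Lb v)), tc (gen E Lb v), tc (gen E Lb (gen E Lb v)),
       tc (gen E Lb (gen E Lb (gen E Lb v))), tc (gen E La (gen E La (gen E La v))),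
       tc (gen E La (gen E La v)), tc (gen E La v), tc v))"
      using x X(1) by (simp add: g_def rhomD(4)[OF i(1), symmetric] \<rho>\<iota> Let_def rhomD(4)[OF f])
    also have "\<dots> = f x" by (cases "f x" rule: oct_cases) (simp add: tc_def)
    finally show ?thesis .
  qed
  ultimately show ?thesis using that by blast
qed

text \<open>Coinduction again, now from the coordinate \<open>u2\<close>. The functional has to kill
  c Y, aaa Y and bbb Y and to be invariant under abab; precomposing any linear functional with (1 +
  c) abab achieves all of this, and it leaves the \<open>u2\<close> coordinate on \<open>E1\<close>
  unchanged.\<close>

lemma E1_injective:
  assumes X: "is_rep X" "fdim (carr X) (scl X) N" and Y: "is_rep Y"
    and i: "rhom X Y \<iota>" "inj_on \<iota> (carr X)" and f: "rhom X (E1 n :: ('k, _) rep) f"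
  obtains g where "rhom Y (E1 n) g" "\<And>x. x \<in> carr X \<Longrightarrow> g (\<iota> x) = f x"
proof -
  obtain l where l: "linon UNIV (scl Y) (scl X) l" "\<And>y. l y \<in> carr X" "\<And>x. x \<in> carr X \<Longrightarrow> l (\<iota> x) = x"
    using fdim_retraction[OF X(2,1) Y i] by blast
  define tc :: "(nat \<Rightarrow> 'k) oct \<Rightarrow> nat \<Rightarrow> 'k" where "tc = (\<lambda>(w1, w2, w3, y, y', u1, u2, u3). u2)"
  define \<psi> where "\<psi> y = tc (f (l y))" for y
  have \<psi>k: "\<psi> y \<in> kn n" for y
    using rhomD(1)[OF f l(2)[of y]] by (auto simp: \<psi>_def tc_def split: prod.splits)
  have tc: "tc (v + w) = tc v + tc w" "tc (scl (E1 n) k v) = fscale k (tc v)" for v w k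
    by (auto simp: tc_def split: prod.splits)
  have \<psi>: "\<psi> (v + w) = \<psi> v + \<psi> w" "\<psi> (scl Y k v) = fscale k (\<psi> v)" for v w k
    using l(1,2) by (simp_all add: \<psi>_def linon_def rhomD[OF f] tc)
  let ?a = "gen Y La" and ?b = "gen Y Lb" and ?c = "gen Y Lc"
  note [simp] = rep_self[OF Y] rep_self2[OF Y] Y
  define \<rho> where "\<rho> v = \<psi> (let w = ?a (?b (?a (?b v))) in w + ?c w)" for v
  have \<psi>0: "\<psi> 0 = 0" using \<psi>(2)[of 0 0] by simp
  have \<rho>: "\<rho> (v + w) = \<rho> v + \<rho> w" "\<rho> (scl Y k v) = fscale k (\<rho> v)" "\<rho> v \<in> kn n" for v w k
    by (simp_all add: \<rho>_def \<psi> \<psi>k Let_def ac_simps)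
  have \<rho>0: "\<rho> 0 = 0" using \<rho>(2)[of 0 0] by simp
  have r1: "\<rho> (?c v) = 0" for v by (simp add: \<rho>_def Let_def \<psi>0 ac_simps)
  have ra: "\<rho> (?a (?a (?a v))) = 0" for v by (simp add: \<rho>_def Let_def \<psi>0 ac_simps)
  have rb: "\<rho> (?b (?b (?b v))) = 0" for v by (simp add: \<rho>_def Let_def \<psi>0 ac_simps)
  have R: "\<rho> (?a (?b (?a (?b v)))) = \<rho> v" for v by (simp add: \<rho>_def Let_def \<psi>0 ac_simps)
  have r2: "\<rho> (?a (?c v)) = \<rho> (?a v)" "\<rho> (?b (?c v)) = \<rho> (?b v)" for v
    using r1[of "?a v"] r1[of "?b v"] f_eq by (simp_all add: \<rho>)
  have r3: "\<rho> (?a (?a (?c v))) = 0" "\<rho> (?a (?b (?c v))) = 0" "\<rho> (?b (?b (?c v))) = 0" for v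
    using r1[of "?a (?a v)"] r1[of "?a (?b v)"] r1[of "?b (?b v)"] by (simp_all add: \<rho> ac_simps)
  have r4: "\<rho> (?a (?a (?b (?c v)))) = \<rho> (?a (?a (?b v)))" "\<rho> (?a (?b (?b (?c v)))) = \<rho> (?a (?b (?b v)))" for v
    using r1[of "?a (?a (?b v))"] r1[of "?a (?b (?b v))"] f_eq by (simp_all add: \<rho> ac_simps)
  have r5: "\<rho> (?a (?a (?b (?b v)))) = \<rho> v + \<rho> (?a (?b v))" for v
    using arg_cong[OF R[of v], of "\<lambda>x. \<rho> (?a (?b v)) + x"] by (simp add: \<rho> r3 ac_simps)
  have r6: "\<rho> (?a (?b (?b (?b v)))) = \<rho> (?b (?b v))" for v
    using rb[of "?a v"] f_eq by (simp add: \<rho> r3 ac_simps)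
  \<comment> \<open>Each coordinate of \<open>E1\<close> is the \<open>u2\<close> coordinate after
    applying a combination of monomials; these combinations dictate the entries.\<close>
  define g where "g v = (\<rho> (?a (?a (?b v))), \<rho> v + \<rho> (?a (?b v)), \<rho> (?a (?b (?b v))) + \<rho> (?b v), \<rho> (?b (?b v)),
      \<rho> (?a (?a v)),
     \<rho> (?a v), \<rho> v, \<rho> (?a (?b (?b v))))" for v
  have "rhom Y (E1 n) g"
    by (rule rhomI) (simp_all add: g_def \<rho> r1 ra rb r2 r3 r4 r5 r6 \<rho>0 ac_simps)
  moreover have "g (\<iota> x) = f x" if x: "x \<in> carr X" for x
  proof -
    have \<rho>\<iota>: "\<rho> (\<iota> v) = tc (f v)" if v: "v \<in> carr X" for v
    proof -
      have "\<rho> (\<iota> v) = \<psi> (\<iota> (let w = gen X La (gen X Lb (gen X La (gen X Lb v))) in w + gen X Lc w))"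
        using v X(1) by (simp add: \<rho>_def Let_def rhomD[OF i(1)] del: rep_rels)
      also have "\<dots> = tc (let w = gen (E1 n) La (gen (E1 n) Lb (gen (E1 n) La (gen (E1 n) Lb (f v)))) in w + gen
          (E1 n) Lc w)"
        using v X(1) by (simp add: \<psi>_def l(3) Let_def rhomD[OF f] del: rep_rels)
      also have "\<dots> = tc (f v)"
        by (cases "f v" rule: oct_cases) (simp add: tc_def ac_simps)
      finally show ?thesis .
    qed
    have "g (\<iota> x) = (let E = E1 n; v = f x in (tc (gen E La (gen E La (gen E Lb v))), tc v + tc (gen E La (gen E Lb v)),
       tc (gen E La (gen E Lb (gen E Lb v))) + tc (gen E Lb v), tc (gen E Lb (gen E Lb v)),
       tc (gen E La (gen E La v)), tc (gen E La v), tc v, tc (gen E La (gen E Lb (gen E Lb v)))))"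
      using x X(1) by (simp add: g_def rhomD(4)[OF i(1), symmetric] \<rho>\<iota> Let_def rhomD(4)[OF f])
    also have "\<dots> = f x" by (cases "f x" rule: oct_cases) (simp add: tc_def ac_simps)
    finally show ?thesis .
  qed
  ultimately show ?thesis using that by blast
qed

lemma Pr_injective:
  assumes X: "is_rep X" "fdim (carr X) (scl X) N" and Y: "is_rep Y"
    and i: "rhom X Y \<iota>" "inj_on \<iota> (carr X)" and f: "rhom X (Pr m n) f"
  obtains g where "rhom Y (Pr m n) g" "\<And>x. x \<in> carr X \<Longrightarrow> g (\<iota> x) = f x"
proof -
  have p: "fst (gen (Pr m n) x v) = gen (E0 m) x (fst v)" "snd (gen (Pr m n) x v) = gen (E1 n) x (snd v)"
    "fst (scl (Pr m n) k v) = scl (E0 m) k (fst v)" "snd (scl (Pr m n) k v) = scl (E1 n) k (snd v)" for x k v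
    by (cases v; simp add: Pr_def)+
  have c: "fst (f v) \<in> carr (E0 m)" "snd (f v) \<in> carr (E1 n)" if "v \<in> carr X" for v
    using rhomD(1)[OF f that] by (auto simp: Pr_def mem_Times_iff simp del: E0_simps E1_simps)
  have f01: "rhom X (E0 m) (\<lambda>x. fst (f x))" "rhom X (E1 n) (\<lambda>x. snd (f x))"
    by (rule rhomI; simp add: c rhomD[OF f] p del: E0_simps E1_simps)+
  obtain g where "rhom Y (E0 m) g" "\<And>x. x \<in> carr X \<Longrightarrow> g (\<iota> x) = fst (f x)"
    by (rule E0_injective[OF X Y i f01(1)]) (rule that)
  moreover obtain h where "rhom Y (E1 n) h" "\<And>x. x \<in> carr X \<Longrightarrow> h (\<iota> x) = snd (f x)"
    by (rule E1_injective[OF X Y i f01(2)]) (rule that)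
  moreover have "rhom Y (Pr m n) (\<lambda>y. (g y, h y))"
    using calculation(1,3) unfolding Pr_def by (intro rhomI) (auto simp: rhomD simp del: E0_simps E1_simps)
  ultimately show ?thesis using that[of "\<lambda>y. (g y, h y)"] by simp
qed

end

section \<open>Embeddings between sums of copies of P_0 and P_1\<close>

lemma rhom_copair:
  assumes "rhom X Z f" "rhom Y Z g" "is_rep Z"
  shows "rhom (X \<times>\<^sub>r Y) Z (\<lambda>(x, y). f x + g y)"
  using rhomD[OF assms(1)] rhomD[OF assms(2)] assms(3) by (intro rhomI) (auto simp: ac_simps)

context char2
begin

text \<open>The action of an element of the algebra that maps the top of \<open>E0\<close> onto its socle and kills \<open>E1\<close>;
  \<open>th1\<close> does the same with the roles exchanged.\<close>

definition th0 :: "('k, 'v::plus) rep \<Rightarrow> 'v \<Rightarrow> 'v" where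
  "th0 X v = (let w = v + gen X Lc v; w' = w + gen X La (gen X Lb (gen X La (gen X Lb w)))
     in gen X La (gen X Lb w') + gen X La (gen X Lb (gen X La (gen X Lb w'))))"

definition th1 :: "('k, 'v::plus) rep \<Rightarrow> 'v \<Rightarrow> 'v" where
  "th1 X v = (let w = v + gen X Lc v; w' = gen X La (gen X Lb (gen X La (gen X Lb w)))
     in gen X La (gen X Lb w') + gen X La (gen X Lb (gen X La (gen X Lb w'))))"

lemma th_rhom:
  assumes "rhom X Y f" "is_rep X" "v \<in> carr X"
  shows "f (th0 X v) = th0 Y (f v)" "f (th1 X v) = th1 Y (f v)"
  using assms(2,3) by (simp_all add: th0_def th1_def Let_def rhomD[OF assms(1)] del: rep_rels rep_gen_add)

lemma th_E [simp]:
  "th0 (E0 n) (z, p1, p2, p3, q1, q2, q3, t :: nat \<Rightarrow> 'k) = (0, 0, 0, 0, 0, 0, 0, z)"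
  "th1 (E0 n) (z, p1, p2, p3, q1, q2, q3, t :: nat \<Rightarrow> 'k) = 0"
  "th0 (E1 n) (w1, w2, w3, y, y', u1, u2, u3 :: nat \<Rightarrow> 'k) = 0"
  "th1 (E1 n) (w1, w2, w3, y, y', u1, u2, u3 :: nat \<Rightarrow> 'k) = (0, 0, 0, 0, 0, 0, w2, 0)"
  by (simp_all add: th0_def th1_def Let_def zero_prod_def ac_simps del: rep_rels)

lemma th_rprod: "th0 (X \<times>\<^sub>r Y) (v, w) = (th0 X v, th0 Y w)" "th1 (X \<times>\<^sub>r Y) (v, w) = (th1 X v, th1 Y w)"
  by (simp_all add: th0_def th1_def Let_def)

definition map8 :: "('f \<Rightarrow> 'f) \<Rightarrow> 'f oct \<Rightarrow> 'f oct" where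
  "map8 A = (\<lambda>(x1, x2, x3, x4, x5, x6, x7, x8). (A x1, A x2, A x3, A x4, A x5, A x6, A x7, A x8))"

lemma rhom_map8:
  assumes "pen m n A"
  shows "rhom (E0 m) (E0 n :: ('k, _) rep) (map8 A)" "rhom (E1 m) (E1 n :: ('k, _) rep) (map8 A)"
  by (rule rhomI; auto simp: map8_def penD[OF assms])+

text \<open>The maps \<open>th0\<close> and \<open>th1\<close> commute with \<open>g\<close> and
  carry top coordinates to socle coordinates of the same kind, so \<open>g\<close> respects the two
  isotypic parts of the socle. On the V_1 part it is known from the coordinate \<open>u2\<close>
  alone: \<open>a\<close> and \<open>b\<close> move \<open>u2\<close> to \<open>u3\<close> and
  \<open>u1\<close>, so one and the same \<open>g1\<close> acts on all three.\<close>

lemma Pr_socle: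
  assumes g: "rhom (Pr d e) (Pr d' e') g" "inj_on g (carr (Pr d e))"
  obtains g0 g1 where "linon (kn d) fscale fscale g0" "inj_on g0 (kn d)" "g0 ` kn d \<subseteq> kn d'"
    "linon (kn e) fscale fscale g1" "inj_on g1 (kn e)" "g1 ` kn e \<subseteq> kn e'"
    "\<And>t u1 u2 u3. t \<in> kn d \<Longrightarrow> u1 \<in> kn e \<Longrightarrow> u2 \<in> kn e \<Longrightarrow> u3 \<in> kn e \<Longrightarrow>
      g ((0, 0, 0, 0, 0, 0, 0, t), (0, 0, 0, 0, 0, u1, u2, u3)) =
        ((0, 0, 0, 0, 0, 0, 0, g0 t), (0, 0, 0, 0, 0, g1 u1, g1 u2, g1 u3))"
proof -
  let ?s = "\<lambda>t. ((0, 0, 0, 0, 0, 0, 0, t), 0) :: (nat \<Rightarrow> 'k) oct \<times> (nat \<Rightarrow> 'k) oct"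
    and ?u = "\<lambda>u. (0, (0, 0, 0, 0, 0, 0, u, 0)) :: (nat \<Rightarrow> 'k) oct \<times> (nat \<Rightarrow> 'k) oct"
  define g0 where "g0 t = snd (snd (snd (snd (snd (snd (snd (fst (g (?s t)))))))))" for t
  define g1 where "g1 u = fst (snd (snd (snd (snd (snd (snd (snd (g (?u u)))))))))" for u
  note gD = rhomD[OF g(1)]
  have 0: "g (?s t) = ?s (g0 t)" "g0 t \<in> kn d'" if t: "t \<in> kn d" for t
  proof -
    let ?x = "((t, 0, 0, 0, 0, 0, 0, 0), 0)"
    have x: "?x \<in> carr (Pr d e)" using t by (simp add: Pr_def zero_prod_def)
    have "g (th0 (Pr d e) ?x) = th0 (Pr d' e') (g ?x)" by (rule th_rhom[OF g(1) is_rep_Pr x])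
    moreover have "th0 (Pr d e) ?x = ?s t" by (simp add: Pr_def th_rprod zero_prod_def)
    moreover obtain z p1 p2 p3 q1 q2 q3 t' w1 w2 w3 y y' u1 u2 u3 where
      gx: "g ?x = ((z, p1, p2, p3, q1, q2, q3, t'), (w1, w2, w3, y, y', u1, u2, u3))"
      by (metis oct_cases surj_pair)
    ultimately have "g (?s t) = ?s z" by (simp add: Pr_def th_rprod)
    moreover have "z \<in> kn d'" using gD(1)[OF x] unfolding gx by (simp add: Pr_def)
    ultimately show "g (?s t) = ?s (g0 t)" "g0 t \<in> kn d'" by (simp_all add: g0_def)
  qed
  have 1: "g (?u t) = ?u (g1 t)" "g1 t \<in> kn e'" if t: "t \<in> kn e" for t
  proof -
    let ?x = "(0, (0, t, 0, 0, 0, 0, 0, 0))"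
    have x: "?x \<in> carr (Pr d e)" using t by (simp add: Pr_def zero_prod_def)
    have "g (th1 (Pr d e) ?x) = th1 (Pr d' e') (g ?x)" by (rule th_rhom[OF g(1) is_rep_Pr x])
    moreover have "th1 (Pr d e) ?x = ?u t" by (simp add: Pr_def th_rprod zero_prod_def)
    moreover obtain z p1 p2 p3 q1 q2 q3 t' w1 w2 w3 y y' u1 u2 u3 where
      gx: "g ?x = ((z, p1, p2, p3, q1, q2, q3, t'), (w1, w2, w3, y, y', u1, u2, u3))"
      by (metis oct_cases surj_pair)
    ultimately have "g (?u t) = ?u w2" by (simp add: Pr_def th_rprod)
    moreover have "w2 \<in> kn e'" using gD(1)[OF x] unfolding gx by (simp add: Pr_def)
    ultimately show "g (?u t) = ?u (g1 t)" "g1 t \<in> kn e'" by (simp_all add: g1_def)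
  qed
  have s: "?s t \<in> carr (Pr d e)" if "t \<in> kn d" for t using that by (simp add: Pr_def zero_prod_def)
  have u: "?u t \<in> carr (Pr d e)" if "t \<in> kn e" for t using that by (simp add: Pr_def zero_prod_def)
  have ua: "g (0, (0, 0, 0, 0, 0, 0, 0, t)) = (0, (0, 0, 0, 0, 0, 0, 0, g1 t))" if t: "t \<in> kn e" for t
  proof -
    have "g (gen (Pr d e) La (?u t)) = gen (Pr d' e') La (?u (g1 t))" using gD(4)[OF u[OF t]] 1[OF t] by simp
    then show ?thesis by (simp add: Pr_def zero_prod_def)
  qed
  have ub: "g (0, (0, 0, 0, 0, 0, t, 0, 0)) = (0, (0, 0, 0, 0, 0, g1 t, 0, 0))" if t: "t \<in> kn e" for t
  proof -
    have "g (gen (Pr d e) Lb (?u t)) = gen (Pr d' e') Lb (?u (g1 t))" using gD(4)[OF u[OF t]] 1[OF t] by simp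
    then show ?thesis by (simp add: Pr_def zero_prod_def)
  qed
  have "linon (kn d) fscale fscale g0" unfolding linon_def
  proof (intro conjI ballI allI)
    fix x y :: "nat \<Rightarrow> 'k" assume xy: "x \<in> kn d" "y \<in> kn d"
    have "g (?s x + ?s y) = ?s (g0 x) + ?s (g0 y)" using gD(2)[OF s[OF xy(1)] s[OF xy(2)]] 0 xy by simp
    then show "g0 (x + y) = g0 x + g0 y" using 0[of "x + y"] xy by simp
  next
    fix k and x :: "nat \<Rightarrow> 'k" assume x: "x \<in> kn d"
    have "g (scl (Pr d e) k (?s x)) = scl (Pr d' e') k (?s (g0 x))" using gD(3)[OF s[OF x]] 0 x by simp
    then show "g0 (fscale k x) = fscale k (g0 x)" using 0[of "fscale k x"] x by (simp add: Pr_def zero_prod_def)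
  qed
  moreover have "inj_on g0 (kn d)"
  proof (rule inj_onI)
    fix x y :: "nat \<Rightarrow> 'k" assume xy: "x \<in> kn d" "y \<in> kn d" "g0 x = g0 y"
    then have "g (?s x) = g (?s y)" using 0 by simp
    then show "x = y" using inj_onD[OF g(2)] s xy by blast
  qed
  moreover have "g0 ` kn d \<subseteq> kn d'" using 0 by blast
  moreover have "linon (kn e) fscale fscale g1" unfolding linon_def
  proof (intro conjI ballI allI)
    fix x y :: "nat \<Rightarrow> 'k" assume xy: "x \<in> kn e" "y \<in> kn e"
    have "g (?u x + ?u y) = ?u (g1 x) + ?u (g1 y)" using gD(2)[OF u[OF xy(1)] u[OF xy(2)]] 1 xy by simp
    then show "g1 (x + y) = g1 x + g1 y" using 1[of "x + y"] xy by simp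
  next
    fix k and x :: "nat \<Rightarrow> 'k" assume x: "x \<in> kn e"
    have "g (scl (Pr d e) k (?u x)) = scl (Pr d' e') k (?u (g1 x))" using gD(3)[OF u[OF x]] 1 x by simp
    then show "g1 (fscale k x) = fscale k (g1 x)" using 1[of "fscale k x"] x by (simp add: Pr_def zero_prod_def)
  qed
  moreover have "inj_on g1 (kn e)"
  proof (rule inj_onI)
    fix x y :: "nat \<Rightarrow> 'k" assume xy: "x \<in> kn e" "y \<in> kn e" "g1 x = g1 y"
    then have "g (?u x) = g (?u y)" using 1 by simp
    then show "x = y" using inj_onD[OF g(2)] u xy by blast
  qed
  moreover have "g1 ` kn e \<subseteq> kn e'" using 1 by blast
  moreover have "g ((0, 0, 0, 0, 0, 0, 0, t), (0, 0, 0, 0, 0, u1, u2, u3)) =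
        ((0, 0, 0, 0, 0, 0, 0, g0 t), (0, 0, 0, 0, 0, g1 u1, g1 u2, g1 u3))"
    if tu: "t \<in> kn d" "u1 \<in> kn e" "u2 \<in> kn e" "u3 \<in> kn e" for t u1 u2 u3
  proof -
    have u': "(0, (0, 0, 0, 0, 0, u1, 0, 0)) \<in> carr (Pr d e)" "(0, (0, 0, 0, 0, 0, 0, 0, u3)) \<in> carr (Pr d e)"
      using tu by (simp_all add: Pr_def zero_prod_def)
    have "g ((?s t + ?u u2) + ((0, (0, 0, 0, 0, 0, u1, 0, 0)) + (0, (0, 0, 0, 0, 0, 0, 0, u3)))) =
        (?s (g0 t) + ?u (g1 u2)) + ((0, (0, 0, 0, 0, 0, g1 u1, 0, 0)) + (0, (0, 0, 0, 0, 0, 0, 0, g1 u3)))"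
      using tu u' s u by (simp only: gD(2) rep_closed[OF is_rep_Pr] 0 1 ua ub)
    then show ?thesis by (simp add: zero_prod_def)
  qed
  ultimately show ?thesis by (rule that)
qed

text \<open>This replaces a cancellation theorem. The linear maps \<open>g0\<close> and
  \<open>g1\<close> on the socle are completed to bijections, which defines a map on further copies
  of P_0 and P_1. Together with \<open>g\<close> it is injective on the socle, which is essential,
  hence injective, and it is bijective because the dimensions agree.\<close>

lemma Pr_complement:
  assumes g: "rhom (Pr d e) (Pr d' e') g" "inj_on g (carr (Pr d e))"
  obtains h where "d \<le> d'" "e \<le> e'" "rhom (Pr (d' - d) (e' - e)) (Pr d' e') h"
    "bij_betw (\<lambda>(x, y). g x + h y) (carr (Pr d e \<times>\<^sub>r Pr (d' - d) (e' - e))) (carr (Pr d' e'))"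
proof -
  obtain g0 g1 where g0: "linon (kn d) fscale fscale g0" "inj_on g0 (kn d)" "g0 ` kn d \<subseteq> kn d'"
    and g1: "linon (kn e) fscale fscale g1" "inj_on g1 (kn e)" "g1 ` kn e \<subseteq> kn e'"
    and gs: "\<And>t u1 u2 u3. t \<in> kn d \<Longrightarrow> u1 \<in> kn e \<Longrightarrow> u2 \<in> kn e \<Longrightarrow> u3 \<in> kn e \<Longrightarrow>
      g ((0, 0, 0, 0, 0, 0, 0, t), (0, 0, 0, 0, 0, u1, u2, u3)) =
        ((0, 0, 0, 0, 0, 0, 0, g0 t), (0, 0, 0, 0, 0, g1 u1, g1 u2, g1 u3))"
    by (rule Pr_socle[OF g]) (rule that; assumption)
  obtain G0 where G0: "d \<le> d'" "linon UNIV fscale fscale G0" "bij_betw G0 (kn d') (kn d')"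
    "\<And>x. x \<in> kn d \<Longrightarrow> G0 x = g0 x" by (rule kn_inj_extend[OF g0]) (rule that; assumption)
  obtain G1 where G1: "e \<le> e'" "linon UNIV fscale fscale G1" "bij_betw G1 (kn e') (kn e')"
    "\<And>x. x \<in> kn e \<Longrightarrow> G1 x = g1 x" by (rule kn_inj_extend[OF g1]) (rule that; assumption)
  have pj: "pen (n - m) n (join m 0)" if "m \<le> n" for m n
    using that by (auto simp: pen_def linon_def join_def kn_def fun_eq_iff fscale_def)
  have pG: "pen d' d' G0" "pen e' e' G1" using G0(2,3) G1(2,3) by (auto simp: pen_def bij_betw_def)
  have pc: "pen p r (\<lambda>x. A (B x))" if "pen p q B" "pen q r A" for p q r A and B :: "(nat \<Rightarrow> 'k) \<Rightarrow> (nat \<Rightarrow> 'k)"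
    using that unfolding pen_def linon_def by (simp add: image_subset_iff)
  \<comment> \<open>\<open>join d 0\<close> puts the new copies behind the first \<open>d\<close>
    coordinates, and \<open>G0\<close> carries this complement of \<open>kn d\<close> to a
    complement of the image of \<open>g0\<close>; a linear map applied to all eight coordinates
    alike is a homomorphism.\<close>
  define h where "h = map_prod (map8 (\<lambda>x. G0 (join d 0 x))) (map8 (\<lambda>x. G1 (join e 0 x)))"
  have h: "rhom (Pr (d' - d) (e' - e)) (Pr d' e') h"
    unfolding Pr_def h_def
    by (intro rhom_rprod rhom_map8 pc[OF pj pG(1)] pc[OF pj pG(2)] G0(1) G1(1))
  define H where "H = (\<lambda>(x, y). g x + h y)"
  have H: "rhom (Pr d e \<times>\<^sub>r Pr (d' - d) (e' - e)) (Pr d' e') H"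
    unfolding H_def by (rule rhom_copair[OF g(1) h is_rep_Pr])
  have "inj_on H (carr (Pr d e \<times>\<^sub>r Pr (d' - d) (e' - e)))"
  proof (rule ress_inj[OF H _ is_rep_Pr ress_rprod[OF is_rep_Pr is_rep_Pr ress_Pr ress_Pr]])
    fix x assume x: "x \<in> (soc0 d \<times> soc1 e) \<times> soc0 (d' - d) \<times> soc1 (e' - e)" and Hx: "H x = 0"
    then obtain t u1 u2 u3 t' u1' u2' u3' where xe: "x = (((0, 0, 0, 0, 0, 0, 0, t), (0, 0, 0, 0, 0, u1, u2, u3)),
        ((0, 0, 0, 0, 0, 0, 0, t'), (0, 0, 0, 0, 0, u1', u2', u3')))"
      and m: "t \<in> kn d" "u1 \<in> kn e" "u2 \<in> kn e" "u3 \<in> kn e" "t' \<in> kn (d' - d)" "u1' \<in> kn (e' - e)"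
        "u2' \<in> kn (e' - e)" "u3' \<in> kn (e' - e)"
      by (auto simp: soc0_def soc1_def)
    have z: "t = 0 \<and> t' = 0" if t: "t \<in> kn m" "t' \<in> kn (n - m)" "m \<le> n" and p: "pen n n G" "bij_betw G (kn n) (kn n)"
      and eq: "G t + G (join m 0 t') = 0" for t t' m n G
    proof -
      have k: "t \<in> kn n" "join m 0 t' \<in> kn n" using t kn_mono[of m n] join_simps(4)[of t' "n - m" m 0] by auto
      have "G (t + join m 0 t') = G 0" using eq penD[OF p(1)] by simp
      moreover have "t + join m 0 t' \<in> kn n" using k by simp
      ultimately have "t + join m 0 t' = 0"
        using inj_onD[OF bij_betw_imp_inj_on[OF p(2)], of "t + join m 0 t'" 0] by simp
      then have tj: "t = join m 0 t'" using f_eq by blast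
      then have "t = 0" using join_inv(1)[of 0 m t'] t(1) by simp
      moreover have "t' = 0" using join_inv(2)[of m 0 t'] tj calculation by (auto simp: fun_eq_iff)
      ultimately show ?thesis by simp
    qed
    have j0: "G0 (join d 0 0) = 0" "G1 (join e 0 0) = 0" using penD(3)[OF pG(1)] penD(3)[OF pG(2)] by (simp_all
        add: join_simps)
    have "G0 t + G0 (join d 0 t') = 0" "G1 u1 + G1 (join e 0 u1') = 0" "G1 u2 + G1 (join e 0 u2') = 0"
      "G1 u3 + G1 (join e 0 u3') = 0"
      using Hx unfolding xe H_def by (simp_all add: gs m h_def map8_def j0 G0(4) G1(4) zero_prod_def)
    then have "t = 0 \<and> t' = 0" "u1 = 0 \<and> u1' = 0" "u2 = 0 \<and> u2' = 0" "u3 = 0 \<and> u3' = 0"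
      using z[OF m(1,5) G0(1) pG(1) G0(3)] z[OF m(2,6) G1(1) pG(2) G1(3)]
        z[OF m(3,7) G1(1) pG(2) G1(3)] z[OF m(4,8) G1(1) pG(2) G1(3)] by simp_all
    then show "x = 0" by (simp add: xe zero_prod_def)
  qed simp
  then have "bij_betw H (carr (Pr d e \<times>\<^sub>r Pr (d' - d) (e' - e))) (carr (Pr d' e'))"
  proof (rule fdim_inj_bij[rotated 3])
    have "(8 * d + 8 * e) + (8 * (d' - d) + 8 * (e' - e)) = 8 * d' + 8 * e'" using G0(1) G1(1) by simp
    then show "fdim (carr (Pr d e \<times>\<^sub>r Pr (d' - d) (e' - e))) (scl (Pr d e \<times>\<^sub>r Pr (d' - d) (e' - e))) (8 * d' + 8 * e')"
      using fdim_prod[OF fdim_Pr fdim_Pr, of d e "d' - d" "e' - e"] by (simp add: rprod_def)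
    show "fdim (carr (Pr d' e')) (scl (Pr d' e')) (8 * d' + 8 * e')" by (rule fdim_Pr)
  qed (use rhomD[OF H] in auto)
  then show ?thesis using that[OF G0(1) G1(1) h] by (simp add: H_def)
qed

lemma riso_rprod_shuffle: "riso ((X \<times>\<^sub>r Y) \<times>\<^sub>r (Z \<times>\<^sub>r W)) ((X \<times>\<^sub>r Z) \<times>\<^sub>r (Y \<times>\<^sub>r W))"
  by (rule riso_byWitness[where f = "\<lambda>((x, y), (z, w)). ((x, z), (y, w))" and g = "\<lambda>((x, y), (z, w)). ((x, z),
      (y, w))"])
    (auto intro!: rhomI)

lemma riso_Pr_add: "riso (Pr a b \<times>\<^sub>r Pr c d) (Pr (a + c) (b + d))"
  unfolding Pr_def by (rule riso_trans[OF riso_rprod_shuffle riso_rprod[OF riso_E0_add riso_E1_add]])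

text \<open>By injectivity of \<open>Q\<close> the embedding of \<open>X\<close> extends to its hull
  J. Together with the given projective summand P of \<open>M\<close> it embeds J \<oplus> P into
  \<open>Q\<close>, since the socle of J lies in the image of \<open>X\<close>;
  \<open>Pr_complement\<close> supplies the rest R of \<open>Q\<close>. So \<open>M\<close> sits in
  \<open>Q\<close> as X \<oplus> P in J \<oplus> P \<oplus> R, with quotient Y \<oplus> R. The
  subtractions are exact by the inequalities in \<open>Pr_complement\<close>.\<close>

lemma cokernel_up_to_projectives:
  assumes reps: "is_rep M" "is_rep Q" "is_rep N" "is_rep X" "is_rep Y"
    and ses: "rses M Q N f p" and M: "riso (X \<times>\<^sub>r Pr m n) M" and Q: "riso Q (Pr m' n')"
    and X: "fdim (carr X) (scl X) k" and hull: "rses X (Pr m1 n1) Y \<iota> \<pi>"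
    and soc: "soc0 m1 \<times> soc1 n1 \<subseteq> \<iota> ` carr X"
  shows "riso N (Y \<times>\<^sub>r Pr (m' - (m1 + m)) (n' - (n1 + n)))"
proof -
  let ?P = "Pr m n" and ?J = "Pr m1 n1" and ?R = "Pr (m' - (m1 + m)) (n' - (n1 + n))"
  obtain a where a: "rhom (X \<times>\<^sub>r ?P) M a" "bij_betw a (carr (X \<times>\<^sub>r ?P)) (carr M)" using M by (auto simp: riso_def)
  obtain b where b: "rhom Q (Pr m' n') b" "bij_betw b (carr Q) (carr (Pr m' n'))" using Q by (auto simp: riso_def)
  have f: "rhom M Q f" "inj_on f (carr M)" using ses by (auto simp: rses_def)
  have i: "rhom X ?J \<iota>" "inj_on \<iota> (carr X)" and \<pi>: "rhom ?J Y \<pi>" "\<pi> ` carr ?J = carr Y"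
    and ker: "\<And>y. y \<in> carr ?J \<Longrightarrow> \<pi> y = 0 \<longleftrightarrow> y \<in> \<iota> ` carr X" using hull by (auto simp: rses_def)
  note i0 = rhom_zero[OF i(1) reps(4) is_rep_Pr] and \<pi>0 = rhom_zero[OF \<pi>(1) is_rep_Pr reps(5)]
  define F where "F x = b (f (a x))" for x
  have F: "rhom (X \<times>\<^sub>r ?P) (Pr m' n') F"
    unfolding F_def by (rule rhom_comp[OF rhom_comp[OF a(1) f(1)] b(1)])
  have Fi: "inj_on F (carr (X \<times>\<^sub>r ?P))"
  proof (rule inj_onI)
    fix x y assume xy: "x \<in> carr (X \<times>\<^sub>r ?P)" "y \<in> carr (X \<times>\<^sub>r ?P)" "F x = F y"
    note m = rhomD(1)[OF a(1) xy(1)] rhomD(1)[OF a(1) xy(2)]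
    have "f (a x) = f (a y)"
      using inj_onD[OF bij_betw_imp_inj_on[OF b(2)] xy(3)[unfolded F_def]] rhomD(1)[OF f(1)] m by blast
    then have "a x = a y" using inj_onD[OF f(2)] m by blast
    then show "x = y" using inj_onD[OF bij_betw_imp_inj_on[OF a(2)]] xy by blast
  qed
  have rX: "is_rep (X \<times>\<^sub>r ?P)" using reps by simp
  have FX: "rhom X (Pr m' n') (\<lambda>x. F (x, 0))"
  proof (rule rhom_comp[OF _ F])
    show "rhom X (X \<times>\<^sub>r ?P) (\<lambda>x. (x, 0))" by (rule rhomI) simp_all
  qed
  obtain g1 where g1: "rhom ?J (Pr m' n') g1" "\<And>x. x \<in> carr X \<Longrightarrow> g1 (\<iota> x) = F (x, 0)"
    by (rule Pr_injective[OF reps(4) X is_rep_Pr i FX]) (rule that; assumption)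
  have F0: "rhom ?P (Pr m' n') (\<lambda>x. F (0, x))"
  proof (rule rhom_comp[OF _ F])
    show "rhom ?P (X \<times>\<^sub>r ?P) (\<lambda>x. (0, x))" by (rule rhomI) (simp_all add: reps)
  qed
  define G where "G = (\<lambda>(j, q). g1 j + F (0, q))"
  have G: "rhom (?J \<times>\<^sub>r ?P) (Pr m' n') G"
    unfolding G_def by (rule rhom_copair[OF g1(1) F0 is_rep_Pr])
  have GF: "G (\<iota> x, q) = F (x, q)" if "x \<in> carr X" "q \<in> carr ?P" for x q
  proof -
    have "F (x, q) = F ((x, 0) + (0, q))" by simp
    also have "\<dots> = F (x, 0) + F (0, q)" using that reps by (intro rhomD(2)[OF F]) simp_all
    finally show ?thesis using that g1 by (simp add: G_def)
  qed
  have Gi: "inj_on G (carr (?J \<times>\<^sub>r ?P))"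
  proof (rule ress_inj[OF G _ is_rep_Pr ress_rprod[OF is_rep_Pr is_rep_Pr ress_Pr ress_self[OF is_rep_Pr]]])
    fix x assume "x \<in> (soc0 m1 \<times> soc1 n1) \<times> carr ?P" and Gx: "G x = 0"
    then obtain v q where vq: "v \<in> carr X" "q \<in> carr ?P" "x = (\<iota> v, q)" using soc by blast
    then have "F (v, q) = 0" using Gx GF by simp
    moreover have "(v, q) \<in> carr (X \<times>\<^sub>r ?P)" using vq by simp
    ultimately have "(v, q) = 0" using Fi unfolding rhom_inj_iff[OF F rX is_rep_Pr] by blast
    then show "x = 0" using vq i0 by (simp add: zero_prod_def)
  qed simp
  obtain e where e: "rhom (?J \<times>\<^sub>r ?P) (Pr (m1 + m) (n1 + n)) e"
    "bij_betw e (carr (?J \<times>\<^sub>r ?P)) (carr (Pr (m1 + m) (n1 + n)))" using riso_Pr_add[of m1 n1 m n] unfolding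
        riso_def by blast
  let ?e' = "the_inv_into (carr (?J \<times>\<^sub>r ?P)) e"
  have e': "rhom (Pr (m1 + m) (n1 + n)) (?J \<times>\<^sub>r ?P) ?e'" by (rule rhom_inv[OF e]) simp
  have e'b: "bij_betw ?e' (carr (Pr (m1 + m) (n1 + n))) (carr (?J \<times>\<^sub>r ?P))" by (rule bij_betw_the_inv_into[OF e(2)])
  have e'e: "?e' (e x) = x" if "x \<in> carr (?J \<times>\<^sub>r ?P)" for x
    using the_inv_into_f_f[OF bij_betw_imp_inj_on[OF e(2)] that] .
  have "inj_on (\<lambda>x. G (?e' x)) (carr (Pr (m1 + m) (n1 + n)))"
    using comp_inj_on[OF bij_betw_imp_inj_on[OF e'b], of G] Gi
    unfolding bij_betw_imp_surj_on[OF e'b] comp_def by blast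
  then obtain h where h: "rhom ?R (Pr m' n') h"
    "bij_betw (\<lambda>(x, y). G (?e' x) + h y) (carr (Pr (m1 + m) (n1 + n) \<times>\<^sub>r ?R)) (carr (Pr m' n'))"
    by (rule Pr_complement[OF rhom_comp[OF e' G]]) (rule that; assumption)
  define H where "H = (\<lambda>(x, y). G x + h y)"
  have H: "rhom ((?J \<times>\<^sub>r ?P) \<times>\<^sub>r ?R) (Pr m' n') H"
    unfolding H_def by (rule rhom_copair[OF G h(1) is_rep_Pr])
  have "bij_betw (map_prod e (\<lambda>x. x)) (carr ((?J \<times>\<^sub>r ?P) \<times>\<^sub>r ?R)) (carr (Pr (m1 + m) (n1 + n) \<times>\<^sub>r ?R))"
    unfolding rprod_simps(1)[of _ ?R] by (rule bij_betw_map_prod[OF e(2)]) (simp add: bij_betw_def)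
  then have "bij_betw ((\<lambda>(x, y). G (?e' x) + h y) \<circ> map_prod e (\<lambda>x. x)) (carr ((?J \<times>\<^sub>r ?P) \<times>\<^sub>r ?R)) (carr (Pr m' n'))"
    using h(2) by (rule bij_betw_trans)
  moreover have "((\<lambda>(x, y). G (?e' x) + h y) \<circ> map_prod e (\<lambda>x. x)) v = H v"
    if v: "v \<in> carr ((?J \<times>\<^sub>r ?P) \<times>\<^sub>r ?R)" for v
  proof -
    obtain x y where "v = (x, y)" "x \<in> carr (?J \<times>\<^sub>r ?P)"
      using v unfolding rprod_simps(1)[of _ ?R] by blast
    then show ?thesis using e'e[of x] unfolding H_def by simp
  qed
  ultimately have Hb: "bij_betw H (carr ((?J \<times>\<^sub>r ?P) \<times>\<^sub>r ?R)) (carr (Pr m' n'))"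
    using bij_betw_cong by blast
  let ?b' = "the_inv_into (carr Q) b"
  have b': "rhom (Pr m' n') Q ?b'" by (rule rhom_inv[OF b reps(2)])
  have b'b: "bij_betw ?b' (carr (Pr m' n')) (carr Q)" by (rule bij_betw_the_inv_into[OF b(2)])
  \<comment> \<open>The model to compare with: P cancels and R is untouched, so only the hull of
    \<open>X\<close> contributes to the quotient. The isomorphism \<open>H\<close> identifies it
    with the given sequence.\<close>
  have ses': "rses (X \<times>\<^sub>r ?P) ((?J \<times>\<^sub>r ?P) \<times>\<^sub>r ?R) (Y \<times>\<^sub>r ?R) (\<lambda>(x, q). ((\<iota> x, q), 0)) (\<lambda>((j, q), s). (\<pi> j, s))"
    unfolding rses_def
  proof (intro conjI ballI)
    show "rhom (X \<times>\<^sub>r ?P) ((?J \<times>\<^sub>r ?P) \<times>\<^sub>r ?R) (\<lambda>(x, q). ((\<iota> x, q), 0))"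
      using rhomD[OF i(1)] by (intro rhomI) auto
    show "rhom ((?J \<times>\<^sub>r ?P) \<times>\<^sub>r ?R) (Y \<times>\<^sub>r ?R) (\<lambda>((j, q), s). (\<pi> j, s))"
      using rhomD[OF \<pi>(1)] by (intro rhomI) auto
    show "inj_on (\<lambda>(x, q). ((\<iota> x, q), 0)) (carr (X \<times>\<^sub>r ?P))" using i(2) by (auto simp: inj_on_def)
    have "\<pi> ` carr ?J \<times> carr ?R \<subseteq> (\<lambda>((j, q), s). (\<pi> j, s)) ` ((carr ?J \<times> carr ?P) \<times> carr ?R)"
    proof clarify
      fix j s assume "j \<in> carr ?J" "s \<in> carr ?R"
      then show "(\<pi> j, s) \<in> (\<lambda>((j, q), s). (\<pi> j, s)) ` ((carr ?J \<times> carr ?P) \<times> carr ?R)"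
        by (intro image_eqI[of _ _ "((j, 0), s)"]) auto
    qed
    then show "(\<lambda>((j, q), s). (\<pi> j, s)) ` carr ((?J \<times>\<^sub>r ?P) \<times>\<^sub>r ?R) = carr (Y \<times>\<^sub>r ?R)"
      using \<pi>(2) by auto
    fix v assume v: "v \<in> carr ((?J \<times>\<^sub>r ?P) \<times>\<^sub>r ?R)"
    obtain j q s where e: "v = ((j, q), s)" by (metis surj_pair)
    show "(case v of (x, xa) \<Rightarrow> (case x of (j, q) \<Rightarrow> \<lambda>s. (\<pi> j, s)) xa) = 0 \<longleftrightarrow> v \<in> (\<lambda>(x, q). ((\<iota> x, q),
        0)) ` carr (X \<times>\<^sub>r ?P)"
      using v ker[of j] unfolding e by (auto simp: zero_prod_def)
  qed
  have "riso (Y \<times>\<^sub>r ?R) N"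
  proof (rule rses_unique[OF ses' ses a])
    show "rhom ((?J \<times>\<^sub>r ?P) \<times>\<^sub>r ?R) Q (\<lambda>x. ?b' (H x))" by (rule rhom_comp[OF H b'])
    show "bij_betw (\<lambda>x. ?b' (H x)) (carr ((?J \<times>\<^sub>r ?P) \<times>\<^sub>r ?R)) (carr Q)"
      using bij_betw_trans[OF Hb b'b] by (simp add: comp_def)
    fix x assume x: "x \<in> carr (X \<times>\<^sub>r ?P)"
    obtain v q where vq: "x = (v, q)" "v \<in> carr X" "q \<in> carr ?P" using x by auto
    have "H ((\<iota> v, q), 0) = F (v, q)"
      using GF[OF vq(2,3)] rhom_zero[OF h(1) is_rep_Pr is_rep_Pr] by (simp add: H_def)
    moreover have "?b' (F (v, q)) = f (a (v, q))"
      unfolding F_def using x vq(1) rhomD(1)[OF a(1)] rhomD(1)[OF f(1)]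
      by (intro the_inv_into_f_f[OF bij_betw_imp_inj_on[OF b(2)]]) blast
    ultimately show "?b' (H (case x of (x, q) \<Rightarrow> ((\<iota> x, q), 0))) = f (a x)" by (simp add: vq(1))
  qed (use reps in simp_all)
  then show ?thesis using riso_sym reps(5) is_rep_Pr is_rep_rprod by blast
qed

end

section \<open>Counting projective summands and the induction on s\<close>

lemma riso_cong_r: "riso X Y \<Longrightarrow> riso (Z \<times>\<^sub>r X) (Z \<times>\<^sub>r Y)"
  by (rule riso_rprod[OF riso_refl])

context char2
begin

lemma is_rep_sop [simp]: "is_rep (F1 r r (sop s0 s1) (sop t0 t1) :: ('k, _) rep)"
    "is_rep (F0 r r (sop s0 s1) (sop t0 t1) :: ('k, _) rep)"
  by (intro is_rep_F1 is_rep_F0 pen_sop)+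

lemma riso_TV1_rfun_E0: "riso (TV1 (rfun r (E0 n))) (E1 (3 * (r * n)) :: ('k, _) rep)"
proof -
  let ?N = "r * n"
  have "riso (TV1 (rfun r (E0 n))) (TV1 (E0 ?N) :: ('k, _) rep)"
    by (rule riso_TV1[OF riso_rfun_E0]) simp_all
  also have "riso (TV1 (E0 ?N)) (E1 ?N \<times>\<^sub>r E1 ?N \<times>\<^sub>r E1 ?N :: ('k, _) rep)" by (rule riso_TV1_E0)
  also have "riso (E1 ?N \<times>\<^sub>r E1 ?N \<times>\<^sub>r E1 ?N) (E1 ?N \<times>\<^sub>r E1 (?N + ?N) :: ('k, _) rep)"
    by (rule riso_cong_r[OF riso_E1_add])
  also have "riso (E1 ?N \<times>\<^sub>r E1 (?N + ?N)) (E1 (?N + (?N + ?N)) :: ('k, _) rep)" by (rule riso_E1_add)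
  finally have "riso (TV1 (rfun r (E0 n))) (E1 (?N + (?N + ?N)) :: ('k, _) rep)" .
  moreover have "?N + (?N + ?N) = 3 * ?N" by simp
  ultimately show ?thesis by (simp only:)
qed

lemma riso_TV1_rfun_E1: "riso (TV1 (rfun r (E1 n))) (Pr (r * n) (2 * (r * n)))"
proof -
  let ?N = "r * n"
  have "riso (TV1 (rfun r (E1 n))) (TV1 (E1 ?N) :: ('k, _) rep)"
    by (rule riso_TV1[OF riso_rfun_E1]) simp_all
  also have "riso (TV1 (E1 ?N)) (E0 ?N \<times>\<^sub>r E1 ?N \<times>\<^sub>r E1 ?N :: ('k, _) rep)" by (rule riso_TV1_E1)
  also have "riso (E0 ?N \<times>\<^sub>r E1 ?N \<times>\<^sub>r E1 ?N) (E0 ?N \<times>\<^sub>r E1 (?N + ?N) :: ('k, _) rep)"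
    by (rule riso_cong_r[OF riso_E1_add])
  finally show ?thesis by (simp add: Pr_def mult_2)
qed

lemma split_E0_Pr:
  assumes "riso T (rfun r (E0 n) \<times>\<^sub>r TV1 (rfun r (E0 n)) :: ('k, _) rep)"
  shows "riso T (Pr (r * n) (3 * (r * n)))"
  unfolding Pr_def by (rule riso_trans[OF assms riso_rprod[OF riso_rfun_E0 riso_TV1_rfun_E0]])

lemma split_E1_Pr:
  assumes "riso T (rfun r (E1 n) \<times>\<^sub>r TV1 (rfun r (E1 n)) :: ('k, _) rep)"
  shows "riso T (Pr (r * n) (3 * (r * n)))"
proof -
  let ?N = "r * n"
  note assms
  also have "riso (rfun r (E1 n) \<times>\<^sub>r TV1 (rfun r (E1 n))) (E1 ?N \<times>\<^sub>r Pr ?N (2 * ?N) :: ('k, _) rep)"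
    by (rule riso_rprod[OF riso_rfun_E1 riso_TV1_rfun_E1])
  also have "riso (E1 ?N \<times>\<^sub>r Pr ?N (2 * ?N)) (Pr ?N (2 * ?N) \<times>\<^sub>r E1 ?N)" by (rule riso_rprod_comm)
  also have "riso (Pr ?N (2 * ?N) \<times>\<^sub>r E1 ?N) (E0 ?N \<times>\<^sub>r (E1 (2 * ?N) \<times>\<^sub>r E1 ?N))"
    unfolding Pr_def by (rule riso_rprod_assoc)
  also have "riso (E0 ?N \<times>\<^sub>r (E1 (2 * ?N) \<times>\<^sub>r E1 ?N)) (E0 ?N \<times>\<^sub>r E1 (2 * ?N + ?N) :: ('k, _) rep)"
    by (rule riso_cong_r[OF riso_E1_add])
  finally have "riso T (E0 ?N \<times>\<^sub>r E1 (2 * ?N + ?N))" .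
  moreover have "2 * ?N + ?N = 3 * ?N" by simp
  ultimately show ?thesis by (simp only: Pr_def)
qed

text \<open>A copy of P_0 contributes P_0 + 3 P_1, a copy of P_1 contributes P_1 + (P_0 + 2 P_1), so
  all four middle terms are the same.\<close>

lemma riso_TF_E:
  "riso (TF1 r s0 s1 t0 t1 (E0 n)) (Pr (r * n) (3 * (r * n)))"
  "riso (TF1 r s0 s1 t0 t1 (E1 n)) (Pr (r * n) (3 * (r * n)))"
  "riso (TF0 r s0 s1 t0 t1 (E0 n)) (Pr (r * n) (3 * (r * n)))"
  "riso (TF0 r s0 s1 t0 t1 (E1 n)) (Pr (r * n) (3 * (r * n)))"
  by (rule split_E0_Pr[OF TF1_split[OF is_rep_E0 splitting_E0_a splitting_E0_b]]
      split_E1_Pr[OF TF1_split[OF is_rep_E1 splitting_E1_a splitting_E1_b]]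
      split_E0_Pr[OF TF0_split[OF is_rep_E0 splitting_E0_a splitting_E0_b]]
      split_E1_Pr[OF TF0_split[OF is_rep_E1 splitting_E1_a splitting_E1_b]])+

lemma rses_zero_left:
  assumes "rses X (E1 q :: ('k, _) rep) Z f p"
  shows "rses X (Pr 0 q) Z (\<lambda>x. (0, f x)) (\<lambda>(v, x). p x)"
proof -
  have c: "carr (Pr 0 q) = {0} \<times> carr (E1 q)" by (simp add: Pr_def zero_prod_def)
  have 1: "rhom X (E1 q) f" "inj_on f (carr X)" "rhom (E1 q) Z p" "p ` carr (E1 q) = carr Z"
    "\<And>y. y \<in> carr (E1 q) \<Longrightarrow> p y = 0 \<longleftrightarrow> y \<in> f ` carr X" using assms unfolding rses_def by blast+
  have "rhom (E1 q) (Pr 0 q) (\<lambda>x. (0, x))" "rhom (Pr 0 q) (E1 q) snd"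
    unfolding Pr_def by (rule rhomI; auto simp: zero_prod_def)+
  then have "rhom X (Pr 0 q) (\<lambda>x. (0, f x))" "rhom (Pr 0 q) Z (\<lambda>x. p (snd x))"
    using rhom_comp 1 by blast+
  moreover have "inj_on (\<lambda>x. (0 :: (nat \<Rightarrow> 'k) oct, f x)) (carr X)" using 1(2) by (auto simp: inj_on_def)
  moreover have "(\<lambda>x. p (snd x)) ` ({0} \<times> carr (E1 q)) = carr Z" using 1(4) by force
  moreover have "p (snd y) = 0 \<longleftrightarrow> y \<in> (\<lambda>x. (0, f x)) ` carr X" if "y \<in> {0} \<times> carr (E1 q)" for y
    using that 1(5)[of "snd y"] by (auto simp del: E1_simps)
  ultimately show ?thesis unfolding rses_def case_prod_beta c by blast
qed

lemma rses_zero_right: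
  assumes "rses X (E0 q :: ('k, _) rep) Z f p"
  shows "rses X (Pr q 0) Z (\<lambda>x. (f x, 0)) (\<lambda>(x, v). p x)"
proof -
  have c: "carr (Pr q 0) = carr (E0 q) \<times> {0}" by (simp add: Pr_def zero_prod_def)
  have 1: "rhom X (E0 q) f" "inj_on f (carr X)" "rhom (E0 q) Z p" "p ` carr (E0 q) = carr Z"
    "\<And>y. y \<in> carr (E0 q) \<Longrightarrow> p y = 0 \<longleftrightarrow> y \<in> f ` carr X" using assms unfolding rses_def by blast+
  have "rhom (E0 q) (Pr q 0) (\<lambda>x. (x, 0))" "rhom (Pr q 0) (E0 q) fst"
    unfolding Pr_def by (rule rhomI; auto simp: zero_prod_def)+
  then have "rhom X (Pr q 0) (\<lambda>x. (f x, 0))" "rhom (Pr q 0) Z (\<lambda>x. p (fst x))"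
    using rhom_comp 1 by blast+
  moreover have "inj_on (\<lambda>x. (f x, 0 :: (nat \<Rightarrow> 'k) oct)) (carr X)" using 1(2) by (auto simp: inj_on_def)
  moreover have "(\<lambda>x. p (fst x)) ` (carr (E0 q) \<times> {0}) = carr Z" using 1(4) by force
  moreover have "p (fst y) = 0 \<longleftrightarrow> y \<in> (\<lambda>x. (f x, 0)) ` carr X" if "y \<in> carr (E0 q) \<times> {0}" for y
    using that 1(5)[of "fst y"] by (auto simp del: E0_simps)
  ultimately show ?thesis unfolding rses_def case_prod_beta c by blast
qed

definition hull1 :: "_ \<Rightarrow> _ \<Rightarrow> (nat \<Rightarrow> 'k) \<times> (nat \<Rightarrow> 'k) \<times> (nat \<Rightarrow> 'k) \<times> (nat \<Rightarrow> 'k) \<Rightarrow> (nat \<Rightarrow> 'k) oct" where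
  "hull1 X Y = (\<lambda>(z, v1, v2, v3). (0, 0, 0, Y z, X z, v1, v2, v3))"

definition hull0 :: "_ \<Rightarrow> _ \<Rightarrow> (nat \<Rightarrow> 'k) \<times> (nat \<Rightarrow> 'k) \<times> (nat \<Rightarrow> 'k) \<times> (nat \<Rightarrow> 'k) \<Rightarrow> (nat \<Rightarrow> 'k) oct" where
  "hull0 X Y = (\<lambda>(z, w1, w2, w3). (0, Y w1, Y w2, Y w3, X w1, X w2, X w3, z))"

lemma soc_hull:
  "pen p q X \<Longrightarrow> pen p q Y \<Longrightarrow> soc1 q \<subseteq> hull1 X Y ` carr (F1 p q X Y)"
  "pen p q X \<Longrightarrow> pen p q Y \<Longrightarrow> soc0 q \<subseteq> hull0 X Y ` carr (F0 p q X Y)"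
proof -
  assume p: "pen p q X" "pen p q Y"
  show "soc1 q \<subseteq> hull1 X Y ` carr (F1 p q X Y)"
  proof
    fix x assume "x \<in> soc1 q"
    then show "x \<in> hull1 X Y ` carr (F1 p q X Y)"
      using penD(3)[OF p(1)] penD(3)[OF p(2)]
      by (intro image_eqI[of _ _ "(0, snd (snd (snd (snd (snd x)))))"]) (auto simp: hull1_def soc1_def)
  qed
  show "soc0 q \<subseteq> hull0 X Y ` carr (F0 p q X Y)"
  proof
    fix x assume "x \<in> soc0 q"
    then show "x \<in> hull0 X Y ` carr (F0 p q X Y)"
      using penD(3)[OF p(1)] penD(3)[OF p(2)]
      by (intro image_eqI[of _ _ "(snd (snd (snd (snd (snd (snd (snd x)))))),
          0)"]) (auto simp: hull0_def soc0_def zero_prod_def)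
  qed
qed

text \<open>A has socle V_1^r and thus hull P(0, r), B has socle V_0^r and hull P(r, 0). This
  accounts for the \<open>r\<close> in the subtracted numbers and for the exchange of A and
  B.\<close>

lemma cokernel_step:
  fixes M :: "('k, 'm::ab_group_add) rep" and Q :: "('k, 'q::ab_group_add) rep" and N :: "('k, 'n::ab_group_add) rep"
  assumes reps: "is_rep M" "is_rep Q" "is_rep N" and ses: "rses M Q N f p" and Q: "riso Q (Pr m' n')"
    and st: "s0 \<noteq> 0 \<or> t0 \<noteq> 0"
  shows "riso M (F1 r r (sop s0 s1) (sop t0 t1) \<times>\<^sub>r Pr m n) \<Longrightarrow>
      riso N (F0 r r (sop s0 s1) (sop t0 t1) \<times>\<^sub>r Pr (m' - m) (n' - (r + n)))"
    "riso M (F0 r r (sop s0 s1) (sop t0 t1) \<times>\<^sub>r Pr m n) \<Longrightarrow>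
      riso N (F1 r r (sop s0 s1) (sop t0 t1) \<times>\<^sub>r Pr (m' - (r + m)) (n' - n))"
proof -
  let ?S = "sop s0 s1" and ?T = "sop t0 t1"
  note k = kexact_sop[OF st, of r s1 t1]
  { assume "riso M (F1 r r ?S ?T \<times>\<^sub>r Pr m n)"
    then have M: "riso (F1 r r ?S ?T \<times>\<^sub>r Pr m n) M" by (rule riso_sym[OF reps(1)])
    have "soc0 0 \<times> soc1 r \<subseteq> (\<lambda>x. (0, hull1 ?S ?T x)) ` carr (F1 r r ?S ?T)"
      using soc_hull(1)[OF pen_sop pen_sop, of r s0 s1 t0 t1] by (auto simp: soc0_def zero_prod_def image_iff
          simp del: F1_simps)
    from cokernel_up_to_projectives[OF reps is_rep_sop ses M Q fdim_F1 rses_zero_left[OF rses_F1[OF k,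
        folded hull1_def]] this]
    show "riso N (F0 r r ?S ?T \<times>\<^sub>r Pr (m' - m) (n' - (r + n)))" by simp }
  { assume "riso M (F0 r r ?S ?T \<times>\<^sub>r Pr m n)"
    then have M: "riso (F0 r r ?S ?T \<times>\<^sub>r Pr m n) M" by (rule riso_sym[OF reps(1)])
    have "soc0 r \<times> soc1 0 \<subseteq> (\<lambda>x. (hull0 ?S ?T x, 0)) ` carr (F0 r r ?S ?T)"
      using soc_hull(2)[OF pen_sop pen_sop, of r s0 s1 t0 t1] by (auto simp: soc1_def zero_prod_def image_iff
          simp del: F0_simps)
    from cokernel_up_to_projectives[OF reps is_rep_sop(2,1) ses M Q fdim_F0 rses_zero_right[OF rses_F0[OF k,
        folded hull0_def]] this]
    show "riso N (F1 r r ?S ?T \<times>\<^sub>r Pr (m' - (r + m)) (n' - n))" by simp }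
qed

text \<open>The explicit s-th cosyzygy of V_i. For s = 0 the upper layer is \<open>kn 0\<close>, so
  that only a single V_0 or V_1 is left; the type of the socle alternates with
  \<open>s\<close>.\<close>

definition Wr :: "nat \<Rightarrow> nat \<Rightarrow> ('k, _) rep" where
  "Wr i s = (if even (i + s) then F0 s (Suc s) (\<lambda>f. f) shiftr else F1 s (Suc s) (\<lambda>f. f) shiftr)"

lemma is_rep_Wr [simp]: "is_rep (Wr i s)"
  using kexact_shift[of s] by (simp add: Wr_def kexact_def is_rep_F0 is_rep_F1)

lemma riso_Wr_0: "riso (Wr 0 0) (V0r :: ('k, _) rep)" "riso (Wr 1 0) (V1r :: ('k, _) rep)"
proof -
  have k: "f i = 0" if "f \<in> kn (Suc 0)" "i \<noteq> 0" for f :: "nat \<Rightarrow> 'k" and i using that by (auto simp: kn_def)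
  have e: "(\<lambda>i. if i = 0 then f 0 else 0) = f" if "f \<in> kn (Suc 0)" for f :: "nat \<Rightarrow> 'k" using k[OF that] by auto
  show "riso (Wr 0 0) (V0r :: ('k, _) rep)"
    unfolding Wr_def
    by (rule riso_byWitness[where f = "\<lambda>(z, v1, v2, v3). z 0" and g = "\<lambda>x. (\<lambda>i. if i = 0 then x else 0, 0, 0, 0)"])
      (auto intro!: rhomI simp: fscale_def e shiftr_def kn_def[of "Suc 0"] fun_eq_iff[of _ 0] split: nat.split)
  show "riso (Wr 1 0) (V1r :: ('k, _) rep)"
    unfolding Wr_def
    by (rule riso_byWitness[where f = "\<lambda>(z, v1, v2, v3). (v1 0, v2 0, v3 0)" and
        g = "\<lambda>(x, y, z). (0, \<lambda>i. if i = 0 then x else 0, \<lambda>i. if i = 0 then y else 0, \<lambda>i. if i = 0 then z else 0)"])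
      (auto intro!: rhomI simp: fscale_def e shiftr_def kn_def[of "Suc 0"])
qed

lemma riso_Pr_0: "is_rep X \<Longrightarrow> riso X (X \<times>\<^sub>r Pr 0 0)"
  by (rule riso_byWitness[where f = "\<lambda>x. (x, 0)" and g = fst])
    (auto intro!: rhomI simp: Pr_def zero_prod_def)

text \<open>Tensoring the sequence of \<open>Wr i s\<close>, its hull and
  \<open>Wr i (Suc s)\<close> with A or B gives a projective middle term, and
  \<open>cokernel_step\<close> turns the decomposition of the left end into one of the right end.
  All four claims have to be carried along because the parity of s + i flips at each step.\<close>

theorem TF_Wr:
  fixes r i s :: nat and s0 s1 t0 t1 :: 'k
  defines "A \<equiv> F1 r r (sop s0 s1) (sop t0 t1)" and "B \<equiv> F0 r r (sop s0 s1) (sop t0 t1)"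
  assumes st: "s0 \<noteq> 0 \<or> t0 \<noteq> 0" and i: "i \<in> {0, 1}"
  shows "(even (s + i) \<longrightarrow> riso (TF1 r s0 s1 t0 t1 (Wr i s)) (A \<times>\<^sub>r Pr 0 (2 * r * s))) \<and>
    (odd (s + i) \<longrightarrow> riso (TF1 r s0 s1 t0 t1 (Wr i s)) (B \<times>\<^sub>r Pr (r * s) (r * (s + 1)))) \<and>
    (even (s + i) \<longrightarrow> riso (TF0 r s0 s1 t0 t1 (Wr i s)) (B \<times>\<^sub>r Pr (r * s) (r * s))) \<and>
    (odd (s + i) \<longrightarrow> riso (TF0 r s0 s1 t0 t1 (Wr i s)) (A \<times>\<^sub>r Pr 0 (r * (2 * s + 1))))"
proof (induction s)
  case 0
  show ?case
  proof (cases "i = 0")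
    case True
    have "riso (TF1 r s0 s1 t0 t1 (Wr 0 0)) A" "riso (TF0 r s0 s1 t0 t1 (Wr 0 0)) B"
      unfolding A_def B_def
      by (rule riso_trans[OF riso_TF1[OF riso_Wr_0(1)] riso_TF1_V0] riso_trans[OF riso_TF0[OF riso_Wr_0(1)]
          riso_TF0_V0]; simp)+
    moreover have "riso A (A \<times>\<^sub>r Pr 0 0)" "riso B (B \<times>\<^sub>r Pr 0 0)" unfolding A_def B_def by (simp_all add: riso_Pr_0)
    ultimately show ?thesis using True riso_trans by fastforce
  next
    case False
    then have i1: "i = 1" using i by simp
    have E: "riso (X \<times>\<^sub>r E1 r) (X \<times>\<^sub>r Pr 0 r)" for X :: "('k, (nat \<Rightarrow> 'k) \<times> (nat \<Rightarrow> 'k) \<times> (nat \<Rightarrow> 'k) \<times> (nat \<Rightarrow> 'k)) rep"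
    proof (rule riso_cong_r, rule riso_byWitness[where f = "\<lambda>x. (0, x)" and g = snd])
      show "rhom (E1 r) (Pr 0 r) (\<lambda>x. (0, x))" unfolding Pr_def by (rule rhomI) (auto simp: zero_prod_def)
    qed (auto simp: Pr_def zero_prod_def)
    have "riso (TF1 r s0 s1 t0 t1 (Wr 1 0)) (B \<times>\<^sub>r E1 r)" "riso (TF0 r s0 s1 t0 t1 (Wr 1 0)) (A \<times>\<^sub>r E1 r)"
      unfolding A_def B_def
      by (rule riso_trans[OF riso_TF1[OF riso_Wr_0(2)] riso_TF1_V1] riso_trans[OF riso_TF0[OF riso_Wr_0(2)]
          riso_TF0_V1]; simp)+
    then have "riso (TF1 r s0 s1 t0 t1 (Wr 1 0)) (B \<times>\<^sub>r Pr 0 r)" "riso (TF0 r s0 s1 t0 t1 (Wr 1 0)) (A \<times>\<^sub>r Pr 0 r)"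
      using riso_trans[OF _ E] by blast+
    then show ?thesis unfolding i1 by simp
  qed
next
  case (Suc s)
  let ?P = "Pr (r * Suc s) (3 * (r * Suc s))"
  \<comment> \<open>The hull has \<open>Suc s\<close> copies, of P_0 or P_1 according to the socle
    of \<open>Wr i s\<close>.\<close>
  obtain f p where j: "rses (Wr i s) (if even (s + i) then E0 (Suc s) else E1 (Suc s)) (Wr i (Suc s)) f p"
    using rses_F0[OF kexact_shift, of s] rses_F1[OF kexact_shift, of s]
    by (cases "even (s + i)") (auto simp: Wr_def add.commute)
  let ?E = "if even (s + i) then E0 (Suc s) else E1 (Suc s) :: ('k, _) rep"
  have E: "is_rep ?E" by simp
  have T: "riso (TF1 r s0 s1 t0 t1 ?E) ?P" "riso (TF0 r s0 s1 t0 t1 ?E) ?P"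
    by (cases "even (s + i)"; simp only: if_True if_False riso_TF_E)+
  note s1 = cokernel_step[OF _ _ _ rses_TF1[OF j is_rep_Wr E is_rep_Wr] T(1) st, of r]
  note s2 = cokernel_step[OF _ _ _ rses_TF0[OF j is_rep_Wr E is_rep_Wr] T(2) st, of r]
  \<comment> \<open>What is left of P(r(s+1), 3r(s+1)) after removing the earlier summands and a
    further \<open>r\<close> copies of P_1 for A or of P_0 for B.\<close>
  have n: "r * Suc s - 0 = r * Suc s" "3 * (r * Suc s) - (r + 2 * r * s) = r * (Suc s + 1)"
    "r * Suc s - (r + r * s) = 0" "3 * (r * Suc s) - r * (s + 1) = 2 * r * Suc s"
    "3 * (r * Suc s) - r * s = r * (2 * Suc s + 1)"
    "3 * (r * Suc s) - (r + r * (2 * s + 1)) = r * Suc s"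
    by (simp_all add: algebra_simps)
  show ?case
  proof (cases "even (s + i)")
    case True
    then have h: "riso (TF1 r s0 s1 t0 t1 (Wr i s)) (A \<times>\<^sub>r Pr 0 (2 * r * s))"
      "riso (TF0 r s0 s1 t0 t1 (Wr i s)) (B \<times>\<^sub>r Pr (r * s) (r * s))" using Suc by blast+
    have "riso (TF1 r s0 s1 t0 t1 (Wr i (Suc s))) (B \<times>\<^sub>r Pr (r * Suc s) (r * (Suc s + 1)))"
      "riso (TF0 r s0 s1 t0 t1 (Wr i (Suc s))) (A \<times>\<^sub>r Pr 0 (r * (2 * Suc s + 1)))"
      unfolding A_def B_def
      by (rule s1(1)[OF is_rep_TF1[OF is_rep_Wr] is_rep_TF1[OF E] is_rep_TF1[OF is_rep_Wr] h(1)[unfolded A_def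
          B_def], unfolded n],
          rule s2(2)[OF is_rep_TF0[OF is_rep_Wr] is_rep_TF0[OF E] is_rep_TF0[OF is_rep_Wr] h(2)[unfolded A_def
              B_def], unfolded n])
    then show ?thesis using True by simp
  next
    case False
    then have h: "riso (TF1 r s0 s1 t0 t1 (Wr i s)) (B \<times>\<^sub>r Pr (r * s) (r * (s + 1)))"
      "riso (TF0 r s0 s1 t0 t1 (Wr i s)) (A \<times>\<^sub>r Pr 0 (r * (2 * s + 1)))" using Suc by blast+
    have "riso (TF1 r s0 s1 t0 t1 (Wr i (Suc s))) (A \<times>\<^sub>r Pr 0 (2 * r * Suc s))"
      "riso (TF0 r s0 s1 t0 t1 (Wr i (Suc s))) (B \<times>\<^sub>r Pr (r * Suc s) (r * Suc s))"
      unfolding A_def B_def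
      by (rule s1(2)[OF is_rep_TF1[OF is_rep_Wr] is_rep_TF1[OF E] is_rep_TF1[OF is_rep_Wr] h(1)[unfolded A_def
          B_def], unfolded n],
          rule s2(1)[OF is_rep_TF0[OF is_rep_Wr] is_rep_TF0[OF E] is_rep_TF0[OF is_rep_Wr] h(2)[unfolded A_def
              B_def], unfolded n])
    then show ?thesis using False by simp
  qed
qed

section \<open>Lifting properties and endomorphisms of P_0 and P_1\<close>

lemma E0_lift:
  assumes Y: "is_rep (Y :: ('k, 'v::ab_group_add) rep)" and p: "rhom Y V0r p" "p ` carr Y = UNIV"
  obtains h where "rhom (E0 1) Y h" "\<And>x. x \<in> carr (E0 1) \<Longrightarrow> p (h x) = fst x 0"
proof -
  note [simp] = rep_self[OF Y] rep_self2[OF Y] Y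
  obtain v0 where v0: "v0 \<in> carr Y" "p v0 = 1" using p(2) by (metis UNIV_I imageE)
  let ?a = "gen Y La" and ?b = "gen Y Lb" and ?c = "gen Y Lc"
  \<comment> \<open>Multiplication by (1 + baba)(1 + c) makes an arbitrary preimage of 1 satisfy the
    relations \<open>n1\<close> to \<open>n3\<close> of the top vector of \<open>E0\<close>. It acts
    as the identity on V_0, so the image stays 1.\<close>
  define v where "v = (let w = v0 + ?c v0 in w + ?b (?a (?b (?a w))))"
  have v: "v \<in> carr Y" using v0 by (simp add: v_def Let_def)
  have pv: "p v = 1" using v0 by (simp add: v_def Let_def rhomD[OF p(1)] del: rep_rels rep_gen_add)
  have n1: "?c v = 0" by (simp add: v_def Let_def ac_simps)
  have n2: "?a (?a (?b v)) = 0" by (simp add: v_def Let_def ac_simps)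
  have n3: "?a (?b (?b v)) = ?b v" by (simp add: v_def Let_def ac_simps)
  have n4: "?a (?b (?b (?b v))) = ?b (?b v)" using arg_cong[OF n3, of ?b] by (simp add: n1)
  have n5: "?a (?a (?a (?b v))) = 0" using arg_cong[OF n2, of ?a] by simp
  \<comment> \<open>The eight monomials are those that produce the coordinate vectors of
    \<open>E0\<close> from its top vector.\<close>
  define h :: "(nat \<Rightarrow> 'k) oct \<Rightarrow> 'v" where "h = (\<lambda>(z, p1, p2, p3, q1, q2, q3,
      t). scl Y (z 0) v + (scl Y (p1 0) (?a v) + (scl Y (p2 0) (?a (?a v)) +
     (scl Y (p3 0) (?a (?a (?a v))) + (scl Y (q1 0) (?b (?b (?b v))) + (scl Y (q2 0) (?b (?b v)) +
     (scl Y (q3 0) (?b v) + scl Y (t 0) (?a (?b v)))))))))"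
  have "rhom (E0 1) Y h"
    by (rule rhomI) (auto simp: h_def v n1 n2 n3 n4 n5 fscale_def ac_simps)
  moreover have "p (h x) = fst x 0" for x
    by (cases x rule: oct_cases) (simp add: h_def rhomD[OF p(1)] v pv)
  ultimately show ?thesis using that by blast
qed

lemma E1_lift:
  assumes Y: "is_rep (Y :: ('k, 'v::ab_group_add) rep)" and p: "rhom Y V1r p" "p ` carr Y = UNIV"
  obtains h where "rhom (E1 1) Y h" "\<And>x. x \<in> carr (E1 1) \<Longrightarrow> p (h x) = (fst x 0, fst (snd x) 0, fst (snd (snd x)) 0)"
proof -
  note [simp] = rep_self[OF Y] rep_self2[OF Y] Y
  obtain v0 where v0: "v0 \<in> carr Y" "p v0 = (0, 1, 0)" using p(2) by (metis UNIV_I imageE)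
  let ?a = "gen Y La" and ?b = "gen Y Lb" and ?c = "gen Y Lc"
  \<comment> \<open>The middle vector of V_1 has weight 0 and is fixed by baba, so baba (1 + c)
    preserves the image of \<open>v0\<close>, while it forces the relations \<open>n1\<close> to
    \<open>n4\<close> that hold for the vector at \<open>w2\<close> in \<open>E1\<close>.\<close>
  define v where "v = (let w = v0 + ?c v0 in ?b (?a (?b (?a w))))"
  have v: "v \<in> carr Y" using v0 by (simp add: v_def Let_def)
  have pv: "p v = (0, 1, 0)" using v0 by (simp add: v_def Let_def rhomD[OF p(1)] del: rep_rels rep_gen_add)
  have n1: "?c v = 0" by (simp add: v_def Let_def ac_simps)
  have n2: "?a (?a (?a v)) = 0" by (simp add: v_def Let_def ac_simps)
  have n3: "?b (?b (?b v)) = 0" by (simp add: v_def Let_def ac_simps)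
  have n4: "?a (?a (?b (?b v))) = v + ?a (?b v)" by (simp add: v_def Let_def ac_simps)
  have n5: "?a (?a (?a (?b v))) = ?a (?a v)" by (simp add: v_def Let_def ac_simps)
  \<comment> \<open>Coordinate vectors of \<open>E1\<close> in terms of the one at
    \<open>w2\<close>: there \<open>b\<close> gives w1 + u1 and \<open>ab\<close> gives w2 + u2,
    whence the sums in the entries for \<open>w1\<close>, \<open>u2\<close> and
    \<open>u3\<close>.\<close>
  define h :: "(nat \<Rightarrow> 'k) oct \<Rightarrow> 'v" where "h = (\<lambda>(w1, w2, w3, y, y', u1, u2,
      u3). scl Y (w1 0) (?a (?b (?b v)) + ?b v) + (scl Y (w2 0) v +
     (scl Y (w3 0) (?a v) + (scl Y (y 0) (?a (?a v)) + (scl Y (y' 0) (?b (?b v)) + (scl Y (u1 0) (?a (?b (?b v))) +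
     (scl Y (u2 0) (v + ?a (?b v)) + scl Y (u3 0) (?a v + ?a (?a (?b v))))))))))"
  have "rhom (E1 1) Y h"
    by (rule rhomI) (auto simp: h_def v n1 n2 n3 n4 n5 fscale_def ac_simps)
  moreover have "p (h x) = (fst x 0, fst (snd x) 0, fst (snd (snd x)) 0)" for x
    by (cases x rule: oct_cases) (simp add: h_def rhomD[OF p(1)] v pv)
  ultimately show ?thesis using that by blast
qed

text \<open>\<open>th0\<close> carries the top coordinate to the socle and commutes with
  \<open>k\<close>. As \<open>k\<close> preserves the top coordinate, it is injective on the socle,
  hence everywhere.\<close>

lemma E0_endo_inj:
  assumes k: "rhom (E0 1) (E0 1 :: ('k, _) rep) k" and p: "\<And>x. x \<in> carr (E0 1) \<Longrightarrow> fst (k x) 0 = fst x 0"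
  shows "inj_on k (carr (E0 1 :: ('k, _) rep))"
proof (rule ress_inj[OF k is_rep_E0 is_rep_E0 ress_E0])
  fix x :: "(nat \<Rightarrow> 'k) oct" assume "x \<in> soc0 1" and kx: "k x = 0"
  then obtain t where t: "x = (0, 0, 0, 0, 0, 0, 0, t)" "t \<in> kn 1" by (auto simp: soc0_def)
  let ?e = "(t, 0, 0, 0, 0, 0, 0, 0)"
  have e: "?e \<in> carr (E0 1)" using t by simp
  have "k (th0 (E0 1) ?e) = th0 (E0 1) (k ?e)" by (rule th_rhom[OF k is_rep_E0 e])
  then have "th0 (E0 1) (k ?e) = 0" using kx t by simp
  then have "fst (k ?e) = 0" by (cases "k ?e" rule: oct_cases) (simp add: zero_prod_def)
  then have "t 0 = 0" using p[OF e] by simp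
  then have "t i = 0" for i using t(2) by (cases i) (auto simp: kn_def)
  then have "t = 0" by (simp add: fun_eq_iff)
  then show "x = 0" using t by (simp add: zero_prod_def)
qed

text \<open>\<open>th1\<close> relates only \<open>w2\<close> and \<open>u2\<close>; the other two
  socle coordinates are reached by moving them to the place of \<open>u2\<close> inside the
  kernel.\<close>

lemma E1_endo_inj:
  assumes k: "rhom (E1 1) (E1 1 :: ('k, _) rep) k"
    and p: "\<And>x. x \<in> carr (E1 1) \<Longrightarrow> fst (snd (k x)) 0 = fst (snd x) 0"
  shows "inj_on k (carr (E1 1 :: ('k, _) rep))"
proof (rule ress_inj[OF k is_rep_E1 is_rep_E1 ress_E1])
  fix x :: "(nat \<Rightarrow> 'k) oct" assume "x \<in> soc1 1" and kx: "k x = 0"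
  then obtain u1 u2 u3 where t: "x = (0, 0, 0, 0, 0, u1, u2, u3)" "u1 \<in> kn 1" "u2 \<in> kn 1" "u3 \<in> kn 1"
    by (auto simp: soc1_def)
  have z: "t = 0" if tk: "t \<in> kn 1" and k0: "k (0, 0, 0, 0, 0, 0, t, 0) = 0" for t
  proof -
    let ?e = "(0, t, 0, 0, 0, 0, 0, 0)"
    have e: "?e \<in> carr (E1 1)" using tk by simp
    have "k (th1 (E1 1) ?e) = th1 (E1 1) (k ?e)" by (rule th_rhom[OF k is_rep_E1 e])
    then have "th1 (E1 1) (k ?e) = 0" using k0 by simp
    then have "fst (snd (k ?e)) = 0" by (cases "k ?e" rule: oct_cases) (simp add: zero_prod_def)
    then have "t 0 = 0" using p[OF e] by simp
    then have "t i = 0" for i using tk by (cases i) (auto simp: kn_def)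
    then show ?thesis by (simp add: fun_eq_iff)
  qed
  have g: "k (gen (E1 1) l v) = 0" if "v \<in> carr (E1 1)" "k v = 0" for v l
    using rhomD(4)[OF k that(1)] that(2) by simp
  have x: "x \<in> carr (E1 1)" using t by simp
  note xa = g[OF x kx, of La] and xb = g[OF x kx, of Lb]
  \<comment> \<open>On the socle baa leaves just \<open>u1\<close>, placed at \<open>u2\<close>;
    below, abb does the same for \<open>u3\<close>.\<close>
  have a: "u1 = 0" using z[of u1] g[OF x kx, of La] g[OF _ g[OF x kx, of La], of La]
    g[OF _ g[OF _ g[OF x kx, of La], of La], of Lb] t by (simp add: zero_prod_def)
  have b: "u3 = 0" using z[of u3] g[OF _ g[OF x kx, of Lb], of Lb]
    g[OF _ g[OF _ g[OF x kx, of Lb], of Lb], of La] t by (simp add: zero_prod_def)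
  then show "x = 0" using a z[of u2] kx t by (simp add: zero_prod_def)
qed

end

section \<open>Modules over u(m) as representations\<close>

lemma pm_induct:
  assumes "\<And>w k. P (Poly_Mapping.single w k)" "\<And>p q. P p \<Longrightarrow> P q \<Longrightarrow> P (p + q)"
  shows "P (p :: 'w \<Rightarrow>\<^sub>0 'k::comm_monoid_add)"
proof -
  have "P (\<Sum>w\<in>A. Poly_Mapping.single w (Poly_Mapping.lookup p w))" if "finite A" for A
    using that
  proof (induction A)
    case empty
    then show ?case using assms(1)[of undefined 0] by simp
  qed (simp add: assms)
  moreover have "p = (\<Sum>w\<in>Poly_Mapping.keys p. Poly_Mapping.single w (Poly_Mapping.lookup p w))"
    by (rule poly_mapping_eqI) (simp add: lookup_sum lookup_single when_def in_keys_iff)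
  ultimately show ?thesis by (metis finite_keys)
qed

text \<open>Entries of \<open>v\<close> beyond the columns are ignored and the result is 0 beyond
  the rows, so a matrix acts linearly on the whole type, and the relations hold there as
  \<open>is_rep\<close> demands.\<close>

definition app :: "'k::field mat \<Rightarrow> (nat \<Rightarrow> 'k) \<Rightarrow> nat \<Rightarrow> 'k" where
  "app A v = (\<lambda>i. if i < dim_row A then \<Sum>j<dim_col A. A $$ (i, j) * v j else 0)"

lemma app_kn: "A \<in> carrier_mat n m \<Longrightarrow> app A v \<in> kn n"
  by (auto simp: app_def kn_def)

lemma app_add: "app A (v + w) = app A v + app A w"
  by (auto simp: app_def fun_eq_iff algebra_simps sum.distrib)

lemma app_scale: "app A (fscale k v) = fscale k (app A v)"
  by (auto simp: app_def fun_eq_iff fscale_def sum_distrib_left algebra_simps intro!: sum.cong)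

lemma app_mat_add: "A \<in> carrier_mat n m \<Longrightarrow> B \<in> carrier_mat n m \<Longrightarrow> app (A + B) v = app A v + app B v"
  by (auto simp: app_def fun_eq_iff algebra_simps sum.distrib)

lemma app_mult:
  assumes "A \<in> carrier_mat n m" "B \<in> carrier_mat m l"
  shows "app (A * B) v = app A (app B v)"
proof
  fix i
  show "app (A * B) v i = app A (app B v) i"
  proof (cases "i < n")
    case True
    have "app (A * B) v i = (\<Sum>j<l. (\<Sum>k<m. A $$ (i, k) * B $$ (k, j)) * v j)"
      using assms True by (simp add: app_def scalar_prod_def lessThan_atLeast0)
    also have "\<dots> = (\<Sum>k<m. A $$ (i, k) * (\<Sum>j<l. B $$ (k, j) * v j))"
      unfolding sum_distrib_left sum_distrib_right by (subst sum.swap) (simp add: mult.assoc)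
    also have "\<dots> = app A (app B v) i" using assms True by (simp add: app_def)
    finally show ?thesis .
  qed (use assms in \<open>simp add: app_def\<close>)
qed

lemma app_one: "app (1\<^sub>m n) v = trunc n v"
proof
  fix i
  have "(\<Sum>j<n. 1\<^sub>m n $$ (i, j) * v j) = (\<Sum>j<n. if j = i then v j else 0)" if "i < n"
    using that by (intro sum.cong) auto
  then show "app (1\<^sub>m n) v i = trunc n v i" by (auto simp: app_def trunc_def sum.delta)
qed

lemma app_zero: "app (0\<^sub>m n m) v = 0"
  by (auto simp: app_def)

lemma app_unitf: "A \<in> carrier_mat n m \<Longrightarrow> j < m \<Longrightarrow> i < n \<Longrightarrow> app A (unitf j) i = A $$ (i, j)"
proof -
  assume a: "A \<in> carrier_mat n m" "j < m" "i < n"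
  have "(\<Sum>l<m. A $$ (i, l) * unitf j l) = (\<Sum>l<m. if l = j then A $$ (i, l) else 0)"
    by (rule sum.cong) (auto simp: unitf_def)
  then show ?thesis using a by (simp add: app_def sum.delta)
qed

lemma app_inject:
  assumes "A \<in> carrier_mat n m" "B \<in> carrier_mat n m" "\<And>v. v \<in> kn m \<Longrightarrow> app A v = app B v"
  shows "A = B"
proof (rule eq_matI)
  fix i j assume "i < dim_row B" "j < dim_col B"
  then have ij: "i < n" "j < m" using assms(2) by auto
  then have "app A (unitf j) i = app B (unitf j) i" using assms(3)[of "unitf j"] by simp
  then show "A $$ (i, j) = B $$ (i, j)" using app_unitf[OF _ ij(2,1)] assms(1,2) by metis
qed (use assms in auto)

definition mat_of :: "nat \<Rightarrow> nat \<Rightarrow> ((nat \<Rightarrow> 'k) \<Rightarrow> nat \<Rightarrow> 'k) \<Rightarrow> 'k::field mat" where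
  "mat_of n m f = mat n m (\<lambda>(i, j). f (unitf j) i)"

lemma mat_of_carrier [simp]: "mat_of n m f \<in> carrier_mat n m"
  by (simp add: mat_of_def)

lemma app_mat_of:
  assumes "linon (kn m) fscale fscale f" "f ` kn m \<subseteq> kn n" "v \<in> kn m"
  shows "app (mat_of n m f) v = f v"
proof
  fix i
  have "f v = f (\<Sum>j<m. fscale (v j) (unitf j))" using kn_expand[OF assms(3)] by simp
  also have "\<dots> = (\<Sum>j<m. fscale (v j) (f (unitf j)))"
    by (rule linon_sum[OF fs.vector_space_axioms fs.vector_space_axioms assms(1) kn_subspace]) auto
  finally have "f v i = (\<Sum>j<m. v j * f (unitf j) i)" by (simp add: sum_apply fscale_def)
  moreover have "f v \<in> kn n" using assms(2,3) by blast
  then have "f v i = 0" if "\<not> i < n" using that by (simp add: kn_def)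
  ultimately show "app (mat_of n m f) v i = f v i" by (auto simp: app_def mat_of_def mult.commute)
qed

lemma lin_ext_carrier [simp]: "lin_ext n F p \<in> carrier_mat n n"
  by (simp add: lin_ext_def)

lemma lin_ext_superset:
  assumes "finite S" "Poly_Mapping.keys p \<subseteq> S" "i < n" "j < n"
  shows "lin_ext n F p $$ (i, j) = (\<Sum>w\<in>S. Poly_Mapping.lookup p w * F w $$ (i, j))"
proof -
  have "(\<Sum>w\<in>Poly_Mapping.keys p. Poly_Mapping.lookup p w * F w $$ (i,
      j)) = (\<Sum>w\<in>S. Poly_Mapping.lookup p w * F w $$ (i, j))"
    by (rule sum.mono_neutral_left) (use assms in \<open>auto simp: in_keys_iff\<close>)
  then show ?thesis using assms by (simp add: lin_ext_def)
qed

lemma lin_ext_add: "lin_ext n F (p + q) = lin_ext n F p + lin_ext n F q"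
proof (rule eq_matI)
  fix i j assume "i < dim_row (lin_ext n F p + lin_ext n F q)" "j < dim_col (lin_ext n F p + lin_ext n F q)"
  then have ij: "i < n" "j < n" by (auto simp: lin_ext_def)
  let ?S = "Poly_Mapping.keys p \<union> Poly_Mapping.keys q"
  have "Poly_Mapping.keys (p + q) \<subseteq> ?S" by (rule Poly_Mapping.keys_add)
  then show "lin_ext n F (p + q) $$ (i, j) = (lin_ext n F p + lin_ext n F q) $$ (i, j)"
    using ij lin_ext_superset[of ?S "p + q"] lin_ext_superset[of ?S p] lin_ext_superset[of ?S q]
    by (simp add: lookup_add algebra_simps sum.distrib lin_ext_carrier[THEN carrier_matD(1)]
        lin_ext_carrier[THEN carrier_matD(2)])
qed (auto simp: lin_ext_def)

lemma lin_ext_single: "F w \<in> carrier_mat n n \<Longrightarrow> lin_ext n F (Poly_Mapping.single w k) = k \<cdot>\<^sub>m F w"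
  by (rule eq_matI) (auto simp: lin_ext_superset[of "{w}"] lin_ext_def[THEN arg_cong[of _ _ dim_row]]
      lin_ext_def[THEN arg_cong[of _ _ dim_col]])

lemma lin_ext_mult:
  fixes F :: "'w::monoid_add \<Rightarrow> 'k::field mat"
  assumes F: "\<And>w. F w \<in> carrier_mat n n" "\<And>u v. F (u + v) = F u * F v"
  shows "lin_ext n F (p * q) = lin_ext n F p * lin_ext n F q"
proof (induction p rule: pm_induct)
  case (1 u k)
  show ?case
  proof (induction q rule: pm_induct)
    case (1 v l)
    have "(k \<cdot>\<^sub>m F u) * (l \<cdot>\<^sub>m F v) = (k * l) \<cdot>\<^sub>m (F u * F v)"
      by (rule eq_matI) (use F(1)[of u] F(1)[of v] in \<open>auto simp: scalar_prod_def sum_distrib_left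
          algebra_simps intro!: sum.cong\<close>)
    then show ?case by (simp add: mult_single lin_ext_single[where F = F, OF F(1)] F(2))
  next
    case (2 p q)
    then show ?case
      by (simp add: distrib_left lin_ext_add mult_add_distrib_mat[OF lin_ext_carrier lin_ext_carrier lin_ext_carrier])
  qed
next
  case (2 p p')
  then show ?case
    by (simp add: distrib_right lin_ext_add add_mult_distrib_mat[OF lin_ext_carrier lin_ext_carrier lin_ext_carrier])
qed

lemma lin_ext_sum:
  assumes "finite A" "i < n" "j < n"
  shows "lin_ext n F (\<Sum>a\<in>A. p a) $$ (i, j) = (\<Sum>a\<in>A. lin_ext n F (p a) $$ (i, j))"
  using assms(1)
proof (induction A)
  case empty
  then show ?case using assms by (simp add: lin_ext_def)
next
  case (insert a A)
  then show ?case using assms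
    by (simp add: lin_ext_add lin_ext_carrier[THEN carrier_matD(1)] lin_ext_carrier[THEN carrier_matD(2)])
qed

section \<open>Modules and homomorphisms in terms of the generators\<close>

definition um_gen :: "letter \<Rightarrow> 'k::field um" where
  "um_gen x = um_word (Word [x])"

definition gact :: "'k::field umod \<Rightarrow> letter \<Rightarrow> 'k mat" where
  "gact M x = uact M (um_gen x)"

lemma um_word_Cons: "um_word (Word (x # ls)) = um_gen x * (um_word (Word ls) :: 'k::field um)"
  by (simp add: um_word_def um_gen_def times_um.abs_eq mult_single plus_word_def)

lemma um_word_Nil: "um_word (Word []) = (1 :: 'k::field um)"
  by (simp add: um_word_def one_um.abs_eq one_poly_mapping.abs_eq zero_word_def[symmetric] single_one[symmetric])

lemma abs_rep_um [simp]: "abs_um (rep_um h) = h"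
  by (rule Quotient3_abs_rep[OF Quotient3_um])

lemma um_induct:
  assumes "\<And>k. P (um_scalar k)" "\<And>x. P (um_gen x)" "\<And>g h. P g \<Longrightarrow> P h \<Longrightarrow> P (g + h)"
    "\<And>g h. P g \<Longrightarrow> P h \<Longrightarrow> P (g * h)"
  shows "P (h :: 'k::field um)"
proof -
  have one: "P 1" using assms(1)[of 1] by (simp add: um_scalar_def one_um.abs_eq single_one)
  have w: "P (um_word (Word ls))" for ls
    by (induction ls) (simp_all add: um_word_Cons um_word_Nil one assms)
  have "P (abs_um p)" for p
  proof (induction p rule: pm_induct)
    case (1 w k)
    obtain ls where "w = Word ls" by (cases w)
    moreover have "abs_um (Poly_Mapping.single w k) = um_scalar k * um_word w"
      by (simp add: um_scalar_def um_word_def times_um.abs_eq mult_single)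
    ultimately show ?case using assms(1,4) w by simp
  next
    case (2 p q)
    then show ?case using assms(3) by (simp add: plus_um.abs_eq[symmetric])
  qed
  from this[of "rep_um h"] show ?thesis by simp
qed

definition wev :: "nat \<Rightarrow> (letter \<Rightarrow> 'k::field mat) \<Rightarrow> word \<Rightarrow> 'k mat" where
  "wev n D w = foldr (\<lambda>x X. D x * X) (letters w) (1\<^sub>m n)"

lemma wev_simps: "wev n D (Word []) = 1\<^sub>m n" "wev n D (Word (x # ls)) = D x * wev n D (Word ls)"
  by (simp_all add: wev_def)

lemma wev_carrier:
  assumes "\<And>x. D x \<in> carrier_mat n n"
  shows "wev n D w \<in> carrier_mat n n"
proof (cases w)
  case (Word ls)
  have "wev n D (Word ls) \<in> carrier_mat n n"
    by (induction ls) (simp_all add: wev_simps assms mult_carrier_mat[OF assms])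
  then show ?thesis using Word by simp
qed

lemma wev_add:
  assumes D: "\<And>x. D x \<in> carrier_mat n n"
  shows "wev n D (u + v) = wev n D u * wev n D v"
proof (cases u; cases v)
  fix ls ms assume uv: "u = Word ls" "v = Word ms"
  have "wev n D (Word (ls @ ms)) = wev n D (Word ls) * wev n D (Word ms)"
    by (induction ls) (simp_all add: wev_simps left_mult_one_mat[OF wev_carrier[OF D]]
        assoc_mult_mat[OF D wev_carrier[OF D] wev_carrier[OF D]])
  then show ?thesis using uv by (simp add: plus_word_def)
qed

lemma um_module_gact: "um_module M \<Longrightarrow> gact M x \<in> carrier_mat (udim M) (udim M)"
  by (simp add: um_module_def gact_def)

lemma um_moduleD:
  assumes "um_module M"
  shows "uact M h \<in> carrier_mat (udim M) (udim M)" "uact M 1 = 1\<^sub>m (udim M)"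
    "uact M (h * h') = uact M h * uact M h'" "uact M (h + h') = uact M h + uact M h'"
    "uact M (um_scalar k) = k \<cdot>\<^sub>m 1\<^sub>m (udim M)"
  using assms unfolding um_module_def by blast+

text \<open>The elements with which \<open>f\<close> is compatible include the scalars and are
  closed under sums and products, so the three generators suffice.\<close>

lemma umod_homI:
  assumes M: "um_module M" and N: "um_module N" and f: "f \<in> carrier_mat (udim N) (udim M)"
    and g: "\<And>x. f * gact M x = gact N x * f"
  shows "f \<in> umod_hom M N"
proof -
  note MD = um_moduleD[OF M] and ND = um_moduleD[OF N]
  have "f * uact M h = uact N h * f" for h
  proof (induction h rule: um_induct)
    case (1 k)
    show ?case using f by (auto simp: MD(5) ND(5) mult_smult_distrib mult_smult_assoc_mat)
  next
    case (2 x)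
    show ?case using g by (simp add: gact_def)
  next
    case (3 g h)
    then show ?case by (simp add: MD(4) ND(4) mult_add_distrib_mat[OF f MD(1) MD(1)] add_mult_distrib_mat[OF
        ND(1) ND(1) f])
  next
    case (4 g h)
    have "f * (uact M g * uact M h) = (f * uact M g) * uact M h"
      by (rule assoc_mult_mat[OF f MD(1) MD(1), symmetric])
    also have "\<dots> = uact N g * (f * uact M h)" unfolding 4(1) by (rule assoc_mult_mat[OF ND(1) f MD(1)])
    also have "\<dots> = (uact N g * uact N h) * f" unfolding 4(2) by (rule assoc_mult_mat[OF ND(1) ND(1) f, symmetric])
    finally show ?case by (simp add: MD(3) ND(3))
  qed
  then show ?thesis using f by (simp add: umod_hom_def)
qed

lemma umod_homD:
  assumes "f \<in> umod_hom M N"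
  shows "f \<in> carrier_mat (udim N) (udim M)" "f * gact M x = gact N x * f"
  using assms by (auto simp: umod_hom_def gact_def)

definition urep :: "'k::field umod \<Rightarrow> ('k, nat \<Rightarrow> 'k) rep" where
  "urep M = \<lparr>carr = kn (udim M), scl = fscale, gen = (\<lambda>x. app (gact M x))\<rparr>"

lemma urep_simps [simp]: "carr (urep M) = kn (udim M)" "scl (urep M) = fscale" "gen (urep M) x = app (gact M x)"
  by (simp_all add: urep_def)

lemma fdim_urep: "fdim (carr (urep M)) (scl (urep M)) (udim M)"
  by (simp add: fdim_kn)

lemma rhom_app:
  assumes M: "um_module M" and N: "um_module N" and f: "f \<in> umod_hom M N"
  shows "rhom (urep M) (urep N) (app f)"
proof -
  note fD = umod_homD[OF f]
  show ?thesis
    by (rule rhomI; simp add: app_kn[OF fD(1)] app_add app_scale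
        app_mult[OF fD(1) um_module_gact[OF M], symmetric] app_mult[OF um_module_gact[OF N] fD(1), symmetric] fD(2))
qed

lemma app_rhom:
  fixes M N :: "'k::field umod"
  assumes f: "rhom (urep M) (urep N) f" and M: "um_module M" and N: "um_module N"
  defines "F \<equiv> mat_of (udim N) (udim M) f"
  shows "F \<in> umod_hom M N" "\<And>v. v \<in> kn (udim M) \<Longrightarrow> app F v = f v"
proof -
  note fD = rhomD[OF f, simplified]
  show a: "app F v = f v" if "v \<in> kn (udim M)" for v
    unfolding F_def using fD(1) by (intro app_mat_of[OF fD(5) _ that]) auto
  have F: "F \<in> carrier_mat (udim N) (udim M)" by (simp add: F_def)
  show "F \<in> umod_hom M N"
  proof (rule umod_homI[OF M N F])
    fix x
    note g = um_module_gact[OF M, of x] um_module_gact[OF N, of x]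
    show "F * gact M x = gact N x * F"
    proof (rule app_inject)
      fix v :: "nat \<Rightarrow> 'k" assume v: "v \<in> kn (udim M)"
      show "app (F * gact M x) v = app (gact N x * F) v"
        using v fD(4)[OF v] app_kn[OF g(1)] by (simp add: app_mult[OF F g(1)] app_mult[OF g(2) F] a)
    qed (use F g in auto)
  qed
qed

lemma umod_iso_riso:
  fixes M N :: "'k::field umod"
  assumes "riso (urep M) (urep N)" and M: "um_module M" "is_rep (urep M)" and N: "um_module N"
  shows "M \<cong>\<^sub>u N"
proof -
  obtain f where f: "rhom (urep M) (urep N) f" "bij_betw f (kn (udim M)) (kn (udim N))"
    using assms(1) by (auto simp: riso_def)
  let ?g = "the_inv_into (kn (udim M)) f"
  have g: "rhom (urep N) (urep M) ?g" using rhom_inv[OF f(1)] f(2) M(2) by simp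
  note i = bij_betw_imp_inj_on[OF f(2)]
  let ?F = "mat_of (udim N) (udim M) f" and ?G = "mat_of (udim M) (udim N) ?g"
  note F = app_rhom[OF f(1) M(1) N] and G = app_rhom[OF g N M(1)]
  note Fc = umod_homD(1)[OF F(1)] and Gc = umod_homD(1)[OF G(1)]
  have "?G * ?F = 1\<^sub>m (udim M)"
  proof (rule app_inject[of _ "udim M" "udim M"])
    fix v :: "nat \<Rightarrow> 'k" assume v: "v \<in> kn (udim M)"
    show "app (?G * ?F) v = app (1\<^sub>m (udim M)) v"
      using v rhomD(1)[OF f(1)] the_inv_into_f_f[OF i v] by (simp add: app_mult[OF Gc Fc] app_one F(2) G(2))
  qed (rule mult_carrier_mat[OF Gc Fc] one_carrier_mat)+
  moreover have "?F * ?G = 1\<^sub>m (udim N)"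
  proof (rule app_inject[of _ "udim N" "udim N"])
    fix v :: "nat \<Rightarrow> 'k" assume v: "v \<in> kn (udim N)"
    show "app (?F * ?G) v = app (1\<^sub>m (udim N)) v"
      using v rhomD(1)[OF g] f_the_inv_into_f_bij_betw[OF f(2)] by (simp add: app_mult[OF Fc Gc] app_one F(2) G(2))
  qed (rule mult_carrier_mat[OF Fc Gc] one_carrier_mat)+
  ultimately show ?thesis unfolding umod_iso_def using F(1) G(1) by blast
qed

section \<open>Modules given by three matrices\<close>

definition um_of :: "nat \<Rightarrow> (letter \<Rightarrow> 'k::field mat) \<Rightarrow> 'k umod" where
  "um_of n D = \<lparr>udim = n, uact = (\<lambda>h. lin_ext n (wev n D) (rep_um h))\<rparr>"

lemma udim_um_of [simp]: "udim (um_of n D) = n"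
  by (simp add: um_of_def)

context char2
begin

definition mrel :: "nat \<Rightarrow> (letter \<Rightarrow> 'k mat) \<Rightarrow> bool" where
  "mrel n D \<longleftrightarrow> (\<forall>x. D x \<in> carrier_mat n n) \<and> D Lb * D La = D La * D Lb + D Lc \<and>
     D Lc * D La = D La * D Lc + D La \<and> D Lc * D Lb = D Lb * D Lc + D Lb \<and> D Lc * D Lc = D Lc \<and>
     D La * (D La * (D La * D La)) = 0\<^sub>m n n \<and> D Lb * (D Lb * (D Lb * D Lb)) = 0\<^sub>m n n"

lemma free_minus: "(p :: 'k free) - q = p + q" "- (p :: 'k free) = p"
  by (rule poly_mapping_eqI; simp add: lookup_minus lookup_add)+

text \<open>Evaluation of words at the matrices is multiplicative, so only the six relators matter.
  They are tested on vectors, where the matrix relations become rewriting rules.\<close>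

lemma lin_ext_wev_ideal:
  assumes D: "mrel n D" and p: "p \<in> two_sided_ideal (relators :: 'k free set)"
  shows "lin_ext n (wev n D) p = 0\<^sub>m n n"
proof -
  let ?E = "\<lambda>p. lin_ext n (wev n D) p"
  have c: "D x \<in> carrier_mat n n" for x using D by (simp add: mrel_def)
  have m: "?E (p * q) = ?E p * ?E q" for p q by (rule lin_ext_mult[OF wev_carrier[OF c] wev_add[OF c]])
  have a: "app (?E (p * q)) v = app (?E p) (app (?E q) v)" for p q v
    unfolding m by (rule app_mult[OF lin_ext_carrier lin_ext_carrier])
  have s: "app (?E (p + q)) v = app (?E p) v + app (?E q) v" for p q v
    unfolding lin_ext_add by (rule app_mat_add[OF lin_ext_carrier lin_ext_carrier])
  have g: "?E (fgen x) = D x" for x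
    using c[of x] by (simp add: fgen_def lin_ext_single[where F = "wev n D",
        OF wev_carrier[OF c]]) (auto simp: wev_simps)
  have D': "app (D Lb) (app (D La) v) = app (D La) (app (D Lb) v) + app (D Lc) v"
    "app (D Lc) (app (D La) v) = app (D La) (app (D Lc) v) + app (D La) v"
    "app (D Lc) (app (D Lb) v) = app (D Lb) (app (D Lc) v) + app (D Lb) v"
    "app (D Lc) (app (D Lc) v) = app (D Lc) v"
    "app (D La) (app (D La) (app (D La) (app (D La) v))) = 0"
    "app (D Lb) (app (D Lb) (app (D Lb) (app (D Lb) v))) = 0" for v
  proof -
    note r = D[unfolded mrel_def]
    show "app (D Lb) (app (D La) v) = app (D La) (app (D Lb) v) + app (D Lc) v"
      using r by (simp add: app_mult[OF c c, symmetric] app_mat_add[OF mult_carrier_mat[OF c c] c])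
    show "app (D Lc) (app (D La) v) = app (D La) (app (D Lc) v) + app (D La) v"
      using r by (simp add: app_mult[OF c c, symmetric] app_mat_add[OF mult_carrier_mat[OF c c] c])
    show "app (D Lc) (app (D Lb) v) = app (D Lb) (app (D Lc) v) + app (D Lb) v"
      using r by (simp add: app_mult[OF c c, symmetric] app_mat_add[OF mult_carrier_mat[OF c c] c])
    show "app (D Lc) (app (D Lc) v) = app (D Lc) v"
      using r by (simp add: app_mult[OF c c, symmetric])
    have "app (D La) (app (D La) (app (D La) (app (D La) v))) = app (D La * (D La * (D La * D La))) v"
      by (simp add: app_mult[OF c c] app_mult[OF c mult_carrier_mat[OF c c]] app_mult[OF c mult_carrier_mat[OF
          c mult_carrier_mat[OF c c]]])
    then show "app (D La) (app (D La) (app (D La) (app (D La) v))) = 0" using r by (simp add: app_zero)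
    have "app (D Lb) (app (D Lb) (app (D Lb) (app (D Lb) v))) = app (D Lb * (D Lb * (D Lb * D Lb))) v"
      by (simp add: app_mult[OF c c] app_mult[OF c mult_carrier_mat[OF c c]] app_mult[OF c mult_carrier_mat[OF
          c mult_carrier_mat[OF c c]]])
    then show "app (D Lb) (app (D Lb) (app (D Lb) (app (D Lb) v))) = 0" using r by (simp add: app_zero)
  qed
  have rel: "app (?E r) v = 0" if "r \<in> relators" for r v
    using that D' by (auto simp: relators_def Let_def free_minus numeral_eq_Suc a s g ac_simps app_one trunc_def)
  have "app (?E p) v = 0" for v
    using p
  proof (induction arbitrary: v rule: two_sided_ideal.induct)
    case zero
    then show ?case by (auto simp: app_def lin_ext_def)
  next
    case (gen r p q)
    have "app (?E p) 0 = 0" by (auto simp: app_def)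
    then show ?case by (simp add: a rel[OF gen])
  next
    case (add p q)
    then show ?case by (simp add: s)
  qed
  then show ?thesis by (intro app_inject[of _ n n]) (auto simp: app_zero)
qed

text \<open>\<open>rep_um\<close> returns some representative; it differs from \<open>p\<close> by
  an element of the ideal, which evaluates to 0.\<close>

lemma lin_ext_wev_abs:
  assumes D: "mrel n D"
  shows "lin_ext n (wev n D) (rep_um (abs_um p)) = lin_ext n (wev n D) p"
proof -
  let ?E = "\<lambda>p. lin_ext n (wev n D) p"
  have "um_rel (rep_um (abs_um p)) p" using um.abs_eq_iff[of "rep_um (abs_um p)" p] by simp
  then have "?E (rep_um (abs_um p) + p) = 0\<^sub>m n n"
    using lin_ext_wev_ideal[OF D] by (simp add: um_rel_def free_minus)
  then have "?E (rep_um (abs_um p)) + ?E p = 0\<^sub>m n n" by (simp add: lin_ext_add)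
  then have "app (?E (rep_um (abs_um p))) v + app (?E p) v = 0" for v
    using app_mat_add[OF lin_ext_carrier lin_ext_carrier] app_zero by metis
  then show ?thesis using f_eq by (intro app_inject[of _ n n]) auto
qed

lemma um_of_module:
  assumes D: "mrel n D"
  shows "um_module (um_of n D)" "gact (um_of n D) x = D x"
proof -
  let ?E = "\<lambda>p. lin_ext n (wev n D) p"
  have c: "D x \<in> carrier_mat n n" for x using D by (simp add: mrel_def)
  have u: "uact (um_of n D) (abs_um p) = ?E p" for p by (simp add: um_of_def lin_ext_wev_abs[OF D])
  have m: "?E (p * q) = ?E p * ?E q" for p q by (rule lin_ext_mult[OF wev_carrier[OF c] wev_add[OF c]])
  have z: "?E (Poly_Mapping.single 0 k) = k \<cdot>\<^sub>m 1\<^sub>m n" for k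
    by (simp add: lin_ext_single[where F = "wev n D", OF wev_carrier[OF c]]) (simp add: zero_word_def wev_simps)
  show "um_module (um_of n D)"
    unfolding um_module_def
  proof (intro conjI allI)
    show "uact (um_of n D) h \<in> carrier_mat (udim (um_of n D)) (udim (um_of n D))" for h
      by (simp add: um_of_def)
    show "uact (um_of n D) 1 = 1\<^sub>m (udim (um_of n D))"
      unfolding one_um.abs_eq u using z[of 1] by (simp add: single_one) (auto intro!: eq_matI)
    fix h h' :: "'k um"
    show "uact (um_of n D) (h * h') = uact (um_of n D) h * uact (um_of n D) h'"
      by (metis abs_rep_um m times_um.abs_eq u)
    show "uact (um_of n D) (h + h') = uact (um_of n D) h + uact (um_of n D) h'"
      by (metis abs_rep_um lin_ext_add plus_um.abs_eq u)
    show "uact (um_of n D) (um_scalar k) = k \<cdot>\<^sub>m 1\<^sub>m (udim (um_of n D))" for k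
      by (simp add: um_scalar_def u z)
  qed
  show "gact (um_of n D) x = D x"
    unfolding gact_def um_gen_def um_word_def u
    using c[of x] by (simp add: lin_ext_single[where F = "wev n D",
        OF wev_carrier[OF c]]) (auto simp: wev_simps intro!: eq_matI)
qed

lemma um_relations:
  "um_gen Lb * um_gen La = um_gen La * um_gen Lb + (um_gen Lc :: 'k um)"
  "um_gen Lc * um_gen La = um_gen La * um_gen Lc + (um_gen La :: 'k um)"
  "um_gen Lc * um_gen Lb = um_gen Lb * um_gen Lc + (um_gen Lb :: 'k um)"
  "um_gen Lc * um_gen Lc = (um_gen Lc :: 'k um)"
  "um_gen La * (um_gen La * (um_gen La * um_gen La)) = (0 :: 'k um)"
  "um_gen Lb * (um_gen Lb * (um_gen Lb * um_gen Lb)) = (0 :: 'k um)"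
proof -
  have g: "um_gen x = (abs_um (fgen x) :: 'k um)" for x by (simp add: um_gen_def um_word_def fgen_def)
  have r: "abs_um p = (abs_um q :: 'k um)" if "p + q \<in> relators" for p q
  proof -
    have "1 * (p + q) * 1 \<in> two_sided_ideal relators" using that by (rule two_sided_ideal.gen)
    then show ?thesis by (simp add: um.abs_eq_iff um_rel_def free_minus)
  qed
  have "p + p = (0 :: 'k free)" for p using free_minus(1)[of p p] by simp
  note s = this
  show "um_gen Lb * um_gen La = um_gen La * um_gen Lb + (um_gen Lc :: 'k um)"
    unfolding g times_um.abs_eq plus_um.abs_eq
    by (rule r) (simp add: relators_def Let_def free_minus ac_simps)
  show "um_gen Lc * um_gen La = um_gen La * um_gen Lc + (um_gen La :: 'k um)"
    unfolding g times_um.abs_eq plus_um.abs_eq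
    by (rule r) (simp add: relators_def Let_def free_minus ac_simps)
  show "um_gen Lc * um_gen Lb = um_gen Lb * um_gen Lc + (um_gen Lb :: 'k um)"
    unfolding g times_um.abs_eq plus_um.abs_eq
    by (rule r) (simp add: relators_def Let_def free_minus ac_simps)
  show "um_gen Lc * um_gen Lc = (um_gen Lc :: 'k um)"
    unfolding g times_um.abs_eq
    by (rule r) (simp add: relators_def Let_def power2_eq_square)
  show "um_gen La * (um_gen La * (um_gen La * um_gen La)) = (0 :: 'k um)"
    unfolding g times_um.abs_eq zero_um.abs_eq
    by (rule r) (simp add: relators_def Let_def numeral_eq_Suc)
  show "um_gen Lb * (um_gen Lb * (um_gen Lb * um_gen Lb)) = (0 :: 'k um)"
    unfolding g times_um.abs_eq zero_um.abs_eq
    by (rule r) (simp add: relators_def Let_def numeral_eq_Suc)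
qed

lemma uact_zero: "um_module M \<Longrightarrow> uact M (0 :: 'k um) = 0\<^sub>m (udim M) (udim M)"
proof -
  assume M: "um_module M"
  have "uact M (um_scalar (0::'k)) = 0\<^sub>m (udim M) (udim M)" using um_moduleD(5)[OF M] by (auto intro!: eq_matI)
  then show ?thesis by (simp add: um_scalar_def zero_um.abs_eq)
qed

lemma gact_mrel: "um_module (M :: 'k umod) \<Longrightarrow> mrel (udim M) (gact M)"
  unfolding mrel_def gact_def
  by (simp add: um_moduleD(1) um_moduleD(3)[symmetric] um_moduleD(4)[symmetric] um_relations uact_zero)

lemma is_rep_urep [simp]:
  assumes M: "um_module (M :: 'k umod)"
  shows "is_rep (urep M)"
proof -
  note c = um_module_gact[OF M]
  note r = gact_mrel[OF M, unfolded mrel_def]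
  show ?thesis
    by (rule is_repI; simp add: app_add app_scale app_kn[OF c] app_mult[OF c c,
        symmetric] app_mat_add[OF mult_carrier_mat[OF c c] c, symmetric]
         app_mult[OF c mult_carrier_mat[OF c c], symmetric] app_mult[OF c mult_carrier_mat[OF c
             mult_carrier_mat[OF c c]], symmetric] r app_zero)
qed

text \<open>The injective map \<open>q\<close> carries both sides of each matrix relation to the
  same relation in \<open>X\<close>. Thus no matrix product is ever computed for the concrete
  modules: an intertwining coordinate map is enough.\<close>

lemma mrel_coord:
  assumes X: "is_rep X" and q: "linon (kn n) fscale (scl X) q" "bij_betw q (kn n) (carr X)"
    and D: "\<And>x. D x \<in> carrier_mat n n" "\<And>x v. v \<in> kn n \<Longrightarrow> q (app (D x) v) = gen X x (q v)"
  shows "mrel n D"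
proof -
  have k: "app (D x) v \<in> kn n" for x v by (rule app_kn[OF D(1)])
  have i: "u = v" if "u \<in> kn n" "v \<in> kn n" "q u = q v" for u v
    using inj_onD[OF bij_betw_imp_inj_on[OF q(2)]] that by blast
  have q0: "q 0 = 0" using linon_zero[OF fs.vector_space_axioms rep_vs[OF X] q(1)] by simp
  have qa: "q (u + v) = q u + q v" if "u \<in> kn n" "v \<in> kn n" for u v using q(1) that by (simp add: linon_def)
  note m = app_mult[OF D(1) D(1)] app_mult[OF D(1) mult_carrier_mat[OF D(1) D(1)]]
    app_mult[OF D(1) mult_carrier_mat[OF D(1) mult_carrier_mat[OF D(1) D(1)]]]
    app_mat_add[OF mult_carrier_mat[OF D(1) D(1)] D(1)]
  show ?thesis
    unfolding mrel_def
    by (intro conjI allI D(1); rule app_inject[of _ n n]; (intro mult_carrier_mat[of _ n n] add_carrier_mat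
        D(1) zero_carrier_mat)?;
        (rule i; simp add: m k D(2) qa q0 X app_zero)?)
qed

lemma um_of_coord:
  assumes "is_rep X" "linon (kn n) fscale (scl X) q" "bij_betw q (kn n) (carr X)"
    "\<And>x. D x \<in> carrier_mat n n" "\<And>x v. v \<in> kn n \<Longrightarrow> q (app (D x) v) = gen X x (q v)"
  shows "um_module (um_of n D)" "riso (urep (um_of n D)) X" "mrel n D"
proof -
  show m: "mrel n D" using assms by (rule mrel_coord)
  show "um_module (um_of n D)" by (rule um_of_module(1)[OF m])
  show "riso (urep (um_of n D)) X"
    by (rule risoI[of _ _ q]) (use assms in \<open>auto simp: rhom_def um_of_module(2)[OF m] bij_betw_def\<close>)
qed

text \<open>Needed because injectivity and projectivity of a \<open>umod\<close> are tested on
  matrix modules only, so \<open>E0\<close> and \<open>E1\<close> must be replaced by such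
  copies.\<close>

lemma rep_coordinates:
  assumes X: "is_rep (X :: ('k, 'v::ab_group_add) rep)" "fdim (carr X) (scl X) n"
  obtains M where "um_module M" "udim M = n" "riso (urep M) X"
proof -
  obtain q where q: "linon (kn n) fscale (scl X) q" "bij_betw q (kn n) (carr X)" using X(2) by (auto simp: fdim_def)
  let ?q = "the_inv_into (kn n) q"
  have qc: "q v \<in> carr X" if "v \<in> kn n" for v using q(2) that by (auto simp: bij_betw_def)
  have qi: "?q x \<in> kn n" "q (?q x) = x" if "x \<in> carr X" for x
    using the_inv_into_into[OF bij_betw_imp_inj_on[OF q(2)] _ subset_refl] f_the_inv_into_f_bij_betw[OF q(2)] that q(2)
    by (auto simp: bij_betw_def)
  have iq: "?q (q v) = v" if "v \<in> kn n" for v using the_inv_into_f_f[OF bij_betw_imp_inj_on[OF q(2)] that] .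
  have qa: "?q (x + y) = ?q x + ?q y" if "x \<in> carr X" "y \<in> carr X" for x y
    using iq[of "?q x + ?q y"] qi that q(1) by (simp add: linon_def)
  have qs: "?q (scl X k x) = fscale k (?q x)" if "x \<in> carr X" for x k
    using iq[of "fscale k (?q x)"] qi that q(1) by (simp add: linon_def)
  define D where "D x = mat_of n n (\<lambda>v. ?q (gen X x (q v)))" for x
  have D: "app (D x) v = ?q (gen X x (q v))" if v: "v \<in> kn n" for x v
    unfolding D_def
  proof (rule app_mat_of[OF _ _ v])
    show "linon (kn n) fscale fscale (\<lambda>v. ?q (gen X x (q v)))"
      using q(1) qc X(1) by (simp add: linon_def qa qs)
    show "(\<lambda>v. ?q (gen X x (q v))) ` kn n \<subseteq> kn n" using qi qc X(1) by auto
  qed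
  have "um_module (um_of n D)" "riso (urep (um_of n D)) X"
  proof (rule um_of_coord[OF X(1) q])
    show "D x \<in> carrier_mat n n" for x by (simp add: D_def)
    show "q (app (D x) v) = gen X x (q v)" if "v \<in> kn n" for x v
      using D[OF that] qi(2) qc[OF that] X(1) by simp
  qed (rule um_of_coord[OF X(1) q]; use D qi qc X(1) in \<open>simp add: D_def\<close>)+
  then show ?thesis using that[of "um_of n D"] by simp
qed

end

section \<open>Tensor products and direct sums of matrix modules\<close>

lemma sum_lessThan_add: "(\<Sum>j<m + n. f j) = (\<Sum>j<m. f j) + (\<Sum>j<n. f (m + j) :: 'a::comm_monoid_add)" for m n :: nat
  by (induction n) (simp_all add: ac_simps)

lemma sum_divmod:
  fixes n m :: nat
  shows "(\<Sum>k<n * m. f (k div m) (k mod m)) = (\<Sum>a<n. \<Sum>b<m. f a b :: 'a::comm_monoid_add)"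
proof (induction n)
  case (Suc n)
  have "(\<Sum>k<Suc n * m. f (k div m) (k mod m)) = (\<Sum>k<n * m + m. f (k div m) (k mod m))" by (simp add: add.commute)
  also have "\<dots> = (\<Sum>k<n * m. f (k div m) (k mod m)) + (\<Sum>b<m. f ((n * m + b) div m) ((n * m + b) mod m))"
    by (rule sum_lessThan_add)
  also have "(\<Sum>b<m. f ((n * m + b) div m) ((n * m + b) mod m)) = (\<Sum>b<m. f n b)"
    by (rule sum.cong) auto
  finally show ?case using Suc by simp
qed simp

lemma kron_carrier: "A \<in> carrier_mat n m \<Longrightarrow> B \<in> carrier_mat p q \<Longrightarrow> kron A B \<in> carrier_mat (n * p) (m * q)"
  by (simp add: kron_def)

lemma kron_index:
  assumes "A \<in> carrier_mat n m" "B \<in> carrier_mat p q" "i < n * p" "j < m * q"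
  shows "kron A B $$ (i, j) = A $$ (i div p, j div q) * B $$ (i mod p, j mod q)"
  using assms by (simp add: kron_def)

lemma kron_one: "kron (1\<^sub>m n) (1\<^sub>m m) = (1\<^sub>m (n * m) :: 'k::field mat)"
proof (rule eq_matI)
  fix i j assume "i < dim_row (1\<^sub>m (n * m) :: 'k mat)" "j < dim_col (1\<^sub>m (n * m) :: 'k mat)"
  then have ij: "i < n * m" "j < n * m" by simp_all
  then have "0 < m" by (metis mult_0_right neq0_conv not_less_zero)
  then have "i div m < n" "j div m < n" "i mod m < m" "j mod m < m" using ij by (simp_all add: less_mult_imp_div_less)
  moreover have "i div m = j div m \<and> i mod m = j mod m \<longleftrightarrow> i = j" by (metis div_mult_mod_eq)
  ultimately show "kron (1\<^sub>m n) (1\<^sub>m m) $$ (i, j) = (1\<^sub>m (n * m) :: 'k mat) $$ (i, j)"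
    using ij by (auto simp: kron_index[of _ n n _ m m])
qed (simp_all add: kron_def)

lemma kron_mult:
  fixes A :: "'k::field mat"
  assumes A: "A \<in> carrier_mat n n" "A' \<in> carrier_mat n n" and B: "B \<in> carrier_mat m m" "B' \<in> carrier_mat m m"
  shows "kron (A * A') (B * B') = kron A B * kron A' B'"
proof (rule eq_matI)
  fix i j assume "i < dim_row (kron A B * kron A' B')" "j < dim_col (kron A B * kron A' B')"
  then have ij: "i < n * m" "j < n * m" using A B by (simp_all add: kron_def)
  then have "0 < m" by (metis mult_0_right neq0_conv not_less_zero)
  then have d: "i div m < n" "j div m < n" "i mod m < m" "j mod m < m" using ij by (simp_all add:
      less_mult_imp_div_less)
  have "kron (A * A') (B * B') $$ (i, j) = (\<Sum>a<n. A $$ (i div m, a) * A' $$ (a,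
      j div m)) * (\<Sum>b<m. B $$ (i mod m, b) * B' $$ (b, j mod m))"
    using A B d ij by (simp add: kron_index[OF mult_carrier_mat[OF A] mult_carrier_mat[OF B]] scalar_prod_def
        lessThan_atLeast0)
  also have "\<dots> = (\<Sum>a<n. \<Sum>b<m. (A $$ (i div m, a) * B $$ (i mod m, b)) * (A' $$ (a, j div m) * B' $$ (b, j mod m)))"
    by (simp add: sum_product mult_ac)
  also have "\<dots> = (\<Sum>k<n * m. (A $$ (i div m, k div m) * B $$ (i mod m, k mod m)) * (A' $$ (k div m,
      j div m) * B' $$ (k mod m, j mod m)))"
    by (rule sum_divmod[symmetric])
  also have "\<dots> = (\<Sum>k<n * m. kron A B $$ (i, k) * kron A' B' $$ (k, j))"
    by (rule sum.cong) (use ij in \<open>simp_all add: kron_index[OF A(1) B(1)] kron_index[OF A(2) B(2)]\<close>)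
  also have "\<dots> = (kron A B * kron A' B') $$ (i, j)"
    using ij kron_carrier[OF A(1) B(1)] kron_carrier[OF A(2) B(2)] by (simp add: scalar_prod_def lessThan_atLeast0)
  finally show "kron (A * A') (B * B') $$ (i, j) = (kron A B * kron A' B') $$ (i, j)" .
qed (use A B in \<open>simp_all add: kron_def\<close>)

definition tgen :: "'k::field umod \<Rightarrow> 'k umod \<Rightarrow> letter \<Rightarrow> 'k mat" where
  "tgen M N x = kron (gact M x) (1\<^sub>m (udim N)) + kron (1\<^sub>m (udim M)) (gact N x)"

lemma lin_ext_scale:
  fixes F :: "'w::monoid_add \<Rightarrow> 'k::field mat"
  assumes F: "\<And>w. F w \<in> carrier_mat n n" "\<And>u v. F (u + v) = F u * F v" "F 0 = 1\<^sub>m n"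
  shows "lin_ext n F (Poly_Mapping.single 0 k * q) = k \<cdot>\<^sub>m lin_ext n F q"
  by (simp add: lin_ext_mult[OF F(1,2)] lin_ext_single[where F = F, OF F(1)] F(3)
      mult_smult_assoc_mat[OF one_carrier_mat lin_ext_carrier] left_mult_one_mat[OF lin_ext_carrier])

text \<open>\<open>coprod\<close> sends a word to the product of the elements x \<otimes> 1 + 1
  \<otimes> x of its letters, and \<open>kron\<close> is multiplicative. So the tensor product is
  the module built from the matrices \<open>tgen\<close> of the letters.\<close>

lemma tensor_um_of:
  assumes M: "um_module M" and N: "um_module N"
  shows "M \<otimes>\<^sub>u N = um_of (udim M * udim N) (tgen M N)"
proof -
  let ?n = "udim M * udim N"
  let ?F = "\<lambda>(u, v). kron (uact M (um_word u)) (uact N (um_word v))"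
  note MD = um_moduleD[OF M] and ND = um_moduleD[OF N]
  have wa: "um_word (u + v) = um_word u * (um_word v :: 'a um)" for u v
    by (simp add: um_word_def times_um.abs_eq mult_single)
  have w0: "um_word 0 = (1 :: 'a um)" using um_word_Nil by (simp add: zero_word_def)
  have F1: "?F w \<in> carrier_mat ?n ?n" for w
    by (cases w) (simp add: kron_carrier[OF MD(1) ND(1)])
  have F2: "?F (u + v) = ?F u * ?F v" for u v
    by (cases u; cases v) (simp add: wa MD(3) ND(3) kron_mult[OF MD(1) MD(1) ND(1) ND(1)])
  have F3: "?F 0 = 1\<^sub>m ?n" by (simp add: zero_prod_def w0 MD(2) ND(2) kron_one)
  let ?G = "\<lambda>x. Poly_Mapping.single (Word [x], 0) 1 + Poly_Mapping.single (0, Word [x]) (1 :: 'a)"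
  have g: "lin_ext ?n ?F (?G x) = tgen M N x" for x
  proof -
    have "?F (Word [x], 0) = kron (gact M x) (1\<^sub>m (udim N))" "?F (0, Word [x]) = kron (1\<^sub>m (udim M)) (gact N x)"
      by (simp_all add: w0 MD(2) ND(2) gact_def um_gen_def)
    moreover have "(1 :: 'a) \<cdot>\<^sub>m X = X" for X by (rule eq_matI) auto
    ultimately show ?thesis
      by (simp only: lin_ext_add lin_ext_single[where F = ?F, OF F1] tgen_def)
  qed
  have p: "lin_ext ?n ?F (prod_list (map ?G ls)) = wev ?n (tgen M N) (Word ls)" for ls
  proof (induction ls)
    case Nil
    have "lin_ext ?n ?F (Poly_Mapping.single 0 1) = 1\<^sub>m ?n"
      unfolding lin_ext_single[where F = ?F, OF F1] F3 by (rule eq_matI) auto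
    then show ?case by (simp add: wev_simps single_one)
  next
    case (Cons x ls)
    then show ?case by (simp only: list.map prod_list.Cons wev_simps g lin_ext_mult[where F = ?F, OF F1 F2])
  qed
  have "lin_ext ?n ?F (coprod h) = lin_ext ?n (wev ?n (tgen M N)) h" for h :: "'a free"
  proof (rule eq_matI)
    fix i j assume "i < dim_row (lin_ext ?n (wev ?n (tgen M N)) h)" "j < dim_col (lin_ext ?n (wev ?n (tgen M N)) h)"
    then have ij: "i < ?n" "j < ?n" by (simp_all add: lin_ext_def)
    have "lin_ext ?n ?F (coprod h) $$ (i, j) = (\<Sum>w\<in>Poly_Mapping.keys h.
        lin_ext ?n ?F (Poly_Mapping.single 0 (Poly_Mapping.lookup h w) * prod_list (map ?G (letters w))) $$ (i, j))"
      unfolding coprod_def by (rule lin_ext_sum[OF finite_keys ij])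
    also have "\<dots> = (\<Sum>w\<in>Poly_Mapping.keys h. Poly_Mapping.lookup h w * wev ?n (tgen M N) w $$ (i, j))"
    proof (rule sum.cong)
      fix w
      have "lin_ext ?n ?F (Poly_Mapping.single 0 (Poly_Mapping.lookup h w) * prod_list (map ?G (letters w)))
          = Poly_Mapping.lookup h w \<cdot>\<^sub>m wev ?n (tgen M N) w"
        unfolding lin_ext_scale[where F = ?F, OF F1 F2 F3] p by simp
      moreover have "wev ?n (tgen M N) w \<in> carrier_mat ?n ?n"
        by (rule wev_carrier) (simp add: tgen_def kron_carrier um_module_gact[OF M] um_module_gact[OF N])
      ultimately show "lin_ext ?n ?F (Poly_Mapping.single 0 (Poly_Mapping.lookup h w) * prod_list (map ?G
          (letters w))) $$ (i, j)
          = Poly_Mapping.lookup h w * wev ?n (tgen M N) w $$ (i, j)" using ij by simp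
    qed simp
    finally show "lin_ext ?n ?F (coprod h) $$ (i, j) = lin_ext ?n (wev ?n (tgen M N)) h $$ (i, j)"
      using ij by (simp add: lin_ext_def)
  qed (simp_all add: lin_ext_def)
  then show ?thesis by (simp add: umod_tensor_def um_of_def)
qed

lemma umod_sum_gact: "gact (M \<oplus>\<^sub>u N) x = four_block_mat (gact M x) (0\<^sub>m (udim M) (udim N)) (0\<^sub>m (udim N) (udim
    M)) (gact N x)"
  by (simp add: gact_def umod_sum_def)

lemma um_module_sum:
  assumes M: "um_module M" and N: "um_module N"
  shows "um_module (M \<oplus>\<^sub>u N)"
proof -
  note MD = um_moduleD[OF M] and ND = um_moduleD[OF N]
  have z: "0\<^sub>m n m * A = 0\<^sub>m n l" "B * 0\<^sub>m m l = 0\<^sub>m n l" if "A \<in> carrier_mat m l" "B \<in> carrier_mat n m" for A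
      B :: "'a mat" and n m l
    using that by auto
  show ?thesis
    unfolding um_module_def umod_sum_def umod.simps
  proof (intro conjI allI)
    fix h h' :: "'a um"
    show "four_block_mat (uact M h) (0\<^sub>m (udim M) (udim N)) (0\<^sub>m (udim N) (udim M)) (uact N h) \<in> carrier_mat
        (udim M + udim N) (udim M + udim N)"
      by (rule four_block_carrier_mat[OF MD(1) ND(1)])
    show "four_block_mat (uact M 1) (0\<^sub>m (udim M) (udim N)) (0\<^sub>m (udim N) (udim M)) (uact N 1) = 1\<^sub>m (udim M + udim N)"
      by (simp add: MD(2) ND(2))
    show "four_block_mat (uact M (h * h')) (0\<^sub>m (udim M) (udim N)) (0\<^sub>m (udim N) (udim M)) (uact N (h * h')) =
        four_block_mat (uact M h) (0\<^sub>m (udim M) (udim N)) (0\<^sub>m (udim N) (udim M)) (uact N h) *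
        four_block_mat (uact M h') (0\<^sub>m (udim M) (udim N)) (0\<^sub>m (udim N) (udim M)) (uact N h')"
      unfolding mult_four_block_mat[OF MD(1) zero_carrier_mat zero_carrier_mat ND(1) MD(1) zero_carrier_mat
          zero_carrier_mat ND(1)]
      using MD(1) ND(1) by (simp add: MD(3) ND(3) right_add_zero_mat[of _ "udim M" "udim M"]
          left_add_zero_mat[of _ "udim N" "udim N"]
        mult_carrier_mat[of _ "udim M" "udim M"] mult_carrier_mat[of _ "udim N" "udim N"]
        left_mult_zero_mat[of _ "udim N" "udim N"] left_mult_zero_mat[of _ "udim M" "udim M"]
        right_mult_zero_mat[of _ "udim N" "udim N"] right_mult_zero_mat[of _ "udim M" "udim M"])
    show "four_block_mat (uact M (h + h')) (0\<^sub>m (udim M) (udim N)) (0\<^sub>m (udim N) (udim M)) (uact N (h + h')) =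
        four_block_mat (uact M h) (0\<^sub>m (udim M) (udim N)) (0\<^sub>m (udim N) (udim M)) (uact N h) +
        four_block_mat (uact M h') (0\<^sub>m (udim M) (udim N)) (0\<^sub>m (udim N) (udim M)) (uact N h')"
      unfolding add_four_block_mat[OF MD(1) zero_carrier_mat zero_carrier_mat ND(1) MD(1) zero_carrier_mat
          zero_carrier_mat ND(1)]
      by (simp add: MD(4) ND(4))
    show "four_block_mat (uact M (um_scalar k)) (0\<^sub>m (udim M) (udim N)) (0\<^sub>m (udim N) (udim M)) (uact N (um_scalar k)) =
        k \<cdot>\<^sub>m 1\<^sub>m (udim M + udim N)" for k
      by (rule eq_matI) (auto simp: MD(5) ND(5))
  qed
qed

lemma riso_urep_sum:
  assumes M: "um_module M" and N: "um_module N"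
  shows "riso (urep (M \<oplus>\<^sub>u N)) (urep M \<times>\<^sub>r urep N)"
proof -
  let ?m = "udim M" and ?n = "udim N"
  note c = um_module_gact[OF M] um_module_gact[OF N]
  note cd = carrier_matD[OF c(1)] carrier_matD[OF c(2)]
  have u: "udim (M \<oplus>\<^sub>u N) = ?m + ?n" by (simp add: umod_sum_def)
  have a1: "app (gact (M \<oplus>\<^sub>u N) x) v i = app (gact M x) (trunc ?m v) i" if "i < ?m" for x v i
  proof -
    have "app (gact (M \<oplus>\<^sub>u N) x) v i = (\<Sum>j<?m + ?n. gact (M \<oplus>\<^sub>u N) x $$ (i, j) * v j)"
      using that by (simp add: app_def umod_sum_gact cd)
    also have "\<dots> = (\<Sum>j<?m. gact M x $$ (i, j) * v j)"
      unfolding sum_lessThan_add using that by (simp add: umod_sum_gact cd)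
    also have "\<dots> = app (gact M x) (trunc ?m v) i"
      using that by (auto simp: app_def trunc_def cd intro!: sum.cong)
    finally show ?thesis .
  qed
  have a2: "app (gact (M \<oplus>\<^sub>u N) x) v (i + ?m) = app (gact N x) (\<lambda>i. v (i + ?m)) i" for x v i
  proof (cases "i < ?n")
    case True
    have "app (gact (M \<oplus>\<^sub>u N) x) v (i + ?m) = (\<Sum>j<?m + ?n. gact (M \<oplus>\<^sub>u N) x $$ (i + ?m, j) * v j)"
      using True by (simp add: app_def umod_sum_gact cd)
    also have "\<dots> = (\<Sum>j<?n. gact N x $$ (i, j) * v (j + ?m))"
      unfolding sum_lessThan_add using True by (simp add: umod_sum_gact cd add.commute)
    also have "\<dots> = app (gact N x) (\<lambda>i. v (i + ?m)) i"
      using True by (simp add: app_def cd)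
    finally show ?thesis .
  next
    case False
    then show ?thesis by (simp add: app_def umod_sum_gact cd)
  qed
  have a: "trunc ?m (app (gact (M \<oplus>\<^sub>u N) x) v) = app (gact M x) (trunc ?m v)"
    "(\<lambda>i. app (gact (M \<oplus>\<^sub>u N) x) v (i + ?m)) = app (gact N x) (\<lambda>i. v (i + ?m))" for x v
    using a1 a2 app_kn[OF c(1)] by (auto simp: trunc_def fun_eq_iff kn_def)
  have sc: "(\<lambda>i. fscale k v (i + ?m)) = fscale k (\<lambda>i. v (i + ?m))" "(\<lambda>i. w i + w' i) = w + w'"
    for k :: 'a and v w w' :: "nat \<Rightarrow> 'a" by (simp_all add: fscale_def plus_fun_def)
  show ?thesis
  proof (rule riso_byWitness[where f = "\<lambda>v. (trunc ?m v, \<lambda>i. v (i + ?m))" and g = "\<lambda>(x,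
      y) i. if i < ?m then x i else y (i - ?m)"])
    show "rhom (urep (M \<oplus>\<^sub>u N)) (urep M \<times>\<^sub>r urep N) (\<lambda>v. (trunc ?m v, \<lambda>i. v (i + ?m)))"
      by (rule rhomI) (auto simp: a u trunc_add trunc_scale sc kn_def[of ?n] kn_def[of "?m + ?n"])
  qed (auto simp: u kn_def trunc_def fun_eq_iff)
qed

section \<open>Duals, and multiples of projective covers\<close>

context char2
begin

text \<open>The antipode reverses words and transposition reverses products, so the two reversals
  cancel; the signs of the antipode disappear in characteristic 2. The letters therefore act by the
  transposed matrices.\<close>

lemma dual_um_of:
  assumes M: "um_module (M :: 'k umod)"
  shows "umod_dual M = um_of (udim M) (\<lambda>x. transpose_mat (gact M x))"
proof -
  let ?n = "udim M" and ?D = "\<lambda>x. transpose_mat (gact M x)"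
  note MD = um_moduleD[OF M]
  have Dc: "?D x \<in> carrier_mat ?n ?n" for x using um_module_gact[OF M] by simp
  note wc = wev_carrier[of ?D, OF Dc]
  define U where "U p = uact M (abs_um p)" for p
  have Uc: "U p \<in> carrier_mat ?n ?n" for p by (simp add: U_def MD(1))
  have Ua: "U (p + q) = U p + U q" and Um: "U (p * q) = U p * U q" for p q
    by (simp_all add: U_def MD(3)[symmetric] MD(4)[symmetric] plus_um.abs_eq times_um.abs_eq)
  have Us: "U (Poly_Mapping.single 0 k) = k \<cdot>\<^sub>m 1\<^sub>m ?n" for k
    using MD(5)[of k] by (simp add: U_def um_scalar_def)
  have U1: "U 1 = 1\<^sub>m ?n" using MD(2) by (simp add: U_def one_um.abs_eq)
  have Ug: "U (fgen x) = gact M x" for x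
    by (simp add:  U_def gact_def um_gen_def um_word_def fgen_def)
  have Usum: "U (\<Sum>w\<in>A. f w) $$ (i, j) = (\<Sum>w\<in>A. U (f w) $$ (i, j))" if "finite A" "i < ?n" "j < ?n" for A f i j
    using that(1)
  proof (induction A)
    case empty
    have "U 0 = 0\<^sub>m ?n ?n" using uact_zero[OF M] by (simp add: U_def zero_um.abs_eq)
    then show ?case using that by simp
  next
    case (insert w A)
    then show ?case using that carrier_matD[OF Uc] by (simp add: Ua)
  qed
  have p: "U (prod_list (map (\<lambda>x. - fgen x) (rev ls))) = transpose_mat (wev ?n ?D (Word ls))" for ls
  proof (induction ls)
    case Nil
    then show ?case by (simp add: wev_simps U1 transpose_one)
  next
    case (Cons x ls)
    then show ?case
      by (simp add: free_minus Um Ug U1 wev_simps transpose_mult[OF Dc wc] right_mult_one_mat[OF um_module_gact[OF M]])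
  qed
  have "transpose_mat (U (antipode h)) = lin_ext ?n (wev ?n ?D) h" for h
  proof (rule eq_matI)
    fix i j assume "i < dim_row (lin_ext ?n (wev ?n ?D) h)" "j < dim_col (lin_ext ?n (wev ?n ?D) h)"
    then have ij: "i < ?n" "j < ?n" by (simp_all add: lin_ext_def)
    have "U (antipode h) $$ (j, i) = (\<Sum>w\<in>Poly_Mapping.keys h. U (Poly_Mapping.single 0 (Poly_Mapping.lookup h w) *
        prod_list (map (\<lambda>x. - fgen x) (rev (letters w)))) $$ (j, i))"
      unfolding antipode_def by (rule Usum[OF finite_keys ij(2,1)])
    also have "\<dots> = (\<Sum>w\<in>Poly_Mapping.keys h. Poly_Mapping.lookup h w * wev ?n ?D w $$ (i, j))"
    proof (rule sum.cong)
      fix w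
      have t: "transpose_mat (wev ?n ?D w) \<in> carrier_mat ?n ?n" using wc by simp
      have "U (Poly_Mapping.single 0 (Poly_Mapping.lookup h w) * prod_list (map (\<lambda>x. - fgen x) (rev (letters w)))) =
         Poly_Mapping.lookup h w \<cdot>\<^sub>m transpose_mat (wev ?n ?D w)"
        unfolding Um Us p by (simp add: mult_smult_assoc_mat[OF one_carrier_mat t] left_mult_one_mat[OF t])
      then show "U (Poly_Mapping.single 0 (Poly_Mapping.lookup h w) * prod_list (map (\<lambda>x. - fgen x) (rev
          (letters w)))) $$ (j, i)
          = Poly_Mapping.lookup h w * wev ?n ?D w $$ (i, j)"
        using ij carrier_matD[OF wc[of w]] by simp
    qed simp
    finally show "transpose_mat (U (antipode h)) $$ (i, j) = lin_ext ?n (wev ?n ?D) h $$ (i, j)"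
      using ij carrier_matD[OF Uc] by (simp add: lin_ext_def)
  qed (use carrier_matD[OF Uc] in \<open>simp_all add: lin_ext_def\<close>)
  then show ?thesis by (simp add: umod_dual_def um_of_def U_def)
qed

lemma um_module_copies: "um_module (M :: 'k umod) \<Longrightarrow> um_module (umod_copies n M)"
proof (induction n)
  case 0
  have "A = B" if "A \<in> carrier_mat 0 0" "B \<in> carrier_mat 0 0" for A B :: "'k mat"
    using that by (intro eq_matI) auto
  then show ?case by (auto simp: um_module_def intro!: eq_matI)
qed (simp add: um_module_sum)

lemma riso_copies_E0:
  assumes M: "um_module (M :: 'k umod)" "riso (urep M) (E0 1)"
  shows "riso (urep (umod_copies n M)) (E0 n)"
proof (induction n)
  case 0
  show ?case
    by (rule riso_byWitness[where f = "\<lambda>_. 0" and g = "\<lambda>_. 0"])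
      (auto intro!: rhomI simp: zero_prod_def app_def)
next
  case (Suc n)
  have "riso (urep (umod_copies (Suc n) M)) (urep M \<times>\<^sub>r urep (umod_copies n M))"
    using riso_urep_sum[OF M(1) um_module_copies[OF M(1)]] by simp
  also have "riso (urep M \<times>\<^sub>r urep (umod_copies n M)) (E0 1 \<times>\<^sub>r E0 n)" by (rule riso_rprod[OF M(2) Suc])
  also have "riso (E0 1 \<times>\<^sub>r E0 n) (E0 (1 + n) :: ('k, _) rep)" by (rule riso_E0_add)
  finally show ?case by simp
qed

lemma riso_copies_E1:
  assumes M: "um_module (M :: 'k umod)" "riso (urep M) (E1 1)"
  shows "riso (urep (umod_copies n M)) (E1 n)"
proof (induction n)
  case 0
  show ?case
    by (rule riso_byWitness[where f = "\<lambda>_. 0" and g = "\<lambda>_. 0"])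
      (auto intro!: rhomI simp: zero_prod_def app_def)
next
  case (Suc n)
  have "riso (urep (umod_copies (Suc n) M)) (urep M \<times>\<^sub>r urep (umod_copies n M))"
    using riso_urep_sum[OF M(1) um_module_copies[OF M(1)]] by simp
  also have "riso (urep M \<times>\<^sub>r urep (umod_copies n M)) (E1 1 \<times>\<^sub>r E1 n)" by (rule riso_rprod[OF M(2) Suc])
  also have "riso (E1 1 \<times>\<^sub>r E1 n) (E1 (1 + n) :: ('k, _) rep)" by (rule riso_E1_add)
  finally show ?case by simp
qed

section \<open>The simple modules and the matrices of A\<close>

lemma basis_module_um_of: "basis_module n co = um_of n (\<lambda>x. mat n n (\<lambda>(i, j). co x (j + 1) (i + 1)))"
  by (simp add: basis_module_def um_of_def wev_def[abs_def])

lemma V_simple_0: "um_module (V_simple 0 :: 'k umod)" "riso (urep (V_simple 0 :: 'k umod)) V0r"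
proof -
  have q: "linon (kn 1) fscale (scl V0r) (\<lambda>v :: nat \<Rightarrow> 'k. v 0)" by (simp add: linon_def fscale_def)
  have b: "bij_betw (\<lambda>v :: nat \<Rightarrow> 'k. v 0) (kn 1) (carr V0r)"
    by (rule bij_betw_byWitness[where f' = "\<lambda>x i. if i = 0 then x else 0"]) (auto simp: kn_def fun_eq_iff)
  have V: "V_simple 0 = um_of 1 (\<lambda>x. mat 1 1 (\<lambda>(i, j). 0 :: 'k))" by (simp add: V_simple_def basis_module_um_of)
  show "um_module (V_simple 0 :: 'k umod)" "riso (urep (V_simple 0 :: 'k umod)) V0r"
    unfolding V by (rule um_of_coord[OF is_rep_V0r q b]; simp add: app_def)+
qed

lemma V_simple_1: "um_module (V_simple 1 :: 'k umod)" "riso (urep (V_simple 1 :: 'k umod)) V1r"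
proof -
  let ?q = "\<lambda>v :: nat \<Rightarrow> 'k. (v 0, v 1, v 2)"
  have q: "linon (kn 3) fscale (scl V1r) ?q" by (simp add: linon_def fscale_def)
  have b: "bij_betw ?q (kn 3) (carr V1r)"
  proof (rule bij_betw_byWitness[where f' = "\<lambda>(x, y, z) i. if i = 0 then x else if i = 1 then y else if i = 2
      then z else 0"])
    have "i \<noteq> 0 \<Longrightarrow> i \<noteq> Suc 0 \<Longrightarrow> i \<noteq> 2 \<Longrightarrow> 3 \<le> i" for i :: nat by arith
    then show "\<forall>v\<in>kn 3. (case ?q v of (x, y, z) \<Rightarrow> \<lambda>i. if i = 0 then x else if i = 1 then y else if i = 2 then z
        else 0) = v"
      by (auto simp: kn_def fun_eq_iff)
  qed (auto simp: kn_def)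
  have V: "V_simple 1 = um_of 3 (\<lambda>x. mat 3 3 (\<lambda>(i, j). V_coeff x (j + 1) (i + 1) :: 'k))"
    by (simp add: V_simple_def basis_module_um_of)
  have s: "(\<Sum>j<3. f j) = f 0 + (f 1 + f 2)" for f :: "nat \<Rightarrow> 'k" by (simp add: numeral_3_eq_3 numeral_2_eq_2 ac_simps)
  have D: "?q (app (mat 3 3 (\<lambda>(i, j). V_coeff x (j + 1) (i + 1) :: 'k)) v) = gen V1r x (?q v)" for x v
    by (cases x) (simp_all add: app_def s)
  show "um_module (V_simple 1 :: 'k umod)" "riso (urep (V_simple 1 :: 'k umod)) V1r"
    unfolding V by (rule um_of_coord[OF is_rep_V1r q b _ D]; simp)+
qed

text \<open>Coefficients of the pencil of A: S = x1 + x2 N and T = x2 + x1 N if x1 \<noteq> x2,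
  while the convention for x1 = x2 amounts to S = 1 and T = 1 + N. This unifies the two branches of
  the definition.\<close>

definition "cs0 x1 x2 = (if x1 \<noteq> x2 then x1 else 1 :: 'k)"
definition "cs1 x1 x2 = (if x1 \<noteq> x2 then x2 else 0 :: 'k)"
definition "ct0 x1 x2 = (if x1 \<noteq> x2 then x2 else 1 :: 'k)"
definition "ct1 x1 x2 = (if x1 \<noteq> x2 then x1 else 1 :: 'k)"
lemmas cs_defs = cs0_def cs1_def ct0_def ct1_def

text \<open>With \<open>q\<close> as the number of a block of four, the guard \<open>0 < q\<close>
  is the special rule for z_1, which has no block before it.\<close>

lemma A_coeff_table:
  "A_coeff x1 x2 La (4 * q + 1) i = cs0 x1 x2 * of_bool (i = 4 * q + 2) + cs1 x1 x2 * of_bool (0 < q \<and> i + 2 = 4 * q)"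
  "A_coeff x1 x2 La (4 * q + 2) i = of_bool (i = 4 * q + 3)"
  "A_coeff x1 x2 La (4 * q + 3) i = of_bool (i = 4 * q + 4)"
  "A_coeff x1 x2 La (4 * q + 4) i = (0 :: 'k)"
  "A_coeff x1 x2 Lb (4 * q + 1) i = ct0 x1 x2 * of_bool (i = 4 * q + 4) + ct1 x1 x2 * of_bool (0 < q \<and> i = 4 * q)"
  "A_coeff x1 x2 Lb (4 * q + 2) i = (0 :: 'k)"
  "A_coeff x1 x2 Lb (4 * q + 3) i = of_bool (i = 4 * q + 2)"
  "A_coeff x1 x2 Lb (4 * q + 4) i = of_bool (i = 4 * q + 3)"
  "A_coeff x1 x2 Lc (4 * q + 1) i = (0 :: 'k)"
  "A_coeff x1 x2 Lc (4 * q + 2) i = of_bool (i = 4 * q + 2)"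
  "A_coeff x1 x2 Lc (4 * q + 3) i = (0 :: 'k)"
  "A_coeff x1 x2 Lc (4 * q + 4) i = of_bool (i = 4 * q + 4)"
  by (cases q; auto simp: cs_defs)+

lemma sum_four:
  fixes r :: nat and g :: "nat \<Rightarrow> 'k"
  shows "(\<Sum>j<4 * r. g j) = (\<Sum>q<r. g (4 * q) + g (4 * q + 1) + g (4 * q + 2) + g (4 * q + 3))"
proof (induction r)
  case (Suc r)
  have "{..<4 * Suc r} = {..<Suc (Suc (Suc (Suc (4 * r))))}" by (simp add: eval_nat_numeral)
  then show ?case using Suc by (simp add: add.assoc eval_nat_numeral)
qed simp

lemma four_eq:
  fixes k q :: nat
  shows "(4 * k + 1 = 4 * q) = False"
    "(Suc (4 * k) = 4 * q) = False"
    "(4 * k + 1 = 4 * q + 2) = False"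
    "(Suc (4 * k) = 4 * q + 2) = False"
    "(4 * k + 1 = 4 * q + 3) = False"
    "(Suc (4 * k) = 4 * q + 3) = False"
    "(4 * k + 1 = 4 * q + 4) = False"
    "(Suc (4 * k) = 4 * q + 4) = False"
    "(4 * k + 2 = 4 * q) = False"
    "(4 * k + 2 = 4 * q + 2) = (q = k)"
    "(4 * k + 2 = 4 * q + 3) = False"
    "(4 * k + 2 = 4 * q + 4) = False"
    "(4 * k + 3 = 4 * q) = False"
    "(4 * k + 3 = 4 * q + 2) = False"
    "(4 * k + 3 = 4 * q + 3) = (q = k)"
    "(4 * k + 3 = 4 * q + 4) = False"
    "(4 * k + 4 = 4 * q) = (q = Suc k)"
    "(4 * k + 4 = 4 * q + 2) = False"
    "(4 * k + 4 = 4 * q + 3) = False"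
    "(4 * k + 4 = 4 * q + 4) = (q = k)"
    "(4 * k + 5 = 4 * q) = False"
    "(4 * k + 5 = 4 * q + 2) = False"
    "(4 * k + 5 = 4 * q + 3) = False"
    "(4 * k + 5 = 4 * q + 4) = False"
    "(4 * k + 6 = 4 * q) = False"
    "(4 * k + 6 = 4 * q + 2) = (q = Suc k)"
    "(4 * k + 6 = 4 * q + 3) = False"
    "(4 * k + 6 = 4 * q + 4) = False"
  by presburger+

lemma sum_delta_bool:
  "k < r \<Longrightarrow> (\<Sum>q<r. c * of_bool (q = k) * f q) = c * (f k :: 'k)"
  "(\<Sum>q<r. c * of_bool (q = Suc k) * f q) = c * (if Suc k < r then f (Suc k) else 0 :: 'k)"
proof -
  have "(\<Sum>q<r. c * of_bool (q = l) * f q) = (\<Sum>q<r. if q = l then c * f q else 0)" for l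
    by (rule sum.cong) auto
  then show "k < r \<Longrightarrow> (\<Sum>q<r. c * of_bool (q = k) * f q) = c * (f k :: 'k)"
    "(\<Sum>q<r. c * of_bool (q = Suc k) * f q) = c * (if Suc k < r then f (Suc k) else 0 :: 'k)"
    by (simp_all add: sum.delta)
qed

text \<open>Basis vectors are numbered from 1 and coordinates from 0, hence the offset. The term
  \<open>y (4 * Suc k)\<close> comes from the next block; in the last block it is 0 because
  \<open>y\<close> lies in \<open>kn (4 * r)\<close>.\<close>

lemma A_rows:
  fixes x1 x2 :: 'k
  assumes y: "y \<in> kn (4 * r)" and k: "k < r"
  defines "R \<equiv> \<lambda>x i. \<Sum>j<4 * r. A_coeff x1 x2 x (j + 1) i * (y j :: 'k)"
  shows "R La (4 * k + 1) = 0" "R La (4 * k + 2) = cs0 x1 x2 * y (4 * k) + cs1 x1 x2 * y (4 * Suc k)"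
    "R La (4 * k + 3) = y (4 * k + 1)" "R La (4 * k + 4) = y (4 * k + 2)"
    "R Lb (4 * k + 1) = 0" "R Lb (4 * k + 2) = y (4 * k + 2)" "R Lb (4 * k + 3) = y (4 * k + 3)"
    "R Lb (4 * k + 4) = ct0 x1 x2 * y (4 * k) + ct1 x1 x2 * y (4 * Suc k)"
    "R Lc (4 * k + 1) = 0" "R Lc (4 * k + 2) = y (4 * k + 1)" "R Lc (4 * k + 3) = 0" "R Lc (4 * k + 4) = y (4 * k + 3)"
proof -
  have a: "4 * q + 1 + 1 = 4 * q + 2" "4 * q + 2 + 1 = 4 * q + 3" "4 * q + 3 + 1 = 4 * q + 4" for q :: nat by simp_all
  have R: "R x i = (\<Sum>q<r. A_coeff x1 x2 x (4 * q + 1) i * y (4 * q) + A_coeff x1 x2 x (4 * q + 2) i * y (4 * q + 1)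
     + A_coeff x1 x2 x (4 * q + 3) i * y (4 * q + 2) + A_coeff x1 x2 x (4 * q + 4) i * y (4 * q + 3))" for x i
    unfolding R_def sum_four a ..
  have y0: "(if Suc k < r then y (4 * Suc k) else 0) = y (4 * Suc k)" using y by (auto simp: kn_def)
  have b: "4 * k + 1 + 2 = 4 * k + 3" "4 * k + 2 + 2 = 4 * k + 4" "4 * k + 3 + 2 = 4 * k + 5" "4 * k + 4 + 2 =
      4 * k + 6" by simp_all
  have c: "(0 < q \<and> q = Suc k) = (q = Suc k)" for q by auto
  note d = sum_delta_bool(1)[OF k, of 1, unfolded mult_1] sum_delta_bool(1)[OF k] sum_delta_bool(2)
  show "R La (4 * k + 1) = 0" "R La (4 * k + 2) = cs0 x1 x2 * y (4 * k) + cs1 x1 x2 * y (4 * Suc k)"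
    "R La (4 * k + 3) = y (4 * k + 1)" "R La (4 * k + 4) = y (4 * k + 2)"
    "R Lb (4 * k + 1) = 0" "R Lb (4 * k + 2) = y (4 * k + 2)" "R Lb (4 * k + 3) = y (4 * k + 3)"
    "R Lb (4 * k + 4) = ct0 x1 x2 * y (4 * k) + ct1 x1 x2 * y (4 * Suc k)"
    "R Lc (4 * k + 1) = 0" "R Lc (4 * k + 2) = y (4 * k + 1)" "R Lc (4 * k + 3) = 0" "R Lc (4 * k + 4) = y (4 * k + 3)"
    unfolding R A_coeff_table b four_eq c
    by (simp_all only: simp_thms of_bool_eq mult_zero_right mult_zero_left add_0_right add_0_left sum.neutral_const
        distrib_right sum.distrib d y0)
qed

text \<open>The same matrices read by columns, for the dual module: the link between blocks now
  points to the previous one, so block 0 is exceptional.\<close>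

lemma A_columns:
  fixes x1 x2 :: 'k
  assumes y: "y \<in> kn (4 * r)" and k: "k < r"
  defines "R \<equiv> \<lambda>x i. \<Sum>j<4 * r. A_coeff x1 x2 x i (j + 1) * (y j :: 'k)"
  shows "R La (4 * k + 1) = cs0 x1 x2 * y (4 * k + 1) + cs1 x1 x2 * (if k = 0 then 0 else y (4 * (k - 1) + 1))"
    "R La (4 * k + 2) = y (4 * k + 2)" "R La (4 * k + 3) = y (4 * k + 3)" "R La (4 * k + 4) = 0"
    "R Lb (4 * k + 1) = ct0 x1 x2 * y (4 * k + 3) + ct1 x1 x2 * (if k = 0 then 0 else y (4 * (k - 1) + 3))"
    "R Lb (4 * k + 2) = 0" "R Lb (4 * k + 3) = y (4 * k + 1)" "R Lb (4 * k + 4) = y (4 * k + 2)"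
    "R Lc (4 * k + 1) = 0" "R Lc (4 * k + 2) = y (4 * k + 1)" "R Lc (4 * k + 3) = 0" "R Lc (4 * k + 4) = y (4 * k + 3)"
proof -
  have d: "(\<Sum>j<4 * r. c * of_bool (P \<and> j = l) * y j) = c * (if P then y l else 0)" for P c l
  proof -
    have "(\<Sum>j<4 * r. c * of_bool (P \<and> j = l) * y j) = (\<Sum>j<4 * r. if j = l then c * of_bool P * y j else 0)"
      by (rule sum.cong) auto
    then show ?thesis using y by (auto simp: sum.delta kn_def)
  qed
  have d1: "(\<Sum>j<4 * r. c * of_bool (j = l) * y j) = c * y l" for c l using d[of c True l] by simp
  have d2: "(\<Sum>j<4 * r. of_bool (j = l) * y j) = y l" for l using d1[of 1 l] by simp
  have e: "(j + 1 = 4 * k + 2) = (j = 4 * k + 1)" "(j + 1 = 4 * k + 3) = (j = 4 * k + 2)" "(j + 1 = 4 * k + 4)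
      = (j = 4 * k + 3)"
    "(0 < k \<and> j + 1 + 2 = 4 * k) = (0 < k \<and> j = 4 * (k - 1) + 1)" "(0 < k \<and> j + 1 = 4 * k) = (0 < k \<and> j = 4 *
        (k - 1) + 3)" for j
    using k by (auto; presburger)+
  have z: "(if 0 < k then u else v) = (if k = 0 then v else u)" for u v :: 'k by simp
  show "R La (4 * k + 1) = cs0 x1 x2 * y (4 * k + 1) + cs1 x1 x2 * (if k = 0 then 0 else y (4 * (k - 1) + 1))"
    "R La (4 * k + 2) = y (4 * k + 2)" "R La (4 * k + 3) = y (4 * k + 3)" "R La (4 * k + 4) = 0"
    "R Lb (4 * k + 1) = ct0 x1 x2 * y (4 * k + 3) + ct1 x1 x2 * (if k = 0 then 0 else y (4 * (k - 1) + 3))"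
    "R Lb (4 * k + 2) = 0" "R Lb (4 * k + 3) = y (4 * k + 1)" "R Lb (4 * k + 4) = y (4 * k + 2)"
    "R Lc (4 * k + 1) = 0" "R Lc (4 * k + 2) = y (4 * k + 1)" "R Lc (4 * k + 3) = 0" "R Lc (4 * k + 4) = y (4 * k + 3)"
    unfolding R_def A_coeff_table e
    by (simp_all only: distrib_right sum.distrib d d1 d2 z mult_zero_left sum.neutral_const)
qed

end

section \<open>Coordinates sorted by residue modulo 4\<close>

definition quad_of :: "(nat \<Rightarrow> 'a::zero) \<Rightarrow> (nat \<Rightarrow> 'a) \<times> (nat \<Rightarrow> 'a) \<times> (nat \<Rightarrow> 'a) \<times> (nat \<Rightarrow> 'a)" where
  "quad_of y = (\<lambda>k. y (4 * k), \<lambda>k. y (4 * k + 1), \<lambda>k. y (4 * k + 2), \<lambda>k. y (4 * k + 3))"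

text \<open>The blocks are taken in reverse order, so that the transpose of the shift is again the shift.\<close>

definition rquad_of :: "nat \<Rightarrow> (nat \<Rightarrow> 'a::zero) \<Rightarrow> (nat \<Rightarrow> 'a) \<times> (nat \<Rightarrow> 'a) \<times> (nat \<Rightarrow> 'a) \<times> (nat \<Rightarrow> 'a)" where
  "rquad_of r y = (\<lambda>k. if k < r then y (4 * (r - 1 - k)) else 0, \<lambda>k. if k < r then y (4 * (r - 1 - k) + 3) else 0,
     \<lambda>k. if k < r then y (4 * (r - 1 - k) + 2) else 0, \<lambda>k. if k < r then y (4 * (r - 1 - k) + 1) else 0)"

definition unquad :: "(nat \<Rightarrow> 'a) \<times> (nat \<Rightarrow> 'a) \<times> (nat \<Rightarrow> 'a) \<times> (nat \<Rightarrow> 'a) \<Rightarrow> nat \<Rightarrow> 'a" where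
  "unquad = (\<lambda>(z, v1, v2, v3) i. (if i mod 4 = 0 then z else if i mod 4 = 1 then v1 else if i mod 4 = 2 then v2
      else v3) (i div 4))"

lemma four_divmod: "4 * k div 4 = k" "(4 * k + 1) div 4 = k" "(4 * k + 2) div 4 = k" "(4 * k + 3) div 4 = k"
  "4 * k mod 4 = 0" "(4 * k + 1) mod 4 = 1" "(4 * k + 2) mod 4 = 2" "(4 * k + 3) mod 4 = 3" for k :: nat
  by presburger+

lemma unquad_at: "unquad (z, v1, v2, v3) (4 * k) = z k" "unquad (z, v1, v2, v3) (4 * k + 1) = v1 k"
  "unquad (z, v1, v2, v3) (4 * k + 2) = v2 k" "unquad (z, v1, v2, v3) (4 * k + 3) = v3 k"
  unfolding unquad_def prod.case four_divmod by simp_all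

lemma four_cases: obtains k where "i = 4 * k" | k where "i = 4 * k + 1" | k where "i = 4 * k + 2" | k where "i
    = 4 * k + (3 :: nat)"
proof -
  have "i = 4 * (i div 4) + i mod 4" by simp
  moreover have "i mod 4 = 0 \<or> i mod 4 = 1 \<or> i mod 4 = 2 \<or> i mod 4 = 3" by presburger
  ultimately show ?thesis using that by (metis add.right_neutral)
qed

text \<open>The values range over a set \<open>S\<close> so that one statement covers A itself, with
  \<open>S = UNIV\<close>, and A \<otimes> N, where the values lie in the space of N.\<close>

lemma bij_quad_of:
  "bij_betw quad_of {y \<in> kn (4 * r). \<forall>i. y i \<in> S} (quad {f \<in> kn r. \<forall>i. f i \<in> S})"
proof (rule bij_betw_byWitness[where f' = unquad])
  show "\<forall>y\<in>{y \<in> kn (4 * r). \<forall>i. y i \<in> S}. unquad (quad_of y) = y"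
  proof (intro ballI ext)
    fix y :: "nat \<Rightarrow> 'a" and i
    show "unquad (quad_of y) i = y i"
      by (rule four_cases[of i]) (simp_all only: quad_of_def unquad_at)
  qed
  show "\<forall>f\<in>quad {f \<in> kn r. \<forall>i. f i \<in> S}. quad_of (unquad f) = f"
    by (simp only: split_paired_Ball_Sigma quad_of_def unquad_at) simp
  show "quad_of ` {y \<in> kn (4 * r). \<forall>i. y i \<in> S} \<subseteq> quad {f \<in> kn r. \<forall>i. f i \<in> S}"
    by (auto simp: quad_of_def kn_def)
  show "unquad ` quad {f \<in> kn r. \<forall>i. f i \<in> S} \<subseteq> {y \<in> kn (4 * r). \<forall>i. y i \<in> S}"
  proof clarify
    fix z v1 v2 v3 :: "nat \<Rightarrow> 'a" assume v: "z \<in> kn r" "v1 \<in> kn r" "v2 \<in> kn r" "v3 \<in> kn r"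
      "\<forall>i. z i \<in> S" "\<forall>i. v1 i \<in> S" "\<forall>i. v2 i \<in> S" "\<forall>i. v3 i \<in> S"
    have "r \<le> i div 4" if "4 * r \<le> i" for i using that by presburger
    then show "unquad (z, v1, v2, v3) \<in> kn (4 * r) \<and> (\<forall>i. unquad (z, v1, v2, v3) i \<in> S)"
      using v by (auto simp: unquad_def kn_def)
  qed
qed

lemma bij_rquad_of:
  fixes S :: "'a::zero set"
  assumes "0 \<in> S"
  shows "bij_betw (rquad_of r) {y \<in> kn (4 * r). \<forall>i. y i \<in> S} (quad {f \<in> kn r. \<forall>i. f i \<in> S})"
proof -
  let ?R = "\<lambda>(f :: nat \<Rightarrow> 'a) k. if k < r then f (r - 1 - k) else 0"
  have R: "bij_betw ?R {f \<in> kn r. \<forall>i. f i \<in> S} {f \<in> kn r. \<forall>i. f i \<in> S}"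
    by (rule bij_betw_byWitness[where f' = ?R]) (use assms in \<open>auto simp: kn_def fun_eq_iff\<close>)
  have P: "bij_betw (\<lambda>(z, v1, v2, v3). (z, v3, v2, v1)) (quad A) (quad A)" for A :: "(nat \<Rightarrow> 'a) set"
    by (rule bij_betw_byWitness[where f' = "\<lambda>(z, v1, v2, v3). (z, v3, v2, v1)"]) auto
  have "bij_betw ((\<lambda>(z, v1, v2, v3). (z, v3, v2, v1)) \<circ> (map_prod ?R (map_prod ?R (map_prod ?R ?R)) \<circ> quad_of))
      {y \<in> kn (4 * r). \<forall>i. y i \<in> S} (quad {f \<in> kn r. \<forall>i. f i \<in> S})"
    by (intro bij_betw_trans[OF bij_betw_trans[OF bij_quad_of] P] bij_betw_map_prod R)
  moreover have "(\<lambda>(z, v1, v2, v3). (z, v3, v2, v1)) \<circ> (map_prod ?R (map_prod ?R (map_prod ?R ?R)) \<circ> quad_of) =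
      rquad_of r"
    by (rule ext) (simp only: rquad_of_def quad_of_def comp_def map_prod_simp prod.case)
  ultimately show ?thesis by (simp only:)
qed

context char2
begin

definition DA :: "'k \<Rightarrow> 'k \<Rightarrow> nat \<Rightarrow> letter \<Rightarrow> 'k mat" where
  "DA x1 x2 r x = mat (4 * r) (4 * r) (\<lambda>(i, j). A_coeff x1 x2 x (j + 1) (i + 1))"

lemma DA_carrier [simp]: "DA x1 x2 r x \<in> carrier_mat (4 * r) (4 * r)"
  by (simp add: DA_def)

lemma app_DA:
  assumes y: "y \<in> kn (4 * r)"
  shows "app (DA x1 x2 r La) y (4 * k) = 0"
    "app (DA x1 x2 r La) y (4 * k + 1) = cs0 x1 x2 * y (4 * k) + cs1 x1 x2 * y (4 * Suc k)"
    "app (DA x1 x2 r La) y (4 * k + 2) = y (4 * k + 1)" "app (DA x1 x2 r La) y (4 * k + 3) = y (4 * k + 2)"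
    "app (DA x1 x2 r Lb) y (4 * k) = 0" "app (DA x1 x2 r Lb) y (4 * k + 1) = y (4 * k + 2)"
    "app (DA x1 x2 r Lb) y (4 * k + 2) = y (4 * k + 3)"
    "app (DA x1 x2 r Lb) y (4 * k + 3) = ct0 x1 x2 * y (4 * k) + ct1 x1 x2 * y (4 * Suc k)"
    "app (DA x1 x2 r Lc) y (4 * k) = 0" "app (DA x1 x2 r Lc) y (4 * k + 1) = y (4 * k + 1)"
    "app (DA x1 x2 r Lc) y (4 * k + 2) = 0" "app (DA x1 x2 r Lc) y (4 * k + 3) = y (4 * k + 3)"
proof -
  have a: "4 * k + 1 + 1 = 4 * k + 2" "4 * k + 2 + 1 = 4 * k + 3" "4 * k + 3 + 1 = 4 * k + 4" by simp_all
  have e: "app (DA x1 x2 r x) y i = (\<Sum>j<4 * r. A_coeff x1 x2 x (j + 1) (i + 1) * y j)" if "i < 4 * r" for x i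
    using that by (simp add: app_def DA_def del: A_coeff.simps)
  have z: "y i = 0" if "4 * r \<le> i" for i using y that by (simp add: kn_def)
  have z': "app (DA x1 x2 r x) y i = 0" if "4 * r \<le> i" for x i
    using app_kn[OF DA_carrier] that by (simp add: kn_def)
  have lt: "4 * k < 4 * r" "4 * k + 1 < 4 * r" "4 * k + 2 < 4 * r" "4 * k + 3 < 4 * r" if "k < r" using that by simp_all
  have ge: "4 * r \<le> 4 * k" "4 * r \<le> 4 * k + 1" "4 * r \<le> 4 * k + 2" "4 * r \<le> 4 * k + 3" "4 * r \<le> 4 * Suc k" if
      "\<not> k < r" using that by simp_all
  have zk: "y (4 * k) = 0" "y (4 * k + 1) = 0" "y (4 * k + 2) = 0" "y (4 * k + 3) = 0" "y (4 * Suc k) = 0" if "\<not> k < r"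
    by (rule z[OF ge(1)[OF that]] z[OF ge(2)[OF that]] z[OF ge(3)[OF that]] z[OF ge(4)[OF that]] z[OF ge(5)[OF that]])+
  show "app (DA x1 x2 r La) y (4 * k) = 0"
    by (cases "k < r") (simp_all only: e lt a A_rows[OF y] zk z' ge mult_zero_right add_0_left not_False_eq_True)
  show "app (DA x1 x2 r La) y (4 * k + 1) = cs0 x1 x2 * y (4 * k) + cs1 x1 x2 * y (4 * Suc k)"
    by (cases "k < r") (simp_all only: e lt a A_rows[OF y] zk z' ge mult_zero_right add_0_left not_False_eq_True)
  show "app (DA x1 x2 r La) y (4 * k + 2) = y (4 * k + 1)"
    by (cases "k < r") (simp_all only: e lt a A_rows[OF y] zk z' ge mult_zero_right add_0_left not_False_eq_True)
  show "app (DA x1 x2 r La) y (4 * k + 3) = y (4 * k + 2)"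
    by (cases "k < r") (simp_all only: e lt a A_rows[OF y] zk z' ge mult_zero_right add_0_left not_False_eq_True)
  show "app (DA x1 x2 r Lb) y (4 * k) = 0"
    by (cases "k < r") (simp_all only: e lt a A_rows[OF y] zk z' ge mult_zero_right add_0_left not_False_eq_True)
  show "app (DA x1 x2 r Lb) y (4 * k + 1) = y (4 * k + 2)"
    by (cases "k < r") (simp_all only: e lt a A_rows[OF y] zk z' ge mult_zero_right add_0_left not_False_eq_True)
  show "app (DA x1 x2 r Lb) y (4 * k + 2) = y (4 * k + 3)"
    by (cases "k < r") (simp_all only: e lt a A_rows[OF y] zk z' ge mult_zero_right add_0_left not_False_eq_True)
  show "app (DA x1 x2 r Lb) y (4 * k + 3) = ct0 x1 x2 * y (4 * k) + ct1 x1 x2 * y (4 * Suc k)"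
    by (cases "k < r") (simp_all only: e lt a A_rows[OF y] zk z' ge mult_zero_right add_0_left not_False_eq_True)
  show "app (DA x1 x2 r Lc) y (4 * k) = 0"
    by (cases "k < r") (simp_all only: e lt a A_rows[OF y] zk z' ge mult_zero_right add_0_left not_False_eq_True)
  show "app (DA x1 x2 r Lc) y (4 * k + 1) = y (4 * k + 1)"
    by (cases "k < r") (simp_all only: e lt a A_rows[OF y] zk z' ge mult_zero_right add_0_left not_False_eq_True)
  show "app (DA x1 x2 r Lc) y (4 * k + 2) = 0"
    by (cases "k < r") (simp_all only: e lt a A_rows[OF y] zk z' ge mult_zero_right add_0_left not_False_eq_True)
  show "app (DA x1 x2 r Lc) y (4 * k + 3) = y (4 * k + 3)"
    by (cases "k < r") (simp_all only: e lt a A_rows[OF y] zk z' ge mult_zero_right add_0_left not_False_eq_True)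
qed

text \<open>Unlike \<open>app_DA\<close> this is confined to k < r: at k = r the right-hand side
  would still see block r - 1.\<close>

lemma app_DA_transpose:
  assumes y: "y \<in> kn (4 * r)" and k: "k < r"
  shows "app (transpose_mat (DA x1 x2 r La)) y (4 * k) = cs0 x1 x2 * y (4 * k + 1) + cs1 x1 x2 * (if k = 0 then
      0 else y (4 * (k - 1) + 1))"
    "app (transpose_mat (DA x1 x2 r La)) y (4 * k + 1) = y (4 * k + 2)"
    "app (transpose_mat (DA x1 x2 r La)) y (4 * k + 2) = y (4 * k + 3)"
    "app (transpose_mat (DA x1 x2 r La)) y (4 * k + 3) = 0"
    "app (transpose_mat (DA x1 x2 r Lb)) y (4 * k) = ct0 x1 x2 * y (4 * k + 3) + ct1 x1 x2 * (if k = 0 then 0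
        else y (4 * (k - 1) + 3))"
    "app (transpose_mat (DA x1 x2 r Lb)) y (4 * k + 1) = 0"
    "app (transpose_mat (DA x1 x2 r Lb)) y (4 * k + 2) = y (4 * k + 1)"
    "app (transpose_mat (DA x1 x2 r Lb)) y (4 * k + 3) = y (4 * k + 2)"
    "app (transpose_mat (DA x1 x2 r Lc)) y (4 * k) = 0"
    "app (transpose_mat (DA x1 x2 r Lc)) y (4 * k + 1) = y (4 * k + 1)"
    "app (transpose_mat (DA x1 x2 r Lc)) y (4 * k + 2) = 0"
    "app (transpose_mat (DA x1 x2 r Lc)) y (4 * k + 3) = y (4 * k + 3)"
proof -
  have a: "4 * k + 1 + 1 = 4 * k + 2" "4 * k + 2 + 1 = 4 * k + 3" "4 * k + 3 + 1 = 4 * k + 4" by simp_all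
  have e: "app (transpose_mat (DA x1 x2 r x)) y i = (\<Sum>j<4 * r. A_coeff x1 x2 x (i + 1) (j + 1) * y j)" if "i <
      4 * r" for x i
    using that by (simp add: app_def DA_def del: A_coeff.simps)
  have lt: "4 * k < 4 * r" "4 * k + 1 < 4 * r" "4 * k + 2 < 4 * r" "4 * k + 3 < 4 * r" using k by simp_all
  note c = A_columns[OF y k, of x1 x2]
  show "app (transpose_mat (DA x1 x2 r La)) y (4 * k) = cs0 x1 x2 * y (4 * k + 1) + cs1 x1 x2 * (if k = 0 then
      0 else y (4 * (k - 1) + 1))"
    "app (transpose_mat (DA x1 x2 r La)) y (4 * k + 1) = y (4 * k + 2)"
    "app (transpose_mat (DA x1 x2 r La)) y (4 * k + 2) = y (4 * k + 3)"
    "app (transpose_mat (DA x1 x2 r La)) y (4 * k + 3) = 0"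
    "app (transpose_mat (DA x1 x2 r Lb)) y (4 * k) = ct0 x1 x2 * y (4 * k + 3) + ct1 x1 x2 * (if k = 0 then 0
        else y (4 * (k - 1) + 3))"
    "app (transpose_mat (DA x1 x2 r Lb)) y (4 * k + 1) = 0"
    "app (transpose_mat (DA x1 x2 r Lb)) y (4 * k + 2) = y (4 * k + 1)"
    "app (transpose_mat (DA x1 x2 r Lb)) y (4 * k + 3) = y (4 * k + 2)"
    "app (transpose_mat (DA x1 x2 r Lc)) y (4 * k) = 0"
    "app (transpose_mat (DA x1 x2 r Lc)) y (4 * k + 1) = y (4 * k + 1)"
    "app (transpose_mat (DA x1 x2 r Lc)) y (4 * k + 2) = 0"
    "app (transpose_mat (DA x1 x2 r Lc)) y (4 * k + 3) = y (4 * k + 3)"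
    by (simp_all only: e lt a c)
qed

abbreviation "SA x \<equiv> sop (cs0 (fst x) (snd x)) (cs1 (fst x) (snd x))"
abbreviation "TA x \<equiv> sop (ct0 (fst x) (snd x)) (ct1 (fst x) (snd x))"

lemma A_mod_um_of: "A_mod x r = um_of (4 * r) (DA (fst x) (snd x) r :: _ \<Rightarrow> 'k mat)"
  by (simp add: A_mod_def basis_module_um_of DA_def[abs_def] del: A_coeff.simps)

lemma A_mod_rep:
  "um_module (A_mod x r :: 'k umod)" "riso (urep (A_mod x r)) (F1 r r (SA x) (TA x))"
  "gact (A_mod x r) = DA (fst x) (snd x) r" "udim (A_mod x r) = 4 * r"
proof -
  let ?F = "F1 r r (SA x) (TA x)"
  have q: "linon (kn (4 * r)) fscale (scl ?F) quad_of"
    by (auto simp: linon_def quad_of_def fscale_def plus_fun_def)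
  have b: "bij_betw quad_of (kn (4 * r)) (carr ?F)" using bij_quad_of[of r UNIV] by simp
  have D: "quad_of (app (DA (fst x) (snd x) r l) v) = gen ?F l (quad_of v)" if v: "v \<in> kn (4 * r)" for l v
    by (cases l; simp only: quad_of_def app_DA[OF v] F1_simps) (simp_all add: sop_def fun_eq_iff)
  have c: "um_module (A_mod x r :: 'k umod)" "riso (urep (A_mod x r)) ?F" "mrel (4 * r) (DA (fst x) (snd x) r)"
    unfolding A_mod_um_of by (rule um_of_coord[OF is_rep_sop(1) q b DA_carrier D]; assumption)+
  show "um_module (A_mod x r :: 'k umod)" "riso (urep (A_mod x r)) ?F" by (rule c)+
  show "gact (A_mod x r) = DA (fst x) (snd x) r" unfolding A_mod_um_of by (rule ext) (rule um_of_module(2)[OF c(3)])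
  show "udim (A_mod x r) = 4 * r" by (simp add: A_mod_um_of)
qed

lemma B_mod_um_of: "B_mod x r = um_of (4 * r) (\<lambda>l. transpose_mat (DA (fst x) (snd x) r l :: 'k mat))"
  unfolding B_mod_def dual_um_of[OF A_mod_rep(1)] A_mod_rep(3,4) ..

text \<open>Transposition reverses the chain v_1, v_2, v_3, which exchanging \<open>v1\<close> and
  \<open>v3\<close> repairs, and turns the link to the next block into one to the previous block,
  which counting blocks backwards repairs. So B has the same pencil as A with the layers
  exchanged.\<close>

lemma rquad_DA:
  assumes v: "v \<in> kn (4 * r)"
  shows "rquad_of r (app (transpose_mat (DA x1 x2 r l)) v) =
    gen (F0 r r (sop (cs0 x1 x2) (cs1 x1 x2)) (sop (ct0 x1 x2) (ct1 x1 x2))) l (rquad_of r v)"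
proof -
  have k: "r - 1 - k < r" if "k < r" for k using that by simp
  have c: "(if r - 1 - k = 0 then 0 else v (4 * (r - 1 - k - 1) + m)) = (if Suc k < r then v (4 * (r - 1 - Suc
      k) + m) else 0)"
    if "k < r" for k m
    using that by auto
  show ?thesis
    by (cases l; simp only: rquad_of_def app_DA_transpose[OF v k] c F0_simps cong: if_cong)
      (auto simp: sop_def fun_eq_iff)
qed

lemma B_mod_rep:
  "um_module (B_mod x r :: 'k umod)" "riso (urep (B_mod x r)) (F0 r r (SA x) (TA x))"
  "gact (B_mod x r) = (\<lambda>l. transpose_mat (DA (fst x) (snd x) r l))" "udim (B_mod x r) = 4 * r"
proof -
  let ?F = "F0 r r (SA x) (TA x)"
  have q: "linon (kn (4 * r)) fscale (scl ?F) (rquad_of r)"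
    by (auto simp: linon_def rquad_of_def fscale_def fun_eq_iff)
  have b: "bij_betw (rquad_of r) (kn (4 * r)) (carr ?F)" using bij_rquad_of[of UNIV r] by simp
  have t: "transpose_mat (DA (fst x) (snd x) r l) \<in> carrier_mat (4 * r) (4 * r)" for l by simp
  have c: "um_module (B_mod x r :: 'k umod)" "riso (urep (B_mod x r)) ?F"
      "mrel (4 * r) (\<lambda>l. transpose_mat (DA (fst x) (snd x) r l))"
    unfolding B_mod_um_of by (rule um_of_coord[OF is_rep_sop(2) q b t rquad_DA]; assumption)+
  show "um_module (B_mod x r :: 'k umod)" "riso (urep (B_mod x r)) ?F" by (rule c)+
  show "gact (B_mod x r) = (\<lambda>l. transpose_mat (DA (fst x) (snd x) r l))" unfolding B_mod_um_of by (rule ext)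
      (rule um_of_module(2)[OF c(3)])
  show "udim (B_mod x r) = 4 * r" by (simp add: B_mod_um_of)
qed

section \<open>Tensor products with A and B in coordinates\<close>

lemma unflat_lin: "unflat m d (v + w) i = unflat m d v i + unflat m d w i" "unflat m d (fscale k v) i = fscale
    k (unflat m d v i)"
  by (auto simp: unflat_def fscale_def fun_eq_iff)

lemma bij_unflat: "bij_betw (unflat m d) (kn (m * d)) {h \<in> kn m. \<forall>i. h i \<in> kn d}"
  by (rule bij_betw_byWitness[where f' = "flat m d"])
    (auto simp: flat_unflat unflat_flat unflat_kn flat_simps)

text \<open>Written as a double array, a vector of the tensor product is acted on in its first index
  by the one module and in its second index by the other.\<close>

lemma unflat_tgen:
  assumes M: "um_module (M :: 'k umod)" and N: "um_module N"
  shows "unflat (udim M) (udim N) (app (tgen M N x) v) i j =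
    app (gact M x) (\<lambda>i'. unflat (udim M) (udim N) v i' j) i + app (gact N x) (unflat (udim M) (udim N) v i) j"
proof -
  let ?m = "udim M" and ?d = "udim N"
  note c = um_module_gact[OF M, of x] um_module_gact[OF N, of x]
  note cd = carrier_matD[OF c(1)] carrier_matD[OF c(2)]
  show ?thesis
  proof (cases "i < ?m \<and> j < ?d")
    case True
    have lt: "i * ?d + j < ?m * ?d"
    proof -
      have "i * ?d + j < Suc i * ?d" using True by simp
      also have "\<dots> \<le> ?m * ?d" using True by (intro mult_le_mono1) simp
      finally show ?thesis .
    qed
    have dm: "(i * ?d + j) div ?d = i" "(i * ?d + j) mod ?d = j" using True by simp_all
    have vk: "v k = unflat ?m ?d v (k div ?d) (k mod ?d)" if "k < ?m * ?d" for k
    proof -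
      have "0 < ?d" using True by simp
      then have "k div ?d < ?m" "k mod ?d < ?d" using that by (simp_all add: less_mult_imp_div_less)
      then show ?thesis by (simp add: unflat_def)
    qed
    have dl: "(\<Sum>b<?d. g * (if j = b then 1 else 0) * u b) = g * u j" for g and u :: "nat \<Rightarrow> 'k"
    proof -
      have "(\<Sum>b<?d. g * (if j = b then 1 else 0) * u b) = (\<Sum>b<?d. if b = j then g * u b else 0)"
        by (rule sum.cong) auto
      then show ?thesis using True by (simp add: sum.delta)
    qed
    have "app (tgen M N x) v (i * ?d + j) = (\<Sum>k<?m * ?d. (gact M x $$ (i, k div ?d) * 1\<^sub>m ?d $$ (j, k mod ?d) +
        1\<^sub>m ?m $$ (i, k div ?d) * gact N x $$ (j, k mod ?d)) * v k)"
      using lt True by (simp add: app_def tgen_def kron_index[OF c(1) one_carrier_mat] kron_index[OF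
          one_carrier_mat c(2)] dm
        carrier_matD[OF kron_carrier[OF one_carrier_mat c(2)]])
    also have "\<dots> = (\<Sum>k<?m * ?d. (gact M x $$ (i, k div ?d) * 1\<^sub>m ?d $$ (j, k mod ?d) +
        1\<^sub>m ?m $$ (i, k div ?d) * gact N x $$ (j, k mod ?d)) * unflat ?m ?d v (k div ?d) (k mod ?d))"
      by (rule sum.cong) (simp_all add: vk)
    also have "\<dots> = (\<Sum>a<?m. \<Sum>b<?d. (gact M x $$ (i, a) * 1\<^sub>m ?d $$ (j, b) + 1\<^sub>m ?m $$ (i, a) * gact N x $$ (j,
        b)) * unflat ?m ?d v a b)"
      by (rule sum_divmod)
    also have "\<dots> = (\<Sum>a<?m. \<Sum>b<?d. if b = j then gact M x $$ (i, a) * unflat ?m ?d v a b else 0) +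
        (\<Sum>a<?m. if a = i then (\<Sum>b<?d. gact N x $$ (j, b) * unflat ?m ?d v a b) else 0)"
      unfolding sum.distrib[symmetric] using True
      by (intro sum.cong refl) (auto simp: distrib_right sum.distrib dl intro!: sum.cong)
    also have "\<dots> = app (gact M x) (\<lambda>i'. unflat ?m ?d v i' j) i + app (gact N x) (unflat ?m ?d v i) j"
      using True by (simp add: app_def cd sum.delta)
    finally show ?thesis using True by (simp add: unflat_def)
  next
    case False
    then show ?thesis by (auto simp: unflat_def app_def cd)
  qed
qed

text \<open>The coordinate map is \<open>unflat\<close> followed by \<open>quad_of\<close> or
  \<open>rquad_of\<close>: the index of A or B is split into block and position, that of N stays. By
  \<open>um_of_coord\<close> the module axioms come along with the isomorphism.\<close>

lemma tensor_coord:
  fixes N :: "'k umod"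
  assumes N: "um_module N" and x: "x = (x1, x2)"
  shows "um_module (A_mod x r \<otimes>\<^sub>u N)"
    "riso (urep (A_mod x r \<otimes>\<^sub>u N)) (TF1 r (cs0 x1 x2) (cs1 x1 x2) (ct0 x1 x2) (ct1 x1 x2) (urep N))"
    "um_module (B_mod x r \<otimes>\<^sub>u N)"
    "riso (urep (B_mod x r \<otimes>\<^sub>u N)) (TF0 r (cs0 x1 x2) (cs1 x1 x2) (ct0 x1 x2) (ct1 x1 x2) (urep N))"
proof -
  let ?d = "udim N" and ?n = "4 * r * udim N" and ?U = "unflat (4 * r) (udim N)"
  let ?X = "TF1 r (cs0 x1 x2) (cs1 x1 x2) (ct0 x1 x2) (ct1 x1 x2) (urep N)"
  let ?Y = "TF0 r (cs0 x1 x2) (cs1 x1 x2) (ct0 x1 x2) (ct1 x1 x2) (urep N)"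
  have c: "quad {f \<in> kn r. \<forall>i. f i \<in> kn ?d} = carr ?X" "quad {f \<in> kn r. \<forall>i. f i \<in> kn ?d} = carr ?Y" by simp_all
  have Uk: "(\<lambda>i. ?U v i j) \<in> kn (4 * r)" for v j by (auto simp: unflat_def kn_def)
  have bX: "bij_betw (\<lambda>v. quad_of (?U v)) (kn ?n) (carr ?X)"
    using bij_betw_trans[OF bij_unflat[of "4 * r" ?d] bij_quad_of[of r "kn ?d"]] unfolding c(1) comp_def .
  have bY: "bij_betw (\<lambda>v. rquad_of r (?U v)) (kn ?n) (carr ?Y)"
    using bij_betw_trans[OF bij_unflat[of "4 * r" ?d] bij_rquad_of[of "kn ?d" r, OF kn_zero]] unfolding c(2) comp_def .
  have lX: "linon (kn ?n) fscale (scl ?X) (\<lambda>v. quad_of (?U v))"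
    by (auto simp: linon_def quad_of_def unflat_lin fun_eq_iff)
  have fz: "fscale k 0 = (0 :: nat \<Rightarrow> 'k)" for k by simp
  have lY: "linon (kn ?n) fscale (scl ?Y) (\<lambda>v. rquad_of r (?U v))"
    by (auto simp: linon_def rquad_of_def unflat_lin fun_eq_iff)
  have xs: "fst x = x1" "snd x = x2" using x by simp_all
  note A = A_mod_rep[of x r, unfolded xs] and B = B_mod_rep[of x r, unfolded xs]
  have tc: "tgen M N l \<in> carrier_mat (udim M * udim N) (udim M * udim N)" if "um_module M" for M l
    unfolding tgen_def using kron_carrier[OF um_module_gact[OF that] one_carrier_mat] kron_carrier[OF
        one_carrier_mat um_module_gact[OF N]] by simp
  have UA: "?U (app (tgen (A_mod x r) N l) v) = (\<lambda>i j. app (DA x1 x2 r l) (\<lambda>i'. ?U v i' j) i + app (gact N l)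
      (?U v i) j)" for l v
    by (rule ext)+ (rule unflat_tgen[OF A(1) N, unfolded A(3,4)])
  have UB: "?U (app (tgen (B_mod x r) N l) v) = (\<lambda>i j. app (transpose_mat (DA x1 x2 r l)) (\<lambda>i'. ?U v i' j) i +
      app (gact N l) (?U v i) j)" for l v
    by (rule ext)+ (rule unflat_tgen[OF B(1) N, unfolded B(3,4)])
  have DX: "quad_of (?U (app (tgen (A_mod x r) N l) v)) = gen ?X l (quad_of (?U v))" for l v
    unfolding UA quad_of_def
    by (cases l; simp only: app_DA[OF Uk] TF1_simps) (simp_all add: fscale_def fun_eq_iff add.commute)
  have DY: "rquad_of r (?U (app (tgen (B_mod x r) N l) v)) = gen ?Y l (rquad_of r (?U v))" for l v
  proof -
    have k: "r - 1 - k < r" if "k < r" for k using that by simp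
    have app0: "app (gact N l) 0 = 0" by (auto simp: app_def)
    have c: "(if r - 1 - k = 0 then 0 else ?U v (4 * (r - 1 - k - 1) + m) j) = (if Suc k < r then ?U v (4 * (r
        - 1 - Suc k) + m) j else 0)"
      if "k < r" for k m j using that by auto
    show ?thesis
      unfolding UB rquad_of_def
      by (cases l; simp only: app_DA_transpose[OF Uk k] c TF0_simps cong: if_cong)
        (auto simp: fscale_def fun_eq_iff add.commute app0 app_def)
  qed
  have TA: "A_mod x r \<otimes>\<^sub>u N = um_of ?n (tgen (A_mod x r) N)" and TB: "B_mod x r \<otimes>\<^sub>u N = um_of ?n (tgen (B_mod x r) N)"
    using tensor_um_of[OF A(1) N] tensor_um_of[OF B(1) N] by (simp_all add: A(4) B(4))
  show "um_module (A_mod x r \<otimes>\<^sub>u N)" "riso (urep (A_mod x r \<otimes>\<^sub>u N)) ?X"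
    unfolding TA by (rule um_of_coord[OF is_rep_TF1[OF is_rep_urep[OF N]] lX bX tc[OF A(1), unfolded A(4)] DX])+
  show "um_module (B_mod x r \<otimes>\<^sub>u N)" "riso (urep (B_mod x r \<otimes>\<^sub>u N)) ?Y"
    unfolding TB by (rule um_of_coord[OF is_rep_TF0[OF is_rep_urep[OF N]] lY bY tc[OF B(1), unfolded B(4)] DY])+
qed

end

section \<open>Cosyzygies and projective covers\<close>

definition vfun :: "'a::zero vec \<Rightarrow> nat \<Rightarrow> 'a" where
  "vfun v = (\<lambda>i. if i < dim_vec v then v $ i else 0)"

lemma vfun_kn: "v \<in> carrier_vec n \<Longrightarrow> vfun v \<in> kn n"
  by (auto simp: vfun_def kn_def)

lemma vfun_vec [simp]: "f \<in> kn n \<Longrightarrow> vfun (vec n f) = f"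
  by (auto simp: vfun_def kn_def)

lemma vfun_zero [simp]: "vfun (0\<^sub>v n) = 0"
  by (auto simp: vfun_def)

lemma vfun_inject: "v \<in> carrier_vec n \<Longrightarrow> w \<in> carrier_vec n \<Longrightarrow> vfun v = vfun w \<longleftrightarrow> v = w"
proof
  assume a: "v \<in> carrier_vec n" "w \<in> carrier_vec n" "vfun v = vfun w"
  show "v = w" by (rule eq_vecI) (use a in \<open>auto simp: vfun_def fun_eq_iff split: if_splits\<close>)
qed simp

lemma vfun_add: "v \<in> carrier_vec n \<Longrightarrow> w \<in> carrier_vec n \<Longrightarrow> vfun (v + w) = vfun v + (vfun w :: nat \<Rightarrow> 'a::field)"
  by (auto simp: vfun_def)

lemma vfun_mult: "A \<in> carrier_mat n m \<Longrightarrow> v \<in> carrier_vec m \<Longrightarrow> vfun (A *\<^sub>v v) = app A (vfun v)"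
  by (auto simp: vfun_def app_def scalar_prod_def lessThan_atLeast0 intro!: sum.cong)

lemma vfun_image: "vfun ` carrier_vec n = (kn n :: (nat \<Rightarrow> 'a::zero) set)"
proof (intro equalityI subsetI)
  fix f :: "nat \<Rightarrow> 'a" assume "f \<in> kn n"
  then show "f \<in> vfun ` carrier_vec n" by (intro image_eqI[of _ _ "vec n f"]) simp_all
qed (auto simp: vfun_kn)

lemma vfun_mat_image:
  assumes "A \<in> carrier_mat n m"
  shows "vfun ` mat_image A = app A ` kn m"
proof -
  have "vfun ` mat_image A = (\<lambda>v. vfun (A *\<^sub>v v)) ` carrier_vec m"
    using assms by (auto simp: mat_image_def)
  also have "\<dots> = (\<lambda>v. app A (vfun v)) ` carrier_vec m" by (rule image_cong) (simp_all add: vfun_mult[OF assms])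
  also have "\<dots> = app A ` kn m" by (simp add: vfun_image[symmetric] image_image)
  finally show ?thesis .
qed

lemma umod_inj_iff: "umod_inj M N f \<longleftrightarrow> f \<in> umod_hom M N \<and> inj_on (app f) (kn (udim M))"
proof -
  have "inj_on (\<lambda>v. f *\<^sub>v v) (carrier_vec (udim M)) \<longleftrightarrow> inj_on (app f) (kn (udim M))" if h: "f \<in> umod_hom M N"
  proof -
    note c = umod_homD(1)[OF h]
    have "f *\<^sub>v v = f *\<^sub>v w \<longleftrightarrow> app f (vfun v) = app f (vfun w)"
      if "v \<in> carrier_vec (udim M)" "w \<in> carrier_vec (udim M)" for v w
      using vfun_inject[OF mult_mat_vec_carrier[OF c that(1)] mult_mat_vec_carrier[OF c that(2)]]
      by (simp add: vfun_mult[OF c] that)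
    then show ?thesis
      unfolding vfun_image[symmetric] inj_on_def by (simp add: vfun_inject)
  qed
  then show ?thesis unfolding umod_inj_def by blast
qed

lemma vfun_image_inject:
  assumes "A \<subseteq> carrier_vec n" "B \<subseteq> carrier_vec n"
  shows "vfun ` A = vfun ` B \<longleftrightarrow> A = B"
proof -
  have "inj_on vfun (carrier_vec n)" by (rule inj_onI) (simp add: vfun_inject)
  then show ?thesis using assms by (rule inj_on_image_eq_iff)
qed

lemma umod_surj_iff: "umod_surj M N f \<longleftrightarrow> f \<in> umod_hom M N \<and> app f ` kn (udim M) = kn (udim N)"
proof -
  have "mat_image f = carrier_vec (udim N) \<longleftrightarrow> app f ` kn (udim M) = kn (udim N)" if h: "f \<in> umod_hom M N"
  proof -
    note c = umod_homD(1)[OF h]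
    have "mat_image f \<subseteq> carrier_vec (udim N)" using c by (auto simp: mat_image_def)
    from vfun_image_inject[OF this subset_refl] show ?thesis
      unfolding vfun_mat_image[OF c] vfun_image by simp
  qed
  then show ?thesis unfolding umod_surj_def by blast
qed

lemma umod_hom_mult:
  assumes M: "um_module M" and N: "um_module N" and f: "f \<in> umod_hom M N" and v: "v \<in> carrier_vec (udim M)"
  shows "f *\<^sub>v (uact M h *\<^sub>v v) = uact N h *\<^sub>v (f *\<^sub>v v)"
proof -
  note c = umod_homD(1)[OF f]
  have "f * uact M h = uact N h * f" using f by (simp add: umod_hom_def)
  then show ?thesis
    using assoc_mult_mat_vec[OF c um_moduleD(1)[OF M] v, of h] assoc_mult_mat_vec[OF um_moduleD(1)[OF N] c v,
        of h] by simp
qed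

lemma submodule_kernel:
  assumes M: "um_module M" and N: "um_module N" and f: "f \<in> umod_hom M N"
  shows "submodule_of (mat_kernel f) M"
proof -
  note c = umod_homD(1)[OF f]
  have k: "mat_kernel f = {v \<in> carrier_vec (udim M). f *\<^sub>v v = 0\<^sub>v (udim N)}"
    using c by (auto simp: mat_kernel_def)
  have z: "A *\<^sub>v 0\<^sub>v m = 0\<^sub>v n" if "A \<in> carrier_mat n m" for A :: "'a mat" and n m
    by (rule eq_vecI) (use that in auto)
  show ?thesis
    unfolding submodule_of_def k
    using z[OF c] z[OF um_moduleD(1)[OF N]]
    by (auto simp: mult_add_distrib_mat_vec[OF c] umod_hom_mult[OF M N f] mult_mat_vec_carrier[OF um_moduleD(1)[OF M]])
qed

lemma submodule_image:
  assumes M: "um_module M" and N: "um_module N" and f: "f \<in> umod_hom M N"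
  shows "submodule_of (mat_image f) N"
proof -
  note c = umod_homD(1)[OF f]
  have k: "mat_image f = (\<lambda>v. f *\<^sub>v v) ` carrier_vec (udim M)"
    using c by (auto simp: mat_image_def)
  have z: "f *\<^sub>v 0\<^sub>v (udim M) = 0\<^sub>v (udim N)"
    by (rule eq_vecI) (use c in auto)
  show ?thesis
    unfolding submodule_of_def k
  proof (intro conjI ballI allI)
    show "(\<lambda>v. f *\<^sub>v v) ` carrier_vec (udim M) \<subseteq> carrier_vec (udim N)" using mult_mat_vec_carrier[OF c] by blast
    show "0\<^sub>v (udim N) \<in> (\<lambda>v. f *\<^sub>v v) ` carrier_vec (udim M)" using z by (intro image_eqI[of _ _ "0\<^sub>v (udim
        M)"]) simp_all
  next
    fix v w assume "v \<in> (\<lambda>v. f *\<^sub>v v) ` carrier_vec (udim M)" "w \<in> (\<lambda>v. f *\<^sub>v v) ` carrier_vec (udim M)"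
    then obtain v' w' where "v = f *\<^sub>v v'" "w = f *\<^sub>v w'" "v' \<in> carrier_vec (udim M)" "w' \<in> carrier_vec (udim
        M)" by blast
    then show "v + w \<in> (\<lambda>v. f *\<^sub>v v) ` carrier_vec (udim M)"
      by (intro image_eqI[of _ _ "v' + w'"]) (simp_all add: mult_add_distrib_mat_vec[OF c])
  next
    fix h v assume "v \<in> (\<lambda>v. f *\<^sub>v v) ` carrier_vec (udim M)"
    then obtain v' where "v = f *\<^sub>v v'" "v' \<in> carrier_vec (udim M)" by blast
    then show "uact N h *\<^sub>v v \<in> (\<lambda>v. f *\<^sub>v v) ` carrier_vec (udim M)"
      by (intro image_eqI[of _ _ "uact M h *\<^sub>v v'"])
        (simp_all add: umod_hom_mult[OF M N f] mult_mat_vec_carrier[OF um_moduleD(1)[OF M]])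
  qed
qed

section \<open>Uniqueness of envelopes and covers\<close>

context char2
begin

lemma urep_injective:
  assumes I: "injective_umod (I :: 'k umod)" and M: "um_module M" and N: "um_module N"
    and j: "rhom (urep M) (urep N) j" "inj_on j (kn (udim M))" and f: "rhom (urep M) (urep I) f"
  obtains g where "rhom (urep N) (urep I) g" "\<And>v. v \<in> kn (udim M) \<Longrightarrow> g (j v) = f v"
proof -
  have Im: "um_module I" using I by (simp add: injective_umod_def)
  let ?J = "mat_of (udim N) (udim M) j" and ?F = "mat_of (udim I) (udim M) f"
  note J = app_rhom[OF j(1) M N] and F = app_rhom[OF f M Im]
  have "inj_on (app ?J) (kn (udim M))" using j(2) by (simp add: inj_on_def J(2))
  then obtain g where g: "g \<in> umod_hom N I" "g * ?J = ?F"
    using I J(1) F(1) M N unfolding injective_umod_def umod_inj_iff by blast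
  have "app g (j v) = f v" if "v \<in> kn (udim M)" for v
    using app_mult[OF umod_homD(1)[OF g(1)] umod_homD(1)[OF J(1)], of v] that by (simp add: g(2) J(2) F(2))
  then show ?thesis using that[OF rhom_app[OF N Im g(1)]] by blast
qed

text \<open>The kernel of \<open>g\<close> is a submodule that meets the image of
  \<open>\<iota>\<close> only in 0, so the envelope condition makes it 0.\<close>

lemma envelope_essential:
  assumes env: "injective_envelope (M :: 'k umod) I \<iota>" and M: "um_module M" and N: "um_module N"
    and g: "rhom (urep I) (urep N) g" and inj: "\<And>v. v \<in> kn (udim M) \<Longrightarrow> g (app \<iota> v) = 0 \<Longrightarrow> v = 0"
  shows "inj_on g (kn (udim I))"
proof -
  have I: "um_module I" and i: "\<iota> \<in> umod_hom M I"
    using env by (auto simp: injective_envelope_def injective_umod_def umod_inj_def)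
  let ?G = "mat_of (udim N) (udim I) g"
  note G = app_rhom[OF g I N] and ic = umod_homD(1)[OF i]
  note Gc = umod_homD(1)[OF G(1)]
  have ker: "v \<in> mat_kernel ?G \<longleftrightarrow> v \<in> carrier_vec (udim I) \<and> g (vfun v) = 0" for v
  proof -
    have "?G *\<^sub>v v = 0\<^sub>v (udim N) \<longleftrightarrow> g (vfun v) = 0" if v: "v \<in> carrier_vec (udim I)"
      using vfun_inject[OF mult_mat_vec_carrier[OF Gc v], of "0\<^sub>v (udim N)"] v
      by (simp add: vfun_mult[OF Gc] G(2) vfun_kn)
    then show ?thesis using carrier_matD[OF Gc] by (auto simp: mat_kernel_def simp del: mat_of_carrier)
  qed
  have "mat_kernel ?G \<inter> mat_image \<iota> = {0\<^sub>v (udim I)}"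
  proof (intro equalityI subsetI)
    fix w :: "'k vec" assume w: "w \<in> mat_kernel ?G \<inter> mat_image \<iota>"
    then obtain v where v: "v \<in> carrier_vec (udim M)" "w = \<iota> *\<^sub>v v" using ic by (auto simp: mat_image_def)
    then have "g (app \<iota> (vfun v)) = 0" using w ker[of w] by (simp add: vfun_mult[OF ic])
    then have "vfun v = 0" using inj vfun_kn[OF v(1)] by blast
    then have "vfun w = 0" using v vfun_mult[OF ic v(1)] by (simp add: app_def fun_eq_iff)
    then show "w \<in> {0\<^sub>v (udim I)}" using vfun_inject[of w "udim I" "0\<^sub>v (udim I)"] w ker[of w] by simp
  next
    fix w :: "'k vec" assume "w \<in> {0\<^sub>v (udim I)}"
    then show "w \<in> mat_kernel ?G \<inter> mat_image \<iota>"
      using submodule_kernel[OF I N G(1)] submodule_image[OF M I i] by (auto simp: submodule_of_def)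
  qed
  then have k: "mat_kernel ?G = {0\<^sub>v (udim I)}"
    using env submodule_kernel[OF I N G(1)] by (auto simp: injective_envelope_def)
  have "v = 0" if v: "v \<in> kn (udim I)" "g v = 0" for v
  proof -
    have "vec (udim I) v \<in> mat_kernel ?G" using ker v by simp
    then have "vec (udim I) v = 0\<^sub>v (udim I)" using k by simp
    then show ?thesis using v vfun_vec[OF v(1)] vfun_zero by metis
  qed
  then show ?thesis
    using rhom_inj_iff[OF g is_rep_urep[OF I] is_rep_urep[OF N]] by simp
qed

lemma cokernel_rses:
  assumes env: "injective_envelope (M :: 'k umod) I \<iota>" and M: "um_module M" and cok: "is_cokernel I \<iota> C"
  obtains p where "rses (urep M) (urep I) (urep C) (app \<iota>) p"
proof -
  have I: "um_module I" and i: "\<iota> \<in> umod_hom M I" "inj_on (app \<iota>) (kn (udim M))"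
    using env by (auto simp: injective_envelope_def injective_umod_def umod_inj_iff)
  have C: "um_module C" using cok by (simp add: is_cokernel_def)
  obtain p where p: "p \<in> umod_hom I C" "app p ` kn (udim I) = kn (udim C)" "mat_kernel p = mat_image \<iota>"
    using cok by (auto simp: is_cokernel_def umod_surj_iff)
  note c = umod_homD(1)[OF p(1)] and ic = umod_homD(1)[OF i(1)]
  have "app p y = 0 \<longleftrightarrow> y \<in> app \<iota> ` kn (udim M)" if y: "y \<in> kn (udim I)" for y
  proof -
    let ?v = "vec (udim I) y"
    have "app p y = 0 \<longleftrightarrow> ?v \<in> mat_kernel p"
      using vfun_inject[OF mult_mat_vec_carrier[OF c, of ?v], of "0\<^sub>v (udim C)"] y c
      by (simp add: mat_kernel_def vfun_mult[OF c])
    also have "\<dots> \<longleftrightarrow> vfun ?v \<in> vfun ` mat_image \<iota>"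
    proof -
      have "mat_image \<iota> \<subseteq> carrier_vec (udim I)" using ic by (auto simp: mat_image_def)
      moreover have "inj_on vfun (carrier_vec (udim I) :: 'k vec set)" by (rule inj_onI) (simp add: vfun_inject)
      ultimately show ?thesis unfolding p(3) by (intro inj_on_image_mem_iff[symmetric]) simp_all
    qed
    also have "\<dots> \<longleftrightarrow> y \<in> app \<iota> ` kn (udim M)" using y by (simp add: vfun_mat_image[OF ic])
    finally show ?thesis .
  qed
  then have "rses (urep M) (urep I) (urep C) (app \<iota>) (app p)"
    using rhom_app[OF M I i(1)] rhom_app[OF I C p(1)] i(2) p(2) by (simp add: rses_def)
  then show ?thesis by (rule that)
qed

text \<open>Uniqueness of injective envelopes with their cokernels: the map from \<open>W\<close>
  extends to \<open>g\<close> from \<open>I\<close> to \<open>E\<close>, injective because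
  \<open>M\<close> is essential in \<open>I\<close>; injectivity of \<open>I\<close> provides a left
  inverse of \<open>g\<close>, itself injective because \<open>S\<close> is essential in
  \<open>E\<close>. Injectivity of \<open>E\<close> enters as the hypothesis \<open>inj\<close>, so
  that \<open>E0\<close> and \<open>E1\<close> are treated together.\<close>

lemma cokernel_riso:
  fixes W :: "('k, 'w::ab_group_add) rep" and E :: "('k, 'e::ab_group_add) rep" and W' :: "('k, 'u::ab_group_add) rep"
  assumes env: "injective_envelope (M :: 'k umod) I \<iota>" and M: "um_module M" and cok: "is_cokernel I \<iota> C"
    and iso: "riso (urep M) W" and W: "is_rep W" and E: "is_rep E" "fdim (carr E) (scl E) N" and W': "is_rep W'"
    and ses: "rses W E W' f q" and soc: "ress E S" "S \<subseteq> f ` carr W"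
    and inj: "\<And>X Y j h. um_module X \<Longrightarrow> um_module Y \<Longrightarrow> rhom (urep X) (urep Y) j \<Longrightarrow> inj_on j (kn (udim X)) \<Longrightarrow>
      rhom (urep X) E h \<Longrightarrow> \<exists>g. rhom (urep Y) E g \<and> (\<forall>x\<in>kn (udim X). g (j x) = h x)"
  shows "um_module C" "riso (urep C) W'"
proof -
  have Ii: "injective_umod I" and I: "um_module I" and i: "\<iota> \<in> umod_hom M I" "inj_on (app \<iota>) (kn (udim M))"
    using env by (auto simp: injective_envelope_def injective_umod_def umod_inj_iff)
  show C: "um_module C" using cok by (simp add: is_cokernel_def)
  obtain p where p: "rses (urep M) (urep I) (urep C) (app \<iota>) p" by (rule cokernel_rses[OF env M cok])
  obtain m where m: "rhom (urep M) W m" "bij_betw m (kn (udim M)) (carr W)" using iso by (auto simp: riso_def)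
  have f: "rhom W E f" "inj_on f (carr W)" using ses by (auto simp: rses_def)
  \<comment> \<open>A matrix copy of \<open>E\<close>, which can be used where the definitions speak
    of a \<open>umod\<close>.\<close>
  obtain J where J: "um_module J" "udim J = N" "riso (urep J) E" by (rule rep_coordinates[OF E])
  obtain e where e: "rhom E (urep J) e" "bij_betw e (carr E) (carr (urep J))"
    using riso_sym[OF is_rep_urep[OF J(1)] J(3)] by (auto simp: riso_def)
  note hi = rhom_app[OF M I i(1)]
  obtain g where g: "rhom (urep I) E g" "\<And>x. x \<in> kn (udim M) \<Longrightarrow> g (app \<iota> x) = f (m x)"
    using inj[OF M I hi i(2) rhom_comp[OF m(1) f(1)]] by blast
  have mW: "m v \<in> carr W" if "v \<in> kn (udim M)" for v using m(2) that by (auto simp: bij_betw_def)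
  have z: "m 0 = 0" "f 0 = 0" "g 0 = 0" "e 0 = 0"
    by (rule rhom_zero[OF m(1) is_rep_urep[OF M] W] rhom_zero[OF f(1) W E(1)]
      rhom_zero[OF g(1) is_rep_urep[OF I] E(1)] rhom_zero[OF e(1) E(1) is_rep_urep[OF J(1)]])+
  have gE: "g v \<in> carr E" if "v \<in> kn (udim I)" for v using rhomD(1)[OF g(1)] that by simp
  have gi: "inj_on (\<lambda>v. e (g v)) (kn (udim I))"
  proof (rule envelope_essential[OF env M J(1) rhom_comp[OF g(1) e(1)]])
    fix v :: "nat \<Rightarrow> 'k" assume v: "v \<in> kn (udim M)" "e (g (app \<iota> v)) = 0"
    have "f (m v) \<in> carr E" by (rule rhomD(1)[OF f(1) mW[OF v(1)]])
    then have "f (m v) = 0" using inj_onD[OF bij_betw_imp_inj_on[OF e(2)], of "f (m v)" 0] v z E(1) by (simp add: g(2))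
    then have "m v = 0" using inj_onD[OF f(2), of "m v" 0] mW[OF v(1)] z W by simp
    then show "v = 0" using inj_onD[OF bij_betw_imp_inj_on[OF m(2)], of v 0] v z by simp
  qed
  obtain r where r: "rhom (urep J) (urep I) r" "\<And>v. v \<in> kn (udim I) \<Longrightarrow> r (e (g v)) = v"
    using urep_injective[OF Ii I J(1) rhom_comp[OF g(1) e(1)] gi rhom_id] by blast
  note re = rhom_comp[OF e(1) r(1)]
  have reI: "r (e x) \<in> kn (udim I)" if "x \<in> carr E" for x using rhomD(1)[OF re that] by simp
  have ri: "inj_on (\<lambda>x. r (e x)) (carr E)"
  \<comment> \<open>An element of \<open>S\<close> comes from \<open>M\<close>, so it is
    \<open>g\<close> of some element of \<open>I\<close>, which the left inverse recovers.\<close>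
  proof (rule ress_inj[OF re E(1) is_rep_urep[OF I] soc(1)])
    fix x assume x: "x \<in> S" "r (e x) = 0"
    then obtain v where v: "v \<in> kn (udim M)" "x = f (m v)"
      using soc(2) unfolding bij_betw_imp_surj_on[OF m(2), symmetric] by blast
    then have "x = g (app \<iota> v)" by (simp add: g(2))
    moreover have "app \<iota> v \<in> kn (udim I)" using rhomD(1)[OF hi] v(1) by simp
    ultimately show "x = 0" using x(2) r(2)[of "app \<iota> v"] z by simp
  qed
  have gb: "bij_betw g (carr (urep I)) (carr E)"
  proof (rule bij_betw_byWitness[where f' = "\<lambda>x. r (e x)"])
    show "\<forall>v\<in>carr (urep I). r (e (g v)) = v" using r(2) by simp
    show "\<forall>x\<in>carr E. g (r (e x)) = x"
    proof
      fix x assume x: "x \<in> carr E"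
      show "g (r (e x)) = x"
        by (rule inj_onD[OF ri]) (use r(2)[OF reI[OF x]] x gE[OF reI[OF x]] in simp_all)
    qed
  qed (use reI gE in auto)
  show "riso (urep C) W'"
    by (rule rses_unique[OF p ses m(1) _ g(1) gb]) (use m(2) g(2) I C E W' in simp_all)
qed

text \<open>Whatever envelopes and cokernels are chosen, each step agrees with the explicit sequence
  given by \<open>kexact_shift\<close>; the parity of i + s decides between \<open>E0\<close> and
  \<open>E1\<close>.\<close>

lemma Omega_neg_riso:
  assumes "is_Omega_neg s V W" and V: "V = (V_simple i :: 'k umod)" and i: "i \<in> {0, 1}"
  shows "um_module W \<and> riso (urep W) (Wr i s)"
  using assms(1) V
proof (induction rule: is_Omega_neg.induct)
  case (zero V)
  show ?case
  proof (cases "i = 0")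
    case True
    then show ?thesis using zero V_simple_0 riso_trans[OF _ riso_sym[OF is_rep_Wr riso_Wr_0(1)]] by blast
  next
    case False
    then have "i = 1" using i by simp
    then show ?thesis using zero V_simple_1 riso_trans[OF _ riso_sym[OF is_rep_Wr riso_Wr_0(2)]] by blast
  qed
next
  case (Suc s V M I \<iota> C)
  then have M: "um_module M" "riso (urep M) (Wr i s)" by blast+
  have C: "um_module C" using Suc(3) by (simp add: is_cokernel_def)
  note k = kexact_shift[of s]
  have p: "pen s (Suc s) (\<lambda>f. f :: nat \<Rightarrow> 'k)" "pen s (Suc s) (shiftr :: (nat \<Rightarrow> 'k) \<Rightarrow> _)" using k by (simp_all
      add: kexact_def)
  show ?case
  proof (cases "even (i + s)")
    case True
    then have w: "Wr i s = F0 s (Suc s) (\<lambda>f. f) shiftr" "Wr i (Suc s) = F1 (Suc s) (Suc (Suc s)) (\<lambda>f. f) shiftr"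
      by (simp_all add: Wr_def)
    note j = rses_F0[OF k, folded w hull0_def]
    show ?thesis
    proof (intro conjI C, rule cokernel_riso(2)[OF Suc(2) M(1) Suc(3) M(2) is_rep_Wr is_rep_E0 fdim_E0
        is_rep_Wr j ress_E0])
      show "soc0 (Suc s) \<subseteq> hull0 (\<lambda>f. f) shiftr ` carr (Wr i s)" unfolding w by (rule soc_hull(2)[OF p])
    next
      fix X Y :: "'k umod" and j h
      assume a: "um_module X" "um_module Y" "rhom (urep X) (urep Y) j" "inj_on j (kn (udim X))" "rhom (urep X)
          (E0 (Suc s)) h"
      show "\<exists>g. rhom (urep Y) (E0 (Suc s)) g \<and> (\<forall>x\<in>kn (udim X). g (j x) = h x)"
        by (rule E0_injective[OF is_rep_urep[OF a(1)] fdim_urep is_rep_urep[OF a(2)] a(3) _ a(5)]) (use a(4) in auto)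
    qed
  next
    case False
    then have w: "Wr i s = F1 s (Suc s) (\<lambda>f. f) shiftr" "Wr i (Suc s) = F0 (Suc s) (Suc (Suc s)) (\<lambda>f. f) shiftr"
      by (simp_all add: Wr_def)
    note j = rses_F1[OF k, folded w hull1_def]
    show ?thesis
    proof (intro conjI C, rule cokernel_riso(2)[OF Suc(2) M(1) Suc(3) M(2) is_rep_Wr is_rep_E1 fdim_E1
        is_rep_Wr j ress_E1])
      show "soc1 (Suc s) \<subseteq> hull1 (\<lambda>f. f) shiftr ` carr (Wr i s)" unfolding w by (rule soc_hull(1)[OF p])
    next
      fix X Y :: "'k umod" and j h
      assume a: "um_module X" "um_module Y" "rhom (urep X) (urep Y) j" "inj_on j (kn (udim X))" "rhom (urep X)
          (E1 (Suc s)) h"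
      show "\<exists>g. rhom (urep Y) (E1 (Suc s)) g \<and> (\<forall>x\<in>kn (udim X). g (j x) = h x)"
        by (rule E1_injective[OF is_rep_urep[OF a(1)] fdim_urep is_rep_urep[OF a(2)] a(3) _ a(5)]) (use a(4) in auto)
    qed
  qed
qed

lemma projective_cover_riso:
  fixes E :: "('k, 'e::ab_group_add) rep" and Vr :: "('k, 'w::ab_group_add) rep"
  assumes cov: "projective_cover (P :: 'k umod) V" and V: "um_module V" "riso (urep V) Vr"
    and E: "is_rep E" "fdim (carr E) (scl E) N" and top: "\<pi> ` carr E = carr Vr" and Vr: "is_rep Vr"
    and lift: "\<And>p. rhom (urep P) Vr p \<Longrightarrow> p ` kn (udim P) = carr Vr \<Longrightarrow>
      \<exists>h. rhom E (urep P) h \<and> (\<forall>x\<in>carr E. p (h x) = \<pi> x)"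
    and endo: "\<And>k. rhom E E k \<Longrightarrow> (\<forall>x\<in>carr E. \<pi> (k x) = \<pi> x) \<Longrightarrow> inj_on k (carr E)"
  shows "um_module P" "riso (urep P) E"
proof -
  have pr: "projective_umod P" using cov by (simp add: projective_cover_def)
  then show P: "um_module P" by (simp add: projective_umod_def)
  obtain p where p: "p \<in> umod_hom P V" "app p ` kn (udim P) = kn (udim V)"
    and small: "\<And>W. submodule_of W P \<Longrightarrow> {v + w |v w. v \<in> W \<and> w \<in> mat_kernel p} = carrier_vec (udim P) \<Longrightarrow> W =
        carrier_vec (udim P)"
    using cov by (auto simp: projective_cover_def umod_surj_iff)
  note pc = umod_homD(1)[OF p(1)]
  obtain n where n: "rhom (urep V) Vr n" "bij_betw n (kn (udim V)) (carr Vr)" using V(2) by (auto simp: riso_def)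
  note hp = rhom_app[OF P V(1) p(1)]
  let ?q = "\<lambda>v. n (app p v)"
  note hq = rhom_comp[OF hp n(1)]
  have "?q ` kn (udim P) = carr Vr" using p(2) bij_betw_imp_surj_on[OF n(2)] by (simp add: image_image[symmetric])
  from lift[OF hq this] obtain h where h: "rhom E (urep P) h" "\<And>x. x \<in> carr E \<Longrightarrow> ?q (h x) = \<pi> x" by blast
  obtain J where J: "um_module J" "udim J = N" "riso (urep J) E" by (rule rep_coordinates[OF E])
  obtain e where e: "rhom (urep J) E e" "bij_betw e (kn (udim J)) (carr E)" using J(3) by (auto simp: riso_def)
  let ?H = "mat_of (udim P) (udim J) (\<lambda>v. h (e v))"
  note H = app_rhom[OF rhom_comp[OF e(1) h(1)] J(1) P]
  note Hc = umod_homD(1)[OF H(1)]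
  \<comment> \<open>Given \<open>u\<close>, take \<open>x\<close> in \<open>E\<close> with the same
    image in V; then h x + u lies in the kernel of the cover, and adding h x once more returns
    \<open>u\<close>.\<close>
  have "carrier_vec (udim P) \<subseteq> {v + w |v w. v \<in> mat_image ?H \<and> w \<in> mat_kernel p}"
  proof
    fix u :: "'k vec" assume u: "u \<in> carrier_vec (udim P)"
    let ?u = "vfun u"
    have "?q ?u \<in> carr Vr" using rhomD(1)[OF hq] vfun_kn[OF u] by simp
    then obtain x where x: "x \<in> carr E" "\<pi> x = ?q ?u" using top by (metis imageE)
    then obtain y where y: "y \<in> kn (udim J)" "e y = x" using x(1) unfolding bij_betw_imp_surj_on[OF e(2),
        symmetric] by blast
    let ?v = "vec (udim P) (h x)"
    have hx: "h x \<in> kn (udim P)" using rhomD(1)[OF h(1) x(1)] by simp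
    have "?v = ?H *\<^sub>v vec (udim J) y"
      using vfun_inject[OF _ mult_mat_vec_carrier[OF Hc], of ?v "vec (udim J) y"] hx y by (simp add:
          vfun_mult[OF Hc] H(2))
    then have v: "?v \<in> mat_image ?H"
      unfolding mat_image_def carrier_matD(2)[OF Hc] by (intro image_eqI[of _ _ "vec (udim J) y"]) simp_all
    let ?w = "?v + u"
    have w: "?w \<in> carrier_vec (udim P)" using u by simp
    have fw: "vfun ?w = h x + ?u" using vfun_add[OF _ u, of ?v] hx by simp
    have "?q (h x + ?u) = ?q (h x) + ?q ?u" using rhomD(2)[OF hq, of "h x" ?u] hx vfun_kn[OF u] by simp
    also have "\<dots> = 0" using h(2)[OF x(1)] x(2) rep_self[OF Vr] by simp
    finally have "n (app p (h x + ?u)) = n 0" by (simp add: rhom_zero[OF n(1) is_rep_urep[OF V(1)] Vr])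
    then have "app p (h x + ?u) = 0" using inj_onD[OF bij_betw_imp_inj_on[OF n(2)]] app_kn[OF pc] by simp
    then have "p *\<^sub>v ?w = 0\<^sub>v (udim V)"
      using vfun_inject[OF mult_mat_vec_carrier[OF pc w], of "0\<^sub>v (udim V)"] by (simp add: vfun_mult[OF pc w] fw)
    then have wk: "?w \<in> mat_kernel p" using w pc by (simp add: mat_kernel_def)
    have "u = ?v + ?w"
    proof (rule eq_vecI)
      fix l assume l: "l < dim_vec (?v + ?w)"
      then have "l < udim P" using u by simp
      then show "u $ l = (?v + ?w) $ l" using u by (simp add: add.assoc[symmetric])
    qed (use u in simp)
    then show "u \<in> {v + w |v w. v \<in> mat_image ?H \<and> w \<in> mat_kernel p}" using v wk by blast
  qed
  moreover have "{v + w |v w. v \<in> mat_image ?H \<and> w \<in> mat_kernel p} \<subseteq> carrier_vec (udim P)"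
    using pc submodule_image[OF J(1) P H(1)] by (auto simp: submodule_of_def mat_kernel_def)
  ultimately have "mat_image ?H = carrier_vec (udim P)" by (rule small[OF submodule_image[OF J(1) P H(1)]
      equalityI, rotated])
  then have Hs: "umod_surj J P ?H" using H(1) by (simp add: umod_surj_def)
  have one: "1\<^sub>m (udim P) \<in> umod_hom P P"
    using left_mult_one_mat[OF um_moduleD(1)[OF P]] right_mult_one_mat[OF um_moduleD(1)[OF P]] by (simp add:
        umod_hom_def)
  \<comment> \<open>The identity of \<open>P\<close> is lifted through the surjection, giving a
    section of \<open>h\<close> with values in the matrix copy of \<open>E\<close>.\<close>
  obtain k where k: "k \<in> umod_hom P J" "?H * k = 1\<^sub>m (udim P)"
    using pr Hs one J(1) P unfolding projective_umod_def by blast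
  note kc = umod_homD(1)[OF k(1)]
  let ?k = "\<lambda>v. e (app k v)"
  note hk = rhom_comp[OF rhom_app[OF P J(1) k(1)] e(1)]
  have k1: "h (?k v) = v" if "v \<in> kn (udim P)" for v
    using app_mult[OF Hc kc, of v] that by (simp add: k(2) H(2) app_kn[OF kc] app_one)
  have hP: "h x \<in> kn (udim P)" if "x \<in> carr E" for x using rhomD(1)[OF h(1) that] by simp
  have kE: "?k v \<in> carr E" if "v \<in> kn (udim P)" for v using rhomD(1)[OF hk] that by simp
  have "inj_on (\<lambda>x. ?k (h x)) (carr E)"
  proof (rule endo[OF rhom_comp[OF h(1) hk]], rule ballI)
    fix x assume x: "x \<in> carr E"
    show "\<pi> (?k (h x)) = \<pi> x"
      using h(2)[OF kE[OF hP[OF x]]] h(2)[OF x] k1[OF hP[OF x]] by simp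
  qed
  then have "inj_on h (carr E)" by (auto simp: inj_on_def)
  moreover have "h ` carr E = kn (udim P)" using hP k1 kE by force
  ultimately have "riso E (urep P)" using risoI[OF h(1)] by (simp add: bij_betw_def)
  then show "riso (urep P) E" by (rule riso_sym[OF E(1)])
qed

lemma projective_cover_V0:
  assumes cov: "projective_cover (P :: 'k umod) (V_simple 0)"
  shows "um_module P" "riso (urep P) (E0 1)"
proof -
  show P: "um_module P" using cov by (simp add: projective_cover_def projective_umod_def)
  show "riso (urep P) (E0 1)"
  proof (rule projective_cover_riso(2)[OF cov V_simple_0 is_rep_E0 fdim_E0 _ is_rep_V0r, of "\<lambda>x. fst x 0"])
    have "c \<in> (\<lambda>x. fst x 0) ` carr (E0 1)" for c :: 'k
      by (rule image_eqI[of _ _ "(\<lambda>i. if i = 0 then c else 0, 0, 0, 0, 0, 0, 0, 0)"]) (simp_all add: kn_def)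
    then show "(\<lambda>x. fst x 0) ` carr (E0 1) = carr (V0r :: ('k, _) rep)"
      unfolding V0r_simps by (rule UNIV_eq_I[symmetric])
  next
    fix p assume p: "rhom (urep P) V0r p" "p ` kn (udim P) = carr V0r"
    show "\<exists>h. rhom (E0 1) (urep P) h \<and> (\<forall>x\<in>carr (E0 1). p (h x) = fst x 0)"
      by (rule E0_lift[OF is_rep_urep[OF P] p(1)]) (use p(2) in simp, blast)
  next
    fix k :: "(nat \<Rightarrow> 'k) oct \<Rightarrow> (nat \<Rightarrow> 'k) oct"
    assume k: "rhom (E0 1) (E0 1 :: ('k, _) rep) k" "\<forall>x\<in>carr (E0 1 :: ('k, _) rep). fst (k x) 0 = fst x 0"
    show "inj_on k (carr (E0 1 :: ('k, _) rep))" by (rule E0_endo_inj[OF k(1) bspec[OF k(2)]])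
  qed
qed

lemma projective_cover_V1:
  assumes cov: "projective_cover (P :: 'k umod) (V_simple 1)"
  shows "um_module P" "riso (urep P) (E1 1)"
proof -
  let ?t = "\<lambda>x :: (nat \<Rightarrow> 'k) oct. (fst x 0, fst (snd x) 0, fst (snd (snd x)) 0)"
  show P: "um_module P" using cov by (simp add: projective_cover_def projective_umod_def)
  show "riso (urep P) (E1 1)"
  proof (rule projective_cover_riso(2)[OF cov V_simple_1 is_rep_E1 fdim_E1 _ is_rep_V1r, of ?t])
    have "c \<in> ?t ` carr (E1 1)" for c :: "'k \<times> 'k \<times> 'k"
      by (rule image_eqI[of _ _ "(\<lambda>i. if i = 0 then fst c else 0, \<lambda>i. if i = 0 then fst (snd c) else 0,
            \<lambda>i. if i = 0 then snd (snd c) else 0, 0, 0, 0, 0, 0)"]) (simp_all add: kn_def)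
    then show "?t ` carr (E1 1) = carr (V1r :: ('k, _) rep)"
      unfolding V1r_simps by (rule UNIV_eq_I[symmetric])
  next
    fix p assume p: "rhom (urep P) V1r p" "p ` kn (udim P) = carr V1r"
    show "\<exists>h. rhom (E1 1) (urep P) h \<and> (\<forall>x\<in>carr (E1 1). p (h x) = ?t x)"
      by (rule E1_lift[OF is_rep_urep[OF P] p(1)]) (use p(2) in simp, blast)
  next
    fix k :: "(nat \<Rightarrow> 'k) oct \<Rightarrow> (nat \<Rightarrow> 'k) oct"
    assume k: "rhom (E1 1) (E1 1 :: ('k, _) rep) k" "\<forall>x\<in>carr (E1 1 :: ('k, _) rep). ?t (k x) = ?t x"
    have "fst (snd (k x)) 0 = fst (snd x) 0" if "x \<in> carr (E1 1 :: ('k, _) rep)" for x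
      using bspec[OF k(2) that] by (simp only: prod.inject)
    then show "inj_on k (carr (E1 1 :: ('k, _) rep))" by (rule E1_endo_inj[OF k(1)])
  qed
qed

section \<open>Return from explicit representations to matrix modules\<close>

lemma P_mod_rep:
  assumes P0: "projective_cover (P0 :: 'k umod) (V_simple 0)" and P1: "projective_cover P1 (V_simple 1)"
  shows "um_module (P_mod P0 P1 m n)" "riso (urep (P_mod P0 P1 m n)) (Pr m n)"
proof -
  note c = um_module_copies[OF projective_cover_V0(1)[OF P0],
      of m] um_module_copies[OF projective_cover_V1(1)[OF P1], of n]
  show "um_module (P_mod P0 P1 m n)" unfolding P_mod_def by (rule um_module_sum[OF c])
  show "riso (urep (P_mod P0 P1 m n)) (Pr m n)"
    unfolding P_mod_def Pr_def
    by (rule riso_trans[OF riso_urep_sum[OF c] riso_rprod[OF riso_copies_E0[OF projective_cover_V0[OF P0]]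
            riso_copies_E1[OF projective_cover_V1[OF P1]]]])
qed

lemma umod_iso_sum:
  fixes L M N :: "'k umod"
  assumes L: "um_module L" "riso (urep L) T" and M: "um_module M" "riso (urep M) X" and N: "um_module N" "riso
      (urep N) Y"
    and T: "riso T (X \<times>\<^sub>r Y)" and X: "is_rep X" "is_rep Y"
  shows "L \<cong>\<^sub>u M \<oplus>\<^sub>u N"
proof (rule umod_iso_riso[OF _ L(1) is_rep_urep[OF L(1)] um_module_sum[OF M(1) N(1)]])
  have "riso (X \<times>\<^sub>r Y) (urep (M \<oplus>\<^sub>u N))"
    by (rule riso_sym[OF is_rep_urep[OF um_module_sum[OF M(1) N(1)]] riso_trans[OF riso_urep_sum[OF M(1) N(1)]
        riso_rprod[OF M(2) N(2)]]])
  then show "riso (urep L) (urep (M \<oplus>\<^sub>u N))" by (rule riso_trans[OF riso_trans[OF L(2) T]])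
qed

theorem tensor_Omega_neg:
  fixes x :: "'k \<times> 'k" and P0 P1 W :: "'k umod"
  assumes x: "x \<noteq> (0, 0)" and i: "i \<in> {0, 1}"
    and P: "projective_cover P0 (V_simple 0)" "projective_cover P1 (V_simple 1)"
    and W: "is_Omega_neg s (V_simple i) W"
  shows "(even (s + i) \<longrightarrow>
            A_mod x r \<otimes>\<^sub>u W \<cong>\<^sub>u A_mod x r \<oplus>\<^sub>u P_mod P0 P1 0 (2 * r * s)) \<and>
         (odd (s + i) \<longrightarrow>
            A_mod x r \<otimes>\<^sub>u W \<cong>\<^sub>u B_mod x r \<oplus>\<^sub>u P_mod P0 P1 (r * s) (r * (s + 1))) \<and>
         (even (s + i) \<longrightarrow>
            B_mod x r \<otimes>\<^sub>u W \<cong>\<^sub>u B_mod x r \<oplus>\<^sub>u P_mod P0 P1 (r * s) (r * s)) \<and>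
         (odd (s + i) \<longrightarrow>
            B_mod x r \<otimes>\<^sub>u W \<cong>\<^sub>u A_mod x r \<oplus>\<^sub>u P_mod P0 P1 0 (r * (2 * s + 1)))"
proof -
  obtain x1 x2 where x12: "x = (x1, x2)" by (cases x)
  \<comment> \<open>The constant terms are x1 and x2 if these differ, not both 0 as x is nonzero;
    otherwise both are 1.\<close>
  then have st: "cs0 x1 x2 \<noteq> 0 \<or> ct0 x1 x2 \<noteq> 0" using x by (auto simp: cs_defs)
  have xs: "fst x = x1" "snd x = x2" using x12 by simp_all
  have Wm: "um_module W" "riso (urep W) (Wr i s)" using Omega_neg_riso[OF W refl i] by blast+
  note t = tensor_coord[OF Wm(1) x12, of r]
  note TA = riso_trans[OF t(2) riso_TF1[OF Wm(2) is_rep_urep[OF Wm(1)] is_rep_Wr]]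
    and TB = riso_trans[OF t(4) riso_TF0[OF Wm(2) is_rep_urep[OF Wm(1)] is_rep_Wr]]
  note A = A_mod_rep(1,2)[of x r, unfolded xs] and B = B_mod_rep(1,2)[of x r, unfolded xs]
  note Q = P_mod_rep[OF P]
  note main = TF_Wr[OF st i, where r = r and s = s and ?s1.0 = "cs1 x1 x2" and ?t1.0 = "ct1 x1 x2"]
  show ?thesis
  proof (intro conjI impI)
    assume e: "even (s + i)"
    show "A_mod x r \<otimes>\<^sub>u W \<cong>\<^sub>u A_mod x r \<oplus>\<^sub>u P_mod P0 P1 0 (2 * r * s)"
      by (rule umod_iso_sum[OF t(1) TA A Q]) (use main e in simp_all)
    show "B_mod x r \<otimes>\<^sub>u W \<cong>\<^sub>u B_mod x r \<oplus>\<^sub>u P_mod P0 P1 (r * s) (r * s)"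
      by (rule umod_iso_sum[OF t(3) TB B Q]) (use main e in simp_all)
  next
    assume e: "odd (s + i)"
    show "A_mod x r \<otimes>\<^sub>u W \<cong>\<^sub>u B_mod x r \<oplus>\<^sub>u P_mod P0 P1 (r * s) (r * (s + 1))"
      by (rule umod_iso_sum[OF t(1) TA B Q]) (use main e in simp_all)
    show "B_mod x r \<otimes>\<^sub>u W \<cong>\<^sub>u A_mod x r \<oplus>\<^sub>u P_mod P0 P1 0 (r * (2 * s + 1))"
      by (rule umod_iso_sum[OF t(3) TB A Q]) (use main e in simp_all)
  qed
qed

end

theorem corollary4p12:
  fixes x :: "'k::alg_closed_field \<times> 'k"
    and P0 P1 W :: "'k umod"
    and r s i :: nat
  assumes "CHAR('k) = 2"
    and "r \<ge> 1"
    and "x \<noteq> (0, 0)"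
    and "i \<in> {0, 1}"
    and "projective_cover P0 (V_simple 0)"
    and "projective_cover P1 (V_simple 1)"
    and "is_Omega_neg s (V_simple i) W"
  shows "(even (s + i) \<longrightarrow>
            A_mod x r \<otimes>\<^sub>u W \<cong>\<^sub>u A_mod x r \<oplus>\<^sub>u P_mod P0 P1 0 (2 * r * s)) \<and>
         (odd (s + i) \<longrightarrow>
            A_mod x r \<otimes>\<^sub>u W \<cong>\<^sub>u B_mod x r \<oplus>\<^sub>u P_mod P0 P1 (r * s) (r * (s + 1))) \<and>
         (even (s + i) \<longrightarrow>
            B_mod x r \<otimes>\<^sub>u W \<cong>\<^sub>u B_mod x r \<oplus>\<^sub>u P_mod P0 P1 (r * s) (r * s)) \<and>
         (odd (s + i) \<longrightarrow>
            B_mod x r \<otimes>\<^sub>u W \<cong>\<^sub>u A_mod x r \<oplus>\<^sub>u P_mod P0 P1 0 (r * (2 * s + 1)))"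
proof -
  interpret char2 "TYPE('k)" by standard (rule assms(1))
  show ?thesis by (rule tensor_Omega_neg) (rule assms)+
qed

end
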